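(* Let $\Omega$ be an open subset of $\mathbb{R}^d$ and let $H_\Omega=-\sum_{i,j=1}^d\partial_i\,c_{ij}\,\partial_j$ be the second-order partial differential operator on $L_2(\Omega)$ with domain $D(H_\Omega)=C_c^\infty(\Omega)$, where the coefficients $c_{ij}=c_{ji}\in W^{1,\infty}(\Omega)$ are real and the matrix $C(x)=(c_{ij}(x))$ is strictly positive-definite for all $x\in\Omega$. Let $S^F_t$ denote the semigroup generated by the Friedrichs extension $H^F_\Omega$ of $H_\Omega$. The following conditions are equivalent: (I) $S^F_t$ is irreducible; (II) $\Omega$ is connected. Moreover, if these conditions are satisfied then each semigroup generated by a submarkovian extension of $H_\Omega$ is irreducible.
   Context: Functions are real-valued and $\partial_i=\partial/\partial x_i$. The Friedrichs extension $H_\Omega^F$ is the positive self-adjoint operator corresponding to the closure of the form $h_\Omega(\varphi)=\sum_{i,j=1}^d\int_\Omega dx\,c_{ij}(x)(\partial_i\varphi)(x)(\partial_j\varphi)(x)$ with domain $D(h_\Omega)=C_c^\infty(\Omega)$, and $S^F_t=e^{-tH_\Omega^F}$. A submarkovian extension of $H_\Omega$ is a self-adjoint extension $K$ which generates a submarkovian semigroup on $L_2(\Omega)$ ($0\le\varphi\le1$ a.e. implies $0\le e^{-tK}\varphi\le1$ a.e.). A positive semigroup $S_t$ on $L_2(\Omega)$ is irreducible if for every $t>0$ and every positive, nonzero $\varphi\in L_2(\Omega)$ one has $S_t\varphi>0$ almost everywhere. *)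

theory Defs
  imports "HOL-Analysis.Analysis"
begin

section \<open>The real Hilbert space of square-integrable functions\<close>

text \<open>
  Elements of \<open>L\<^sub>2(M)\<close> are handled through their representatives; equality in \<open>L\<^sub>2(M)\<close>
  is equality almost everywhere.  A (possibly unbounded) operator is given by its graph, a set of
  pairs of representatives.
\<close>

definition L2 :: "'a measure \<Rightarrow> ('a \<Rightarrow> real) set" where
  "L2 M = {f \<in> borel_measurable M. integrable M (\<lambda>x. (f x)\<^sup>2)}"

definition l2_inner :: "'a measure \<Rightarrow> ('a \<Rightarrow> real) \<Rightarrow> ('a \<Rightarrow> real) \<Rightarrow> real" where
  "l2_inner M f g = (LINT x|M. f x * g x)"

definition l2_norm :: "'a measure \<Rightarrow> ('a \<Rightarrow> real) \<Rightarrow> real" where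
  "l2_norm M f = sqrt (l2_inner M f f)"

definition l2_tendsto ::
  "'a measure \<Rightarrow> ('b \<Rightarrow> 'a \<Rightarrow> real) \<Rightarrow> ('a \<Rightarrow> real) \<Rightarrow> 'b filter \<Rightarrow> bool" where
  "l2_tendsto M u f F \<longleftrightarrow> ((\<lambda>n. l2_norm M (\<lambda>x. u n x - f x)) \<longlongrightarrow> 0) F"

section \<open>Unbounded operators and semigroups\<close>

definition densely_defined ::
  "'a measure \<Rightarrow> (('a \<Rightarrow> real) \<times> ('a \<Rightarrow> real)) set \<Rightarrow> bool" where
  "densely_defined M K \<longleftrightarrow>
     (\<forall>f \<in> L2 M. \<exists>u. (\<forall>n. u n \<in> Domain K \<inter> L2 M) \<and> l2_tendsto M u f sequentially)"

definition adjoint_op ::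
  "'a measure \<Rightarrow> (('a \<Rightarrow> real) \<times> ('a \<Rightarrow> real)) set \<Rightarrow> (('a \<Rightarrow> real) \<times> ('a \<Rightarrow> real)) set" where
  "adjoint_op M K =
     {(f, g). f \<in> L2 M \<and> g \<in> L2 M \<and> (\<forall>(u, v) \<in> K. l2_inner M f v = l2_inner M g u)}"

text \<open>
  An adjoint graph is automatically a closed linear subspace that is saturated under equality almost
  everywhere, and the adjoint of a densely defined graph is single-valued up to equality almost
  everywhere.  So the following says precisely that \<open>K\<close> is (the saturated graph of) a self-adjoint
  operator.
\<close>

definition selfadjoint_op ::
  "'a measure \<Rightarrow> (('a \<Rightarrow> real) \<times> ('a \<Rightarrow> real)) set \<Rightarrow> bool" where
  "selfadjoint_op M K \<longleftrightarrow> densely_defined M K \<and> adjoint_op M K = K"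

definition bounded_op_L2 :: "'a measure \<Rightarrow> (('a \<Rightarrow> real) \<Rightarrow> 'a \<Rightarrow> real) \<Rightarrow> bool" where
  "bounded_op_L2 M T \<longleftrightarrow>
     (\<forall>f \<in> L2 M. T f \<in> L2 M) \<and>
     (\<forall>f \<in> L2 M. \<forall>g \<in> L2 M. (AE x in M. f x = g x) \<longrightarrow> (AE x in M. T f x = T g x)) \<and>
     (\<forall>f \<in> L2 M. \<forall>g \<in> L2 M. \<forall>a b.
        AE x in M. T (\<lambda>y. a * f y + b * g y) x = a * T f x + b * T g x) \<and>
     (\<exists>B. \<forall>f \<in> L2 M. l2_norm M (T f) \<le> B * l2_norm M f)"

definition C0_semigroup :: "'a measure \<Rightarrow> (real \<Rightarrow> ('a \<Rightarrow> real) \<Rightarrow> 'a \<Rightarrow> real) \<Rightarrow> bool" where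
  "C0_semigroup M S \<longleftrightarrow>
     (\<forall>t\<ge>0. bounded_op_L2 M (S t)) \<and>
     (\<forall>f \<in> L2 M. AE x in M. S 0 f x = f x) \<and>
     (\<forall>s\<ge>0. \<forall>t\<ge>0. \<forall>f \<in> L2 M. AE x in M. S (s + t) f x = S s (S t f) x) \<and>
     (\<forall>f \<in> L2 M. l2_tendsto M (\<lambda>t. S t f) f (at_right 0))"

text \<open>
  \<open>S t = exp (- t K)\<close>.  Note the sign: \<open>K\<close> is minus the infinitesimal generator, so
  \<open>K f\<close> is the limit of \<open>(f - S t f) / t\<close>, defined for exactly those \<open>f\<close> for which this
  limit exists.
\<close>

definition generates ::
  "'a measure \<Rightarrow> (('a \<Rightarrow> real) \<times> ('a \<Rightarrow> real)) set \<Rightarrow> (real \<Rightarrow> ('a \<Rightarrow> real) \<Rightarrow> 'a \<Rightarrow> real) \<Rightarrow> bool"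
  where
  "generates M K S \<longleftrightarrow> C0_semigroup M S \<and>
     K = {(f, g). f \<in> L2 M \<and> g \<in> L2 M \<and>
            l2_tendsto M (\<lambda>t x. (f x - S t f x) / t) g (at_right 0)}"

definition positive_semigroup ::
  "'a measure \<Rightarrow> (real \<Rightarrow> ('a \<Rightarrow> real) \<Rightarrow> 'a \<Rightarrow> real) \<Rightarrow> bool" where
  "positive_semigroup M S \<longleftrightarrow>
     (\<forall>t>0. \<forall>f \<in> L2 M. (AE x in M. 0 \<le> f x) \<longrightarrow> (AE x in M. 0 \<le> S t f x))"

definition submarkovian_semigroup ::
  "'a measure \<Rightarrow> (real \<Rightarrow> ('a \<Rightarrow> real) \<Rightarrow> 'a \<Rightarrow> real) \<Rightarrow> bool" where
  "submarkovian_semigroup M S \<longleftrightarrow>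
     (\<forall>t>0. \<forall>f \<in> L2 M. (AE x in M. 0 \<le> f x \<and> f x \<le> 1) \<longrightarrow>
                        (AE x in M. 0 \<le> S t f x \<and> S t f x \<le> 1))"

definition irreducible_semigroup ::
  "'a measure \<Rightarrow> (real \<Rightarrow> ('a \<Rightarrow> real) \<Rightarrow> 'a \<Rightarrow> real) \<Rightarrow> bool" where
  "irreducible_semigroup M S \<longleftrightarrow> positive_semigroup M S \<and>
     (\<forall>t>0. \<forall>f \<in> L2 M. (AE x in M. 0 \<le> f x) \<and> \<not> (AE x in M. f x = 0) \<longrightarrow>
                        (AE x in M. 0 < S t f x))"

section \<open>Closure of a form and the associated operator\<close>

text \<open>
  \<open>a\<close> is a symmetric bilinear form with domain \<open>D\<close>.  An element \<open>f\<close> of \<open>L\<^sub>2\<close> is in the domain of the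
  closure iff it is the \<open>L\<^sub>2\<close>-limit of an \<open>a\<close>-Cauchy sequence in \<open>D\<close>; the closed form is then
  the limit of the values along such sequences (unique whenever \<open>a\<close> is positive and closable).
\<close>

definition form_approx ::
  "'a measure \<Rightarrow> ('a \<Rightarrow> real) set \<Rightarrow> (('a \<Rightarrow> real) \<Rightarrow> ('a \<Rightarrow> real) \<Rightarrow> real)
     \<Rightarrow> (nat \<Rightarrow> 'a \<Rightarrow> real) \<Rightarrow> ('a \<Rightarrow> real) \<Rightarrow> bool" where
  "form_approx M D a u f \<longleftrightarrow>
     (\<forall>n. u n \<in> D) \<and> l2_tendsto M u f sequentially \<and>
     (\<forall>e>0. \<exists>N. \<forall>m\<ge>N. \<forall>n\<ge>N. a (\<lambda>x. u m x - u n x) (\<lambda>x. u m x - u n x) < e)"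

definition closure_form_domain ::
  "'a measure \<Rightarrow> ('a \<Rightarrow> real) set \<Rightarrow> (('a \<Rightarrow> real) \<Rightarrow> ('a \<Rightarrow> real) \<Rightarrow> real) \<Rightarrow> ('a \<Rightarrow> real) set" where
  "closure_form_domain M D a = {f \<in> L2 M. \<exists>u. form_approx M D a u f}"

definition closure_form ::
  "'a measure \<Rightarrow> ('a \<Rightarrow> real) set \<Rightarrow> (('a \<Rightarrow> real) \<Rightarrow> ('a \<Rightarrow> real) \<Rightarrow> real)
     \<Rightarrow> ('a \<Rightarrow> real) \<Rightarrow> ('a \<Rightarrow> real) \<Rightarrow> real" where
  "closure_form M D a f g =
     (THE r. \<forall>u v. form_approx M D a u f \<and> form_approx M D a v g \<longrightarrow> (\<lambda>n. a (u n) (v n)) \<longlonglongrightarrow> r)"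

definition form_operator ::
  "'a measure \<Rightarrow> ('a \<Rightarrow> real) set \<Rightarrow> (('a \<Rightarrow> real) \<Rightarrow> ('a \<Rightarrow> real) \<Rightarrow> real)
     \<Rightarrow> (('a \<Rightarrow> real) \<times> ('a \<Rightarrow> real)) set" where
  "form_operator M D a =
     {(f, g). f \<in> D \<and> g \<in> L2 M \<and> (\<forall>v \<in> D. a f v = l2_inner M g v)}"

section \<open>Test functions, weak derivatives and Sobolev functions\<close>

definition partial_deriv :: "'n::finite \<Rightarrow> (real^'n \<Rightarrow> real) \<Rightarrow> real^'n \<Rightarrow> real" where
  "partial_deriv i f x = frechet_derivative f (at x) (axis i 1)"

text \<open>All iterated partial derivatives exist and are (Frechet) differentiable.\<close>

definition smooth_fun :: "(real^'n::finite \<Rightarrow> real) \<Rightarrow> bool" where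
  "smooth_fun f \<longleftrightarrow> (\<forall>is x. foldr partial_deriv is f differentiable (at x))"

definition test_functions :: "(real^'n::finite) set \<Rightarrow> (real^'n \<Rightarrow> real) set" where
  "test_functions \<Omega> =
     {f. smooth_fun f \<and> compact (closure {x. f x \<noteq> 0}) \<and> closure {x. f x \<noteq> 0} \<subseteq> \<Omega>}"

definition locally_integrable_on :: "(real^'n::finite \<Rightarrow> real) \<Rightarrow> (real^'n) set \<Rightarrow> bool" where
  "locally_integrable_on f \<Omega> \<longleftrightarrow> (\<forall>K. compact K \<and> K \<subseteq> \<Omega> \<longrightarrow> f absolutely_integrable_on K)"

definition has_weak_partial ::
  "(real^'n::finite) set \<Rightarrow> 'n \<Rightarrow> (real^'n \<Rightarrow> real) \<Rightarrow> (real^'n \<Rightarrow> real) \<Rightarrow> bool" where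
  "has_weak_partial \<Omega> i f g \<longleftrightarrow>
     locally_integrable_on f \<Omega> \<and> locally_integrable_on g \<Omega> \<and>
     (\<forall>\<eta> \<in> test_functions \<Omega>.
        (LINT x|lebesgue_on \<Omega>. f x * partial_deriv i \<eta> x) = - (LINT x|lebesgue_on \<Omega>. g x * \<eta> x))"

definition L_infinity :: "'a measure \<Rightarrow> ('a \<Rightarrow> real) set" where
  "L_infinity M = {f \<in> borel_measurable M. \<exists>B. AE x in M. \<bar>f x\<bar> \<le> B}"

definition W1_infinity :: "(real^'n::finite) set \<Rightarrow> (real^'n \<Rightarrow> real) set" where
  "W1_infinity \<Omega> =
     {f \<in> L_infinity (lebesgue_on \<Omega>).
        \<forall>i. \<exists>g \<in> L_infinity (lebesgue_on \<Omega>). has_weak_partial \<Omega> i f g}"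

section \<open>The elliptic operator and its extensions\<close>

text \<open>
  The coefficients are given by a matrix-valued function, \<open>c\<^sub>i\<^sub>j(x) = c x $ i $ j\<close>.  An element of
  \<open>W\<^sup>1\<^sup>,\<^sup>\<infinity>(\<Omega>)\<close> has a unique continuous representative on the open set \<open>\<Omega>\<close>.  This representative is the
  one meant here: positive-definiteness is required at \<^emph>\<open>every\<close> point of \<open>\<Omega>\<close>, a condition that is
  meaningless for functions defined only up to null sets.
\<close>

definition admissible_coefficients ::
  "(real^'n::finite) set \<Rightarrow> (real^'n \<Rightarrow> real^'n^'n) \<Rightarrow> bool" where
  "admissible_coefficients \<Omega> c \<longleftrightarrow>
     (\<forall>i j. (\<lambda>x. c x $ i $ j) \<in> W1_infinity \<Omega> \<and> continuous_on \<Omega> (\<lambda>x. c x $ i $ j)) \<and>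
     (\<forall>x\<in>\<Omega>. \<forall>i j. c x $ i $ j = c x $ j $ i) \<and>
     (\<forall>x\<in>\<Omega>. \<forall>v. v \<noteq> 0 \<longrightarrow> 0 < v \<bullet> (c x *v v))"

text \<open>
  Graph of \<open>\<phi> \<mapsto> - (\<Sum>i j. \<partial>\<^sub>i (c\<^sub>i\<^sub>j \<partial>\<^sub>j \<phi>))\<close> on \<open>C\<^sub>c\<^sup>\<infinity>(\<Omega>)\<close>; the outer derivatives are weak ones since
  the coefficients are only Lipschitz.
\<close>

definition elliptic_op ::
  "(real^'n::finite) set \<Rightarrow> (real^'n \<Rightarrow> real^'n^'n) \<Rightarrow> ((real^'n \<Rightarrow> real) \<times> (real^'n \<Rightarrow> real)) set" where
  "elliptic_op \<Omega> c =
     {(\<phi>, \<psi>). \<phi> \<in> test_functions \<Omega> \<and> \<psi> \<in> L2 (lebesgue_on \<Omega>) \<and>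
        (\<exists>G. (\<forall>i j. has_weak_partial \<Omega> i (\<lambda>x. c x $ i $ j * partial_deriv j \<phi> x) (G i j)) \<and>
             (AE x in lebesgue_on \<Omega>. \<psi> x = - (\<Sum>i\<in>UNIV. \<Sum>j\<in>UNIV. G i j x)))}"

text \<open>The form \<open>h\<^sub>\<Omega>\<close>, polarized.\<close>

definition elliptic_form ::
  "(real^'n::finite) set \<Rightarrow> (real^'n \<Rightarrow> real^'n^'n) \<Rightarrow> (real^'n \<Rightarrow> real) \<Rightarrow> (real^'n \<Rightarrow> real) \<Rightarrow> real" where
  "elliptic_form \<Omega> c \<phi> \<psi> =
     (\<Sum>i\<in>UNIV. \<Sum>j\<in>UNIV.
        LINT x|lebesgue_on \<Omega>. c x $ i $ j * partial_deriv i \<phi> x * partial_deriv j \<psi> x)"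

definition friedrichs_extension ::
  "(real^'n::finite) set \<Rightarrow> (real^'n \<Rightarrow> real^'n^'n) \<Rightarrow> ((real^'n \<Rightarrow> real) \<times> (real^'n \<Rightarrow> real)) set" where
  "friedrichs_extension \<Omega> c =
     form_operator (lebesgue_on \<Omega>)
       (closure_form_domain (lebesgue_on \<Omega>) (test_functions \<Omega>) (elliptic_form \<Omega> c))
       (closure_form (lebesgue_on \<Omega>) (test_functions \<Omega>) (elliptic_form \<Omega> c))"

definition submarkovian_extension ::
  "(real^'n::finite) set \<Rightarrow> (real^'n \<Rightarrow> real^'n^'n)
     \<Rightarrow> ((real^'n \<Rightarrow> real) \<times> (real^'n \<Rightarrow> real)) set \<Rightarrow> bool" where
  "submarkovian_extension \<Omega> c K \<longleftrightarrow>
     selfadjoint_op (lebesgue_on \<Omega>) K \<and> elliptic_op \<Omega> c \<subseteq> K \<and>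
     (\<exists>S. generates (lebesgue_on \<Omega>) K S \<and> submarkovian_semigroup (lebesgue_on \<Omega>) S)"

end

theory Submission
  imports Defs "HOL-Real_Asymp.Real_Asymp"
begin

text \<open>
  The domain is denoted by \<open>\<Omega>\<close>, the operator \<open>H = - \<Sum> \<partial>\<^sub>i c\<^sub>i\<^sub>j \<partial>\<^sub>j\<close> on test functions by \<open>ell\<close>, and
  \<open>1\<^sub>A\<close> is the indicator of \<open>A\<close>.

  Both irreducibility claims rest on one principle (\<open>symmetric_positive_irreducible\<close>): a symmetric,
  positive semigroup whose generator extends \<open>H\<close> on a connected domain is irreducible.  Its proof
  has an abstract and a local half.

  Abstract half.  Suppose that \<open>S\<^sub>t f\<close> fails to be strictly positive, for some \<open>t > 0\<close> and \<open>f \<ge> 0\<close>,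
  \<open>f \<noteq> 0\<close>, and let \<open>A\<close> be the set where it is positive.  If \<open>w \<ge> 0\<close> vanishes on \<open>A\<close> then the pairing
  \<open>(w, S\<^sub>s f)\<close> is zero at \<open>s = t\<close>; by symmetry and positivity it is zero for all smaller \<open>s\<close>
  (\<open>pairing_zero_backward\<close>), and then for all larger ones as well, because \<open>s \<mapsto> (w, S\<^sub>s f)\<close> is real
  analytic.  Analyticity enters only in the following form (\<open>pairing_zero_double\<close>): powers \<open>x\<^sup>n\<close> are
  uniformly close on \<open>[-1, 1]\<close> to polynomials of a degree much smaller than \<open>n\<close>, and Chebyshev
  polynomials of a symmetric contraction are contractions.  This takes the place of the
  spectral theorem.  It follows that \<open>1\<^sub>A\<close> commutes with the semigroup (\<open>support_reduces\<close>), hence with its generator, and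
  that \<open>\<integral>\<^sub>A (u H v - v H u) = 0\<close> for all test functions \<open>u\<close>, \<open>v\<close>.

  Local half.  Taking \<open>u = \<theta>\<close> and \<open>v = \<theta> x\<^sub>k\<close> turns this identity into
  \<open>\<integral>\<^sub>A \<Sum>\<^sub>i \<partial>\<^sub>i (c\<^sub>i\<^sub>k \<theta>\<^sup>2) = 0\<close>, which says that \<open>C \<nabla>1\<^sub>A = 0\<close> in the sense of distributions
  (\<open>weak_gradient_zero\<close>).  The coefficients are locally Lipschitz and \<open>C\<close> is locally bounded below, so
  a commutator estimate bounds the Lipschitz constants of the mollifications of \<open>1\<^sub>A\<close>, locally and
  uniformly in the scale (\<open>mollified_indicator_lipschitz\<close>).  The limit \<open>1\<^sub>A\<close> is then
  Lipschitz up to a null set; having only the values 0 and 1, it is locally constant, and constant if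
  \<open>\<Omega>\<close> is connected.

  To apply the principle one has to know that the semigroups are symmetric and positive.  A semigroup
  whose generator is symmetric and densely defined is symmetric and determined by its generator
  (\<open>generators_dual\<close>, \<open>symmetric_generator_semigroup_unique\<close>).  So for a submarkovian extension
  positivity is inherited from the submarkovian semigroup with the same generator.  For the Friedrichs
  extension positivity is proved by an energy argument: \<open>p(\<phi>)\<close> is a test function for
  suitable smooth increasing \<open>p\<close>, which yields \<open>(K u, u\<^sup>-) \<le> 0\<close> for its generator \<open>K\<close>, so that the norm
  of the negative part of \<open>S\<^sub>t f\<close> cannot increase (\<open>energy_decreasing\<close>).  The same energy argument,
  with multiplication by the indicator of a component in place of \<open>p\<close>, shows that on a disconnected
  domain the Friedrichs semigroup leaves the two parts invariant, and hence is not irreducible.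
\<close>

section \<open>Square-integrable functions\<close>

lemma quadratic_nonneg_imp_discriminant:
  fixes a b c :: real
  assumes "\<And>t. 0 \<le> a + 2 * t * b + t\<^sup>2 * c"
  shows "b\<^sup>2 \<le> a * c"
proof (cases "c = 0")
  case True
  have "b = 0"
  proof (rule ccontr)
    assume "b \<noteq> 0"
    then show False
      using assms[of "-(a + 1) / (2 * b)"] True by (simp add: field_simps)
  qed
  then show ?thesis using True by simp
next
  case False
  have "c \<ge> 0"
  proof (rule ccontr)
    assume "\<not> c \<ge> 0"
    then have c: "c < 0" by simp
    define t where "t = (\<bar>a\<bar> + 2 * \<bar>b\<bar> + 1) / (- c) + 1"
    have t1: "t \<ge> 1" unfolding t_def using c by (simp add: field_simps)
    have tc: "t * (- c) > \<bar>a\<bar> + 2 * \<bar>b\<bar>"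
      unfolding t_def using c by (simp add: field_simps)
    have "t * (t * (- c)) > t * (\<bar>a\<bar> + 2 * \<bar>b\<bar>)"
      using tc t1 by (intro mult_strict_left_mono) auto
    moreover have "t * (\<bar>a\<bar> + 2 * \<bar>b\<bar>) \<ge> a + 2 * t * b"
    proof -
      have "a \<le> t * \<bar>a\<bar>" using t1 mult_right_mono[of 1 t "\<bar>a\<bar>"] by simp
      moreover have "t * b \<le> t * \<bar>b\<bar>" using t1 by (intro mult_left_mono) auto
      ultimately show ?thesis by (simp add: algebra_simps)
    qed
    ultimately have "a + 2 * t * b + t\<^sup>2 * c < 0"
      by (simp add: power2_eq_square algebra_simps)
    then show False using assms[of t] by simp
  qed
  with False have c: "c > 0" by simp
  have "0 \<le> a + 2 * (- b / c) * b + (- b / c)\<^sup>2 * c" by (rule assms)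
  also have "\<dots> = a - b\<^sup>2 / c" using c by (simp add: power2_eq_square field_simps)
  finally show ?thesis using c by (simp add: field_simps)
qed

lemma L2_measurable [measurable_dest]: "f \<in> L2 M \<Longrightarrow> f \<in> borel_measurable M"
  by (simp add: L2_def)

lemma L2_integrable_square: "f \<in> L2 M \<Longrightarrow> integrable M (\<lambda>x. (f x)\<^sup>2)"
  by (simp add: L2_def)

lemma L2_integrable_mult:
  assumes "f \<in> L2 M" "g \<in> L2 M"
  shows "integrable M (\<lambda>x. f x * g x)"
proof (rule Bochner_Integration.integrable_bound)
  show "integrable M (\<lambda>x. (f x)\<^sup>2 + (g x)\<^sup>2)"
    using assms by (auto intro: L2_integrable_square)
  show "(\<lambda>x. f x * g x) \<in> borel_measurable M"
    using assms by (auto simp: L2_def)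
  have "\<bar>a * b\<bar> \<le> a\<^sup>2 + b\<^sup>2" for a b :: real
  proof -
    have "2 * (\<bar>a\<bar> * \<bar>b\<bar>) \<le> a\<^sup>2 + b\<^sup>2"
      using sum_squares_bound[of "\<bar>a\<bar>" "\<bar>b\<bar>"] by (simp add: mult.assoc)
    moreover have "0 \<le> \<bar>a\<bar> * \<bar>b\<bar>" by simp
    ultimately show ?thesis unfolding abs_mult by linarith
  qed
  then show "AE x in M. norm (f x * g x) \<le> norm ((f x)\<^sup>2 + (g x)\<^sup>2)"
    by simp
qed

lemma L2_dominated:
  assumes "g \<in> L2 M" "f \<in> borel_measurable M" "AE x in M. \<bar>f x\<bar> \<le> \<bar>g x\<bar>"
  shows "f \<in> L2 M"
proof -
  have "integrable M (\<lambda>x. (f x)\<^sup>2)"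
  proof (rule Bochner_Integration.integrable_bound[OF L2_integrable_square[OF assms(1)]])
    show "(\<lambda>x. (f x)\<^sup>2) \<in> borel_measurable M" using assms(2) by simp
    show "AE x in M. norm ((f x)\<^sup>2) \<le> norm ((g x)\<^sup>2)"
      using assms(3) by eventually_elim (simp add: power2_le_iff_abs_le abs_le_square_iff)
  qed
  then show ?thesis using assms(2) by (simp add: L2_def)
qed

lemma L2_scale: "f \<in> L2 M \<Longrightarrow> (\<lambda>x. a * f x) \<in> L2 M"
  by (auto simp: L2_def power_mult_distrib)

lemma L2_add:
  assumes "f \<in> L2 M" "g \<in> L2 M" shows "(\<lambda>x. f x + g x) \<in> L2 M"
proof -
  have "integrable M (\<lambda>x. (f x)\<^sup>2 + 2 * (f x * g x) + (g x)\<^sup>2)"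
    using assms by (intro Bochner_Integration.integrable_add integrable_mult_right
        L2_integrable_square L2_integrable_mult)
  then have "integrable M (\<lambda>x. (f x + g x)\<^sup>2)"
    by (simp add: power2_sum algebra_simps)
  then show ?thesis using assms by (auto simp: L2_def)
qed

lemma L2_uminus: "f \<in> L2 M \<Longrightarrow> (\<lambda>x. - f x) \<in> L2 M"
  using L2_scale[of f M "-1"] by simp

lemma L2_diff: "f \<in> L2 M \<Longrightarrow> g \<in> L2 M \<Longrightarrow> (\<lambda>x. f x - g x) \<in> L2 M"
  using L2_add[OF _ L2_uminus, of f M g] by simp

lemma L2_zero: "(\<lambda>x. 0) \<in> L2 M"
  by (simp add: L2_def)

lemma L2_divide: "f \<in> L2 M \<Longrightarrow> (\<lambda>x. f x / a) \<in> L2 M"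
  using L2_scale[of f M "1/a"] by simp

lemma L2_sum:
  assumes "finite I" "\<And>i. i \<in> I \<Longrightarrow> f i \<in> L2 M"
  shows "(\<lambda>x. \<Sum>i\<in>I. f i x) \<in> L2 M"
  using assms by (induction I rule: finite_induct) (auto intro: L2_zero L2_add)

lemma L2_abs: "f \<in> L2 M \<Longrightarrow> (\<lambda>x. \<bar>f x\<bar>) \<in> L2 M"
  by (auto simp: L2_def)

lemma L2_mult_bounded:
  assumes "f \<in> L2 M" "b \<in> borel_measurable M" "AE x in M. \<bar>b x\<bar> \<le> B"
  shows "(\<lambda>x. b x * f x) \<in> L2 M"
proof (rule L2_dominated[OF L2_scale[OF assms(1), of B]])
  show "(\<lambda>x. b x * f x) \<in> borel_measurable M"
    using assms by (auto simp: L2_def)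
  show "AE x in M. \<bar>b x * f x\<bar> \<le> \<bar>B * f x\<bar>"
    using assms(3)
  proof eventually_elim
    case (elim x)
    then have "\<bar>b x\<bar> \<le> \<bar>B\<bar>" by linarith
    then show ?case by (simp add: abs_mult mult_right_mono)
  qed
qed

lemma L2_indicator_mult:
  assumes "f \<in> L2 M" "A \<in> sets M"
  shows "(\<lambda>x. indicator A x * f x) \<in> L2 M"
  by (rule L2_mult_bounded[OF assms(1), of _ 1]) (use assms(2) in \<open>auto split: split_indicator\<close>)

lemmas L2_intros = L2_add L2_diff L2_scale L2_uminus L2_divide L2_zero L2_abs L2_sum

section \<open>Inner product and norm\<close>

lemma l2_inner_commute: "l2_inner M f g = l2_inner M g f"
  by (simp add: l2_inner_def mult.commute)

lemma l2_inner_add_left: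
  assumes "f \<in> L2 M" "g \<in> L2 M" "h \<in> L2 M"
  shows "l2_inner M (\<lambda>x. f x + g x) h = l2_inner M f h + l2_inner M g h"
  unfolding l2_inner_def
  by (subst Bochner_Integration.integral_add[symmetric])
    (use assms in \<open>auto intro: L2_integrable_mult simp: algebra_simps\<close>)

lemma l2_inner_diff_left:
  assumes "f \<in> L2 M" "g \<in> L2 M" "h \<in> L2 M"
  shows "l2_inner M (\<lambda>x. f x - g x) h = l2_inner M f h - l2_inner M g h"
  unfolding l2_inner_def
  by (subst Bochner_Integration.integral_diff[symmetric])
    (use assms in \<open>auto intro: L2_integrable_mult simp: algebra_simps\<close>)

lemma l2_inner_scale_left: "l2_inner M (\<lambda>x. a * f x) h = a * l2_inner M f h"
  by (simp add: l2_inner_def mult.assoc)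

lemma l2_inner_divide_left: "l2_inner M (\<lambda>x. f x / a) h = l2_inner M f h / a"
  using l2_inner_scale_left[of M "1/a" f h] by simp

lemma l2_inner_add_right:
  assumes "f \<in> L2 M" "g \<in> L2 M" "h \<in> L2 M"
  shows "l2_inner M h (\<lambda>x. f x + g x) = l2_inner M h f + l2_inner M h g"
  using l2_inner_add_left[OF assms] by (simp add: l2_inner_commute)

lemma l2_inner_diff_right:
  assumes "f \<in> L2 M" "g \<in> L2 M" "h \<in> L2 M"
  shows "l2_inner M h (\<lambda>x. f x - g x) = l2_inner M h f - l2_inner M h g"
  using l2_inner_diff_left[OF assms] by (simp add: l2_inner_commute)

lemma l2_inner_scale_right: "l2_inner M h (\<lambda>x. a * f x) = a * l2_inner M h f"
  by (simp add: l2_inner_def mult.left_commute)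

lemma l2_inner_divide_right: "l2_inner M h (\<lambda>x. f x / a) = l2_inner M h f / a"
  using l2_inner_scale_right[of M h "1/a" f] by simp

lemma l2_inner_zero_left [simp]: "l2_inner M (\<lambda>x. 0) h = 0"
  by (simp add: l2_inner_def)

lemma l2_inner_cong_AE:
  assumes "f \<in> L2 M" "g \<in> L2 M" "f' \<in> L2 M" "g' \<in> L2 M"
    and "AE x in M. f x = f' x" "AE x in M. g x = g' x"
  shows "l2_inner M f g = l2_inner M f' g'"
  unfolding l2_inner_def
proof (rule integral_cong_AE)
  show "AE x in M. f x * g x = f' x * g' x"
    using assms(5,6) by eventually_elim simp
qed (use assms in \<open>auto simp: L2_def\<close>)

lemma l2_inner_mono_AE:
  assumes "f \<in> L2 M" "g \<in> L2 M" "f' \<in> L2 M" "g' \<in> L2 M"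
    and "AE x in M. f x * g x \<le> f' x * g' x"
  shows "l2_inner M f g \<le> l2_inner M f' g'"
  unfolding l2_inner_def
  by (rule integral_mono_AE) (use assms in \<open>auto intro: L2_integrable_mult\<close>)

lemma l2_inner_nonneg_AE:
  assumes "AE x in M. 0 \<le> f x * g x"
  shows "0 \<le> l2_inner M f g"
  unfolding l2_inner_def by (rule integral_nonneg_AE) fact

lemma l2_inner_eq_0_AE:
  assumes "f \<in> L2 M" "g \<in> L2 M" "AE x in M. f x * g x = 0"
  shows "l2_inner M f g = 0"
  unfolding l2_inner_def by (rule integral_eq_zero_AE) fact

lemma l2_inner_eq_0_imp_AE:
  assumes "f \<in> L2 M" "g \<in> L2 M" "AE x in M. 0 \<le> f x * g x" "l2_inner M f g = 0"
  shows "AE x in M. f x * g x = 0"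
  using integral_nonneg_eq_0_iff_AE[OF L2_integrable_mult[OF assms(1,2)] assms(3)] assms(4)
  by (simp add: l2_inner_def)

lemma l2_norm_nonneg [simp]: "0 \<le> l2_norm M f"
  by (simp add: l2_norm_def l2_inner_def)

lemma l2_norm_square: "(l2_norm M f)\<^sup>2 = l2_inner M f f"
  by (simp add: l2_norm_def l2_inner_def)

lemma l2_norm_cong_AE:
  assumes "f \<in> L2 M" "g \<in> L2 M" "AE x in M. f x = g x"
  shows "l2_norm M f = l2_norm M g"
  unfolding l2_norm_def by (subst l2_inner_cong_AE[of f M f g g]) (use assms in auto)

lemma l2_norm_mono_AE:
  assumes "f \<in> borel_measurable M" "g \<in> L2 M" "AE x in M. \<bar>f x\<bar> \<le> \<bar>g x\<bar>"
  shows "l2_norm M f \<le> l2_norm M g"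
proof -
  have f: "f \<in> L2 M" using L2_dominated[OF assms(2,1,3)] .
  have "AE x in M. f x * f x \<le> g x * g x"
    using assms(3) by eventually_elim (metis abs_mult_self_eq abs_ge_zero mult_mono)
  then have "l2_inner M f f \<le> l2_inner M g g"
    by (intro l2_inner_mono_AE f assms(2))
  then show ?thesis by (simp add: l2_norm_def)
qed

lemma l2_norm_eq_0_iff:
  assumes "f \<in> L2 M"
  shows "l2_norm M f = 0 \<longleftrightarrow> (AE x in M. f x = 0)"
proof -
  have "l2_norm M f = 0 \<longleftrightarrow> (AE x in M. f x * f x = 0)"
    using integral_nonneg_eq_0_iff_AE[OF L2_integrable_mult[OF assms assms]]
    by (simp add: l2_norm_def l2_inner_def)
  then show ?thesis by simp
qed

lemma l2_norm_scale: "l2_norm M (\<lambda>x. a * f x) = \<bar>a\<bar> * l2_norm M f"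
proof -
  have "l2_inner M (\<lambda>x. a * f x) (\<lambda>x. a * f x) = a\<^sup>2 * l2_inner M f f"
    by (simp add: l2_inner_scale_left l2_inner_scale_right power2_eq_square)
  then show ?thesis by (simp add: l2_norm_def real_sqrt_mult)
qed

lemma l2_norm_uminus: "l2_norm M (\<lambda>x. - f x) = l2_norm M f"
  using l2_norm_scale[of M "-1" f] by simp

lemma l2_norm_divide: "l2_norm M (\<lambda>x. f x / a) = l2_norm M f / \<bar>a\<bar>"
  using l2_norm_scale[of M "1/a" f] by simp

lemma l2_norm_minus_commute: "l2_norm M (\<lambda>x. f x - g x) = l2_norm M (\<lambda>x. g x - f x)"
  using l2_norm_uminus[of M "\<lambda>x. f x - g x"] by simp

lemma l2_norm_zero [simp]: "l2_norm M (\<lambda>x. 0) = 0"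
  by (simp add: l2_norm_def)

lemma l2_Cauchy_Schwarz:
  assumes "f \<in> L2 M" "g \<in> L2 M"
  shows "\<bar>l2_inner M f g\<bar> \<le> l2_norm M f * l2_norm M g"
proof -
  have "0 \<le> l2_inner M f f + 2 * t * l2_inner M f g + t\<^sup>2 * l2_inner M g g" for t
  proof -
    have "0 \<le> l2_inner M (\<lambda>x. f x + t * g x) (\<lambda>x. f x + t * g x)"
      by (simp add: l2_inner_def)
    also have "\<dots> = l2_inner M f f + 2 * t * l2_inner M f g + t\<^sup>2 * l2_inner M g g"
      using assms by (simp add: l2_inner_add_left l2_inner_add_right l2_inner_scale_left
          l2_inner_scale_right L2_intros l2_inner_commute[of M g f] power2_eq_square algebra_simps)
    finally show ?thesis .
  qed
  then have "(l2_inner M f g)\<^sup>2 \<le> (l2_norm M f)\<^sup>2 * (l2_norm M g)\<^sup>2"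
    unfolding l2_norm_square by (rule quadratic_nonneg_imp_discriminant)
  then have "(l2_inner M f g)\<^sup>2 \<le> (l2_norm M f * l2_norm M g)\<^sup>2"
    by (simp add: power_mult_distrib)
  then show ?thesis by (simp add: abs_le_square_iff[symmetric])
qed

lemma l2_norm_add:
  assumes "f \<in> L2 M" "g \<in> L2 M"
  shows "l2_norm M (\<lambda>x. f x + g x) \<le> l2_norm M f + l2_norm M g"
proof (rule power2_le_imp_le)
  have "(l2_norm M (\<lambda>x. f x + g x))\<^sup>2 = l2_inner M f f + 2 * l2_inner M f g + l2_inner M g g"
    using assms unfolding l2_norm_square
    by (simp add: l2_inner_add_left l2_inner_add_right L2_intros l2_inner_commute[of M g f])
  also have "\<dots> \<le> (l2_norm M f)\<^sup>2 + 2 * (l2_norm M f * l2_norm M g) + (l2_norm M g)\<^sup>2"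
    using l2_Cauchy_Schwarz[OF assms] by (simp add: l2_norm_square)
  also have "\<dots> = (l2_norm M f + l2_norm M g)\<^sup>2"
    by (simp add: power2_eq_square algebra_simps)
  finally show "(l2_norm M (\<lambda>x. f x + g x))\<^sup>2 \<le> (l2_norm M f + l2_norm M g)\<^sup>2" .
qed simp

lemma l2_norm_diff:
  assumes "f \<in> L2 M" "g \<in> L2 M"
  shows "l2_norm M (\<lambda>x. f x - g x) \<le> l2_norm M f + l2_norm M g"
  using l2_norm_add[OF assms(1) L2_uminus[OF assms(2)]] by (simp add: l2_norm_uminus)

lemma l2_norm_triangle:
  assumes "f \<in> L2 M" "g \<in> L2 M" "h \<in> L2 M"
  shows "l2_norm M (\<lambda>x. f x - h x) \<le> l2_norm M (\<lambda>x. f x - g x) + l2_norm M (\<lambda>x. g x - h x)"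
  using l2_norm_add[of "\<lambda>x. f x - g x" M "\<lambda>x. g x - h x"] assms by (simp add: L2_diff)

lemma l2_norm_le_add_diff:
  assumes "f \<in> L2 M" "g \<in> L2 M"
  shows "l2_norm M f \<le> l2_norm M g + l2_norm M (\<lambda>x. f x - g x)"
  using l2_norm_add[of g M "\<lambda>x. f x - g x"] assms by (simp add: L2_diff)

section \<open>Convergence\<close>

lemma l2_tendsto_norm:
  assumes "l2_tendsto M u f F" "\<forall>\<^sub>F n in F. u n \<in> L2 M" "f \<in> L2 M"
  shows "((\<lambda>n. l2_norm M (u n)) \<longlongrightarrow> l2_norm M f) F"
proof (rule LIM_zero_cancel, rule tendsto_0_le[where K = 1])
  show "((\<lambda>n. l2_norm M (\<lambda>x. u n x - f x)) \<longlongrightarrow> 0) F"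
    using assms(1) by (simp add: l2_tendsto_def)
  show "\<forall>\<^sub>F n in F. norm (l2_norm M (u n) - l2_norm M f) \<le> norm (l2_norm M (\<lambda>x. u n x - f x)) * 1"
    using assms(2)
  proof eventually_elim
    case (elim n)
    show ?case
      using l2_norm_le_add_diff[OF elim assms(3)] l2_norm_le_add_diff[OF assms(3) elim]
      by (simp add: l2_norm_minus_commute[of M f])
  qed
qed

lemma l2_tendsto_inner:
  assumes "l2_tendsto M u f F" "\<forall>\<^sub>F n in F. u n \<in> L2 M" "f \<in> L2 M" "g \<in> L2 M"
  shows "((\<lambda>n. l2_inner M (u n) g) \<longlongrightarrow> l2_inner M f g) F"
proof (rule LIM_zero_cancel, rule tendsto_0_le[where K = "l2_norm M g"])
  show "((\<lambda>n. l2_norm M (\<lambda>x. u n x - f x)) \<longlongrightarrow> 0) F"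
    using assms(1) by (simp add: l2_tendsto_def)
  show "\<forall>\<^sub>F n in F. norm (l2_inner M (u n) g - l2_inner M f g)
           \<le> norm (l2_norm M (\<lambda>x. u n x - f x)) * l2_norm M g"
    using assms(2)
  proof eventually_elim
    case (elim n)
    show ?case
      using l2_Cauchy_Schwarz[OF L2_diff[OF elim assms(3)] assms(4)]
      by (simp add: l2_inner_diff_left elim assms)
  qed
qed

lemma l2_tendsto_inner2:
  assumes "l2_tendsto M u f F" "\<forall>\<^sub>F n in F. u n \<in> L2 M" "f \<in> L2 M"
    and "l2_tendsto M v g F" "\<forall>\<^sub>F n in F. v n \<in> L2 M" "g \<in> L2 M"
  shows "((\<lambda>n. l2_inner M (u n) (v n)) \<longlongrightarrow> l2_inner M f g) F"
proof -
  have "((\<lambda>n. l2_inner M (u n) (v n) - l2_inner M (u n) g) \<longlongrightarrow> 0) F"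
  proof (rule tendsto_0_le[where K = 1])
    show "((\<lambda>n. l2_norm M (u n) * l2_norm M (\<lambda>x. v n x - g x)) \<longlongrightarrow> 0) F"
      using tendsto_mult[OF l2_tendsto_norm[OF assms(1-3)] assms(4)[unfolded l2_tendsto_def]]
      by simp
    show "\<forall>\<^sub>F n in F. norm (l2_inner M (u n) (v n) - l2_inner M (u n) g)
           \<le> norm (l2_norm M (u n) * l2_norm M (\<lambda>x. v n x - g x)) * 1"
      using assms(2,5)
    proof eventually_elim
      case (elim n)
      show ?case
        using l2_Cauchy_Schwarz[OF elim(1) L2_diff[OF elim(2) assms(6)]]
        by (simp add: l2_inner_diff_right elim assms abs_mult)
    qed
  qed
  from tendsto_add[OF this l2_tendsto_inner[OF assms(1-3,6)]] show ?thesis by simp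
qed

lemma l2_tendsto_squeeze:
  assumes "l2_tendsto M u f F"
    and "\<forall>\<^sub>F n in F. l2_norm M (\<lambda>x. v n x - g x) \<le> C * l2_norm M (\<lambda>x. u n x - f x)"
  shows "l2_tendsto M v g F"
  unfolding l2_tendsto_def
proof (rule tendsto_0_le[where K = C])
  show "((\<lambda>n. l2_norm M (\<lambda>x. u n x - f x)) \<longlongrightarrow> 0) F"
    using assms(1) by (simp add: l2_tendsto_def)
  show "\<forall>\<^sub>F n in F. norm (l2_norm M (\<lambda>x. v n x - g x)) \<le> norm (l2_norm M (\<lambda>x. u n x - f x)) * C"
    using assms(2) by eventually_elim (simp add: mult.commute)
qed

lemma l2_tendsto_dominated:
  assumes u: "\<And>n. u n \<in> borel_measurable M" and f: "f \<in> borel_measurable M" and w: "w \<in> L2 M"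
    and lim: "AE x in M. (\<lambda>n. u n x) \<longlonglongrightarrow> f x"
    and bd: "\<And>n. AE x in M. \<bar>u n x\<bar> \<le> \<bar>w x\<bar>"
  shows "f \<in> L2 M" "l2_tendsto M u f sequentially"
proof -
  have fb: "AE x in M. \<bar>f x\<bar> \<le> \<bar>w x\<bar>"
  proof -
    have "AE x in M. \<forall>n. \<bar>u n x\<bar> \<le> \<bar>w x\<bar>" using bd by (simp add: AE_all_countable)
    with lim show ?thesis
    proof eventually_elim
      case (elim x)
      from tendsto_rabs[OF elim(1)] show ?case
        by (rule tendsto_upperbound) (use elim(2) in auto)
    qed
  qed
  show fL: "f \<in> L2 M" by (rule L2_dominated[OF w f fb])
  have "(\<lambda>n. LINT x|M. (u n x - f x) * (u n x - f x)) \<longlonglongrightarrow> (LINT x|M. 0)"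
  proof (rule integral_dominated_convergence[where w = "\<lambda>x. 4 * (w x)\<^sup>2"])
    show "integrable M (\<lambda>x. 4 * (w x)\<^sup>2)" using L2_integrable_square[OF w] by simp
    show "AE x in M. (\<lambda>n. (u n x - f x) * (u n x - f x)) \<longlonglongrightarrow> 0"
      using lim
    proof eventually_elim
      case (elim x)
      then have "(\<lambda>n. u n x - f x) \<longlonglongrightarrow> 0" by (simp add: LIM_zero)
      from tendsto_mult[OF this this] show ?case by simp
    qed
    show "AE x in M. norm ((u n x - f x) * (u n x - f x)) \<le> 4 * (w x)\<^sup>2" for n
      using bd[of n] fb
    proof eventually_elim
      case (elim x)
      then have "\<bar>u n x - f x\<bar> \<le> 2 * \<bar>w x\<bar>" by linarith
      then have "\<bar>u n x - f x\<bar> * \<bar>u n x - f x\<bar> \<le> (2 * \<bar>w x\<bar>) * (2 * \<bar>w x\<bar>)"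
        by (intro mult_mono) auto
      then show ?case by (simp add: abs_mult power2_eq_square abs_mult_self_eq)
    qed
  qed (use u f in auto)
  then have "(\<lambda>n. l2_inner M (\<lambda>x. u n x - f x) (\<lambda>x. u n x - f x)) \<longlonglongrightarrow> 0"
    by (simp add: l2_inner_def)
  from tendsto_real_sqrt[OF this] show "l2_tendsto M u f sequentially"
    by (simp add: l2_tendsto_def l2_norm_def)
qed

lemma l2_nonneg_limit:
  assumes "l2_tendsto M u f F" "\<forall>\<^sub>F n in F. u n \<in> L2 M \<and> (AE x in M. 0 \<le> u n x)"
    and f: "f \<in> L2 M" and "F \<noteq> bot"
  shows "AE x in M. 0 \<le> f x"
proof -
  define m where "m = (\<lambda>x. max (- f x) 0)"
  have m_meas: "m \<in> borel_measurable M" using f by (auto simp: m_def L2_def)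
  have mL: "m \<in> L2 M" by (rule L2_dominated[OF f m_meas]) (auto simp: m_def)
  have "((\<lambda>n. l2_norm M (\<lambda>x. u n x - f x)) \<longlongrightarrow> 0) F"
    using assms(1) by (simp add: l2_tendsto_def)
  moreover have "\<forall>\<^sub>F n in F. l2_norm M m \<le> l2_norm M (\<lambda>x. u n x - f x)"
    using assms(2)
  proof eventually_elim
    case (elim n)
    have "AE x in M. \<bar>m x\<bar> \<le> \<bar>u n x - f x\<bar>"
      using conjunct2[OF elim] by eventually_elim (auto simp: m_def)
    then show ?case
      using elim f by (intro l2_norm_mono_AE m_meas L2_diff) auto
  qed
  ultimately have "l2_norm M m \<le> 0"
    using \<open>F \<noteq> bot\<close> by (intro tendsto_lowerbound[of _ 0 F]) auto
  then have "l2_norm M m = 0" using l2_norm_nonneg[of M m] by simp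
  then have "AE x in M. m x = 0" using l2_norm_eq_0_iff[OF mL] by simp
  then show ?thesis by eventually_elim (auto simp: m_def)
qed

section \<open>Completeness along geometric sequences\<close>

lemma l2_norm_nn_integral:
  assumes "f \<in> L2 M"
  shows "(\<integral>\<^sup>+x. ennreal ((f x)\<^sup>2) \<partial>M) = ennreal ((l2_norm M f)\<^sup>2)"
  using nn_integral_eq_integral[OF L2_integrable_square[OF assms]]
  unfolding l2_norm_square l2_inner_def by (simp add: power2_eq_square)

lemma L2_Fatou:
  assumes u: "\<And>n. u n \<in> L2 M" and f: "f \<in> borel_measurable M"
    and lim: "AE x in M. (\<lambda>n. u n x) \<longlonglongrightarrow> f x"
    and bd: "\<forall>\<^sub>F n in sequentially. l2_norm M (u n) \<le> C"
  shows "f \<in> L2 M" "l2_norm M f \<le> C"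
proof -
  obtain n0 where n0: "\<And>n. n \<ge> n0 \<Longrightarrow> l2_norm M (u n) \<le> C"
    using bd by (auto simp: eventually_sequentially)
  have C: "C \<ge> 0" using order_trans[OF l2_norm_nonneg n0[OF order_refl]] .
  have "(\<integral>\<^sup>+x. ennreal ((f x)\<^sup>2) \<partial>M) = (\<integral>\<^sup>+x. liminf (\<lambda>n. ennreal ((u n x)\<^sup>2)) \<partial>M)"
  proof (rule nn_integral_cong_AE)
    show "AE x in M. ennreal ((f x)\<^sup>2) = liminf (\<lambda>n. ennreal ((u n x)\<^sup>2))"
      using lim
    proof eventually_elim
      case (elim x)
      have "(\<lambda>n. ennreal ((u n x)\<^sup>2)) \<longlonglongrightarrow> ennreal ((f x)\<^sup>2)"
        by (intro tendsto_intros elim)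
      then show ?case by (metis lim_imp_Liminf trivial_limit_sequentially)
    qed
  qed
  also have "\<dots> \<le> liminf (\<lambda>n. \<integral>\<^sup>+x. ennreal ((u n x)\<^sup>2) \<partial>M)"
    by (rule nn_integral_liminf) (use u in \<open>auto simp: L2_def\<close>)
  also have "\<dots> \<le> ennreal (C\<^sup>2)"
  proof (rule Liminf_le)
    show "\<forall>\<^sub>F n in sequentially. (\<integral>\<^sup>+x. ennreal ((u n x)\<^sup>2) \<partial>M) \<le> ennreal (C\<^sup>2)"
      using bd
    proof eventually_elim
      case (elim n)
      then show ?case
        unfolding l2_norm_nn_integral[OF u] by (intro ennreal_leI power_mono) auto
    qed
  qed simp
  finally have le: "(\<integral>\<^sup>+x. ennreal ((f x)\<^sup>2) \<partial>M) \<le> ennreal (C\<^sup>2)" .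
  then have "(\<integral>\<^sup>+x. ennreal ((f x)\<^sup>2) \<partial>M) < \<infinity>"
    using le_less_trans by fastforce
  then have "integrable M (\<lambda>x. (f x)\<^sup>2)"
    using f by (intro integrableI_bounded) auto
  then show fL: "f \<in> L2 M" using f by (simp add: L2_def)
  have "ennreal ((l2_norm M f)\<^sup>2) \<le> ennreal (C\<^sup>2)"
    using le l2_norm_nn_integral[OF fL] by simp
  then have "(l2_norm M f)\<^sup>2 \<le> C\<^sup>2" by simp
  then show "l2_norm M f \<le> C" using C by (rule power2_le_imp_le)
qed

text \<open>
  Since the norms of the increments decay
  geometrically, the increments are absolutely summable almost everywhere, so the whole sequence
  converges pointwise; Fatou's lemma then gives the norm estimate.
\<close>

lemma L2_complete_geometric:
  assumes x: "\<And>n. x n \<in> L2 M" and c: "0 \<le> c" "c < 1"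
    and d: "\<And>n. l2_norm M (\<lambda>y. x (Suc n) y - x n y) \<le> c ^ n"
  obtains z where "z \<in> L2 M" "\<And>n. l2_norm M (\<lambda>y. x n y - z y) \<le> c ^ n / (1 - c)"
proof -
  define D where "D = (\<lambda>k y. \<bar>x (Suc k) y - x k y\<bar>)"
  define Fn where "Fn = (\<lambda>N y. \<Sum>k<N. D k y)"
  have DL: "D k \<in> L2 M" for k unfolding D_def by (intro L2_intros x)
  have Dn: "l2_norm M (D k) \<le> c ^ k" for k
  proof -
    have "l2_norm M (D k) \<le> l2_norm M (\<lambda>y. x (Suc k) y - x k y)"
      using DL by (intro l2_norm_mono_AE L2_diff x) (auto simp: D_def L2_def)
    then show ?thesis using d[of k] by simp
  qed
  have FL: "Fn N \<in> L2 M" for N unfolding Fn_def by (intro L2_sum DL) auto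
  have "l2_norm M (Fn N) \<le> (\<Sum>k<N. c ^ k)" for N
  proof (induction N)
    case 0
    then show ?case by (simp add: Fn_def)
  next
    case (Suc N)
    have "l2_norm M (Fn (Suc N)) \<le> l2_norm M (Fn N) + l2_norm M (D N)"
      using l2_norm_add[OF FL DL] by (simp add: Fn_def)
    then show ?case using Suc Dn[of N] by simp
  qed
  moreover have geo: "(\<Sum>k<N. c ^ k) \<le> 1 / (1 - c)" for N
    using c by (auto simp: sum_gp_strict intro!: divide_right_mono)
  ultimately have Fb: "l2_norm M (Fn N) \<le> 1 / (1 - c)" for N by (meson order_trans)
  have Fmono: "Fn m y \<le> Fn n y" if "m \<le> n" for m n y
    unfolding Fn_def using that by (intro sum_mono2) (auto simp: D_def)
  have F0: "0 \<le> Fn m y" for m y unfolding Fn_def by (intro sum_nonneg) (auto simp: D_def)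
  \<comment> \<open>\<open>Fn N\<close> increases to the total variation of \<open>n \<mapsto> x n y\<close>, which is finite almost everywhere
    because its square has a finite integral.\<close>
  have "(\<integral>\<^sup>+y. (SUP N. ennreal ((Fn N y)\<^sup>2)) \<partial>M) = (SUP N. \<integral>\<^sup>+y. ennreal ((Fn N y)\<^sup>2) \<partial>M)"
  proof (rule nn_integral_monotone_convergence_SUP)
    show "incseq (\<lambda>N y. ennreal ((Fn N y)\<^sup>2))"
      by (auto simp: incseq_def le_fun_def intro!: ennreal_leI power_mono Fmono F0)
  qed (use FL in \<open>auto simp: L2_def\<close>)
  also have "\<dots> \<le> ennreal ((1 / (1 - c))\<^sup>2)"
    unfolding l2_norm_nn_integral[OF FL]
    by (intro SUP_least ennreal_leI power_mono Fb) auto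
  finally have "(\<integral>\<^sup>+y. (SUP N. ennreal ((Fn N y)\<^sup>2)) \<partial>M) \<noteq> \<infinity>"
    using neq_top_trans[OF ennreal_neq_top] by (auto simp: infinity_ennreal_def)
  then have "AE y in M. (SUP N. ennreal ((Fn N y)\<^sup>2)) \<noteq> \<infinity>"
    using FL by (intro nn_integral_noteq_infinite borel_measurable_SUP) (auto simp: L2_def)
  then have conv: "AE y in M. convergent (\<lambda>n. x n y)"
  proof eventually_elim
    case (elim y)
    define B where "B = enn2real (SUP N. ennreal ((Fn N y)\<^sup>2))"
    have "ennreal ((Fn N y)\<^sup>2) \<le> ennreal B" for N
    proof -
      have "ennreal ((Fn N y)\<^sup>2) \<le> (SUP N. ennreal ((Fn N y)\<^sup>2))" by (rule SUP_upper) simp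
      moreover have "ennreal B = (SUP N. ennreal ((Fn N y)\<^sup>2))"
        using elim by (simp only: B_def ennreal_enn2real_if infinity_ennreal_def if_False)
      ultimately show ?thesis by simp
    qed
    moreover have "B \<ge> 0" by (simp add: B_def)
    ultimately have "(Fn N y)\<^sup>2 \<le> B" for N by simp
    then have "Fn N y \<le> sqrt B" for N by (rule real_le_rsqrt)
    then have "(\<Sum>k<N. D k y) \<le> sqrt B" for N by (simp add: Fn_def)
    then have "summable (\<lambda>k. D k y)"
      by (intro summableI_nonneg_bounded[of _ "sqrt B"]) (auto simp: D_def)
    then have "summable (\<lambda>k. x (Suc k) y - x k y)"
      unfolding D_def by (rule summable_rabs_cancel)
    then have "convergent (\<lambda>n. \<Sum>k<n. (x (Suc k) y - x k y))"
      by (simp add: summable_iff_convergent)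
    then have "convergent (\<lambda>n. x n y - x 0 y)" 
      by (simp add: sum_lessThan_telescope[of "\<lambda>n. x n y"])
    then show "convergent (\<lambda>n. x n y)" by (simp add: convergent_diff_const_right_iff)
  qed
  define z where "z = (\<lambda>y. lim (\<lambda>n. x n y))"
  have xm: "x n \<in> borel_measurable M" for n using x by (simp add: L2_def)
  have zm: "z \<in> borel_measurable M" unfolding z_def
    by (rule borel_measurable_lim_metric) (rule xm)
  have zlim: "AE y in M. (\<lambda>n. x n y) \<longlonglongrightarrow> z y"
    using conv by eventually_elim (simp add: z_def convergent_LIMSEQ_iff)
  have tail: "l2_norm M (\<lambda>y. x n y - x (n + j) y) \<le> c ^ n / (1 - c)" for n j
  proof -
    have "l2_norm M (\<lambda>y. x n y - x (n + j) y) \<le> (\<Sum>k<j. c ^ (n + k))"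
    proof (induction j)
      case (Suc j)
      have "l2_norm M (\<lambda>y. x n y - x (n + Suc j) y)
        \<le> l2_norm M (\<lambda>y. x n y - x (n + j) y) + l2_norm M (\<lambda>y. x (n + j) y - x (n + Suc j) y)"
        by (intro l2_norm_triangle x)
      then show ?case
        using Suc d[of "n + j"] by (simp add: l2_norm_minus_commute[of M "x (n + j)"])
    qed simp
    also have "\<dots> = c ^ n * (\<Sum>k<j. c ^ k)" by (simp add: power_add sum_distrib_left)
    also have "\<dots> \<le> c ^ n * (1 / (1 - c))"
      using c by (intro mult_left_mono geo) auto
    finally show ?thesis by simp
  qed
  have "(\<lambda>y. x n y - z y) \<in> L2 M \<and> l2_norm M (\<lambda>y. x n y - z y) \<le> c ^ n / (1 - c)" for n
  proof -
    have "AE y in M. (\<lambda>j. x n y - x (n + j) y) \<longlonglongrightarrow> x n y - z y"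
      using zlim
    proof eventually_elim
      case (elim y)
      from LIMSEQ_ignore_initial_segment[OF elim, of n]
      show ?case by (intro tendsto_intros) (simp add: add.commute)
    qed
    then show ?thesis
      using L2_Fatou[of "\<lambda>j y. x n y - x (n + j) y" M "\<lambda>y. x n y - z y" "c ^ n / (1 - c)"]
        tail xm zm x by (auto intro: L2_diff)
  qed note tz = this
  have "(\<lambda>y. x 0 y - (x 0 y - z y)) \<in> L2 M" by (rule L2_diff[OF x conjunct1[OF tz]])
  then have "z \<in> L2 M" by simp
  then show ?thesis using tz that by blast
qed

section \<open>Boundedness of strongly continuous semigroups\<close>

lemma bounded_op_almost_attains_norm:
  assumes T: "bounded_op_L2 M T" and c: "0 < c"
    and nb: "\<not> (\<forall>f\<in>L2 M. l2_norm M (T f) \<le> c * l2_norm M f)"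
  obtains N f where "c \<le> N" "\<And>f. f \<in> L2 M \<Longrightarrow> l2_norm M (T f) \<le> N * l2_norm M f"
    "f \<in> L2 M" "l2_norm M f \<le> 1" "2 / 3 * N \<le> l2_norm M (T f)"
proof -
  obtain B where B: "\<And>f. f \<in> L2 M \<Longrightarrow> l2_norm M (T f) \<le> B * l2_norm M f"
    using T unfolding bounded_op_L2_def by blast
  define X where "X = (\<lambda>f. l2_norm M (T f)) ` {f \<in> L2 M. l2_norm M f \<le> 1}"
  have bdd: "bdd_above X"
  proof (rule bdd_aboveI)
    fix r assume "r \<in> X"
    then obtain f where f: "f \<in> L2 M" "l2_norm M f \<le> 1" "r = l2_norm M (T f)"
      by (auto simp: X_def)
    have "r \<le> B * l2_norm M f" using B f by simp
    also have "\<dots> \<le> \<bar>B\<bar> * 1" using f by (intro mult_mono) auto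
    finally show "r \<le> \<bar>B\<bar>" by simp
  qed
  have scale: "l2_norm M (T (\<lambda>x. a * f x)) = \<bar>a\<bar> * l2_norm M (T f)" if "f \<in> L2 M" for a f
  proof -
    have "AE x in M. T (\<lambda>y. a * f y + 0 * f y) x = a * T f x + 0 * T f x"
      using T that unfolding bounded_op_L2_def by blast
    then have "AE x in M. T (\<lambda>y. a * f y) x = a * T f x" by simp
    then have "l2_norm M (T (\<lambda>y. a * f y)) = l2_norm M (\<lambda>x. a * T f x)"
      using T that by (intro l2_norm_cong_AE) (auto simp: bounded_op_L2_def intro: L2_scale)
    then show ?thesis by (simp add: l2_norm_scale)
  qed
  define N where "N = Sup X"
  have N: "l2_norm M (T f) \<le> N * l2_norm M f" if f: "f \<in> L2 M" for f
  proof (cases "l2_norm M f = 0")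
    case True
    then show ?thesis using B[OF f] by simp
  next
    case False
    then have p: "l2_norm M f > 0" by (simp add: less_le)
    let ?g = "\<lambda>x. (1 / l2_norm M f) * f x"
    have "l2_norm M ?g = 1" using p unfolding l2_norm_scale by simp
    then have "l2_norm M (T ?g) \<in> X" unfolding X_def by (intro imageI CollectI conjI L2_scale f) simp
    then have "l2_norm M (T ?g) \<le> N" unfolding N_def by (rule cSup_upper) (rule bdd)
    then show ?thesis unfolding scale[OF f] using p by (simp add: field_simps)
  qed
  obtain f0 where f0: "f0 \<in> L2 M" "l2_norm M (T f0) > c * l2_norm M f0"
    using nb by (auto simp: not_le)
  have cN: "c \<le> N"
  proof (rule ccontr)
    assume "\<not> c \<le> N"
    then have "N * l2_norm M f0 \<le> c * l2_norm M f0" by (intro mult_right_mono) auto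
    then show False using N[OF f0(1)] f0(2) by linarith
  qed
  have "X \<noteq> {}" unfolding X_def using L2_zero[of M] by force
  moreover have "2 / 3 * N < Sup X" using cN c by (simp add: N_def[symmetric])
  ultimately obtain r where "r \<in> X" "2 / 3 * N < r" using less_cSupD by blast
  then show ?thesis using that[OF cN N] by (auto simp: X_def)
qed

locale l2_semigroup =
  fixes M :: "'a measure" and S :: "real \<Rightarrow> ('a \<Rightarrow> real) \<Rightarrow> 'a \<Rightarrow> real"
  assumes C0: "C0_semigroup M S"
begin

lemma bounded: "0 \<le> t \<Longrightarrow> bounded_op_L2 M (S t)"
  using C0 by (simp add: C0_semigroup_def)

lemma S_L2: "0 \<le> t \<Longrightarrow> f \<in> L2 M \<Longrightarrow> S t f \<in> L2 M"
  using bounded by (simp add: bounded_op_L2_def)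

lemma S_cong:
  "0 \<le> t \<Longrightarrow> f \<in> L2 M \<Longrightarrow> g \<in> L2 M \<Longrightarrow> AE x in M. f x = g x \<Longrightarrow> AE x in M. S t f x = S t g x"
  using bounded by (simp add: bounded_op_L2_def)

lemma S_lin:
  "0 \<le> t \<Longrightarrow> f \<in> L2 M \<Longrightarrow> g \<in> L2 M \<Longrightarrow>
    AE x in M. S t (\<lambda>y. a * f y + b * g y) x = a * S t f x + b * S t g x"
  using bounded by (simp add: bounded_op_L2_def)

lemma S_scale: "0 \<le> t \<Longrightarrow> f \<in> L2 M \<Longrightarrow> AE x in M. S t (\<lambda>y. a * f y) x = a * S t f x"
  using S_lin[of t f f a 0] by simp

lemma S_add:
  "0 \<le> t \<Longrightarrow> f \<in> L2 M \<Longrightarrow> g \<in> L2 M \<Longrightarrow> AE x in M. S t (\<lambda>y. f y + g y) x = S t f x + S t g x"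
  using S_lin[of t f g 1 1] by simp

lemma S_diff:
  "0 \<le> t \<Longrightarrow> f \<in> L2 M \<Longrightarrow> g \<in> L2 M \<Longrightarrow> AE x in M. S t (\<lambda>y. f y - g y) x = S t f x - S t g x"
  using S_lin[of t f g 1 "-1"] by simp

lemma S_divide: "0 \<le> t \<Longrightarrow> f \<in> L2 M \<Longrightarrow> AE x in M. S t (\<lambda>y. f y / a) x = S t f x / a"
  using S_scale[of t f "1/a"] by simp

lemma S_lin3:
  assumes "0 \<le> t" "f \<in> L2 M" "g \<in> L2 M" "k \<in> L2 M"
  shows "AE x in M. S t (\<lambda>y. f y - g y + a * k y) x = S t f x - S t g x + a * S t k x"
  using S_add[OF assms(1) L2_diff[OF assms(2,3)] L2_scale[OF assms(4), of a]]
    S_diff[OF assms(1-3)] S_scale[OF assms(1,4), of a]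
  by eventually_elim simp

lemma S_plus:
  "0 \<le> s \<Longrightarrow> 0 \<le> t \<Longrightarrow> f \<in> L2 M \<Longrightarrow> AE x in M. S (s + t) f x = S s (S t f) x"
  using C0 by (simp add: C0_semigroup_def)

lemma S_0: "f \<in> L2 M \<Longrightarrow> AE x in M. S 0 f x = f x"
  using C0 by (simp add: C0_semigroup_def)

lemma S_tendsto: "f \<in> L2 M \<Longrightarrow> l2_tendsto M (\<lambda>t. S t f) f (at_right 0)"
  using C0 by (simp add: C0_semigroup_def)

lemma S_commute:
  assumes "0 \<le> s" "0 \<le> t" "f \<in> L2 M"
  shows "AE x in M. S s (S t f) x = S t (S s f) x"
  using S_plus[OF assms] S_plus[OF assms(2,1,3)] by eventually_elim (simp add: add.commute)

lemma eventually_S_L2: "f \<in> L2 M \<Longrightarrow> \<forall>\<^sub>F t in at_right 0. S t f \<in> L2 M"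
  using S_L2 by (auto simp: eventually_at_filter)

text \<open>
  The uniform boundedness principle for \<open>S\<^sub>t\<close> as \<open>t \<rightarrow> 0\<close>, by a gliding hump without Baire's theorem.  If
  the operators \<open>S (t n)\<close> had norms above \<open>4\<^sup>n\<close>, one could add vectors \<open>\<plusminus> 3\<^sup>-\<^sup>n f\<^sub>n\<close> such that the norm of
  \<open>S (t n)\<close> on the partial sum is at least two thirds of \<open>3\<^sup>-\<^sup>n\<close> times the operator norm.  The remaining
  terms have total norm at most half of \<open>3\<^sup>-\<^sup>n\<close>, so \<open>S (t n) z\<close> is unbounded for the sum \<open>z\<close>, in
  contradiction to strong continuity.
\<close>

lemma norm_bounded_near_0:
  obtains d B where "0 < d" "1 \<le> B"
    "\<And>t f. 0 \<le> t \<Longrightarrow> t \<le> d \<Longrightarrow> f \<in> L2 M \<Longrightarrow> l2_norm M (S t f) \<le> B * l2_norm M f"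
proof -
  have "\<exists>d>0. \<exists>B\<ge>1. \<forall>t f. 0 \<le> t \<longrightarrow> t \<le> d \<longrightarrow> f \<in> L2 M \<longrightarrow> l2_norm M (S t f) \<le> B * l2_norm M f"
  proof (rule ccontr)
    assume neg: "\<not> ?thesis"
    have "\<exists>t. 0 \<le> t \<and> t \<le> 1 / real (Suc n)
        \<and> \<not> (\<forall>f\<in>L2 M. l2_norm M (S t f) \<le> 4 ^ n * l2_norm M f)" for n
    proof -
      have "0 < 1 / real (Suc n)" "1 \<le> (4::real) ^ n" by auto
      with neg show ?thesis by blast
    qed
    then obtain t where t: "\<And>n. 0 \<le> t n" "\<And>n. t n \<le> 1 / real (Suc n)"
      and tb: "\<And>n. \<not> (\<forall>f\<in>L2 M. l2_norm M (S (t n) f) \<le> 4 ^ n * l2_norm M f)"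
      by metis
    have tpos: "0 < t n" for n
    proof (rule ccontr)
      assume "\<not> 0 < t n"
      then have "t n = 0" using t(1)[of n] by simp
      moreover have "l2_norm M (S 0 f) \<le> 4 ^ n * l2_norm M f" if f: "f \<in> L2 M" for f
      proof -
        have "l2_norm M (S 0 f) = 1 * l2_norm M f"
          using l2_norm_cong_AE[OF S_L2[OF _ f] f S_0[OF f]] by simp
        also have "\<dots> \<le> 4 ^ n * l2_norm M f" by (intro mult_right_mono) auto
        finally show ?thesis .
      qed
      ultimately show False using tb[of n] by simp
    qed
    have "\<exists>N f. 4 ^ n \<le> N \<and> (\<forall>g\<in>L2 M. l2_norm M (S (t n) g) \<le> N * l2_norm M g) \<and>
       f \<in> L2 M \<and> l2_norm M f \<le> 1 \<and> 2 / 3 * N \<le> l2_norm M (S (t n) f)" for n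
      by (rule bounded_op_almost_attains_norm[OF bounded[OF t(1)] _ tb[of n]]) auto
    then obtain N f where N: "\<And>n. 4 ^ n \<le> N n"
      "\<And>n g. g \<in> L2 M \<Longrightarrow> l2_norm M (S (t n) g) \<le> N n * l2_norm M g"
      and f: "\<And>n. f n \<in> L2 M" "\<And>n. l2_norm M (f n) \<le> 1"
      "\<And>n. 2 / 3 * N n \<le> l2_norm M (S (t n) (f n))"
      by metis
    define c where "c = (1 / 3 :: real)"
    define e where "e = (\<lambda>n x. c ^ n * f n x)"
    have eL: "e n \<in> L2 M" for n unfolding e_def by (intro L2_scale f)
    have en: "l2_norm M (e n) \<le> c ^ n" for n
      unfolding e_def l2_norm_scale using f(2)[of n] by (simp add: c_def mult_left_le)
    have Te: "l2_norm M (S (t n) (e n)) \<ge> c ^ n * (2 / 3 * N n)" for n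
    proof -
      have "l2_norm M (S (t n) (e n)) = l2_norm M (\<lambda>x. c ^ n * S (t n) (f n) x)"
        unfolding e_def using S_scale[OF t(1) f(1)]
        by (intro l2_norm_cong_AE S_L2 L2_scale t f) auto
      then show ?thesis unfolding l2_norm_scale using f(3)[of n]
        by (simp add: c_def mult_left_mono)
    qed
    define x where "x = rec_nat (\<lambda>_. 0) (\<lambda>n y. if l2_norm M (S (t n) (\<lambda>z. y z + e n z))
        \<ge> l2_norm M (S (t n) (e n)) then (\<lambda>z. y z + e n z) else (\<lambda>z. y z - e n z))"
    have x0: "x 0 = (\<lambda>_. 0)" by (simp add: x_def)
    have xS: "x (Suc n) = (if l2_norm M (S (t n) (\<lambda>z. x n z + e n z))
        \<ge> l2_norm M (S (t n) (e n)) then (\<lambda>z. x n z + e n z) else (\<lambda>z. x n z - e n z))" for n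
      by (simp add: x_def)
    have xL: "x n \<in> L2 M" for n
      by (induction n) (auto simp: x0 xS intro!: L2_intros eL)
    have step: "l2_norm M (\<lambda>z. x (Suc n) z - x n z) \<le> c ^ n" for n
      using en[of n] by (auto simp: xS l2_norm_uminus)
    \<comment> \<open>One of the two signs must work, because the two candidates differ by \<open>2 e n\<close>.\<close>
    have big: "l2_norm M (S (t n) (x (Suc n))) \<ge> l2_norm M (S (t n) (e n))" for n
    proof (cases "l2_norm M (S (t n) (\<lambda>z. x n z + e n z)) \<ge> l2_norm M (S (t n) (e n))")
      case True
      then show ?thesis by (simp add: xS)
    next
      case False
      have "2 * l2_norm M (S (t n) (e n)) = l2_norm M (\<lambda>z. 2 * S (t n) (e n) z)"
        by (simp add: l2_norm_scale)
      also have "\<dots> = l2_norm M (\<lambda>z. S (t n) (\<lambda>z. x n z + e n z) z - S (t n) (\<lambda>z. x n z - e n z) z)"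
      proof (rule l2_norm_cong_AE)
        show "AE z in M. 2 * S (t n) (e n) z
            = S (t n) (\<lambda>z. x n z + e n z) z - S (t n) (\<lambda>z. x n z - e n z) z"
          using S_add[OF t(1) xL eL, of n n n] S_diff[OF t(1) xL eL, of n n n] by eventually_elim simp
      qed (intro L2_intros S_L2 t xL eL)+
      also have "\<dots> \<le> l2_norm M (S (t n) (\<lambda>z. x n z + e n z)) + l2_norm M (S (t n) (\<lambda>z. x n z - e n z))"
        by (intro l2_norm_diff L2_intros S_L2 t xL eL)
      finally show ?thesis using False by (simp add: xS)
    qed
    obtain z where z: "z \<in> L2 M" "\<And>n. l2_norm M (\<lambda>y. x n y - z y) \<le> c ^ n / (1 - c)"
      by (rule L2_complete_geometric[of x M c, OF xL _ _ step]) (auto simp: c_def)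
    have low: "l2_norm M (S (t n) z) \<ge> 1 / 6 * (4 / 3) ^ n" for n
    proof -
      have cn: "c ^ n \<ge> 0" by (simp add: c_def)
      have "l2_norm M (S (t n) (x (Suc n)))
          \<le> l2_norm M (S (t n) z) + l2_norm M (\<lambda>y. S (t n) (x (Suc n)) y - S (t n) z y)"
        by (intro l2_norm_le_add_diff S_L2 t xL z)
      also have "l2_norm M (\<lambda>y. S (t n) (x (Suc n)) y - S (t n) z y)
          = l2_norm M (S (t n) (\<lambda>y. x (Suc n) y - z y))"
        by (intro l2_norm_cong_AE L2_intros S_L2 t xL z)
          (use S_diff[OF t(1)[of n] xL[of "Suc n"] z(1)] in eventually_elim, simp)
      also have "\<dots> \<le> N n * l2_norm M (\<lambda>y. x (Suc n) y - z y)"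
        by (intro N L2_intros xL z)
      also have "\<dots> \<le> N n * (c ^ Suc n / (1 - c))"
        using N(1)[of n] z(2)[of "Suc n"] order_trans[of 0 "4 ^ n" "N n"]
        by (intro mult_left_mono) auto
      also have "c ^ Suc n / (1 - c) = c ^ n / 2" by (simp add: c_def)
      finally have "c ^ n * (2 / 3 * N n) \<le> l2_norm M (S (t n) z) + N n * (c ^ n / 2)"
        using Te[of n] big[of n] by linarith
      then have "1 / 6 * (c ^ n * N n) \<le> l2_norm M (S (t n) z)" by (simp add: field_simps)
      moreover have "c ^ n * 4 ^ n \<le> c ^ n * N n" using N(1) cn by (intro mult_left_mono)
      moreover have "c ^ n * 4 ^ n = (4 / 3) ^ n"
        by (simp add: c_def power_mult_distrib[symmetric])
      ultimately show ?thesis by linarith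
    qed
    have "filterlim t (at_right 0) sequentially"
    proof (rule tendsto_imp_filterlim_at_right)
      show "t \<longlonglongrightarrow> 0"
        by (rule tendsto_sandwich[of "\<lambda>_. 0" _ _ "\<lambda>n. 1 / real (Suc n)"])
          (use t LIMSEQ_inverse_real_of_nat in \<open>auto simp: inverse_eq_divide\<close>)
    qed (use tpos in simp)
    then have "(\<lambda>n. l2_norm M (S (t n) z)) \<longlonglongrightarrow> l2_norm M z"
      using filterlim_compose[OF l2_tendsto_norm[OF S_tendsto[OF z(1)] eventually_S_L2[OF z(1)] z(1)]]
      by blast
    then have "Bseq (\<lambda>n. l2_norm M (S (t n) z))" by (metis convergent_def convergent_imp_Bseq)
    then obtain C where C: "\<And>n. l2_norm M (S (t n) z) \<le> C"
      by (auto simp: Bseq_def)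
    obtain n where "6 * C < (4 / 3) ^ n" using real_arch_pow[of "4/3" "6 * C"] by auto
    then show False using low[of n] C[of n] by linarith
  qed
  then show ?thesis using that by blast
qed

lemma norm_bounded_on_interval:
  obtains B where "1 \<le> B"
    "\<And>t f. 0 \<le> t \<Longrightarrow> t \<le> T \<Longrightarrow> f \<in> L2 M \<Longrightarrow> l2_norm M (S t f) \<le> B * l2_norm M f"
proof -
  obtain d B where d: "0 < d" and B: "1 \<le> B"
    and b: "\<And>t f. 0 \<le> t \<Longrightarrow> t \<le> d \<Longrightarrow> f \<in> L2 M \<Longrightarrow> l2_norm M (S t f) \<le> B * l2_norm M f"
    by (rule norm_bounded_near_0) blast
  obtain n where n: "T \<le> real n * d" using reals_Archimedean3[OF d] by (metis less_imp_le)
  have "\<forall>t f. 0 \<le> t \<longrightarrow> t \<le> real n * d \<longrightarrow> f \<in> L2 M \<longrightarrow> l2_norm M (S t f) \<le> B ^ n * l2_norm M f"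
  proof (induction n)
    case 0
    then show ?case
      using l2_norm_cong_AE[OF S_L2 _ S_0] by simp
  next
    case (Suc n)
    show ?case
    proof (intro allI impI)
      fix t f assume t: "0 \<le> t" "t \<le> real (Suc n) * d" and f: "f \<in> L2 M"
      show "l2_norm M (S t f) \<le> B ^ Suc n * l2_norm M f"
      proof (cases "t \<le> d")
        case True
        have "l2_norm M (S t f) \<le> B * l2_norm M f" by (rule b[OF t(1) True f])
        also have "\<dots> \<le> B ^ Suc n * l2_norm M f"
          using B by (intro mult_right_mono) (auto intro: self_le_power)
        finally show ?thesis .
      next
        case False
        have "l2_norm M (S t f) = l2_norm M (S d (S (t - d) f))"
          using S_plus[of d "t - d" f] False f d t
          by (intro l2_norm_cong_AE S_L2) auto
        also have "\<dots> \<le> B * l2_norm M (S (t - d) f)"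
          using False f d t by (intro b S_L2) auto
        also have "\<dots> \<le> B * (B ^ n * l2_norm M f)"
          using Suc False f B t by (intro mult_left_mono) (auto simp: algebra_simps)
        finally show ?thesis by (simp add: mult.assoc)
      qed
    qed
  qed
  then show ?thesis using that[of "B ^ n"] B n by (meson one_le_power order_trans)
qed

lemma S_l2_tendsto:
  assumes "0 \<le> t" "l2_tendsto M u f F" "\<forall>\<^sub>F n in F. u n \<in> L2 M" "f \<in> L2 M"
  shows "l2_tendsto M (\<lambda>n. S t (u n)) (S t f) F"
proof -
  obtain B where B: "\<And>f. f \<in> L2 M \<Longrightarrow> l2_norm M (S t f) \<le> B * l2_norm M f"
    using bounded[OF assms(1)] unfolding bounded_op_L2_def by blast
  show ?thesis
  proof (rule l2_tendsto_squeeze[OF assms(2), where C = B])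
    show "\<forall>\<^sub>F n in F. l2_norm M (\<lambda>x. S t (u n) x - S t f x) \<le> B * l2_norm M (\<lambda>x. u n x - f x)"
      using assms(3)
    proof eventually_elim
      case (elim n)
      have "l2_norm M (\<lambda>x. S t (u n) x - S t f x) = l2_norm M (S t (\<lambda>x. u n x - f x))"
        by (intro l2_norm_cong_AE L2_intros S_L2 assms elim)
          (use S_diff[OF assms(1) elim assms(4)] in eventually_elim, simp)
      then show ?case using B[OF L2_diff[OF elim assms(4)]] by simp
    qed
  qed
qed

end

section \<open>Generators and duality\<close>

text \<open>
  This replaces differentiation along a semigroup orbit.  From the definition of the generator one gets
  right increments with an error \<open>o(h)\<close> that is uniform in the starting point; summing them over a fine
  partition needs neither left derivatives nor continuity of the orbit.
\<close>

lemma le_of_uniform_right_increments: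
  fixes F w :: "real \<Rightarrow> real"
  assumes T: "0 \<le> T"
    and inc: "\<And>s h. 0 \<le> s \<Longrightarrow> 0 < h \<Longrightarrow> s + h \<le> T \<Longrightarrow> F (s + h) - F s \<le> h * w h"
    and w: "(w \<longlongrightarrow> 0) (at_right 0)"
  shows "F T \<le> F 0"
proof (cases "T = 0")
  case False
  with T have T: "T > 0" by simp
  have "F T - F 0 \<le> T * w (T / real (Suc n))" for n
  proof -
    define h where "h = T / real (Suc n)"
    have h: "h > 0" using T by (simp add: h_def)
    have "F (real k * h) - F 0 \<le> real k * (h * w h)" if "k \<le> Suc n" for k
      using that
    proof (induction k)
      case (Suc k)
      have "real k * h + h = real (Suc k) * h" by (simp add: algebra_simps)
      also have "\<dots> \<le> real (Suc n) * h" using Suc h by (intro mult_right_mono) auto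
      also have "\<dots> = T" by (simp add: h_def)
      finally have "F (real k * h + h) - F (real k * h) \<le> h * w h"
        using h by (intro inc) auto
      then show ?case using Suc by (simp add: algebra_simps)
    qed simp
    from this[of "Suc n"] show ?thesis by (simp add: h_def)
  qed
  moreover have "(\<lambda>n. T * w (T / real (Suc n))) \<longlonglongrightarrow> T * 0"
  proof (intro tendsto_mult tendsto_const filterlim_compose[OF w])
    show "filterlim (\<lambda>n. T / real (Suc n)) (at_right 0) sequentially"
    proof (rule tendsto_imp_filterlim_at_right)
      show "(\<lambda>n. T / real (Suc n)) \<longlonglongrightarrow> 0"
        using tendsto_mult_right_zero[OF LIMSEQ_inverse_real_of_nat, of T]
        by (simp add: divide_inverse)
    qed (use T in simp)
  qed
  ultimately have "F T - F 0 \<le> T * 0" by (intro LIMSEQ_le_const) auto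
  then show ?thesis by simp
qed simp

locale l2_generator =
  fixes M :: "'a measure" and K :: "(('a \<Rightarrow> real) \<times> ('a \<Rightarrow> real)) set"
    and S :: "real \<Rightarrow> ('a \<Rightarrow> real) \<Rightarrow> 'a \<Rightarrow> real"
  assumes generates: "generates M K S"

sublocale l2_generator \<subseteq> l2_semigroup
  using generates by unfold_locales (simp add: generates_def)

context l2_generator
begin

lemma K_iff: "(f, g) \<in> K \<longleftrightarrow> f \<in> L2 M \<and> g \<in> L2 M \<and>
            l2_tendsto M (\<lambda>t x. (f x - S t f x) / t) g (at_right 0)"
  using generates by (auto simp: generates_def)

lemma K_L2: "(f, g) \<in> K \<Longrightarrow> f \<in> L2 M" "(f, g) \<in> K \<Longrightarrow> g \<in> L2 M"
  by (auto simp: K_iff)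

lemma K_remainder:
  assumes "(f, g) \<in> K"
  shows "((\<lambda>h. l2_norm M (\<lambda>x. S h f x - f x + h * g x) / h) \<longlongrightarrow> 0) (at_right 0)"
proof -
  have "((\<lambda>h. l2_norm M (\<lambda>x. (f x - S h f x) / h - g x)) \<longlongrightarrow> 0) (at_right 0)"
    using assms by (simp add: K_iff l2_tendsto_def)
  then show ?thesis
  proof (rule Lim_transform_eventually)
    show "\<forall>\<^sub>F h in at_right 0. l2_norm M (\<lambda>x. (f x - S h f x) / h - g x)
       = l2_norm M (\<lambda>x. S h f x - f x + h * g x) / h"
      unfolding eventually_at_filter
    proof (intro always_eventually allI impI)
      fix h :: real assume "h \<noteq> 0" "h \<in> {0<..}"
      then have h: "h > 0" by simp
      then have "(\<lambda>x. (f x - S h f x) / h - g x) = (\<lambda>x. (-1 / h) * (S h f x - f x + h * g x))"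
        by (auto simp: field_simps)
      then show "l2_norm M (\<lambda>x. (f x - S h f x) / h - g x)
          = l2_norm M (\<lambda>x. S h f x - f x + h * g x) / h"
        using h by (simp only: l2_norm_scale) simp
    qed
  qed
qed

lemma K_invariant:
  assumes fg: "(f, g) \<in> K" and t: "0 \<le> t"
  shows "(S t f, S t g) \<in> K"
proof -
  note L = K_L2[OF fg]
  have ev: "\<forall>\<^sub>F h in at_right 0. (0::real) < h" by (simp add: eventually_at_filter)
  have "l2_tendsto M (\<lambda>h. S t (\<lambda>x. (f x - S h f x) / h)) (S t g) (at_right 0)"
  proof (rule S_l2_tendsto[OF t _ _ L(2)])
    show "l2_tendsto M (\<lambda>h x. (f x - S h f x) / h) g (at_right 0)"
      using fg by (simp add: K_iff)
    show "\<forall>\<^sub>F h in at_right 0. (\<lambda>x. (f x - S h f x) / h) \<in> L2 M"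
      using ev by eventually_elim (intro L2_intros S_L2 L, simp)
  qed
  then have "l2_tendsto M (\<lambda>h x. (S t f x - S h (S t f) x) / h) (S t g) (at_right 0)"
  proof (rule l2_tendsto_squeeze[where C = 1])
    show "\<forall>\<^sub>F h in at_right 0. l2_norm M (\<lambda>x. (S t f x - S h (S t f) x) / h - S t g x)
        \<le> 1 * l2_norm M (\<lambda>x. S t (\<lambda>x. (f x - S h f x) / h) x - S t g x)"
      using ev
    proof eventually_elim
      case (elim h)
      then have h: "0 \<le> h" by simp
      have "l2_norm M (\<lambda>x. (S t f x - S h (S t f) x) / h - S t g x)
        = l2_norm M (\<lambda>x. S t (\<lambda>x. (f x - S h f x) / h) x - S t g x)"
      proof (intro l2_norm_cong_AE L2_intros S_L2 L t h)
        show "AE x in M. (S t f x - S h (S t f) x) / h - S t g x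
          = S t (\<lambda>x. (f x - S h f x) / h) x - S t g x"
          using S_commute[OF t h L(1)] S_divide[OF t L2_diff[OF L(1) S_L2[OF h L(1)]], of h]
            S_diff[OF t L(1) S_L2[OF h L(1)]]
          by eventually_elim simp
      qed
      then show ?case by simp
    qed
  qed
  then show ?thesis using S_L2[OF t] L by (simp add: K_iff)
qed

text \<open>
  Formally \<open>d/dt \<integral>P(x, S\<^sub>t f) = - (p(S\<^sub>t f), K S\<^sub>t f) \<le> 0\<close> where \<open>p\<close> is the derivative of \<open>P\<close>.  The
  inequality between \<open>P\<close> and \<open>p\<close> is a one-sided Taylor estimate, which also holds for functions like
  the square of the negative part, whose second derivative is only bounded.
\<close>

lemma energy_decreasing:
  fixes P p :: "'a \<Rightarrow> real \<Rightarrow> real"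
  assumes P: "\<And>f. f \<in> L2 M \<Longrightarrow> integrable M (\<lambda>x. P x (f x))"
    and p: "\<And>f. f \<in> L2 M \<Longrightarrow> (\<lambda>x. p x (f x)) \<in> L2 M"
    and pb: "\<And>x a. \<bar>p x a\<bar> \<le> 2 * \<bar>a\<bar>"
    and Pp: "\<And>x a b. P x (a + b) \<le> P x a + p x a * b + b\<^sup>2"
    and acc: "\<And>u u'. (u, u') \<in> K \<Longrightarrow> 0 \<le> l2_inner M (\<lambda>x. p x (u x)) u'"
    and fg: "(f, g) \<in> K" and t: "0 \<le> t"
  shows "(LINT x|M. P x (S t f x)) \<le> (LINT x|M. P x (f x))"
proof -
  note L = K_L2[OF fg]
  obtain B where B: "1 \<le> B"
    "\<And>s f. 0 \<le> s \<Longrightarrow> s \<le> t \<Longrightarrow> f \<in> L2 M \<Longrightarrow> l2_norm M (S s f) \<le> B * l2_norm M f"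
    by (rule norm_bounded_on_interval) blast
  define R where "R = (\<lambda>h. l2_norm M (\<lambda>x. S h f x - f x + h * g x))"
  have R: "((\<lambda>h. R h / h) \<longlongrightarrow> 0) (at_right 0)" unfolding R_def by (rule K_remainder[OF fg])
  define w where "w = (\<lambda>h. 2 * (B * l2_norm M f) * (B * (R h / h))
      + h * (B * (R h / h) + B * l2_norm M g)\<^sup>2)"
  have "(w \<longlongrightarrow> 2 * (B * l2_norm M f) * (B * 0) + 0 * (B * 0 + B * l2_norm M g)\<^sup>2) (at_right 0)"
    unfolding w_def by (intro tendsto_intros R)
  then have w: "(w \<longlongrightarrow> 0) (at_right 0)" by simp
  have "(LINT x|M. P x (S t f x)) \<le> (LINT x|M. P x (S 0 f x))"
  proof (rule le_of_uniform_right_increments[OF t _ w])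
    fix s h :: real assume s: "0 \<le> s" and h: "0 < h" and sh: "s + h \<le> t"
    then have h0: "0 \<le> h" by simp
    let ?u = "S s f" and ?v = "S s g"
    let ?e = "\<lambda>x. S h f x - f x + h * g x"
    have eL: "?e \<in> L2 M" using L h0 by (intro L2_intros S_L2)
    let ?d = "\<lambda>x. S s ?e x - h * ?v x"
    have uL: "?u \<in> L2 M" and vL: "?v \<in> L2 M" and SeL: "S s ?e \<in> L2 M"
      using S_L2[OF s] L eL by auto
    have dL: "?d \<in> L2 M" by (intro L2_intros SeL vL)
    have Se: "l2_norm M (S s ?e) \<le> B * R h"
      using B(2)[OF s _ eL] sh h by (simp add: R_def)
    have un: "l2_norm M ?u \<le> B * l2_norm M f" and vn: "l2_norm M ?v \<le> B * l2_norm M g"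
      using B(2)[OF s] L sh h by auto
    have Rh: "R h \<ge> 0" by (simp add: R_def)
    have dn: "l2_norm M ?d \<le> B * R h + h * (B * l2_norm M g)"
    proof -
      have "l2_norm M ?d \<le> l2_norm M (S s ?e) + l2_norm M (\<lambda>x. h * ?v x)"
        by (intro l2_norm_diff L2_intros SeL vL)
      also have "\<dots> \<le> B * R h + h * (B * l2_norm M g)"
        unfolding l2_norm_scale using Se vn h by (intro add_mono) auto
      finally show ?thesis .
    qed
    have pL: "(\<lambda>x. p x (?u x)) \<in> L2 M" by (rule p[OF uL])
    \<comment> \<open>\<open>S (s + h) f = u + d\<close> where \<open>d = - h K u\<close> up to an error of norm \<open>o(h)\<close>.\<close>
    have "(LINT x|M. P x (S (s + h) f x))
        \<le> (LINT x|M. P x (?u x) + p x (?u x) * ?d x + (?d x)\<^sup>2)"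
    proof (rule integral_mono_AE)
      show "integrable M (\<lambda>x. P x (S (s + h) f x))"
        using s h by (intro P S_L2 L) auto
      show "integrable M (\<lambda>x. P x (?u x) + p x (?u x) * ?d x + (?d x)\<^sup>2)"
        by (intro Bochner_Integration.integrable_add P uL L2_integrable_mult pL dL
            L2_integrable_square)
      show "AE x in M. P x (S (s + h) f x) \<le> P x (?u x) + p x (?u x) * ?d x + (?d x)\<^sup>2"
        using S_plus[OF s h0 L(1)] S_lin3[OF s S_L2[OF h0 L(1)] L, of h]
      proof eventually_elim
        case (elim x)
        then have "S (s + h) f x = ?u x + ?d x" by simp
        then show ?case using Pp[of x "?u x" "?d x"] by simp
      qed
    qed
    also have "\<dots> = (LINT x|M. P x (?u x)) + l2_inner M (\<lambda>x. p x (?u x)) ?d + (l2_norm M ?d)\<^sup>2"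
      unfolding l2_norm_square l2_inner_def
      by (simp add: P uL L2_integrable_mult pL dL L2_integrable_square power2_eq_square)
    also have "l2_inner M (\<lambda>x. p x (?u x)) ?d \<le> 2 * (B * l2_norm M f) * (B * R h)"
    proof -
      have "l2_inner M (\<lambda>x. p x (?u x)) ?d = l2_inner M (\<lambda>x. p x (?u x)) (S s ?e)
          - h * l2_inner M (\<lambda>x. p x (?u x)) ?v"
        by (simp add: l2_inner_diff_right pL SeL vL L2_scale l2_inner_scale_right)
      also have "\<dots> \<le> l2_inner M (\<lambda>x. p x (?u x)) (S s ?e)"
        using acc[OF K_invariant[OF fg s]] h by simp
      also have "\<dots> \<le> l2_norm M (\<lambda>x. p x (?u x)) * l2_norm M (S s ?e)"
        using l2_Cauchy_Schwarz[OF pL SeL] by linarith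
      also have "\<dots> \<le> 2 * (B * l2_norm M f) * (B * R h)"
      proof (intro mult_mono Se)
        have "l2_norm M (\<lambda>x. p x (?u x)) \<le> l2_norm M (\<lambda>x. 2 * ?u x)"
          using pL pb uL by (intro l2_norm_mono_AE L2_scale) (auto simp: L2_def abs_mult)
        then show "l2_norm M (\<lambda>x. p x (?u x)) \<le> 2 * (B * l2_norm M f)"
          using un by (simp add: l2_norm_scale)
      qed (use B Rh in auto)
      finally show ?thesis .
    qed
    also have "(l2_norm M ?d)\<^sup>2 \<le> (B * R h + h * (B * l2_norm M g))\<^sup>2"
      using dn by (intro power_mono) auto
    also have "(B * R h + h * (B * l2_norm M g))\<^sup>2 = h * (h * (B * (R h / h) + B * l2_norm M g)\<^sup>2)"
      using h by (simp add: power2_eq_square field_simps)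
    finally have "(LINT x|M. P x (S (s + h) f x)) \<le> (LINT x|M. P x (S s f x))
        + 2 * (B * l2_norm M f) * (B * R h) + h * (h * (B * (R h / h) + B * l2_norm M g)\<^sup>2)"
      by simp
    moreover have "h * w h = 2 * (B * l2_norm M f) * (B * R h)
        + h * (h * (B * (R h / h) + B * l2_norm M g)\<^sup>2)"
      using h by (simp add: w_def distrib_left)
    ultimately show "(LINT x|M. P x (S (s + h) f x)) - (LINT x|M. P x (S s f x)) \<le> h * w h"
      by linarith
  qed
  also have "\<dots> = (LINT x|M. P x (f x))"
  proof (rule integral_cong_AE)
    show "AE x in M. P x (S 0 f x) = P x (f x)" using S_0[OF L(1)] by eventually_elim simp
  qed (use P S_L2 L in \<open>auto intro: borel_measurable_integrable\<close>)
  finally show ?thesis .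
qed

end

text \<open>
  The function \<open>F s = (S\<^sub>s f, S'\<^sub>t\<^sub>-\<^sub>s g)\<close> is constant on \<open>[0, t]\<close>: in an increment of \<open>F\<close> the first order terms
  cancel by the duality of the generators, and the remainders of \<open>f\<close> and \<open>g\<close> are merely transported by
  the two semigroups, so their bound does not depend on \<open>s\<close>.
\<close>

lemma generators_dual_on_domain:
  assumes "generates M K S" "generates M K' S'"
    and dual: "\<And>f f' g g'. (f, f') \<in> K \<Longrightarrow> (g, g') \<in> K' \<Longrightarrow> l2_inner M f' g = l2_inner M f g'"
    and ff: "(f, f') \<in> K" and gg: "(g, g') \<in> K'" and t: "0 \<le> t"
  shows "l2_inner M (S t f) g = l2_inner M f (S' t g)"
proof -
  interpret A: l2_generator M K S by unfold_locales fact
  interpret B: l2_generator M K' S' by unfold_locales fact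
  note L = A.K_L2[OF ff] B.K_L2[OF gg]
  obtain C where C: "1 \<le> C"
    "\<And>s f. 0 \<le> s \<Longrightarrow> s \<le> t \<Longrightarrow> f \<in> L2 M \<Longrightarrow> l2_norm M (S s f) \<le> C * l2_norm M f"
    by (rule A.norm_bounded_on_interval) blast
  obtain D where D: "1 \<le> D"
    "\<And>s f. 0 \<le> s \<Longrightarrow> s \<le> t \<Longrightarrow> f \<in> L2 M \<Longrightarrow> l2_norm M (S' s f) \<le> D * l2_norm M f"
    by (rule B.norm_bounded_on_interval) blast
  define R where "R = (\<lambda>h. l2_norm M (\<lambda>x. S h f x - f x + h * f' x))"
  define R' where "R' = (\<lambda>h. l2_norm M (\<lambda>x. S' h g x - g x + h * g' x))"
  define w where "w = (\<lambda>h. (C * (R h / h)) * (D * l2_norm M g) + (C * l2_norm M f) * (D * (R' h / h)))"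
  have "(w \<longlongrightarrow> (C * 0) * (D * l2_norm M g) + (C * l2_norm M f) * (D * 0)) (at_right 0)"
    unfolding w_def R_def R'_def
    by (intro tendsto_intros A.K_remainder[OF ff] B.K_remainder[OF gg])
  then have w: "(w \<longlongrightarrow> 0) (at_right 0)" by simp
  define F where "F = (\<lambda>s. l2_inner M (S s f) (S' (t - s) g))"
  have inc: "\<bar>F (s + h) - F s\<bar> \<le> h * w h" if s: "0 \<le> s" and h: "0 < h" and sh: "s + h \<le> t" for s h
  proof -
    define r where "r = t - s - h"
    have r: "0 \<le> r" "r \<le> t" "s \<le> t" "0 \<le> h" using s h sh by (auto simp: r_def)
    let ?e = "\<lambda>x. S h f x - f x + h * f' x"
    let ?e' = "\<lambda>x. S' h g x - g x + h * g' x"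
    have eL: "?e \<in> L2 M" "?e' \<in> L2 M" using L r by (intro L2_intros A.S_L2 B.S_L2; simp)+
    note LL = A.S_L2[OF s L(1)] A.S_L2[OF s L(2)] B.S_L2[OF r(1) L(3)] B.S_L2[OF r(1) L(4)]
      A.S_L2[OF s eL(1)] B.S_L2[OF r(1) eL(2)]
    have shL: "S (s + h) f \<in> L2 M" using s r L by (intro A.S_L2) auto
    have rhL: "S' (r + h) g \<in> L2 M" using r L by (intro B.S_L2) auto
    have 1: "l2_inner M (S s ?e) (S' r g)
        = F (s + h) - l2_inner M (S s f) (S' r g) + h * l2_inner M (S s f') (S' r g)"
    proof -
      have "AE x in M. S s ?e x = S (s + h) f x - S s f x + h * S s f' x"
        using A.S_plus[OF s r(4) L(1)] A.S_lin3[OF s A.S_L2[OF r(4) L(1)] L(1,2), of h]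
        by eventually_elim simp
      then have "l2_inner M (S s ?e) (S' r g)
        = l2_inner M (\<lambda>x. S (s + h) f x - S s f x + h * S s f' x) (S' r g)"
        by (intro l2_inner_cong_AE LL L2_intros shL) auto
      also have "\<dots> = l2_inner M (S (s + h) f) (S' r g) - l2_inner M (S s f) (S' r g)
          + h * l2_inner M (S s f') (S' r g)"
        by (simp add: l2_inner_add_left l2_inner_diff_left l2_inner_scale_left LL L2_intros shL)
      also have "l2_inner M (S (s + h) f) (S' r g) = F (s + h)"
        by (simp add: F_def r_def diff_diff_eq)
      finally show ?thesis .
    qed
    have 2: "l2_inner M (S s f) (S' r ?e')
        = F s - l2_inner M (S s f) (S' r g) + h * l2_inner M (S s f) (S' r g')"
    proof -
      have "AE x in M. S' r ?e' x = S' (r + h) g x - S' r g x + h * S' r g' x"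
        using B.S_plus[OF r(1,4) L(3)] B.S_lin3[OF r(1) B.S_L2[OF r(4) L(3)] L(3,4), of h]
        by eventually_elim simp
      then have "l2_inner M (S s f) (S' r ?e')
        = l2_inner M (S s f) (\<lambda>x. S' (r + h) g x - S' r g x + h * S' r g' x)"
        by (intro l2_inner_cong_AE LL L2_intros rhL) auto
      also have "\<dots> = l2_inner M (S s f) (S' (r + h) g) - l2_inner M (S s f) (S' r g)
          + h * l2_inner M (S s f) (S' r g')"
        by (simp add: l2_inner_add_right l2_inner_diff_right l2_inner_scale_right LL L2_intros rhL)
      also have "r + h = t - s" by (simp add: r_def)
      finally show ?thesis by (simp add: F_def)
    qed
    have "l2_inner M (S s f') (S' r g) = l2_inner M (S s f) (S' r g')"
      by (rule dual[OF A.K_invariant[OF ff s] B.K_invariant[OF gg r(1)]])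
    with 1 2 have "F (s + h) - F s = l2_inner M (S s ?e) (S' r g) - l2_inner M (S s f) (S' r ?e')"
      by simp
    then have "\<bar>F (s + h) - F s\<bar>
        \<le> l2_norm M (S s ?e) * l2_norm M (S' r g) + l2_norm M (S s f) * l2_norm M (S' r ?e')"
      using l2_Cauchy_Schwarz[OF LL(5,3)] l2_Cauchy_Schwarz[OF LL(1,6)] by linarith
    also have "\<dots> \<le> (C * R h) * (D * l2_norm M g) + (C * l2_norm M f) * (D * R' h)"
      using C(2)[OF s r(3) eL(1)] D(2)[OF r(1,2) L(3)] C(2)[OF s r(3) L(1)] D(2)[OF r(1,2) eL(2)]
        C(1) D(1)
      by (intro add_mono mult_mono) (auto simp: R_def R'_def)
    also have "\<dots> = h * w h" using h by (simp add: w_def field_simps)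
    finally show ?thesis .
  qed
  have "F t \<le> F 0"
    by (rule le_of_uniform_right_increments[OF t _ w]) (use inc in \<open>force simp: abs_le_iff\<close>)
  moreover have "(\<lambda>s. - F s) t \<le> (\<lambda>s. - F s) 0"
    by (rule le_of_uniform_right_increments[OF t _ w]) (use inc in \<open>force simp: abs_le_iff\<close>)
  ultimately have "F t = F 0" by simp
  moreover have "F t = l2_inner M (S t f) g"
    unfolding F_def using B.S_0[OF L(3)] t L
    by (intro l2_inner_cong_AE A.S_L2 B.S_L2) auto
  moreover have "F 0 = l2_inner M f (S' t g)"
    unfolding F_def using A.S_0[OF L(1)] t L
    by (intro l2_inner_cong_AE A.S_L2 B.S_L2) auto
  ultimately show ?thesis by simp
qed

lemma generators_dual:
  assumes G: "generates M K S" "generates M K' S'"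
    and dual: "\<And>f f' g g'. (f, f') \<in> K \<Longrightarrow> (g, g') \<in> K' \<Longrightarrow> l2_inner M f' g = l2_inner M f g'"
    and dense: "densely_defined M K" "densely_defined M K'"
    and f: "f \<in> L2 M" and g: "g \<in> L2 M" and t: "0 \<le> t"
  shows "l2_inner M (S t f) g = l2_inner M f (S' t g)"
proof -
  interpret A: l2_generator M K S by unfold_locales fact
  interpret B: l2_generator M K' S' by unfold_locales fact
  obtain u where u: "\<And>n. u n \<in> Domain K" "\<And>n. u n \<in> L2 M" "l2_tendsto M u f sequentially"
    using dense(1) f unfolding densely_defined_def by (meson IntD1 IntD2)
  obtain v where v: "\<And>n. v n \<in> Domain K'" "\<And>n. v n \<in> L2 M" "l2_tendsto M v g sequentially"
    using dense(2) g unfolding densely_defined_def by (meson IntD1 IntD2)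
  have "(\<lambda>n. l2_inner M (S t (u n)) (v n)) \<longlonglongrightarrow> l2_inner M (S t f) g"
    by (intro l2_tendsto_inner2 A.S_l2_tendsto always_eventually allI A.S_L2 t u v f g)
  moreover have "(\<lambda>n. l2_inner M (u n) (S' t (v n))) \<longlonglongrightarrow> l2_inner M f (S' t g)"
    by (intro l2_tendsto_inner2 B.S_l2_tendsto always_eventually allI B.S_L2 t u v f g)
  moreover have "l2_inner M (S t (u n)) (v n) = l2_inner M (u n) (S' t (v n))" for n
  proof -
    obtain u' v' where "(u n, u') \<in> K" "(v n, v') \<in> K'" using u(1) v(1) by (meson DomainE)
    then show ?thesis using generators_dual_on_domain[OF G dual _ _ t] by blast
  qed
  ultimately show ?thesis using LIMSEQ_unique by simp
qed

text \<open>
  Apply the duality of the generator with itself twice, once for each pair of semigroups; the symmetric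
  semigroup is thereby its own transpose and the transpose of the other one.
\<close>

lemma symmetric_generator_semigroup_unique:
  assumes G: "generates M K S" "generates M K S'"
    and sym: "\<And>f f' g g'. (f, f') \<in> K \<Longrightarrow> (g, g') \<in> K \<Longrightarrow> l2_inner M f' g = l2_inner M f g'"
    and dense: "densely_defined M K" and f: "f \<in> L2 M" and t: "0 \<le> t"
  shows "AE x in M. S t f x = S' t f x"
proof -
  interpret A: l2_generator M K S by unfold_locales fact
  interpret B: l2_generator M K S' by unfold_locales fact
  let ?d = "\<lambda>x. S t f x - S' t f x"
  have dL: "?d \<in> L2 M" using f t by (intro L2_diff A.S_L2 B.S_L2)
  have "l2_inner M (S t f) ?d = l2_inner M f (S' t ?d)"
    by (rule generators_dual[OF G sym dense dense f dL t])
  also have "\<dots> = l2_inner M (S' t f) ?d"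
    by (rule generators_dual[OF G(2,2) sym dense dense f dL t, symmetric])
  finally have "l2_inner M ?d ?d = 0"
    using f t by (simp add: l2_inner_diff_left dL A.S_L2 B.S_L2)
  then have "l2_norm M ?d = 0" by (simp add: l2_norm_def)
  then show ?thesis using l2_norm_eq_0_iff[OF dL] by auto
qed

section \<open>Chebyshev polynomials of a symmetric contraction\<close>

locale symmetric_contraction =
  fixes M :: "'a measure" and A :: "('a \<Rightarrow> real) \<Rightarrow> 'a \<Rightarrow> real"
  assumes A_L2: "f \<in> L2 M \<Longrightarrow> A f \<in> L2 M"
    and A_lin: "f \<in> L2 M \<Longrightarrow> g \<in> L2 M \<Longrightarrow>
      AE x in M. A (\<lambda>y. a * f y + b * g y) x = a * A f x + b * A g x"
    and A_cong: "f \<in> L2 M \<Longrightarrow> g \<in> L2 M \<Longrightarrow> AE x in M. f x = g x \<Longrightarrow> AE x in M. A f x = A g x"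
    and A_sym: "f \<in> L2 M \<Longrightarrow> g \<in> L2 M \<Longrightarrow> l2_inner M (A f) g = l2_inner M f (A g)"
    and A_contraction: "f \<in> L2 M \<Longrightarrow> l2_norm M (A f) \<le> l2_norm M f"
begin

lemma A_add: "f \<in> L2 M \<Longrightarrow> g \<in> L2 M \<Longrightarrow> AE x in M. A (\<lambda>y. f y + g y) x = A f x + A g x"
  using A_lin[of f g 1 1] by simp

lemma A_diff: "f \<in> L2 M \<Longrightarrow> g \<in> L2 M \<Longrightarrow> AE x in M. A (\<lambda>y. f y - g y) x = A f x - A g x"
  using A_lin[of f g 1 "-1"] by simp

lemma A_zero: "AE x in M. A (\<lambda>y. 0) x = 0"
  using A_lin[OF L2_zero L2_zero, of 0 0] by simp

text \<open>
  The pair \<open>(T\<^sub>j(A) v, U\<^sub>j\<^sub>-\<^sub>1(A) v)\<close> of Chebyshev polynomials of the first and second kind, generated by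
  \<open>T\<^sub>j\<^sub>+\<^sub>1 = x T\<^sub>j - (1 - x\<^sup>2) U\<^sub>j\<^sub>-\<^sub>1\<close> and \<open>U\<^sub>j = x U\<^sub>j\<^sub>-\<^sub>1 + T\<^sub>j\<close>.  This recursion by pairs makes the norm identity
  below immediate.
\<close>

primrec chebyshev :: "('a \<Rightarrow> real) \<Rightarrow> nat \<Rightarrow> ('a \<Rightarrow> real) \<times> ('a \<Rightarrow> real)" where
  "chebyshev v 0 = (v, \<lambda>x. 0)"
| "chebyshev v (Suc j) = ((\<lambda>x. A (fst (chebyshev v j)) x - snd (chebyshev v j) x + A (A (snd (chebyshev v j))) x),
     (\<lambda>x. A (snd (chebyshev v j)) x + fst (chebyshev v j) x))"

abbreviation T where "T v j \<equiv> fst (chebyshev v j)"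
abbreviation U where "U v j \<equiv> snd (chebyshev v j)"

lemma chebyshev_L2:
  assumes "v \<in> L2 M"
  shows "T v j \<in> L2 M" "U v j \<in> L2 M"
  using assms by (induction j) (auto intro!: L2_intros A_L2)

text \<open>
  The operator form of \<open>T\<^sub>j\<^sup>2 + (1 - x\<^sup>2) U\<^sub>j\<^sub>-\<^sub>1\<^sup>2 = 1\<close>.  As \<open>1 - A\<^sup>2\<close> is a positive operator, \<open>T\<^sub>j(A)\<close> is
  a contraction.
\<close>

lemma chebyshev_norm:
  assumes v: "v \<in> L2 M"
  shows "(l2_norm M (T v j))\<^sup>2 + (l2_norm M (U v j))\<^sup>2 - (l2_norm M (A (U v j)))\<^sup>2 = (l2_norm M v)\<^sup>2"
proof (induction j)
  case 0
  have "l2_norm M (A (\<lambda>x. 0)) = 0"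
    using A_zero by (simp add: l2_norm_eq_0_iff A_L2 L2_zero)
  then show ?case by simp
next
  case (Suc j)
  define p q where "p = T v j" and "q = U v j"
  have pq: "p \<in> L2 M" "q \<in> L2 M" unfolding p_def q_def by (rule chebyshev_L2[OF v])+
  define P Q R where "P = A p" and "Q = A q" and "R = A (A q)"
  have L: "P \<in> L2 M" "Q \<in> L2 M" "R \<in> L2 M" unfolding P_def Q_def R_def by (intro A_L2 pq)+
  note L = L pq
  have TS: "T v (Suc j) = (\<lambda>x. P x - q x + R x)" and US: "U v (Suc j) = (\<lambda>x. Q x + p x)"
    by (simp_all add: p_def q_def P_def Q_def R_def)
  have AU: "l2_norm M (A (U v (Suc j))) = l2_norm M (\<lambda>x. R x + P x)"
  proof (rule l2_norm_cong_AE)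
    show "AE x in M. A (U v (Suc j)) x = R x + P x"
      using A_add[OF L(2,4)] unfolding US by eventually_elim (simp add: P_def R_def Q_def)
  qed (intro A_L2 chebyshev_L2 v L2_intros L)+
  have Pq: "l2_inner M P q = l2_inner M Q p"
    unfolding P_def Q_def A_sym[OF pq] by (rule l2_inner_commute)
  have Rq: "l2_inner M R q = l2_inner M Q Q"
    unfolding R_def Q_def by (rule A_sym[OF A_L2[OF pq(2)] pq(2)])
  have "(l2_norm M (T v (Suc j)))\<^sup>2 + (l2_norm M (U v (Suc j)))\<^sup>2 - (l2_norm M (A (U v (Suc j))))\<^sup>2
      = (l2_norm M p)\<^sup>2 + (l2_norm M q)\<^sup>2 - (l2_norm M Q)\<^sup>2"
    unfolding AU unfolding TS US l2_norm_square
    using Pq Rq by (simp add: l2_inner_add_left l2_inner_add_right l2_inner_diff_left l2_inner_diff_right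
      L L2_intros l2_inner_commute[of M q P] l2_inner_commute[of M q R] l2_inner_commute[of M p Q]
      l2_inner_commute[of M R P])
  then show ?case using Suc by (simp add: p_def q_def Q_def)
qed

lemma chebyshev_norm_le:
  assumes v: "v \<in> L2 M" shows "l2_norm M (T v j) \<le> l2_norm M v"
proof -
  have "(l2_norm M (A (U v j)))\<^sup>2 \<le> (l2_norm M (U v j))\<^sup>2"
    by (intro power_mono A_contraction chebyshev_L2 v) simp
  then have "(l2_norm M (T v j))\<^sup>2 \<le> (l2_norm M v)\<^sup>2" using chebyshev_norm[OF v, of j] by linarith
  then show ?thesis by (rule power2_le_imp_le) simp
qed

lemma chebyshev_recurrence:
  assumes v: "v \<in> L2 M"
  shows "AE x in M. 2 * A (T v (Suc j)) x = T v (Suc (Suc j)) x + T v j x"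
proof -
  define p q where "p = T v j" and "q = U v j"
  have pq: "p \<in> L2 M" "q \<in> L2 M" unfolding p_def q_def by (rule chebyshev_L2[OF v])+
  define P Q R where "P = A p" and "Q = A q" and "R = A (A q)"
  have L: "P \<in> L2 M" "Q \<in> L2 M" "R \<in> L2 M" unfolding P_def Q_def R_def by (intro A_L2 pq)+
  note L = L pq
  have TS: "T v (Suc j) = (\<lambda>x. P x - q x + R x)" and US: "U v (Suc j) = (\<lambda>x. Q x + p x)"
    by (simp_all add: p_def q_def P_def Q_def R_def)
  have TSS: "T v (Suc (Suc j)) = (\<lambda>x. A (T v (Suc j)) x - U v (Suc j) x + A (A (U v (Suc j))) x)"
    by simp
  have 1: "AE x in M. A (T v (Suc j)) x = A P x - Q x + A R x"
    using A_add[OF L2_diff[OF L(1,5)] L(3)] A_diff[OF L(1,5)]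
    unfolding TS by eventually_elim (simp add: Q_def)
  have 2: "AE x in M. A (A (U v (Suc j))) x = A R x + A P x"
  proof -
    have "AE x in M. A (U v (Suc j)) x = R x + P x"
      using A_add[OF L(2,4)] unfolding US by eventually_elim (simp add: P_def R_def Q_def)
    then have "AE x in M. A (A (U v (Suc j))) x = A (\<lambda>x. R x + P x) x"
      by (intro A_cong A_L2 chebyshev_L2 v L2_intros L)
    with A_add[OF L(3,1)] show ?thesis by eventually_elim simp
  qed
  from 1 2 show ?thesis
    unfolding TSS by eventually_elim (simp add: p_def Q_def q_def)
qed

text \<open>
  Quantifies that \<open>x\<^sup>n\<close> is a mean of Chebyshev polynomials, most of them of degree about \<open>\<surd>n\<close>.  The numbers
  \<open>a n j = (u, A\<^sup>n T\<^sub>j(A) v)\<close> solve the discrete heat equation \<open>2 a\<^sub>n\<^sub>+\<^sub>1\<^sub>,\<^sub>j = a\<^sub>n\<^sub>,\<^sub>j\<^sub>+\<^sub>1 + a\<^sub>n\<^sub>,\<^sub>j\<^sub>-\<^sub>1\<close>, with even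
  reflection at \<open>j = 0\<close>.  The initial values \<open>a\<^sub>0\<^sub>,\<^sub>j\<close> vanish for \<open>j \<le> N\<close> and are bounded, hence lie below
  \<open>j\<^sup>2 / N\<^sup>2\<close> times a constant, and \<open>(j\<^sup>2 + n) / N\<^sup>2\<close> is a solution.
\<close>

lemma power_pairing_small:
  assumes u: "u \<in> L2 M" and v: "v \<in> L2 M" and N: "0 < N"
    and zero: "\<And>k. k \<le> N \<Longrightarrow> l2_inner M ((A ^^ k) u) v = 0"
  shows "\<bar>l2_inner M ((A ^^ n) u) v\<bar> \<le> real n / (real N)\<^sup>2 * (l2_norm M u * l2_norm M v)"
proof -
  have uL: "(A ^^ n) u \<in> L2 M" for n by (induction n) (auto intro: u A_L2)
  define a where "a = (\<lambda>n j. l2_inner M ((A ^^ n) u) (T v j))"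
  define C where "C = l2_norm M u * l2_norm M v"
  have C0: "C \<ge> 0" by (simp add: C_def)
  have a0: "a (Suc n) 0 = a n 1" for n
  proof -
    have AA0: "AE x in M. A (A (\<lambda>x. 0)) x = 0"
      using A_cong[OF A_L2[OF L2_zero] L2_zero A_zero] A_zero by eventually_elim simp
    have "a (Suc n) 0 = l2_inner M ((A ^^ n) u) (A v)"
      using A_sym[OF uL v] by (simp add: a_def)
    also have "\<dots> = a n 1"
      unfolding a_def
    proof (rule l2_inner_cong_AE)
      show "AE x in M. A v x = T v 1 x" using AA0 by eventually_elim simp
    qed (intro uL A_L2 v chebyshev_L2 | simp)+
    finally show ?thesis .
  qed
  have aS: "2 * a (Suc n) (Suc j) = a n (Suc (Suc j)) + a n j" for n j
  proof -
    have "2 * a (Suc n) (Suc j) = l2_inner M ((A ^^ n) u) (\<lambda>x. 2 * A (T v (Suc j)) x)"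
      unfolding l2_inner_scale_right a_def 
      using A_sym[OF uL[of n] chebyshev_L2(1)[OF v, of "Suc j"]] by (simp del: chebyshev.simps)
    also have "\<dots> = l2_inner M ((A ^^ n) u) (\<lambda>x. T v (Suc (Suc j)) x + T v j x)"
      by (intro l2_inner_cong_AE uL L2_intros A_L2 chebyshev_L2 v chebyshev_recurrence) simp
    also have "\<dots> = a n (Suc (Suc j)) + a n j"
      unfolding a_def by (intro l2_inner_add_right uL chebyshev_L2 v)
    finally show ?thesis .
  qed
  have az: "a n j = 0" if "n + j \<le> N" for n j
    using that
  proof (induction j arbitrary: n rule: less_induct)
    case (less j)
    consider "j = 0" | "j = 1" | i where "j = Suc (Suc i)"
      by (metis One_nat_def not0_implies_Suc)
    then show ?case
    proof cases
      case 1
      then show ?thesis using zero[of n] less by (simp add: a_def)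
    next
      case 2
      then show ?thesis using less a0[of n] by simp
    next
      case 3
      then show ?thesis using less aS[of n i] less.IH[of "Suc i" "Suc n"] less.IH[of i n] by simp
    qed
  qed
  have ab: "\<bar>a 0 j\<bar> \<le> (real j)\<^sup>2 / (real N)\<^sup>2 * C" for j
  proof (cases "j \<le> N")
    case True
    then show ?thesis using az[of 0 j] C0 by simp
  next
    case False
    have "\<bar>a 0 j\<bar> \<le> l2_norm M u * l2_norm M (T v j)"
      unfolding a_def using l2_Cauchy_Schwarz[OF u chebyshev_L2(1)[OF v]] by simp
    also have "\<dots> \<le> C" unfolding C_def by (intro mult_left_mono chebyshev_norm_le v) simp
    also have "C \<le> (real j)\<^sup>2 / (real N)\<^sup>2 * C"
    proof -
      have "(real N)\<^sup>2 \<le> (real j)\<^sup>2" using False by (intro power_mono) auto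
      then have "1 \<le> (real j)\<^sup>2 / (real N)\<^sup>2" using N by simp
      from mult_right_mono[OF this C0] show ?thesis by simp
    qed
    finally show ?thesis .
  qed
  have "\<bar>a n j\<bar> \<le> ((real j)\<^sup>2 + real n) / (real N)\<^sup>2 * C" for j
  proof (induction n arbitrary: j)
    case 0
    then show ?case using ab by simp
  next
    case (Suc n)
    show ?case
    proof (cases j)
      case 0
      then show ?thesis using Suc[of 1] a0[of n] by (simp add: add.commute)
    next
      case (Suc i)
      have "2 * \<bar>a (Suc n) j\<bar> \<le> \<bar>a n (Suc (Suc i))\<bar> + \<bar>a n i\<bar>"
        using aS[of n i] unfolding Suc by linarith
      also have "\<dots> \<le> ((real (Suc (Suc i)))\<^sup>2 + real n) / (real N)\<^sup>2 * C
          + ((real i)\<^sup>2 + real n) / (real N)\<^sup>2 * C"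
        using Suc.IH by (intro add_mono)
      also have "\<dots> = 2 * (((real j)\<^sup>2 + real (Suc n)) / (real N)\<^sup>2 * C)"
        using Suc N by (simp add: field_simps power2_eq_square)
      finally show ?thesis by simp
    qed
  qed
  from this[of 0] show ?thesis by (simp add: a_def C_def)
qed

end

section \<open>Supports under symmetric positive semigroups\<close>

locale symmetric_positive_semigroup = l2_semigroup +
  assumes sym: "0 \<le> t \<Longrightarrow> f \<in> L2 M \<Longrightarrow> g \<in> L2 M \<Longrightarrow> l2_inner M (S t f) g = l2_inner M f (S t g)"
    and pos: "positive_semigroup M S"
begin

lemma S_nonneg:
  assumes "0 \<le> t" "f \<in> L2 M" "AE x in M. 0 \<le> f x"
  shows "AE x in M. 0 \<le> S t f x"
proof (cases "t = 0")
  case True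
  show ?thesis unfolding True using S_0[OF assms(2)] assms(3) by eventually_elim simp
next
  case False
  then show ?thesis using pos assms by (simp add: positive_semigroup_def)
qed

lemma inner_S_nonneg:
  assumes "0 \<le> t" "f \<in> L2 M" "AE x in M. 0 \<le> f x" "g \<in> L2 M" "AE x in M. 0 \<le> g x"
  shows "0 \<le> l2_inner M f (S t g)"
  by (rule l2_inner_nonneg_AE) (use assms(3) S_nonneg[OF assms(1,4,5)] in eventually_elim, simp)

lemma S_mono:
  assumes "0 \<le> t" "f \<in> L2 M" "g \<in> L2 M" "AE x in M. f x \<le> g x"
  shows "AE x in M. S t f x \<le> S t g x"
proof -
  have "AE x in M. 0 \<le> S t (\<lambda>y. g y - f y) x"
    by (rule S_nonneg[OF assms(1) L2_diff[OF assms(3,2)]]) (use assms(4) in eventually_elim, simp)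
  with S_diff[OF assms(1,3,2)] show ?thesis by eventually_elim simp
qed

lemma norm_S_half:
  assumes "0 \<le> t" "f \<in> L2 M"
  shows "(l2_norm M (S (t / 2) f))\<^sup>2 = l2_inner M f (S t f)"
proof -
  have t: "0 \<le> t / 2" using assms by simp
  have "(l2_norm M (S (t / 2) f))\<^sup>2 = l2_inner M f (S (t / 2) (S (t / 2) f))"
    unfolding l2_norm_square by (rule sym[OF t assms(2) S_L2[OF t assms(2)]])
  also have "\<dots> = l2_inner M f (S (t / 2 + t / 2) f)"
    using S_plus[OF t t assms(2)] assms t
    by (intro l2_inner_cong_AE S_L2) auto
  finally show ?thesis by simp
qed

text \<open>
  \<open>(f, S\<^sub>t f) = 0\<close> means \<open>S\<^sub>t\<^sub>/\<^sub>2 f = 0\<close>; halving the time repeatedly and letting it tend to 0 gives \<open>f = 0\<close>.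
\<close>

lemma S_injective:
  assumes "0 \<le> t" "f \<in> L2 M" "l2_inner M f (S t f) = 0"
  shows "AE x in M. f x = 0"
proof (cases "t = 0")
  case True
  have "l2_inner M f (S 0 f) = l2_inner M f f"
    using S_0[OF assms(2)] assms(2) by (intro l2_inner_cong_AE S_L2) auto
  then have "l2_norm M f = 0" using assms(3) True by (simp add: l2_norm_def)
  then show ?thesis using l2_norm_eq_0_iff[OF assms(2)] by simp
next
  case False
  with assms have t: "t > 0" by simp
  have z: "l2_inner M f (S (t / 2 ^ n) f) = 0" for n
  proof (induction n)
    case (Suc n)
    have n0: "0 \<le> t / 2 ^ n" using t by simp
    have "l2_norm M (S (t / 2 ^ n / 2) f) = 0"
      using norm_S_half[OF n0 assms(2)] Suc by simp
    then have "l2_norm M (S (t / 2 ^ Suc n) f) = 0" by (simp add: mult.commute)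
    then have "\<bar>l2_inner M f (S (t / 2 ^ Suc n) f)\<bar> \<le> 0"
      using l2_Cauchy_Schwarz[OF assms(2) S_L2[of "t / 2 ^ Suc n" f]] assms(2) t by simp
    then show ?case by simp
  qed (use assms in simp)
  have "filterlim (\<lambda>n. t / 2 ^ n) (at_right 0) sequentially"
  proof (rule tendsto_imp_filterlim_at_right)
    have "(\<lambda>n. t * (1 / 2) ^ n) \<longlonglongrightarrow> t * 0" by (intro tendsto_intros LIMSEQ_realpow_zero) auto
    then show "(\<lambda>n. t / 2 ^ n) \<longlonglongrightarrow> 0" by (simp add: power_divide)
  qed (use t in simp)
  from filterlim_compose[OF l2_tendsto_inner[OF S_tendsto[OF assms(2)] eventually_S_L2[OF assms(2)]
      assms(2,2)] this]
  have "(\<lambda>n. l2_inner M (S (t / 2 ^ n) f) f) \<longlonglongrightarrow> l2_inner M f f" .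
  moreover have "l2_inner M (S (t / 2 ^ n) f) f = 0" for n
    using z[of n] by (metis l2_inner_commute)
  ultimately have "l2_inner M f f = 0" by (simp add: LIMSEQ_const_iff)
  then have "l2_norm M f = 0" by (simp add: l2_norm_def)
  then show ?thesis using l2_norm_eq_0_iff[OF assms(2)] by simp
qed

text \<open>
  With \<open>w = min u (S\<^sub>s v)\<close> one has \<open>(u, S\<^sub>s\<^sub>+\<^sub>t v) = (S\<^sub>t u, S\<^sub>s v) \<ge> (w, S\<^sub>t w)\<close>.  So if the pairing vanishes at
  the later time, then \<open>w = 0\<close>, that is, \<open>u\<close> and \<open>S\<^sub>s v\<close> have disjoint supports.
\<close>

lemma pairing_zero_backward:
  assumes s: "0 \<le> s" and t: "0 \<le> t"
    and u: "u \<in> L2 M" "AE x in M. 0 \<le> u x" and v: "v \<in> L2 M" "AE x in M. 0 \<le> v x"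
    and z: "l2_inner M u (S (s + t) v) = 0"
  shows "l2_inner M u (S s v) = 0"
proof -
  note sL = S_L2[OF s v(1)] and sp = S_nonneg[OF s v]
  define w where "w = (\<lambda>x. min (u x) (S s v x))"
  have wp: "AE x in M. 0 \<le> w x" using u(2) sp by eventually_elim (simp add: w_def)
  have wL: "w \<in> L2 M"
  proof (rule L2_dominated[OF u(1)])
    show "w \<in> borel_measurable M" unfolding w_def using u sL by (auto simp: L2_def)
    show "AE x in M. \<bar>w x\<bar> \<le> \<bar>u x\<bar>" using u(2) sp by eventually_elim (simp add: w_def)
  qed
  have "l2_inner M w (S t w) \<le> l2_inner M u (S t w)"
    by (intro l2_inner_mono_AE wL u S_L2 t)
      (use S_nonneg[OF t wL wp] in eventually_elim, simp add: w_def mult_right_mono)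
  also have "\<dots> = l2_inner M (S t u) w" by (rule sym[OF t u(1) wL, symmetric])
  also have "\<dots> \<le> l2_inner M (S t u) (S s v)"
    by (intro l2_inner_mono_AE wL u S_L2 t s v)
      (use S_nonneg[OF t u] in eventually_elim, simp add: w_def mult_left_mono)
  also have "\<dots> = l2_inner M u (S t (S s v))" by (rule sym[OF t u(1) sL])
  also have "\<dots> = l2_inner M u (S (s + t) v)"
    using S_plus[OF t s v(1)] s t by (intro l2_inner_cong_AE u S_L2 sL v) (auto simp: add.commute)
  finally have "l2_inner M w (S t w) = 0"
    using z inner_S_nonneg[OF t wL wp wL wp] by simp
  from S_injective[OF t wL this] have "AE x in M. u x * S s v x = 0"
    using u(2) sp by eventually_elim (auto simp: w_def min_def split: if_splits)
  then show ?thesis by (intro l2_inner_eq_0_AE u sL)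
qed

text \<open>
  By symmetry \<open>\<parallel>S\<^sub>t f\<parallel>\<^sup>2 \<le> \<parallel>f\<parallel> \<parallel>S\<^sub>2\<^sub>t f\<parallel>\<close>, so a bound \<open>B\<close> at time \<open>t\<close> improves to the \<open>2\<^sup>m\<close>-th root of \<open>B\<close> at
  time \<open>t / 2\<^sup>m\<close>.  Thus rescaling \<open>S\<close> at that time to a contraction costs, over \<open>2\<^sup>m\<close> steps, only a factor \<open>B\<close>.
\<close>

lemma dyadic_norm_bound:
  assumes t: "0 \<le> t" and B: "0 \<le> B" and f: "f \<in> L2 M"
    and b: "l2_norm M (S t f) \<le> B * l2_norm M f"
  shows "l2_norm M (S (t / 2 ^ m) f) \<le> root (2 ^ m) B * l2_norm M f"
proof -
  have "l2_norm M (S (t / 2 ^ m) f) ^ (2 ^ m) \<le> B * l2_norm M f ^ (2 ^ m)"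
  proof (induction m)
    case (Suc m)
    have m0: "0 \<le> t / 2 ^ m" using t by simp
    have "(l2_norm M (S (t / 2 ^ Suc m) f))\<^sup>2 \<le> l2_norm M f * l2_norm M (S (t / 2 ^ m) f)"
      using norm_S_half[OF m0 f] l2_Cauchy_Schwarz[OF f S_L2[OF m0 f]]
      by (simp add: mult.commute)
    then have "((l2_norm M (S (t / 2 ^ Suc m) f))\<^sup>2) ^ (2 ^ m)
        \<le> (l2_norm M f * l2_norm M (S (t / 2 ^ m) f)) ^ (2 ^ m)"
      by (intro power_mono) auto
    also have "\<dots> = l2_norm M f ^ (2 ^ m) * l2_norm M (S (t / 2 ^ m) f) ^ (2 ^ m)"
      by (rule power_mult_distrib)
    also have "\<dots> \<le> l2_norm M f ^ (2 ^ m) * (B * l2_norm M f ^ (2 ^ m))"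
      by (intro mult_left_mono Suc) auto
    finally have "((l2_norm M (S (t / 2 ^ Suc m) f))\<^sup>2) ^ (2 ^ m)
        \<le> B * (l2_norm M f ^ (2 ^ m) * l2_norm M f ^ (2 ^ m))"
      by (simp add: mult.left_commute)
    moreover have "a ^ (2 ^ Suc m) = (a\<^sup>2) ^ (2 ^ m)" for a :: real
      by (simp only: power_Suc power_mult)
    moreover have "a ^ (2 ^ Suc m) = a ^ (2 ^ m) * a ^ (2 ^ m)" for a :: real
      by (simp only: power_Suc mult_2 power_add)
    ultimately show ?case by metis
  qed (use b in simp)
  also have "\<dots> = (root (2 ^ m) B * l2_norm M f) ^ (2 ^ m)"
    using B by (simp add: power_mult_distrib)
  finally show ?thesis
    using B by (subst (asm) power_mono_iff) (auto simp: real_root_ge_zero)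
qed

lemma S_multiple:
  assumes "0 \<le> h" "f \<in> L2 M" "a \<noteq> 0"
  shows "((\<lambda>f x. S h f x / a) ^^ k) f \<in> L2 M \<and>
    (AE x in M. ((\<lambda>f x. S h f x / a) ^^ k) f x = S (real k * h) f x / a ^ k)"
proof (induction k)
  case 0
  show ?case using S_0[OF assms(2)] assms(2) by auto
next
  case (Suc k)
  let ?A = "\<lambda>f x. S h f x / a"
  have kh: "0 \<le> real k * h" using assms by simp
  have L: "(?A ^^ k) f \<in> L2 M" using Suc by blast
  have Sk: "S (real k * h) f \<in> L2 M" by (rule S_L2[OF kh assms(2)])
  have "AE x in M. S h ((?A ^^ k) f) x = S h (\<lambda>x. S (real k * h) f x / a ^ k) x"
    using Suc by (intro S_cong assms L L2_divide Sk) blast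
  then have *: "AE x in M. ?A ((?A ^^ k) f) x = S (h + real k * h) f x / a ^ Suc k"
    using S_divide[OF assms(1) Sk, of "a ^ k"] S_plus[OF assms(1) kh assms(2)]
    by eventually_elim simp
  have "real (Suc k) * h = h + real k * h" by (simp add: algebra_simps)
  with * have "AE x in M. ?A ((?A ^^ k) f) x = S (real (Suc k) * h) f x / a ^ Suc k"
    by (simp only:)
  then show ?case using S_L2[OF assms(1) L] by (auto intro: L2_divide)
qed

text \<open>
  The substitute for real analyticity of \<open>t \<mapsto> (u, S\<^sub>t v)\<close>.  For \<open>N = 2\<^sup>m\<close> and the contraction
  \<open>A = S\<^sub>s\<^sub>/\<^sub>N / a\<close> the pairings \<open>(u, A\<^sup>k v)\<close> vanish for \<open>k \<le> N\<close>, so the one with \<open>k = 2 N\<close>, which is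
  \<open>(u, S\<^sub>2\<^sub>s v)\<close> up to the bounded factor \<open>a\<^sup>2\<^sup>N = B\<^sup>2\<close>, is of order \<open>1 / N\<close>.
\<close>

lemma pairing_zero_double:
  assumes s: "0 < s" and u: "u \<in> L2 M" and v: "v \<in> L2 M"
    and z: "\<And>t. 0 \<le> t \<Longrightarrow> t \<le> s \<Longrightarrow> l2_inner M u (S t v) = 0"
  shows "l2_inner M u (S (2 * s) v) = 0"
proof -
  obtain B where B: "1 \<le> B"
    "\<And>t f. 0 \<le> t \<Longrightarrow> t \<le> s \<Longrightarrow> f \<in> L2 M \<Longrightarrow> l2_norm M (S t f) \<le> B * l2_norm M f"
    by (rule norm_bounded_on_interval) blast
  have bound: "\<bar>l2_inner M u (S (2 * s) v)\<bar> \<le> B\<^sup>2 * (2 / 2 ^ m * (l2_norm M u * l2_norm M v))" for m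
  proof -
    define N where "N = (2 ^ m :: nat)"
    define h where "h = s / 2 ^ m"
    define a where "a = root (2 ^ m) B"
    have N: "N > 0" by (simp add: N_def)
    have h: "0 \<le> h" using s by (simp add: h_def)
    have Nh: "real N * h = s" by (simp add: N_def h_def)
    have a1: "a \<ge> 1" using B by (simp add: a_def)
    have aN: "a ^ N = B" using B by (simp add: a_def N_def)
    have a: "a \<noteq> 0" using a1 by simp
    let ?A = "\<lambda>f x. S h f x / a"
    interpret A: symmetric_contraction M ?A
    proof
      fix f g :: "'a \<Rightarrow> real" and b c :: real assume f: "f \<in> L2 M"
      show "?A f \<in> L2 M" by (intro L2_divide S_L2 h f)
      have "l2_norm M (S h f) \<le> a * l2_norm M f"
        unfolding h_def a_def using B s f by (intro dyadic_norm_bound) auto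
      then show "l2_norm M (?A f) \<le> l2_norm M f"
        unfolding l2_norm_divide using a1 by (simp add: field_simps)
      assume g: "g \<in> L2 M"
      show "AE x in M. ?A (\<lambda>y. b * f y + c * g y) x = b * ?A f x + c * ?A g x"
        using S_lin[OF h f g, of b c] by eventually_elim (simp add: add_divide_distrib)
      show "l2_inner M (?A f) g = l2_inner M f (?A g)"
        using sym[OF h f g] by (simp add: l2_inner_divide_left l2_inner_divide_right)
      assume "AE x in M. f x = g x"
      from S_cong[OF h f g this] show "AE x in M. ?A f x = ?A g x" by eventually_elim simp
    qed
    have pw: "l2_inner M ((?A ^^ k) u) v = l2_inner M u (S (real k * h) v) / a ^ k" for k
    proof -
      have kh: "0 \<le> real k * h" using h by simp
      have "l2_inner M ((?A ^^ k) u) v = l2_inner M (\<lambda>x. S (real k * h) u x / a ^ k) v"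
        using S_multiple[OF h u a, of k] by (intro l2_inner_cong_AE L2_divide S_L2 kh u v) auto
      then show ?thesis using sym[OF kh u v] by (simp add: l2_inner_divide_left)
    qed
    have "l2_inner M ((?A ^^ k) u) v = 0" if "k \<le> N" for k
    proof -
      have "real k * h \<le> real N * h" using that h by (intro mult_right_mono) auto
      then show ?thesis using z[of "real k * h"] h Nh unfolding pw by simp
    qed
    from A.power_pairing_small[OF u v N this, of "2 * N"]
    have "\<bar>l2_inner M u (S (real (2 * N) * h) v) / a ^ (2 * N)\<bar>
        \<le> real (2 * N) / (real N)\<^sup>2 * (l2_norm M u * l2_norm M v)"
      unfolding pw .
    moreover have "real (2 * N) * h = 2 * s" using Nh by simp
    moreover have "a ^ (2 * N) = B\<^sup>2" using aN by (simp add: power_mult mult.commute[of 2])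
    moreover have "real (2 * N) / (real N)\<^sup>2 = 2 / 2 ^ m"
      using N by (simp add: power2_eq_square N_def)
    ultimately have "\<bar>l2_inner M u (S (2 * s) v)\<bar> / B\<^sup>2 \<le> 2 / 2 ^ m * (l2_norm M u * l2_norm M v)"
      by (simp only: abs_divide abs_power2 power2_abs)
    then show ?thesis using B(1) by (subst (asm) pos_divide_le_eq) (auto simp: mult.commute)
  qed
  have "(\<lambda>m. B\<^sup>2 * (2 * (1 / 2) ^ m * (l2_norm M u * l2_norm M v)))
      \<longlonglongrightarrow> B\<^sup>2 * (2 * 0 * (l2_norm M u * l2_norm M v))"
    by (intro tendsto_intros LIMSEQ_realpow_zero) auto
  then have "\<bar>l2_inner M u (S (2 * s) v)\<bar> \<le> B\<^sup>2 * (2 * 0 * (l2_norm M u * l2_norm M v))"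
    by (rule LIMSEQ_le_const) (use bound in \<open>auto simp: power_divide\<close>)
  then show ?thesis by simp
qed

lemma pairing_zero_everywhere:
  assumes s: "0 < s" and u: "u \<in> L2 M" "AE x in M. 0 \<le> u x"
    and v: "v \<in> L2 M" "AE x in M. 0 \<le> v x"
    and z: "l2_inner M u (S s v) = 0" and t: "0 \<le> t"
  shows "l2_inner M u (S t v) = 0"
proof -
  have earlier: "l2_inner M u (S r v) = 0" if "0 \<le> r" "r \<le> q" "l2_inner M u (S q v) = 0" for r q
    using pairing_zero_backward[OF that(1) _ u v, of "q - r"] that by simp
  have "l2_inner M u (S (2 ^ n * s) v) = 0" for n
  proof (induction n)
    case (Suc n)
    have "l2_inner M u (S (2 * (2 ^ n * s)) v) = 0"
      using s earlier Suc by (intro pairing_zero_double u v) auto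
    then show ?case by (simp add: mult.assoc)
  qed (use z in simp)
  moreover obtain n where "t / s < 2 ^ n" using real_arch_pow[of 2 "t / s"] by auto
  then have "t \<le> 2 ^ n * s" using s by (simp add: field_simps)
  ultimately show ?thesis using earlier[OF t] by blast
qed

context
  fixes f :: "'a \<Rightarrow> real" and t0 :: real and P :: "'a set"
  assumes f: "f \<in> L2 M" "AE x in M. 0 \<le> f x" and t0: "0 < t0"
    and P_def: "P = {x \<in> space M. 0 < S t0 f x}"
begin

lemma support_measurable: "P \<in> sets M"
  unfolding P_def using L2_measurable[OF S_L2[of t0 f]] f t0 by simp

text \<open>
  The claim holds for \<open>g = S\<^sub>t\<^sub>0 f\<close>, since \<open>w\<close> is orthogonal to \<open>S\<^sub>t\<^sub>0 f\<close> and therefore to all \<open>S\<^sub>t f\<close>.  A general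
  \<open>g \<ge> 0\<close> supported in \<open>P\<close> is the limit of \<open>min g (n S\<^sub>t\<^sub>0 f)\<close>, which is dominated by a multiple of \<open>S\<^sub>t\<^sub>0 f\<close>.
\<close>

lemma support_pairing_zero:
  assumes w: "w \<in> L2 M" "AE x in M. 0 \<le> w x" "AE x in M. x \<in> P \<longrightarrow> w x = 0"
    and g: "g \<in> L2 M" "AE x in M. 0 \<le> g x" "AE x in M. x \<notin> P \<longrightarrow> g x = 0" and t: "0 \<le> t"
  shows "l2_inner M w (S t g) = 0"
proof -
  let ?F = "S t0 f"
  have t00: "0 \<le> t0" using t0 by simp
  have FL: "?F \<in> L2 M" by (rule S_L2[OF t00 f(1)])
  have Fp: "AE x in M. 0 \<le> ?F x" by (rule S_nonneg[OF t00 f])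
  have "l2_inner M w ?F = 0"
  proof (rule l2_inner_eq_0_AE[OF w(1) FL])
    show "AE x in M. w x * ?F x = 0"
      using w(3) Fp AE_space by eventually_elim (auto simp: P_def)
  qed
  then have "l2_inner M w (S (t + t0) f) = 0"
    using pairing_zero_everywhere[OF t0 w(1,2) f, of "t + t0"] t t0 by simp
  then have zF: "l2_inner M w (S t ?F) = 0"
    using S_plus[OF t t00 f(1)] t t0
    by (subst l2_inner_cong_AE[of w M _ w "S (t + t0) f"]) (auto intro!: w S_L2 f)
  define gn where "gn = (\<lambda>n x. min (g x) (real n * ?F x))"
  have gm: "gn n \<in> borel_measurable M" for n unfolding gn_def using g FL by (auto simp: L2_def)
  have gb: "AE x in M. \<bar>gn n x\<bar> \<le> \<bar>g x\<bar>" for n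
    using g(2) Fp by eventually_elim (auto simp: gn_def min_def)
  have gL: "gn n \<in> L2 M" for n by (rule L2_dominated[OF g(1) gm gb])
  have lim: "l2_tendsto M gn g sequentially"
  proof (rule l2_tendsto_dominated(2)[OF gm _ g(1) _ gb])
    show "AE x in M. (\<lambda>n. gn n x) \<longlonglongrightarrow> g x"
      using g(2,3) Fp AE_space
    proof eventually_elim
      case (elim x)
      show ?case
      proof (cases "x \<in> P")
        case True
        then have F: "0 < ?F x" by (simp add: P_def)
        obtain n0 where n0: "g x < real n0 * ?F x" using reals_Archimedean3[OF F] by blast
        have "\<forall>\<^sub>F n in sequentially. gn n x = g x"
          using eventually_ge_at_top[of n0]
        proof eventually_elim
          case (elim n)
          have "real n0 * ?F x \<le> real n * ?F x" using elim F by (intro mult_right_mono) auto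
          then show ?case using n0 by (simp add: gn_def)
        qed
        then show ?thesis by (rule tendsto_eventually)
      next
        case False
        then show ?thesis using elim by (simp add: gn_def min_absorb1)
      qed
    qed
  qed (use g in \<open>simp add: L2_def\<close>)
  have "l2_inner M w (S t (gn n)) = 0" for n
  proof (rule antisym)
    have "AE x in M. S t (gn n) x \<le> S t (\<lambda>x. real n * ?F x) x"
      by (intro S_mono t gL L2_scale FL) (simp add: gn_def)
    then have "AE x in M. w x * S t (gn n) x \<le> w x * (real n * S t ?F x)"
      using S_scale[OF t FL, of "real n"] w(2) by eventually_elim (simp add: mult_left_mono)
    then have "l2_inner M w (S t (gn n)) \<le> l2_inner M w (\<lambda>x. real n * S t ?F x)"
      by (intro l2_inner_mono_AE w S_L2 t gL L2_scale FL)
    then show "l2_inner M w (S t (gn n)) \<le> 0" using zF by (simp add: l2_inner_scale_right)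
    show "0 \<le> l2_inner M w (S t (gn n))"
      by (rule inner_S_nonneg[OF t w(1,2) gL]) (use g(2) Fp in eventually_elim, simp add: gn_def)
  qed
  moreover have "(\<lambda>n. l2_inner M (S t (gn n)) w) \<longlonglongrightarrow> l2_inner M (S t g) w"
    by (intro l2_tendsto_inner S_l2_tendsto lim g w t always_eventually allI S_L2 gL)
  ultimately show ?thesis
    by (simp add: l2_inner_commute[of M _ w] LIMSEQ_const_iff)
qed

lemma support_invariant:
  assumes g: "g \<in> L2 M" "AE x in M. x \<notin> P \<longrightarrow> g x = 0" and t: "0 \<le> t"
  shows "AE x in M. x \<notin> P \<longrightarrow> S t g x = 0"
proof -
  have *: "AE x in M. x \<notin> P \<longrightarrow> S t k x = 0"
    if k: "k \<in> L2 M" "AE x in M. 0 \<le> k x" "AE x in M. x \<notin> P \<longrightarrow> k x = 0" for k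
  proof -
    let ?w = "\<lambda>x. indicator (space M - P) x * S t k x"
    have wL: "?w \<in> L2 M" using support_measurable by (intro L2_indicator_mult S_L2 t k) auto
    have "l2_inner M ?w (S t k) = 0"
      by (rule support_pairing_zero[OF wL _ _ k t])
        (use S_nonneg[OF t k(1,2)] in \<open>auto elim!: eventually_mono simp: indicator_def\<close>)
    then have "AE x in M. ?w x * S t k x = 0"
      by (intro l2_inner_eq_0_imp_AE wL S_L2 t k) (auto simp: indicator_def)
    then show ?thesis using AE_space by eventually_elim (auto simp: indicator_def)
  qed
  define gp gm where "gp = (\<lambda>x. max (g x) 0)" and "gm = (\<lambda>x. max (- g x) 0)"
  have L: "gp \<in> L2 M" "gm \<in> L2 M"
    by (rule L2_dominated[OF g(1)]; use g in \<open>auto simp: gp_def gm_def L2_def\<close>)+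
  have g_eq: "g = (\<lambda>x. gp x - gm x)" by (auto simp: gp_def gm_def)
  have "AE x in M. x \<notin> P \<longrightarrow> S t gp x = 0" "AE x in M. x \<notin> P \<longrightarrow> S t gm x = 0"
    by (rule *; use L g(2) in \<open>auto elim!: eventually_mono simp: gp_def gm_def\<close>)+
  with S_diff[OF t L] show ?thesis unfolding g_eq by eventually_elim simp
qed

text \<open>
  Functions supported in \<open>P\<close> stay supported in \<open>P\<close>, and by symmetry so do functions supported in the
  complement.
\<close>

lemma support_reduces:
  assumes g: "g \<in> L2 M" and t: "0 \<le> t"
  shows "AE x in M. S t (\<lambda>x. indicator P x * g x) x = indicator P x * S t g x"
proof -
  note Pm = support_measurable
  let ?a = "\<lambda>x. indicator P x * g x" and ?b = "\<lambda>x. indicator (space M - P) x * g x"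
  have L: "?a \<in> L2 M" "?b \<in> L2 M" using Pm by (auto intro!: L2_indicator_mult g)
  have 1: "AE x in M. x \<notin> P \<longrightarrow> S t ?a x = 0"
    by (rule support_invariant[OF L(1) _ t]) simp
  have 2: "AE x in M. x \<in> P \<longrightarrow> S t ?b x = 0"
  proof -
    let ?w = "\<lambda>x. indicator P x * S t ?b x"
    have wL: "?w \<in> L2 M" by (intro L2_indicator_mult Pm S_L2 t L)
    have "AE x in M. x \<notin> P \<longrightarrow> S t ?w x = 0"
      by (rule support_invariant[OF wL _ t]) simp
    then have "AE x in M. ?b x * S t ?w x = 0"
      by eventually_elim (auto simp: indicator_def)
    then have "l2_inner M ?b (S t ?w) = 0" by (intro l2_inner_eq_0_AE L S_L2 t wL)
    then have "l2_inner M ?w (S t ?b) = 0"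
      using sym[OF t L(2) wL] by (simp add: l2_inner_commute)
    then have "AE x in M. ?w x * S t ?b x = 0"
      by (intro l2_inner_eq_0_imp_AE wL S_L2 t L) (auto simp: indicator_def)
    then show ?thesis by eventually_elim (auto simp: indicator_def)
  qed
  have "AE x in M. S t g x = S t (\<lambda>x. ?a x + ?b x) x"
    by (intro S_cong t g L2_add L) (use AE_space in eventually_elim, auto simp: indicator_def)
  with S_add[OF t L] 1 2 show ?thesis by eventually_elim (auto simp: indicator_def)
qed

end

end

locale symmetric_positive_generator = l2_generator + symmetric_positive_semigroup
begin

lemma K_symmetric:
  assumes "(f, f') \<in> K" "(g, g') \<in> K"
  shows "l2_inner M f' g = l2_inner M f g'"
proof -
  note L = K_L2[OF assms(1)] K_L2[OF assms(2)]
  have ev: "\<forall>\<^sub>F h in at_right 0. (0::real) < h" by (simp add: eventually_at_filter)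
  have lim: "((\<lambda>h. l2_inner M (\<lambda>x. (f x - S h f x) / h) g) \<longlongrightarrow> l2_inner M f' g) (at_right 0)"
    by (rule l2_tendsto_inner[OF _ _ L(2,3)])
      (use assms(1) ev L in \<open>auto simp: K_iff elim!: eventually_mono intro!: L2_intros S_L2\<close>)
  have "((\<lambda>h. l2_inner M (\<lambda>x. (g x - S h g x) / h) f) \<longlongrightarrow> l2_inner M g' f) (at_right 0)"
    by (rule l2_tendsto_inner[OF _ _ L(4,1)])
      (use assms(2) ev L in \<open>auto simp: K_iff elim!: eventually_mono intro!: L2_intros S_L2\<close>)
  moreover have "\<forall>\<^sub>F h in at_right 0. l2_inner M (\<lambda>x. (g x - S h g x) / h) f
      = l2_inner M (\<lambda>x. (f x - S h f x) / h) g"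
    using ev
  proof eventually_elim
    case (elim h)
    then have h: "0 \<le> h" by simp
    have "l2_inner M (S h g) f = l2_inner M (S h f) g"
      unfolding sym[OF h L(1,3)] by (rule l2_inner_commute)
    then have "(l2_inner M g f - l2_inner M (S h g) f) / h = (l2_inner M f g - l2_inner M (S h f) g) / h"
      by (rule arg_cong2[where f = "\<lambda>a b. (a - b) / h", OF l2_inner_commute[of M g f]])
    then show ?case
      by (simp only: l2_inner_divide_left l2_inner_diff_left[OF L(1) S_L2[OF h L(1)] L(3)]
          l2_inner_diff_left[OF L(3) S_L2[OF h L(3)] L(1)])
  qed
  ultimately have "((\<lambda>h. l2_inner M (\<lambda>x. (f x - S h f x) / h) g) \<longlongrightarrow> l2_inner M g' f) (at_right 0)"
    by (rule Lim_transform_eventually)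
  then have "l2_inner M f' g = l2_inner M g' f"
    using lim by (intro tendsto_unique[OF trivial_limit_at_right_real])
  then show ?thesis using l2_inner_commute by metis
qed

lemma support_reduces_generator:
  assumes f: "f \<in> L2 M" "AE x in M. 0 \<le> f x" and t0: "0 < t0"
    and uu: "(u, u') \<in> K"
  defines "P \<equiv> {x \<in> space M. 0 < S t0 f x}"
  shows "((\<lambda>x. indicator P x * u x), (\<lambda>x. indicator P x * u' x)) \<in> K"
proof -
  have Pe: "P = {x \<in> space M. 0 < S t0 f x}" by (simp add: P_def)
  note L = K_L2[OF uu]
  note Pm = support_measurable[OF f t0 Pe]
  let ?u = "\<lambda>x. indicator P x * u x" and ?v = "\<lambda>x. indicator P x * u' x"
  have iL: "?u \<in> L2 M" "?v \<in> L2 M" by (intro L2_indicator_mult Pm L)+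
  have "l2_tendsto M (\<lambda>h x. (u x - S h u x) / h) u' (at_right 0)"
    using uu by (simp add: K_iff)
  then have "l2_tendsto M (\<lambda>h x. (?u x - S h ?u x) / h) ?v (at_right 0)"
  proof (rule l2_tendsto_squeeze[where C = 1])
    show "\<forall>\<^sub>F h in at_right 0. l2_norm M (\<lambda>x. (?u x - S h ?u x) / h - ?v x)
        \<le> 1 * l2_norm M (\<lambda>x. (u x - S h u x) / h - u' x)"
      unfolding eventually_at_filter
    proof (intro always_eventually allI impI)
      fix h :: real assume "h \<in> {0<..}"
      then have h: "0 \<le> h" by simp
      have "AE x in M. \<bar>(?u x - S h ?u x) / h - ?v x\<bar> \<le> \<bar>(u x - S h u x) / h - u' x\<bar>"
        using support_reduces[OF f t0 Pe L(1) h] by eventually_elim (auto simp: indicator_def)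
      then have "l2_norm M (\<lambda>x. (?u x - S h ?u x) / h - ?v x)
          \<le> l2_norm M (\<lambda>x. (u x - S h u x) / h - u' x)"
        by (intro l2_norm_mono_AE L2_measurable L2_intros S_L2 h iL L)
      then show "l2_norm M (\<lambda>x. (?u x - S h ?u x) / h - ?v x)
          \<le> 1 * l2_norm M (\<lambda>x. (u x - S h u x) / h - u' x)" by simp
    qed
  qed
  then show ?thesis using iL by (simp add: K_iff)
qed

text \<open>
  The vanishing integral expresses that multiplication by the indicator of \<open>P\<close> commutes with the
  symmetric generator.  It is the only trace of the semigroup that the local analysis uses.
\<close>

lemma not_irreducible_imp_reducing_set:
  assumes "\<not> irreducible_semigroup M S"
  obtains P where "P \<in> sets M" "\<not> (AE x in M. x \<in> P)" "\<not> (AE x in M. x \<notin> P)"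
    "\<And>u u' v v'. (u, u') \<in> K \<Longrightarrow> (v, v') \<in> K \<Longrightarrow>
      (LINT x|M. indicator P x * (u x * v' x - u' x * v x)) = 0"
proof -
  obtain t0 f where t0: "0 < t0" and f: "f \<in> L2 M" "AE x in M. 0 \<le> f x"
    and nz: "\<not> (AE x in M. f x = 0)" and np: "\<not> (AE x in M. 0 < S t0 f x)"
    using assms pos by (auto simp: irreducible_semigroup_def)
  define P where "P = {x \<in> space M. 0 < S t0 f x}"
  have t00: "0 \<le> t0" using t0 by simp
  note Pm = support_measurable[OF f t0 P_def]
  have "\<not> (AE x in M. x \<in> P)"
    using np by (auto simp: P_def elim: eventually_mono)
  moreover have "\<not> (AE x in M. x \<notin> P)"
  proof
    assume "AE x in M. x \<notin> P"
    then have "AE x in M. f x * S t0 f x = 0"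
      using S_nonneg[OF t00 f] AE_space by eventually_elim (auto simp: P_def)
    then have "l2_inner M f (S t0 f) = 0" by (intro l2_inner_eq_0_AE f S_L2 t00)
    from S_injective[OF t00 f(1) this] show False using nz by simp
  qed
  moreover have "(LINT x|M. indicator P x * (u x * v' x - u' x * v x)) = 0"
    if uu: "(u, u') \<in> K" and vv: "(v, v') \<in> K" for u u' v v'
  proof -
    note L = K_L2[OF uu] K_L2[OF vv]
    have iL: "(\<lambda>x. indicator P x * u x) \<in> L2 M" "(\<lambda>x. indicator P x * u' x) \<in> L2 M"
      by (intro L2_indicator_mult Pm L)+
    have "l2_inner M (\<lambda>x. indicator P x * u' x) v = l2_inner M (\<lambda>x. indicator P x * u x) v'"
      unfolding P_def by (rule K_symmetric[OF support_reduces_generator[OF f t0 uu] vv])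
    moreover have "(LINT x|M. indicator P x * (u x * v' x - u' x * v x))
      = (LINT x|M. (indicator P x * u x) * v' x - (indicator P x * u' x) * v x)"
      by (simp add: algebra_simps)
    ultimately show ?thesis
      by (simp add: l2_inner_def L2_integrable_mult iL L)
  qed
  ultimately show ?thesis using that[OF Pm] by blast
qed

end

section \<open>Smooth functions of one variable\<close>

definition flat_exp :: "nat \<Rightarrow> real \<Rightarrow> real" where
  "flat_exp m t = (if t > 0 then exp (- 1 / t) / t ^ m else 0)"

lemma flat_exp_tendsto_0: "(flat_exp m \<longlongrightarrow> 0) (at 0)"
proof (rule filterlim_split_at)
  show "(flat_exp m \<longlongrightarrow> 0) (at_left 0)"
    by (rule tendsto_eventually) (auto simp: flat_exp_def eventually_at_filter)
  have "((\<lambda>t. inverse t ^ m / exp (inverse t)) \<longlongrightarrow> (0::real)) (at_right 0)"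
    by (rule filterlim_compose[OF tendsto_power_div_exp_0 filterlim_inverse_at_top_right])
  then show "(flat_exp m \<longlongrightarrow> 0) (at_right 0)"
    by (rule Lim_transform_eventually)
      (auto simp: flat_exp_def eventually_at_filter exp_minus field_simps)
qed

lemma flat_exp_deriv:
  "(flat_exp m has_real_derivative (- real m * flat_exp (m + 1) t + flat_exp (m + 2) t)) (at t)"
proof -
  consider "t > 0" | "t < 0" | "t = 0" by linarith
  then show ?thesis
  proof cases
    case 1
    have "((\<lambda>t. exp (- 1 / t) / t ^ m) has_real_derivative
        (- real m * flat_exp (m + 1) t + flat_exp (m + 2) t)) (at t)"
    proof (rule DERIV_cong)
      show "((\<lambda>t. exp (- 1 / t) / t ^ m) has_real_derivative
        (exp (- 1 / t) * (1 / t\<^sup>2) * t ^ m - exp (- 1 / t) * (real m * t ^ (m - 1))) / (t ^ m * t ^ m)) (at t)"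
        using 1 by (auto intro!: derivative_eq_intros simp: power2_eq_square)
      show "(exp (- 1 / t) * (1 / t\<^sup>2) * t ^ m - exp (- 1 / t) * (real m * t ^ (m - 1))) / (t ^ m * t ^ m)
        = - real m * flat_exp (m + 1) t + flat_exp (m + 2) t"
      proof (cases m)
        case 0
        then show ?thesis using 1 by (simp add: flat_exp_def power2_eq_square)
      next
        case (Suc k)
        then show ?thesis using 1
          by (simp add: flat_exp_def power2_eq_square divide_simps) (simp add: algebra_simps)
      qed
    qed
    then show ?thesis
      by (rule has_field_derivative_transform_within_open[of _ _ _ "{0<..}"])
        (use 1 in \<open>auto simp: flat_exp_def\<close>)
  next
    case 2
    have "((\<lambda>t. 0) has_real_derivative 0) (at t)" by simp
    then have "(flat_exp m has_real_derivative 0) (at t)"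
      by (rule has_field_derivative_transform_within_open[of _ _ _ "{..<0}"])
        (use 2 in \<open>auto simp: flat_exp_def\<close>)
    then show ?thesis using 2 by (simp add: flat_exp_def)
  next
    case 3
    have "((\<lambda>h. (flat_exp m (0 + h) - flat_exp m 0) / h) \<longlongrightarrow> 0) (at 0)"
      by (rule Lim_transform_eventually[OF flat_exp_tendsto_0[of "m + 1"]])
        (auto simp: flat_exp_def eventually_at_filter)
    then show ?thesis unfolding 3 by (simp add: DERIV_def) (simp add: flat_exp_def)
  qed
qed

lemma flat_exp_nonneg: "0 \<le> flat_exp m t" by (simp add: flat_exp_def)
lemma flat_exp_pos_iff: "0 < flat_exp m t \<longleftrightarrow> 0 < t" by (simp add: flat_exp_def)

text \<open>
  A class of smooth functions that is visibly closed under differentiation and contains what is composed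
  with test functions later: the functions \<open>exp (- 1 / s) / s\<^sup>m\<close> for bumps, and \<open>(s\<^sup>2 + 1) powr a\<close> for smooth
  approximations of the absolute value and of the sign.
\<close>

inductive smooth1 :: "(real \<Rightarrow> real) \<Rightarrow> bool" where
  const: "smooth1 (\<lambda>s. c)"
| ident: "smooth1 (\<lambda>s. s)"
| flat: "smooth1 (flat_exp m)"
| powr: "smooth1 (\<lambda>s. (s\<^sup>2 + 1) powr a)"
| add: "smooth1 f \<Longrightarrow> smooth1 g \<Longrightarrow> smooth1 (\<lambda>s. f s + g s)"
| mult: "smooth1 f \<Longrightarrow> smooth1 g \<Longrightarrow> smooth1 (\<lambda>s. f s * g s)"

lemma smooth1_deriv:
  "smooth1 g \<Longrightarrow> \<exists>g'. smooth1 g' \<and> (\<forall>t. (g has_real_derivative g' t) (at t))"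
proof (induction rule: smooth1.induct)
  case (const c)
  show ?case by (intro exI[of _ "\<lambda>_. 0"] conjI smooth1.const) simp
next
  case ident
  show ?case by (intro exI[of _ "\<lambda>_. 1"] conjI smooth1.const) simp
next
  case (flat m)
  have "smooth1 (\<lambda>t. - real m * flat_exp (m + 1) t + flat_exp (m + 2) t)"
    by (intro smooth1.intros)
  then show ?case using flat_exp_deriv by blast
next
  case (powr a)
  have "smooth1 (\<lambda>s. 2 * a * s * (s\<^sup>2 + 1) powr (a - 1))"
    by (intro smooth1.intros)
  moreover have "((\<lambda>s. (s\<^sup>2 + 1) powr a) has_real_derivative 2 * a * s * (s\<^sup>2 + 1) powr (a - 1)) (at s)"
    for s :: real
  proof -
    have p: "s\<^sup>2 + 1 > 0" using zero_le_power2[of s] by linarith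
    show ?thesis using p
      by (auto intro!: derivative_eq_intros simp: powr_diff field_simps)
  qed
  ultimately show ?case by blast
next
  case (add f g)
  then obtain f' g' where *: "smooth1 f'" "smooth1 g'"
    "\<forall>t. (f has_real_derivative f' t) (at t)" "\<forall>t. (g has_real_derivative g' t) (at t)" by blast
  show ?case
    by (intro exI[of _ "\<lambda>t. f' t + g' t"] conjI smooth1.add allI DERIV_add) (use * in auto)
next
  case (mult f g)
  then obtain f' g' where *: "smooth1 f'" "smooth1 g'"
    "\<forall>t. (f has_real_derivative f' t) (at t)" "\<forall>t. (g has_real_derivative g' t) (at t)" by blast
  have "smooth1 (\<lambda>t. f' t * g t + g' t * f t)"
    by (intro smooth1.intros * mult)
  then show ?case using * by (blast intro: DERIV_mult)
qed

section \<open>Smooth functions of several variables\<close>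

lemma partial_deriv_eqI: "(f has_derivative f') (at x) \<Longrightarrow> partial_deriv i f x = f' (axis i 1)"
  unfolding partial_deriv_def by (metis frechet_derivative_at)

lemma has_derivative_frechet:
  "f differentiable (at x) \<Longrightarrow> (f has_derivative frechet_derivative f (at x)) (at x)"
  by (simp add: frechet_derivative_works)

text \<open>
  Smoothness is established by exhibiting a family of differentiable functions that is closed under all
  partial derivatives, in place of an explicit description of the iterated derivatives.
\<close>

lemma smooth_fun_coinduct:
  assumes "f \<in> F" and "\<And>g x. g \<in> F \<Longrightarrow> g differentiable (at x)"
    and "\<And>g i. g \<in> F \<Longrightarrow> partial_deriv i g \<in> F"
  shows "smooth_fun f"
proof -
  have "foldr partial_deriv is f \<in> F" for "is"
    by (induction "is") (use assms in auto)
  then show ?thesis using assms(2) by (simp add: smooth_fun_def)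
qed

lemma smooth_fun_differentiable: "smooth_fun f \<Longrightarrow> f differentiable (at x)"
  unfolding smooth_fun_def by (metis foldr.simps(1) id_apply)

lemma smooth_fun_partial: "smooth_fun f \<Longrightarrow> smooth_fun (partial_deriv i f)"
  unfolding smooth_fun_def
proof (intro allI)
  fix "is" x assume *: "\<forall>is x. foldr partial_deriv is f differentiable at x"
  from *[rule_format, of "is @ [i]" x] show "foldr partial_deriv is (partial_deriv i f) differentiable at x"
    by simp
qed

lemma smooth_fun_continuous: "smooth_fun f \<Longrightarrow> continuous_on S f"
  by (meson differentiable_imp_continuous_within continuous_at_imp_continuous_on smooth_fun_differentiable)

text \<open>
  The family for \<open>smooth_fun_coinduct\<close> that shows that smooth functions are closed under sums, products
  and composition.
\<close>

inductive smooth_alg :: "(real^'n::finite \<Rightarrow> real) \<Rightarrow> bool" where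
  base: "smooth_fun f \<Longrightarrow> smooth_alg f"
| add: "smooth_alg f \<Longrightarrow> smooth_alg g \<Longrightarrow> smooth_alg (\<lambda>x. f x + g x)"
| mult: "smooth_alg f \<Longrightarrow> smooth_alg g \<Longrightarrow> smooth_alg (\<lambda>x. f x * g x)"
| comp: "smooth1 h \<Longrightarrow> smooth_alg f \<Longrightarrow> smooth_alg (\<lambda>x. h (f x))"

lemma partial_deriv_add:
  "f differentiable (at x) \<Longrightarrow> g differentiable (at x) \<Longrightarrow>
    partial_deriv i (\<lambda>x. f x + g x) x = partial_deriv i f x + partial_deriv i g x"
  by (subst partial_deriv_eqI[OF has_derivative_add[OF has_derivative_frechet has_derivative_frechet]])
    (simp_all add: partial_deriv_def)

lemma partial_deriv_mult:
  "f differentiable (at x) \<Longrightarrow> g differentiable (at x) \<Longrightarrow>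
    partial_deriv i (\<lambda>x. f x * g x) x = f x * partial_deriv i g x + partial_deriv i f x * g x"
  by (subst partial_deriv_eqI[OF has_derivative_mult[OF has_derivative_frechet has_derivative_frechet]])
    (simp_all add: partial_deriv_def)

lemma partial_deriv_comp:
  assumes "f differentiable (at x)" "(h has_real_derivative h') (at (f x))"
  shows "((\<lambda>x. h (f x)) has_derivative (\<lambda>v. h' * frechet_derivative f (at x) v)) (at x)"
    "partial_deriv i (\<lambda>x. h (f x)) x = h' * partial_deriv i f x"
proof -
  show *: "((\<lambda>x. h (f x)) has_derivative (\<lambda>v. h' * frechet_derivative f (at x) v)) (at x)"
    using has_derivative_compose[OF has_derivative_frechet[OF assms(1)]
        assms(2)[unfolded has_field_derivative_def]] by simp
  show "partial_deriv i (\<lambda>x. h (f x)) x = h' * partial_deriv i f x"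
    using partial_deriv_eqI[OF *] by (simp add: partial_deriv_def)
qed

lemma smooth_alg_differentiable: "smooth_alg f \<Longrightarrow> f differentiable (at x)"
proof (induction rule: smooth_alg.induct)
  case (comp h f)
  obtain h' where "\<And>t. (h has_real_derivative h' t) (at t)" using smooth1_deriv[OF comp(1)] by blast
  from partial_deriv_comp(1)[OF comp(3) this] show ?case by (auto simp: differentiable_def)
qed (auto intro: smooth_fun_differentiable derivative_intros)

lemma smooth_alg_partial: "smooth_alg f \<Longrightarrow> smooth_alg (partial_deriv i f)"
proof (induction rule: smooth_alg.induct)
  case (base f)
  then show ?case by (intro smooth_alg.base smooth_fun_partial)
next
  case (add f g)
  have "partial_deriv i (\<lambda>x. f x + g x) = (\<lambda>x. partial_deriv i f x + partial_deriv i g x)"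
    using add by (intro ext partial_deriv_add smooth_alg_differentiable)
  then show ?case using add by (simp add: smooth_alg.add)
next
  case (mult f g)
  have "partial_deriv i (\<lambda>x. f x * g x) = (\<lambda>x. f x * partial_deriv i g x + partial_deriv i f x * g x)"
    using mult by (intro ext partial_deriv_mult smooth_alg_differentiable)
  then show ?case using mult by (simp add: smooth_alg.add smooth_alg.mult)
next
  case (comp h f)
  obtain h' where h': "smooth1 h'" "\<And>t. (h has_real_derivative h' t) (at t)"
    using smooth1_deriv[OF comp(1)] by blast
  have "partial_deriv i (\<lambda>x. h (f x)) = (\<lambda>x. h' (f x) * partial_deriv i f x)"
    using comp h' by (intro ext partial_deriv_comp(2) smooth_alg_differentiable)
  then show ?case using comp h' by (simp add: smooth_alg.comp smooth_alg.mult)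
qed

lemma smooth_alg_iff: "smooth_alg f \<longleftrightarrow> smooth_fun f"
  using smooth_fun_coinduct[of f "Collect smooth_alg"] smooth_alg_differentiable smooth_alg_partial
  by (auto intro: smooth_alg.base)

lemma smooth_fun_add: "smooth_fun f \<Longrightarrow> smooth_fun g \<Longrightarrow> smooth_fun (\<lambda>x. f x + g x)"
  using smooth_alg.add unfolding smooth_alg_iff .

lemma smooth_fun_mult: "smooth_fun f \<Longrightarrow> smooth_fun g \<Longrightarrow> smooth_fun (\<lambda>x. f x * g x)"
  using smooth_alg.mult unfolding smooth_alg_iff .

lemma smooth_fun_comp: "smooth1 h \<Longrightarrow> smooth_fun f \<Longrightarrow> smooth_fun (\<lambda>x. h (f x))"
  using smooth_alg.comp unfolding smooth_alg_iff .

lemma affine_coordinate_deriv: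
  "((\<lambda>x::real^'n. a * x $ k + b) has_derivative (\<lambda>v. a * v $ k)) (at x)"
proof -
  have "((\<lambda>x::real^'n. x $ k) has_derivative (\<lambda>v. v $ k)) (at x)"
    by (rule bounded_linear_imp_has_derivative[OF bounded_linear_vec_nth])
  then show ?thesis by (auto intro!: derivative_eq_intros)
qed

lemma smooth_fun_affine: "smooth_fun (\<lambda>x::real^'n::finite. a * x $ k + b)"
proof (rule smooth_fun_coinduct[where F = "range (\<lambda>(a, b) x. a * x $ k + b)"])
  show "(\<lambda>x. a * x $ k + b) \<in> range (\<lambda>(a, b) x. a * x $ k + b)" by (auto simp: image_iff)
next
  fix g x assume "g \<in> range (\<lambda>(a, b) x::real^'n. a * x $ k + b)"
  then obtain a b where g: "g = (\<lambda>x. a * x $ k + b)" by auto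
  show "g differentiable at x"
    unfolding g by (rule differentiableI[OF affine_coordinate_deriv])
next
  fix g i assume "g \<in> range (\<lambda>(a, b) x::real^'n. a * x $ k + b)"
  then obtain a b where g: "g = (\<lambda>x. a * x $ k + b)" by auto
  have "partial_deriv i g = (\<lambda>x. 0 * x $ k + a * axis i 1 $ k)"
    unfolding g by (rule ext) (simp add: partial_deriv_eqI[OF affine_coordinate_deriv])
  then show "partial_deriv i g \<in> range (\<lambda>(a, b) x. a * x $ k + b)"
    by (intro image_eqI[of _ _ "(0, a * axis i 1 $ k)"]) auto
qed

lemma smooth_fun_const: "smooth_fun (\<lambda>x::real^'n::finite. c)"
  using smooth_fun_affine[of 0 undefined c] by simp

lemma smooth_fun_coordinate: "smooth_fun (\<lambda>x::real^'n::finite. x $ k)"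
  using smooth_fun_affine[of 1 k 0] by simp

lemma smooth_fun_scale: "smooth_fun f \<Longrightarrow> smooth_fun (\<lambda>x. c * f x)"
  by (intro smooth_fun_mult smooth_fun_const)

lemma smooth_fun_diff: "smooth_fun f \<Longrightarrow> smooth_fun g \<Longrightarrow> smooth_fun (\<lambda>x. f x - g x)"
  using smooth_fun_add[OF _ smooth_fun_scale, of f g "-1"] by simp

lemma smooth_fun_sum:
  "finite I \<Longrightarrow> (\<And>i. i \<in> I \<Longrightarrow> smooth_fun (f i)) \<Longrightarrow> smooth_fun (\<lambda>x. \<Sum>i\<in>I. f i x)"
  by (induction I rule: finite_induct) (auto intro: smooth_fun_const smooth_fun_add)

lemma smooth_fun_dist_square: "smooth_fun (\<lambda>y::real^'n::finite. r - (norm (a *\<^sub>R y + b))\<^sup>2)"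
proof -
  have "(norm (a *\<^sub>R y + b))\<^sup>2 = (\<Sum>k\<in>UNIV. (a * y $ k + b $ k) * (a * y $ k + b $ k))" for y :: "real^'n"
    unfolding power2_norm_eq_inner inner_vec_def by simp
  then show ?thesis
    by (auto intro!: smooth_fun_diff smooth_fun_const smooth_fun_sum smooth_fun_mult smooth_fun_affine)
qed

section \<open>Test functions\<close>

lemma test_functionsI:
  assumes "smooth_fun f" "compact C" "C \<subseteq> \<Omega>" "\<And>x. x \<notin> C \<Longrightarrow> f x = 0"
  shows "f \<in> test_functions \<Omega>"
proof -
  have "closure {x. f x \<noteq> 0} \<subseteq> C"
    using assms by (intro closure_minimal compact_imp_closed) auto
  then show ?thesis
    using assms(1-3) closed_closure compact_Int_closed[OF assms(2), of "closure {x. f x \<noteq> 0}"]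
    by (auto simp: test_functions_def Int_absorb1)
qed

lemma test_functionsE:
  assumes "f \<in> test_functions \<Omega>"
  obtains C where "smooth_fun f" "compact C" "C \<subseteq> \<Omega>" "\<And>x. x \<notin> C \<Longrightarrow> f x = 0"
    "\<And>x i. x \<notin> C \<Longrightarrow> partial_deriv i f x = 0"
proof (rule that[of "closure {x. f x \<noteq> 0}"])
  show "f x = 0" if "x \<notin> closure {x. f x \<noteq> 0}" for x
    using that closure_subset[of "{x. f x \<noteq> 0}"] by auto
  show "partial_deriv i f x = 0" if "x \<notin> closure {x. f x \<noteq> 0}" for x i
  proof -
    have "((\<lambda>_. 0) has_derivative (\<lambda>_. 0)) (at x)" by simp
    then have "(f has_derivative (\<lambda>_. 0)) (at x)"
      by (rule has_derivative_transform_within_open[of _ _ _ _ "- closure {x. f x \<noteq> 0}"])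
        (use that closure_subset[of "{x. f x \<noteq> 0}"] in \<open>auto simp: open_Compl\<close>)
    then show ?thesis by (rule partial_deriv_eqI)
  qed
qed (use assms in \<open>auto simp: test_functions_def\<close>)

lemma test_functions_smooth: "f \<in> test_functions \<Omega> \<Longrightarrow> smooth_fun f"
  by (simp add: test_functions_def)

lemma test_functions_differentiable: "f \<in> test_functions \<Omega> \<Longrightarrow> f differentiable (at x)"
  by (intro smooth_fun_differentiable test_functions_smooth)

lemma test_functions_partial:
  assumes "f \<in> test_functions \<Omega>" shows "partial_deriv i f \<in> test_functions \<Omega>"
proof -
  obtain C where C: "compact C" "C \<subseteq> \<Omega>" "\<And>x i. x \<notin> C \<Longrightarrow> partial_deriv i f x = 0"
    by (rule test_functionsE[OF assms]) blast
  show ?thesis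
    by (rule test_functionsI[of _ C])
      (use C assms in \<open>auto intro!: smooth_fun_partial intro: test_functions_smooth\<close>)
qed

lemma test_functions_mult:
  assumes "f \<in> test_functions \<Omega>" "smooth_fun g" shows "(\<lambda>x. f x * g x) \<in> test_functions \<Omega>"
proof -
  obtain C where C: "compact C" "C \<subseteq> \<Omega>" "\<And>x. x \<notin> C \<Longrightarrow> f x = 0"
    by (rule test_functionsE[OF assms(1)]) blast
  show ?thesis
    by (rule test_functionsI[of _ C])
      (use C assms in \<open>auto intro!: smooth_fun_mult intro: test_functions_smooth\<close>)
qed

lemma test_functions_add:
  assumes "f \<in> test_functions \<Omega>" "g \<in> test_functions \<Omega>"
  shows "(\<lambda>x. f x + g x) \<in> test_functions \<Omega>"
proof -
  obtain C where C: "compact C" "C \<subseteq> \<Omega>" "\<And>x. x \<notin> C \<Longrightarrow> f x = 0"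
    by (rule test_functionsE[OF assms(1)]) blast
  obtain D where D: "compact D" "D \<subseteq> \<Omega>" "\<And>x. x \<notin> D \<Longrightarrow> g x = 0"
    by (rule test_functionsE[OF assms(2)]) blast
  show ?thesis
    by (rule test_functionsI[of _ "C \<union> D"])
      (use C D assms in \<open>auto intro!: smooth_fun_add intro: test_functions_smooth\<close>)
qed

lemma test_functions_scale: "f \<in> test_functions \<Omega> \<Longrightarrow> (\<lambda>x. c * f x) \<in> test_functions \<Omega>"
  using test_functions_mult[OF _ smooth_fun_const, of f \<Omega> c] by (simp add: mult.commute)

lemma test_functions_comp:
  assumes "f \<in> test_functions \<Omega>" "smooth1 h" "h 0 = 0"
  shows "(\<lambda>x. h (f x)) \<in> test_functions \<Omega>"
proof -
  obtain C where C: "compact C" "C \<subseteq> \<Omega>" "\<And>x. x \<notin> C \<Longrightarrow> f x = 0"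
    by (rule test_functionsE[OF assms(1)]) blast
  show ?thesis
    by (rule test_functionsI[OF smooth_fun_comp[OF assms(2) test_functions_smooth[OF assms(1)]] C(1,2)])
      (use C(3) assms(3) in auto)
qed

lemma test_functions_zero: "(\<lambda>x. 0) \<in> test_functions \<Omega>"
  by (rule test_functionsI[of _ "{}"]) (auto intro: smooth_fun_const)

lemma test_functions_sum:
  "finite I \<Longrightarrow> (\<And>i. i \<in> I \<Longrightarrow> f i \<in> test_functions \<Omega>) \<Longrightarrow> (\<lambda>x. \<Sum>i\<in>I. f i x) \<in> test_functions \<Omega>"
  by (induction I rule: finite_induct) (auto intro: test_functions_zero test_functions_add)

lemma test_functions_bounded:
  assumes "f \<in> test_functions \<Omega>"
  obtains B where "\<And>x. \<bar>f x\<bar> \<le> B"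
proof -
  obtain C where C: "smooth_fun f" "compact C" "C \<subseteq> \<Omega>" "\<And>x. x \<notin> C \<Longrightarrow> f x = 0"
    by (rule test_functionsE[OF assms]) blast
  have "bounded (f ` C)"
    by (intro compact_imp_bounded compact_continuous_image smooth_fun_continuous C)
  then obtain B where B: "\<And>x. x \<in> C \<Longrightarrow> \<bar>f x\<bar> \<le> B" by (auto simp: bounded_iff)
  have "\<bar>f x\<bar> \<le> \<bar>B\<bar>" for x using B[of x] C(4)[of x] by (cases "x \<in> C") auto
  then show ?thesis using that by blast
qed

lemma test_functions_measurable:
  "f \<in> test_functions \<Omega> \<Longrightarrow> open \<Omega> \<Longrightarrow> f \<in> borel_measurable (lebesgue_on \<Omega>)"
  by (intro continuous_imp_measurable_on_sets_lebesgue smooth_fun_continuous test_functions_smooth)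
    (auto simp: borel_open)

lemma indicator_L2:
  assumes "A \<in> sets M" "emeasure M A < \<infinity>" shows "(\<lambda>x. indicator A x) \<in> L2 M"
proof -
  have "(\<lambda>x. (indicator A x :: real)\<^sup>2) = indicator A" by (auto simp: indicator_def)
  then show ?thesis using assms by (simp add: L2_def integrable_indicator_iff)
qed

lemma emeasure_lebesgue_on:
  assumes "open \<Omega>" "A \<subseteq> \<Omega>"
  shows "emeasure (lebesgue_on \<Omega>) A = emeasure lebesgue A"
  using assms by (intro emeasure_restrict_space) (auto simp: borel_open)

lemma sets_lebesgue_on:
  assumes "open \<Omega>" shows "A \<in> sets (lebesgue_on \<Omega>) \<longleftrightarrow> A \<in> sets lebesgue \<and> A \<subseteq> \<Omega>"
  using assms by (subst sets_restrict_space_iff) (auto simp: borel_open)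

lemma indicator_compact_L2:
  assumes "open \<Omega>" "compact C" "C \<subseteq> \<Omega>" shows "(\<lambda>x. indicator C x) \<in> L2 (lebesgue_on \<Omega>)"
proof (rule indicator_L2)
  show "C \<in> sets (lebesgue_on \<Omega>)"
    using assms by (auto simp: sets_lebesgue_on lmeasurable_compact fmeasurableD)
  show "emeasure (lebesgue_on \<Omega>) C < \<infinity>"
    unfolding emeasure_lebesgue_on[OF assms(1,3)] infinity_ennreal_def less_top[symmetric]
    by (rule fmeasurableD2[OF lmeasurable_compact[OF assms(2)]])
qed

lemma bounded_compact_support_L2:
  assumes \<Omega>: "open \<Omega>" and C: "compact C" "C \<subseteq> \<Omega>" and f: "f \<in> borel_measurable (lebesgue_on \<Omega>)"
    and z: "\<And>x. x \<in> \<Omega> \<Longrightarrow> x \<notin> C \<Longrightarrow> f x = 0" and b: "AE x in lebesgue_on \<Omega>. \<bar>f x\<bar> \<le> B"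
  shows "f \<in> L2 (lebesgue_on \<Omega>)" "integrable (lebesgue_on \<Omega>) f"
proof -
  note I = indicator_compact_L2[OF \<Omega> C]
  have *: "AE x in lebesgue_on \<Omega>. \<bar>f x\<bar> \<le> \<bar>B * indicator C x\<bar>"
    using b AE_space by eventually_elim (use z in \<open>auto simp: indicator_def\<close>)
  show "f \<in> L2 (lebesgue_on \<Omega>)"
    by (rule L2_dominated[OF L2_scale[OF I] f *])
  show "integrable (lebesgue_on \<Omega>) f"
  proof (rule Bochner_Integration.integrable_bound[OF _ f])
    have "integrable (lebesgue_on \<Omega>) (\<lambda>x. indicator C x * indicator C x :: real)"
      by (rule L2_integrable_mult[OF I I])
    then show "integrable (lebesgue_on \<Omega>) (\<lambda>x. B * indicator C x)"
      by (simp add: indicator_inter_arith[symmetric])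
    show "AE x in lebesgue_on \<Omega>. norm (f x) \<le> norm (B * indicator C x)" using * by simp
  qed
qed

lemma test_functions_L2:
  assumes "f \<in> test_functions \<Omega>" "open \<Omega>" shows "f \<in> L2 (lebesgue_on \<Omega>)"
proof -
  obtain B where "\<And>x. \<bar>f x\<bar> \<le> B" by (rule test_functions_bounded[OF assms(1)]) blast
  then show ?thesis
    by (rule_tac test_functionsE[OF assms(1)])
      (auto intro: bounded_compact_support_L2[OF assms(2)] test_functions_measurable[OF assms])
qed

lemma bounded_mult_test_integrable:
  assumes \<Omega>: "open \<Omega>" and f: "f \<in> test_functions \<Omega>"
    and b: "b \<in> borel_measurable (lebesgue_on \<Omega>)" "AE x in lebesgue_on \<Omega>. \<bar>b x\<bar> \<le> B"
  shows "integrable (lebesgue_on \<Omega>) (\<lambda>x. b x * f x)" "(\<lambda>x. b x * f x) \<in> L2 (lebesgue_on \<Omega>)"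
proof -
  obtain C where C: "compact C" "C \<subseteq> \<Omega>" "\<And>x. x \<notin> C \<Longrightarrow> f x = 0"
    by (rule test_functionsE[OF f]) blast
  obtain F where F: "\<And>x. \<bar>f x\<bar> \<le> F" by (rule test_functions_bounded[OF f]) blast
  have m: "(\<lambda>x. b x * f x) \<in> borel_measurable (lebesgue_on \<Omega>)"
    using b(1) test_functions_measurable[OF f \<Omega>] by simp
  have *: "AE x in lebesgue_on \<Omega>. \<bar>b x * f x\<bar> \<le> B * F"
    using b(2) by eventually_elim (use F in \<open>auto simp: abs_mult intro: mult_mono order_trans[OF abs_ge_zero]\<close>)
  show "integrable (lebesgue_on \<Omega>) (\<lambda>x. b x * f x)" "(\<lambda>x. b x * f x) \<in> L2 (lebesgue_on \<Omega>)"
    using bounded_compact_support_L2[OF \<Omega> C(1,2) m _ *] C(3) by auto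
qed

section \<open>Bumps and density\<close>

definition bump :: "real^'n::finite \<Rightarrow> real \<Rightarrow> real^'n \<Rightarrow> real" where
  "bump x r y = flat_exp 0 (r\<^sup>2 - (norm (y - x))\<^sup>2)"

lemma bump_nonneg: "0 \<le> bump x r y" by (simp add: bump_def flat_exp_nonneg)

lemma bump_pos_iff: "0 < r \<Longrightarrow> 0 < bump x r y \<longleftrightarrow> y \<in> ball x r"
proof -
  assume "0 < r"
  then have "(norm (y - x))\<^sup>2 < r\<^sup>2 \<longleftrightarrow> norm (y - x) < r"
    using power_mono_iff[of r "norm (y - x)" 2] by (auto simp: not_le[symmetric])
  then show ?thesis by (simp add: bump_def flat_exp_pos_iff dist_norm norm_minus_commute)
qed

lemma bump_test:
  assumes "0 < r" "cball x r \<subseteq> \<Omega>" shows "bump x r \<in> test_functions \<Omega>"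
proof (rule test_functionsI[OF _ compact_cball assms(2)])
  have "smooth_fun (\<lambda>y. flat_exp 0 (r\<^sup>2 - (norm (1 *\<^sub>R y + - x))\<^sup>2))"
    by (rule smooth_fun_comp[OF smooth1.flat smooth_fun_dist_square])
  then show "smooth_fun (bump x r)" by (simp add: bump_def[abs_def])
  fix y assume "y \<notin> cball x r"
  then show "bump x r y = 0"
    using bump_pos_iff[OF assms(1), of x y] bump_nonneg[of x r y] by (auto simp: not_less)
qed

text \<open>
  Exhaust the open set by countably many balls.  If \<open>s N\<close> is the sum of the first bumps, then \<open>G (N s N)\<close>
  increases from 0 outside the set to 1 inside, where \<open>G s = s / \<surd>(s\<^sup>2 + 1)\<close> is smooth, vanishes
  at 0 and tends to 1.
\<close>

lemma test_functions_approx_open: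
  fixes U :: "(real^'n::finite) set"
  assumes \<Omega>: "open \<Omega>" and U: "open U" "U \<subseteq> \<Omega>" "emeasure lebesgue U < \<infinity>"
  obtains u where "\<And>n. u n \<in> test_functions \<Omega>"
    "l2_tendsto (lebesgue_on \<Omega>) u (\<lambda>x. indicator U x) sequentially"
proof (cases "U = {}")
  case True
  show ?thesis
    by (rule that[of "\<lambda>n x. 0"]) (auto simp: l2_tendsto_def True test_functions_zero)
next
  case False
  define F where "F = {(x, r). 0 < r \<and> cball x r \<subseteq> U}"
  obtain F' where F': "F' \<subseteq> (\<lambda>(x, r). ball x r) ` F" "countable F'"
      "\<Union>F' = \<Union>((\<lambda>(x, r). ball x r) ` F)"
    by (rule Lindelof[of "(\<lambda>(x, r). ball x r) ` F"]) auto
  have "\<Union>((\<lambda>(x, r). ball x r) ` F) = U"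
  proof safe
    fix y x r assume "(x, r) \<in> F" "y \<in> ball x r"
    then show "y \<in> U" using ball_subset_cball by (auto simp: F_def)
  next
    fix y assume "y \<in> U"
    then obtain r where "r > 0" "cball y r \<subseteq> U" using U(1) open_contains_cball by blast
    then show "y \<in> \<Union>((\<lambda>(x, r). ball x r) ` F)"
      by (intro UnionI[of "ball y r"]) (auto simp: F_def image_iff intro!: exI[of _ y] exI[of _ r])
  qed
  with F' have UF: "\<Union>F' = U" by simp
  with False have ne: "F' \<noteq> {}" by auto
  have "\<exists>z. z \<in> F \<and> from_nat_into F' n = (case z of (x, r) \<Rightarrow> ball x r)" for n
  proof -
    have "from_nat_into F' n \<in> (\<lambda>(x, r). ball x r) ` F"
      using F'(1) from_nat_into[OF ne, of n] by (rule subsetD)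
    then show ?thesis by (auto simp only: image_iff)
  qed
  then obtain z where z: "\<And>n. z n \<in> F" "\<And>n. from_nat_into F' n = (case z n of (x, r) \<Rightarrow> ball x r)"
    by metis
  define b where "b = (\<lambda>n. bump (fst (z n)) (snd (z n)))"
  have b_test: "b n \<in> test_functions \<Omega>" for n
    using z(1)[of n] U(2) unfolding b_def by (intro bump_test) (auto simp: F_def)
  have b_pos: "0 < b n y \<longleftrightarrow> y \<in> from_nat_into F' n" for n y
    using z(1)[of n] z(2)[of n] bump_pos_iff[of "snd (z n)" "fst (z n)" y]
    by (auto simp: F_def b_def)
  have b0: "0 \<le> b n y" for n y by (simp add: b_def bump_nonneg)
  define s where "s = (\<lambda>N y. \<Sum>n\<le>N. b n y)"
  define G where "G = (\<lambda>s::real. s * (s\<^sup>2 + 1) powr (- 1 / 2))"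
  have G0: "G 0 = 0" by (simp add: G_def)
  have Gs: "smooth1 G" unfolding G_def by (intro smooth1.intros)
  have G1: "(G \<longlongrightarrow> 1) at_top" unfolding G_def by real_asymp
  have Gb: "\<bar>G t\<bar> \<le> 1" for t
  proof -
    have p: "t\<^sup>2 + 1 > 0" using zero_le_power2[of t] by linarith
    have "G t = t / sqrt (t\<^sup>2 + 1)"
      using p by (simp add: G_def powr_minus_divide powr_half_sqrt)
    moreover have "\<bar>t\<bar> \<le> sqrt (t\<^sup>2 + 1)" by (rule real_le_rsqrt) simp
    ultimately show ?thesis using p by (simp add: abs_divide)
  qed
  define u where "u = (\<lambda>N y. G (real N * s N y))"
  have s_test: "s N \<in> test_functions \<Omega>" for N
    unfolding s_def by (intro test_functions_sum b_test) auto
  have u_test: "u N \<in> test_functions \<Omega>" for N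
    unfolding u_def by (intro test_functions_comp[OF test_functions_scale[OF s_test] Gs G0])
  have out: "u N y = 0" if "y \<notin> U" for N y
  proof -
    have "y \<notin> from_nat_into F' n" for n using that from_nat_into[OF ne, of n] UF by blast
    then have "b n y = 0" for n using b_pos[of n y] b0[of n y] by simp
    then show ?thesis by (simp add: u_def s_def G0)
  qed
  have inn: "(\<lambda>N. u N y) \<longlonglongrightarrow> 1" if yU: "y \<in> U" for y
  proof -
    obtain V where "V \<in> F'" "y \<in> V" using yU UF by blast
    then obtain k where "y \<in> from_nat_into F' k" using from_nat_into_surj[OF F'(2)] by metis
    then have bk: "0 < b k y" by (simp add: b_pos)
    have "filterlim (\<lambda>N. b k y * real N) at_top sequentially"
      by (intro filterlim_tendsto_pos_mult_at_top[OF tendsto_const bk] filterlim_real_sequentially)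
    then have "filterlim (\<lambda>N. real N * s N y) at_top sequentially"
    proof (rule filterlim_at_top_mono)
      show "\<forall>\<^sub>F N in sequentially. b k y * real N \<le> real N * s N y"
        using eventually_ge_at_top[of k]
      proof eventually_elim
        case (elim N)
        have "b k y \<le> s N y" unfolding s_def using elim b0 by (intro member_le_sum) auto
        then show ?case by (simp add: mult.commute mult_left_mono)
      qed
    qed
    then show ?thesis unfolding u_def by (rule filterlim_compose[OF G1])
  qed
  have "l2_tendsto (lebesgue_on \<Omega>) u (\<lambda>x. indicator U x) sequentially"
  proof (rule l2_tendsto_dominated(2))
    have Us: "U \<in> sets (lebesgue_on \<Omega>)" using U by (simp add: sets_lebesgue_on[OF \<Omega>] borel_open)
    show "u n \<in> borel_measurable (lebesgue_on \<Omega>)" for n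
      by (rule test_functions_measurable[OF u_test \<Omega>])
    show IL: "(\<lambda>x. indicator U x) \<in> L2 (lebesgue_on \<Omega>)"
      using Us U by (intro indicator_L2) (auto simp: emeasure_lebesgue_on[OF \<Omega>])
    then show "(\<lambda>x. indicator U x :: real) \<in> borel_measurable (lebesgue_on \<Omega>)" by (simp add: L2_def)
    show "AE x in lebesgue_on \<Omega>. (\<lambda>n. u n x) \<longlonglongrightarrow> indicator U x"
      using inn out by (intro always_eventually allI) (auto simp: indicator_def)
    show "AE x in lebesgue_on \<Omega>. \<bar>u n x\<bar> \<le> \<bar>indicator U x\<bar>" for n
      using out Gb by (intro always_eventually allI) (auto simp: indicator_def u_def)
  qed
  then show ?thesis using that u_test by blast
qed

definition test_approximable :: "(real^'n::finite) set \<Rightarrow> (real^'n \<Rightarrow> real) \<Rightarrow> bool" where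
  "test_approximable \<Omega> f \<longleftrightarrow>
     (\<forall>e>0. \<exists>\<phi>\<in>test_functions \<Omega>. l2_norm (lebesgue_on \<Omega>) (\<lambda>x. \<phi> x - f x) < e)"

lemma test_approximable_limit:
  assumes \<Omega>: "open \<Omega>" and f: "f \<in> L2 (lebesgue_on \<Omega>)"
    and u: "\<And>e. e > 0 \<Longrightarrow> \<exists>g\<in>L2 (lebesgue_on \<Omega>). test_approximable \<Omega> g \<and>
       l2_norm (lebesgue_on \<Omega>) (\<lambda>x. g x - f x) < e"
  shows "test_approximable \<Omega> f"
  unfolding test_approximable_def
proof (intro allI impI)
  fix e :: real assume "e > 0"
  then have e2: "e / 2 > 0" by simp
  obtain g where g: "g \<in> L2 (lebesgue_on \<Omega>)" "test_approximable \<Omega> g"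
    "l2_norm (lebesgue_on \<Omega>) (\<lambda>x. g x - f x) < e / 2" using u[OF e2] by blast
  obtain \<phi> where \<phi>: "\<phi> \<in> test_functions \<Omega>" "l2_norm (lebesgue_on \<Omega>) (\<lambda>x. \<phi> x - g x) < e / 2"
    using g(2) e2 unfolding test_approximable_def by blast
  have "l2_norm (lebesgue_on \<Omega>) (\<lambda>x. \<phi> x - f x) < e"
    using l2_norm_triangle[OF test_functions_L2[OF \<phi>(1) \<Omega>] g(1) f] g(3) \<phi>(2) by linarith
  then show "\<exists>\<phi>\<in>test_functions \<Omega>. l2_norm (lebesgue_on \<Omega>) (\<lambda>x. \<phi> x - f x) < e"
    using \<phi>(1) by blast
qed

lemma test_approximable_add:
  assumes \<Omega>: "open \<Omega>" and f: "f \<in> L2 (lebesgue_on \<Omega>)" "test_approximable \<Omega> f"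
    and g: "g \<in> L2 (lebesgue_on \<Omega>)" "test_approximable \<Omega> g"
  shows "test_approximable \<Omega> (\<lambda>x. f x + g x)"
  unfolding test_approximable_def
proof (intro allI impI)
  fix e :: real assume "e > 0"
  then have e2: "e / 2 > 0" by simp
  obtain \<phi> \<psi> where \<phi>: "\<phi> \<in> test_functions \<Omega>" "l2_norm (lebesgue_on \<Omega>) (\<lambda>x. \<phi> x - f x) < e / 2"
    and \<psi>: "\<psi> \<in> test_functions \<Omega>" "l2_norm (lebesgue_on \<Omega>) (\<lambda>x. \<psi> x - g x) < e / 2"
    using f(2) g(2) e2 unfolding test_approximable_def by meson
  have "l2_norm (lebesgue_on \<Omega>) (\<lambda>x. (\<phi> x - f x) + (\<psi> x - g x)) < e"
    using l2_norm_add[OF L2_diff[OF test_functions_L2[OF \<phi>(1) \<Omega>] f(1)]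
        L2_diff[OF test_functions_L2[OF \<psi>(1) \<Omega>] g(1)]] \<phi>(2) \<psi>(2) by linarith
  then show "\<exists>\<phi>\<in>test_functions \<Omega>. l2_norm (lebesgue_on \<Omega>) (\<lambda>x. \<phi> x - (f x + g x)) < e"
    by (intro bexI[OF _ test_functions_add[OF \<phi>(1) \<psi>(1)]]) (simp add: algebra_simps)
qed

lemma test_approximable_scale:
  assumes "test_approximable \<Omega> f" shows "test_approximable \<Omega> (\<lambda>x. c * f x)"
  unfolding test_approximable_def
proof (intro allI impI)
  fix e :: real assume e: "e > 0"
  then have "e / (\<bar>c\<bar> + 1) > 0" by (intro divide_pos_pos) auto
  then obtain \<phi> where \<phi>: "\<phi> \<in> test_functions \<Omega>"
    "l2_norm (lebesgue_on \<Omega>) (\<lambda>x. \<phi> x - f x) < e / (\<bar>c\<bar> + 1)"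
    using assms unfolding test_approximable_def by blast
  have "l2_norm (lebesgue_on \<Omega>) (\<lambda>x. c * (\<phi> x - f x)) \<le> (\<bar>c\<bar> + 1) * l2_norm (lebesgue_on \<Omega>) (\<lambda>x. \<phi> x - f x)"
    unfolding l2_norm_scale by (intro mult_right_mono) auto
  also have "\<dots> < e" using \<phi>(2) by (simp add: field_simps)
  finally show "\<exists>\<phi>\<in>test_functions \<Omega>. l2_norm (lebesgue_on \<Omega>) (\<lambda>x. \<phi> x - c * f x) < e"
    by (intro bexI[OF _ test_functions_scale[OF \<phi>(1), of c]]) (simp add: right_diff_distrib)
qed

lemma test_approximable_indicator:
  fixes \<Omega> :: "(real^'n::finite) set"
  assumes \<Omega>: "open \<Omega>" and E: "E \<in> sets lebesgue" "E \<subseteq> \<Omega>" "emeasure lebesgue E < \<infinity>"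
  shows "test_approximable \<Omega> (\<lambda>x. indicator E x)"
proof (rule test_approximable_limit[OF \<Omega>])
  have Es: "E \<in> sets (lebesgue_on \<Omega>)" using E by (simp add: sets_lebesgue_on[OF \<Omega>])
  show EL: "(\<lambda>x. indicator E x) \<in> L2 (lebesgue_on \<Omega>)"
    using Es E by (intro indicator_L2) (auto simp: emeasure_lebesgue_on[OF \<Omega>])
  fix e :: real assume e: "e > 0"
  then have "e\<^sup>2 > 0" by simp
  then obtain V where V: "open V" "E \<subseteq> V" "V - E \<in> lmeasurable"
      "emeasure lebesgue (V - E) < ennreal (e\<^sup>2)"
    using sets_lebesgue_outer_open[OF E(1)] by blast
  define U where "U = V \<inter> \<Omega>"
  have U: "open U" "U \<subseteq> \<Omega>" "E \<subseteq> U" using V \<Omega> E by (auto simp: U_def)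
  have Um: "U - E \<in> sets lebesgue" using U E by (auto intro: borel_open)
  have mUE: "emeasure lebesgue (U - E) < ennreal (e\<^sup>2)"
  proof (rule le_less_trans[OF _ V(4)])
    show "emeasure lebesgue (U - E) \<le> emeasure lebesgue (V - E)"
      using V(3) by (intro emeasure_mono) (auto simp: U_def)
  qed
  have "emeasure lebesgue U = emeasure lebesgue E + emeasure lebesgue (U - E)"
    using E Um U(3) by (subst plus_emeasure) (auto simp: Un_absorb1)
  also have "\<dots> < \<infinity>"
    using E(3) mUE by (auto simp: ennreal_add_eq_top less_top[symmetric])
  finally have Uf: "emeasure lebesgue U < \<infinity>" .
  have Us: "U \<in> sets (lebesgue_on \<Omega>)" using U by (simp add: sets_lebesgue_on[OF \<Omega>] borel_open)
  have UL: "(\<lambda>x. indicator U x) \<in> L2 (lebesgue_on \<Omega>)"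
    using Us Uf U by (intro indicator_L2) (auto simp: emeasure_lebesgue_on[OF \<Omega>])
  have "test_approximable \<Omega> (\<lambda>x. indicator U x)"
  proof -
    obtain u where u: "\<And>n. u n \<in> test_functions \<Omega>"
      "l2_tendsto (lebesgue_on \<Omega>) u (\<lambda>x. indicator U x) sequentially"
      by (rule test_functions_approx_open[OF \<Omega> U(1,2) Uf]) blast
    show ?thesis unfolding test_approximable_def
    proof (intro allI impI)
      fix e :: real assume "e > 0"
      with u(2) have "\<forall>\<^sub>F n in sequentially. l2_norm (lebesgue_on \<Omega>) (\<lambda>x. u n x - indicator U x) < e"
        unfolding l2_tendsto_def by (rule order_tendstoD(2))
      then obtain n where "l2_norm (lebesgue_on \<Omega>) (\<lambda>x. u n x - indicator U x) < e"
        by (auto simp: eventually_sequentially)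
      then show "\<exists>\<phi>\<in>test_functions \<Omega>. l2_norm (lebesgue_on \<Omega>) (\<lambda>x. \<phi> x - indicator U x) < e"
        using u(1) by blast
    qed
  qed
  moreover have "l2_norm (lebesgue_on \<Omega>) (\<lambda>x. indicator U x - indicator E x) < e"
  proof -
    let ?d = "\<lambda>x. indicator U x - indicator E x :: real"
    have "?d = (\<lambda>x. indicator (U - E) x)" using U(3) by (auto simp: indicator_def fun_eq_iff)
    moreover have "(\<lambda>x. indicator (U - E) x * indicator (U - E) x :: real) = (\<lambda>x. indicator (U - E) x)"
      by (auto simp: indicator_def)
    ultimately have "l2_inner (lebesgue_on \<Omega>) ?d ?d = measure (lebesgue_on \<Omega>) (U - E)"
      using Um U Int_absorb2[OF subset_trans[OF Diff_subset[of U E] U(2)]]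
      by (simp add: l2_inner_def sets_lebesgue_on[OF \<Omega>])
    also have "\<dots> = measure lebesgue (U - E)"
      using emeasure_lebesgue_on[OF \<Omega> subset_trans[OF Diff_subset[of U E] U(2)]]
      by (simp add: measure_def)
    also have "\<dots> < e\<^sup>2"
    proof -
      have "emeasure lebesgue (U - E) \<noteq> top"
        using less_trans[OF mUE ennreal_less_top] by (rule less_imp_neq)
      then show ?thesis
        using mUE by (simp add: emeasure_eq_ennreal_measure ennreal_less_iff)
    qed
    finally show ?thesis using e by (simp add: l2_norm_def real_less_lsqrt real_sqrt_less_iff)
  qed
  ultimately show "\<exists>g\<in>L2 (lebesgue_on \<Omega>). test_approximable \<Omega> g \<and>
       l2_norm (lebesgue_on \<Omega>) (\<lambda>x. g x - indicator E x) < e"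
    using UL by blast
qed

text \<open>
  Outer regularity reduces indicators of measurable sets to those of open sets; simple functions
  and dominated convergence do the rest.
\<close>

lemma test_functions_dense:
  fixes \<Omega> :: "(real^'n::finite) set"
  assumes \<Omega>: "open \<Omega>" and f: "f \<in> L2 (lebesgue_on \<Omega>)"
  shows "\<exists>u. (\<forall>n. u n \<in> test_functions \<Omega>) \<and> l2_tendsto (lebesgue_on \<Omega>) u f sequentially"
proof -
  let ?M = "lebesgue_on \<Omega>"
  have sp: "space ?M = \<Omega>" by simp
  obtain F where F0: "(\<forall>i. simple_function ?M (F i)) \<and> (\<forall>x\<in>space ?M. (\<lambda>i. F i x) \<longlonglongrightarrow> f x) \<and>
      (\<forall>i. \<forall>x\<in>space ?M. dist (F i x) 0 \<le> 2 * dist (f x) 0)"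
    using borel_measurable_implies_sequence_metric[OF L2_measurable[OF f], of 0] by blast
  have F: "\<And>i. simple_function ?M (F i)" "\<And>x. x \<in> \<Omega> \<Longrightarrow> (\<lambda>i. F i x) \<longlonglongrightarrow> f x"
    "\<And>i x. x \<in> \<Omega> \<Longrightarrow> \<bar>F i x\<bar> \<le> 2 * \<bar>f x\<bar>"
    using F0 by (auto simp: dist_real_def)
  have Fm: "F i \<in> borel_measurable ?M" for i using F(1) by (rule borel_measurable_simple_function)
  have f2: "(\<lambda>x. 2 * f x) \<in> L2 ?M" by (rule L2_scale[OF f])
  have Fb: "AE x in ?M. \<bar>F i x\<bar> \<le> \<bar>2 * f x\<bar>" for i
    using AE_space by eventually_elim (use F(3) in \<open>auto simp: abs_mult\<close>)
  have FL: "F i \<in> L2 ?M" for i by (rule L2_dominated[OF f2 Fm Fb])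
  have lim: "l2_tendsto ?M F f sequentially"
  proof (rule l2_tendsto_dominated(2)[OF Fm L2_measurable[OF f] f2 _ Fb])
    show "AE x in ?M. (\<lambda>i. F i x) \<longlonglongrightarrow> f x"
      using AE_space by eventually_elim (use F(2) in auto)
  qed
  have Fapp: "test_approximable \<Omega> (F i)" for i
  proof -
    define E where "E = (\<lambda>y. F i -` {y} \<inter> \<Omega>)"
    define Y where "Y = F i ` \<Omega> - {0}"
    have Yf: "finite Y" using F(1)[of i] by (simp add: simple_function_def Y_def)
    have Es: "E y \<in> sets ?M" for y
      using measurable_sets[OF Fm[of i], of "{y}"] by (simp add: E_def)
    have EL: "(\<lambda>x. indicator (E y) x) \<in> L2 ?M" if "y \<in> Y" for y
    proof (rule L2_dominated[OF L2_scale[OF FL[of i], of "1 / y"]])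
      show "(\<lambda>x. indicator (E y) x :: real) \<in> borel_measurable ?M" using Es by simp
      show "AE x in ?M. \<bar>indicator (E y) x\<bar> \<le> \<bar>1 / y * F i x\<bar>"
        using that by (intro always_eventually allI) (auto simp: E_def Y_def indicator_def)
    qed
    have Ea: "test_approximable \<Omega> (\<lambda>x. indicator (E y) x)" if "y \<in> Y" for y
    proof (rule test_approximable_indicator[OF \<Omega>])
      have "(\<lambda>x. (indicator (E y) x :: real)\<^sup>2) = indicator (E y)" by (auto simp: indicator_def)
      then have "integrable ?M (indicator (E y) :: _ \<Rightarrow> real)"
        using L2_integrable_square[OF EL[OF that]] by simp
      then have "emeasure ?M (E y) < \<infinity>" using Es[of y]
        by (simp add: integrable_indicator_iff sets.sets_into_space Int_absorb2 E_def)
      then show "emeasure lebesgue (E y) < \<infinity>"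
        by (subst (asm) emeasure_lebesgue_on[OF \<Omega>]) (auto simp: E_def)
      show "E y \<in> sets lebesgue" "E y \<subseteq> \<Omega>" using Es[of y] by (simp_all add: sets_lebesgue_on[OF \<Omega>])
    qed
    have sumapp: "(\<lambda>x. \<Sum>y\<in>Z. y * indicator (E y) x) \<in> L2 ?M \<and>
        test_approximable \<Omega> (\<lambda>x. \<Sum>y\<in>Z. y * indicator (E y) x)" if "finite Z" "Z \<subseteq> Y" for Z
      using that
    proof (induction Z rule: finite_induct)
      case empty
      have "test_approximable \<Omega> (\<lambda>x. 0)"
        using test_functions_zero unfolding test_approximable_def
        by (intro allI impI bexI[of _ "\<lambda>x. 0"]) auto
      then show ?case by (simp add: L2_zero)
    next
      case (insert y Z)
      then have y: "y \<in> Y" and Z: "(\<lambda>x. \<Sum>y\<in>Z. y * indicator (E y) x) \<in> L2 ?M"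
        "test_approximable \<Omega> (\<lambda>x. \<Sum>y\<in>Z. y * indicator (E y) x)" by blast+
      note yL = L2_scale[OF EL[OF y], of y]
      show ?case
        unfolding sum.insert[OF insert(1,2)]
        by (intro conjI L2_add yL Z test_approximable_add[OF \<Omega>] test_approximable_scale Ea y)
    qed
    have rep: "(\<Sum>y\<in>Y. y * indicator (E y) x) = F i x" if "x \<in> \<Omega>" for x
    proof (cases "F i x = 0")
      case True
      then show ?thesis by (intro sum.neutral[THEN trans]) (auto simp: E_def Y_def)
    next
      case False
      have "(\<Sum>y\<in>Y. y * indicator (E y) x) = (\<Sum>y\<in>Y. if y = F i x then y else 0)"
        using that by (intro sum.cong) (auto simp: E_def indicator_def)
      then show ?thesis using Yf False that by (simp add: Y_def)
    qed
    show ?thesis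
    proof (rule test_approximable_limit[OF \<Omega> FL])
      fix e :: real assume "e > 0"
      have "l2_norm ?M (\<lambda>x. (\<Sum>y\<in>Y. y * indicator (E y) x) - F i x) = 0"
      proof (subst l2_norm_eq_0_iff)
        show "AE x in ?M. (\<Sum>y\<in>Y. y * indicator (E y) x) - F i x = 0"
          using AE_space by eventually_elim (use rep in auto)
      qed (use sumapp[OF Yf] FL in \<open>auto intro: L2_diff\<close>)
      then show "\<exists>g\<in>L2 ?M. test_approximable \<Omega> g \<and> l2_norm ?M (\<lambda>x. g x - F i x) < e"
        using sumapp[OF Yf] \<open>e > 0\<close> by (intro bexI[of _ "\<lambda>x. \<Sum>y\<in>Y. y * indicator (E y) x"]) auto
    qed
  qed
  have "test_approximable \<Omega> f"
  proof (rule test_approximable_limit[OF \<Omega> f])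
    fix e :: real assume "e > 0"
    with lim have "\<forall>\<^sub>F i in sequentially. l2_norm ?M (\<lambda>x. F i x - f x) < e"
      unfolding l2_tendsto_def by (rule order_tendstoD(2))
    then show "\<exists>g\<in>L2 ?M. test_approximable \<Omega> g \<and> l2_norm ?M (\<lambda>x. g x - f x) < e"
      using FL Fapp by (auto simp: eventually_sequentially)
  qed
  then have "\<exists>\<phi>\<in>test_functions \<Omega>. l2_norm ?M (\<lambda>x. \<phi> x - f x) < 1 / real (Suc n)" for n
    unfolding test_approximable_def by simp
  then obtain u where u: "\<And>n. u n \<in> test_functions \<Omega>"
    "\<And>n. l2_norm ?M (\<lambda>x. u n x - f x) < 1 / real (Suc n)" by metis
  have "l2_tendsto ?M u f sequentially"
    unfolding l2_tendsto_def
    by (rule tendsto_sandwich[of "\<lambda>_. 0" _ _ "\<lambda>n. 1 / real (Suc n)"])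
      (use u LIMSEQ_inverse_real_of_nat in \<open>auto simp: inverse_eq_divide intro!: always_eventually less_imp_le\<close>)
  then show ?thesis using u(1) by blast
qed

section \<open>Differentiation under the integral sign\<close>

lemma has_real_derivative_integral:
  fixes f f' :: "real \<Rightarrow> 'a \<Rightarrow> real"
  assumes int: "\<And>t. t \<in> {a<..<b} \<Longrightarrow> integrable M (f t)"
    and der: "\<And>t y. t \<in> {a<..<b} \<Longrightarrow> ((\<lambda>t. f t y) has_real_derivative f' t y) (at t)"
    and bound: "AE y in M. \<forall>t\<in>{a<..<b}. \<bar>f' t y\<bar> \<le> g y"
    and g: "integrable M g" and t: "t \<in> {a<..<b}"
  shows "((\<lambda>t. LINT y|M. f t y) has_real_derivative (LINT y|M. f' t y)) (at t)"
  unfolding has_field_derivative_iff tendsto_at_iff_sequentially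
proof (intro allI impI)
  fix X :: "nat \<Rightarrow> real" assume "\<forall>i. X i \<in> UNIV - {t}" and lim: "X \<longlonglongrightarrow> t"
  then have ne: "X i \<noteq> t" for i by blast
  have "\<forall>\<^sub>F n in sequentially. X n \<in> {a<..<b}"
    using lim t by (intro topological_tendstoD) auto
  then obtain n0 where n0: "\<And>n. n \<ge> n0 \<Longrightarrow> X n \<in> {a<..<b}" by (auto simp: eventually_sequentially)
  define Y where "Y = (\<lambda>n. X (n + n0))"
  have Y: "Y n \<in> {a<..<b}" "Y n \<noteq> t" for n using n0 ne by (auto simp: Y_def)
  have Yt: "Y \<longlonglongrightarrow> t" unfolding Y_def using lim by (rule LIMSEQ_ignore_initial_segment)
  have quot: "(\<lambda>n. (f (Y n) y - f t y) / (Y n - t)) \<longlonglongrightarrow> f' t y" for y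
    using der[OF t, of y, unfolded has_field_derivative_iff tendsto_at_iff_sequentially,
        rule_format, of Y] Y Yt by (simp add: comp_def)
  have "(\<lambda>n. LINT y|M. (f (Y n) y - f t y) / (Y n - t)) \<longlonglongrightarrow> (LINT y|M. f' t y)"
  proof (rule integral_dominated_convergence[OF _ _ g])
    show m: "(\<lambda>y. (f (Y n) y - f t y) / (Y n - t)) \<in> borel_measurable M" for n
      using int[OF Y(1)] int[OF t] by (intro borel_measurable_divide borel_measurable_diff) auto
    show "f' t \<in> borel_measurable M"
      by (rule borel_measurable_LIMSEQ_real[OF quot m])
    show "AE y in M. (\<lambda>n. (f (Y n) y - f t y) / (Y n - t)) \<longlonglongrightarrow> f' t y"
      using quot by simp
    show "AE y in M. norm ((f (Y n) y - f t y) / (Y n - t)) \<le> g y" for n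
      using bound
    proof eventually_elim
      case (elim y)
      have "norm (f (Y n) y - f t y) \<le> g y * norm (Y n - t)"
      proof (rule field_differentiable_bound[of "{a<..<b}" "\<lambda>t. f t y" "\<lambda>t. f' t y"])
        show "((\<lambda>t. f t y) has_field_derivative f' s y) (at s within {a<..<b})" if "s \<in> {a<..<b}" for s
          by (rule has_field_derivative_at_within[OF der[OF that]])
      qed (use elim Y t in auto)
      then show ?case using Y(2)[of n] by (simp add: field_simps)
    qed
  qed
  moreover have "(LINT y|M. (f (Y n) y - f t y) / (Y n - t))
      = ((LINT y|M. f (Y n) y) - (LINT y|M. f t y)) / (Y n - t)" for n
    using int[OF Y(1)] int[OF t] by simp
  ultimately have "(\<lambda>n. ((LINT y|M. f (Y n) y) - (LINT y|M. f t y)) / (Y n - t))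
      \<longlonglongrightarrow> (LINT y|M. f' t y)"
    by (simp only:)
  then have "(\<lambda>n. ((LINT y|M. f (X (n + n0)) y) - (LINT y|M. f t y)) / (X (n + n0) - t))
      \<longlonglongrightarrow> (LINT y|M. f' t y)"
    unfolding Y_def .
  then show "((\<lambda>s. ((LINT y|M. f s y) - (LINT y|M. f t y)) / (s - t)) \<circ> X) \<longlonglongrightarrow> (LINT y|M. f' t y)"
    unfolding comp_def by (rule LIMSEQ_offset)
qed

section \<open>Rescaled kernels\<close>

definition rescale :: "(real^'n::finite \<Rightarrow> real) \<Rightarrow> real \<Rightarrow> real^'n \<Rightarrow> real^'n \<Rightarrow> real" where
  "rescale q e x y = q ((1 / e) *\<^sub>R (y - x))"

lemma frechet_derivative_partials:
  assumes "q differentiable (at z)"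
  shows "frechet_derivative q (at z) v = (\<Sum>l\<in>UNIV. v $ l * partial_deriv l q z)"
proof -
  interpret linear "frechet_derivative q (at z)"
    by (rule linear_frechet_derivative[OF assms])
  have "frechet_derivative q (at z) v = frechet_derivative q (at z) (\<Sum>l\<in>UNIV. v $ l *\<^sub>R axis l 1)"
    using basis_expansion[of v] by (simp add: scalar_mult_eq_scaleR)
  then show ?thesis by (simp add: sum scaleR partial_deriv_def)
qed

lemma rescale_has_derivative:
  assumes "q differentiable (at ((1 / e) *\<^sub>R (y - x)))"
  shows "(rescale q e x has_derivative
     (\<lambda>v. frechet_derivative q (at ((1 / e) *\<^sub>R (y - x))) ((1 / e) *\<^sub>R v))) (at y)"
proof -
  have "((\<lambda>y. (1 / e) *\<^sub>R (y - x)) has_derivative (\<lambda>v. (1 / e) *\<^sub>R v)) (at y)"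
    by (auto intro!: derivative_eq_intros)
  from has_derivative_compose[OF this has_derivative_frechet[OF assms]]
  show ?thesis by (simp add: rescale_def[abs_def])
qed

lemma partial_deriv_rescale:
  assumes "smooth_fun q"
  shows "partial_deriv i (rescale q e x) y = 1 / e * rescale (partial_deriv i q) e x y"
proof -
  note d = smooth_fun_differentiable[OF assms, of "(1 / e) *\<^sub>R (y - x)"]
  show ?thesis
    by (subst partial_deriv_eqI[OF rescale_has_derivative[OF d]])
      (simp add: linear_cmul[OF linear_frechet_derivative[OF d]] rescale_def partial_deriv_def)
qed

lemma smooth_fun_rescale:
  assumes "smooth_fun q" shows "smooth_fun (rescale q e x)"
proof (rule smooth_fun_coinduct[where F = "{(\<lambda>y. k * rescale f e x y) |k f. smooth_fun f}"])
  show "rescale q e x \<in> {(\<lambda>y. k * rescale f e x y) |k f. smooth_fun f}"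
    using assms by (intro CollectI exI[of _ 1] exI[of _ q]) auto
next
  fix g y assume "g \<in> {(\<lambda>y. k * rescale f e x y) |k f. smooth_fun f}"
  then obtain k f where g: "g = (\<lambda>y. k * rescale f e x y)" and f: "smooth_fun f" by auto
  show "g differentiable at y" unfolding g
    using differentiableI[OF rescale_has_derivative[OF smooth_fun_differentiable[OF f]]]
    by (intro derivative_intros) auto
next
  fix g i assume "g \<in> {(\<lambda>y. k * rescale f e x y) |k f. smooth_fun f}"
  then obtain k f where g: "g = (\<lambda>y. k * rescale f e x y)" and f: "smooth_fun f" by auto
  have "partial_deriv i g = (\<lambda>y. (k * (1 / e)) * rescale (partial_deriv i f) e x y)"
  proof
    fix y
    have d: "rescale f e x differentiable (at y)"
      by (rule differentiableI[OF rescale_has_derivative[OF smooth_fun_differentiable[OF f]]])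
    have "partial_deriv i g y = k * partial_deriv i (rescale f e x) y"
      unfolding g by (subst partial_deriv_mult) (auto simp: d partial_deriv_def)
    then show "partial_deriv i g y = (k * (1 / e)) * rescale (partial_deriv i f) e x y"
      by (simp add: partial_deriv_rescale[OF f])
  qed
  then show "partial_deriv i g \<in> {(\<lambda>y. k * rescale f e x y) |k f. smooth_fun f}"
    using smooth_fun_partial[OF f]
    by (intro CollectI exI[of _ "k * (1 / e)"] exI[of _ "partial_deriv i f"] conjI)
qed

lemma One_component: "(\<Sum>b\<in>(Basis :: (real^'n::finite) set). b $ i) = 1"
proof -
  have "(\<Sum>b\<in>(Basis :: (real^'n::finite) set). b $ i) = (One :: real^'n) \<bullet> axis i 1"
    by (simp add: cart_eq_inner_axis inner_sum_left)
  also have "\<dots> = 1" by (simp add: inner_sum_Basis axis_in_Basis_iff)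
  finally show ?thesis .
qed

text \<open>
  Kernels are supported in the cube that has the point as its lowest corner, rather than in a centred one,
  because this is the shape of the sets in the differentiation theorem for integrals that is used below.
\<close>

definition corner_cube :: "real^'n::finite \<Rightarrow> real \<Rightarrow> (real^'n) set" where
  "corner_cube x e = cbox x (x + e *\<^sub>R One)"

lemma mem_corner_cube: "y \<in> corner_cube x e \<longleftrightarrow> (\<forall>i. x $ i \<le> y $ i \<and> y $ i \<le> x $ i + e)"
  by (simp add: corner_cube_def mem_box_cart One_component)

lemma corner_cube_norm:
  fixes x :: "real^'n::finite"
  assumes "y \<in> corner_cube x e" shows "norm (y - x) \<le> e * real CARD('n)"
proof -
  have "norm (y - x) \<le> (\<Sum>i\<in>UNIV. \<bar>(y - x) $ i\<bar>)" by (rule norm_le_l1_cart)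
  also have "\<dots> \<le> (\<Sum>i\<in>(UNIV::'n set). e)"
  proof (rule sum_mono)
    fix i show "\<bar>(y - x) $ i\<bar> \<le> e"
      using assms spec[of _ i] unfolding mem_corner_cube by (smt (verit) vector_minus_component)
  qed
  finally show ?thesis by (simp add: mult.commute)
qed

lemma corner_cube_subset_cball:
  fixes x :: "real^'n::finite"
  assumes "e * real CARD('n) \<le> r" "x \<in> cball x0 s" shows "corner_cube x e \<subseteq> cball x0 (s + r)"
proof
  fix y assume "y \<in> corner_cube x e"
  then have "norm (y - x) \<le> r" using corner_cube_norm[of y x e] assms(1) by linarith
  then show "y \<in> cball x0 (s + r)"
    using assms(2) dist_triangle[of x0 y x] by (simp add: dist_norm norm_minus_commute)
qed

lemma measure_corner_cube:
  fixes x :: "real^'n::finite"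
  assumes "0 \<le> e" shows "measure lebesgue (corner_cube x e) = e ^ CARD('n)"
proof -
  have "measure lborel (cbox x (x + e *\<^sub>R One)) = (\<Prod>i\<in>UNIV. (x + e *\<^sub>R One) $ i - x $ i)"
    using assms by (intro content_cbox_cart) (auto simp: interval_ne_empty_cart One_component)
  then show ?thesis by (simp add: corner_cube_def One_component)
qed

lemma rescale_outside:
  assumes "0 < e" "\<And>z. z \<notin> corner_cube 0 1 \<Longrightarrow> q z = 0" "y \<notin> corner_cube x e"
  shows "rescale q e x y = 0"
proof -
  have "(1 / e) *\<^sub>R (y - x) \<notin> corner_cube 0 1"
    using assms(1,3) unfolding mem_corner_cube by (auto simp: field_simps)
  then show ?thesis using assms(2) by (simp add: rescale_def)
qed

definition kernel :: "(real^'n::finite \<Rightarrow> real) \<Rightarrow> bool" where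
  "kernel q \<longleftrightarrow> smooth_fun q \<and> (\<forall>z. z \<notin> corner_cube 0 1 \<longrightarrow> q z = 0)"

lemma kernel_test: "kernel q \<Longrightarrow> q \<in> test_functions UNIV"
  by (rule test_functionsI[of _ "corner_cube 0 1"]) (auto simp: kernel_def corner_cube_def compact_cbox)

lemma kernel_bounded:
  assumes "kernel q" obtains B where "0 \<le> B" "\<And>z. \<bar>q z\<bar> \<le> B"
proof -
  obtain B where "\<And>z. \<bar>q z\<bar> \<le> B" by (rule test_functions_bounded[OF kernel_test[OF assms]]) blast
  then show ?thesis using that[of B] order_trans[OF abs_ge_zero] by blast
qed

lemma kernel_partial:
  assumes "kernel q" shows "kernel (partial_deriv i q)"
  unfolding kernel_def
proof (intro conjI allI impI)
  show "smooth_fun (partial_deriv i q)" using assms by (auto simp: kernel_def smooth_fun_partial)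
  fix z :: "real^'a" assume z: "z \<notin> corner_cube 0 1"
  have "((\<lambda>_. 0) has_derivative (\<lambda>_. 0)) (at z)" by simp
  then have "(q has_derivative (\<lambda>_. 0)) (at z)"
    by (rule has_derivative_transform_within_open[of _ _ _ _ "- corner_cube 0 1"])
      (use z assms in \<open>auto simp: open_Compl kernel_def corner_cube_def closed_cbox\<close>)
  then show "partial_deriv i q z = 0" by (rule partial_deriv_eqI)
qed

lemma rescale_kernel_outside: "kernel q \<Longrightarrow> 0 < e \<Longrightarrow> y \<notin> corner_cube x e \<Longrightarrow> rescale q e x y = 0"
  by (rule rescale_outside) (auto simp: kernel_def)

lemma rescale_kernel_test:
  assumes "kernel q" "0 < e" "corner_cube x e \<subseteq> \<Omega>" shows "rescale q e x \<in> test_functions \<Omega>"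
  by (rule test_functionsI[of _ "corner_cube x e"])
    (use assms in \<open>auto simp: kernel_def corner_cube_def compact_cbox
      intro!: smooth_fun_rescale rescale_kernel_outside[unfolded kernel_def corner_cube_def]\<close>)

lemma rescale_kernel_measurable:
  "kernel q \<Longrightarrow> open \<Omega> \<Longrightarrow> rescale q e x \<in> borel_measurable (lebesgue_on \<Omega>)"
  by (intro continuous_imp_measurable_on_sets_lebesgue smooth_fun_continuous smooth_fun_rescale)
    (auto simp: kernel_def borel_open)

lemma emeasure_lebesgue_on_bounded:
  assumes "open \<Omega>" "bounded C" "C \<in> sets lebesgue"
  shows "C \<inter> \<Omega> \<in> sets (lebesgue_on \<Omega>)" "emeasure (lebesgue_on \<Omega>) (C \<inter> \<Omega>) < \<infinity>"
proof -
  have s: "C \<inter> \<Omega> \<in> sets lebesgue" using assms by (auto simp: borel_open)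
  then show "C \<inter> \<Omega> \<in> sets (lebesgue_on \<Omega>)" using assms(1) by (simp add: sets_lebesgue_on)
  have "C \<inter> \<Omega> \<in> lmeasurable"
    using s assms(2) by (intro bounded_set_imp_lmeasurable) (auto intro: bounded_subset)
  from fmeasurableD2[OF this] show "emeasure (lebesgue_on \<Omega>) (C \<inter> \<Omega>) < \<infinity>"
    unfolding emeasure_lebesgue_on[OF assms(1) Int_lower2] infinity_ennreal_def less_top[symmetric] .
qed

lemma bounded_support_integrable:
  fixes h :: "real^'n::finite \<Rightarrow> real"
  assumes \<Omega>: "open \<Omega>" and C: "bounded C" "C \<in> sets lebesgue"
    and h: "h \<in> borel_measurable (lebesgue_on \<Omega>)" "AE y in lebesgue_on \<Omega>. \<bar>h y\<bar> \<le> B"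
    and z: "\<And>y. y \<notin> C \<Longrightarrow> h y = 0"
  shows "integrable (lebesgue_on \<Omega>) h"
proof (rule integrableI_bounded_set[where A = "C \<inter> \<Omega>" and B = B])
  show "C \<inter> \<Omega> \<in> sets (lebesgue_on \<Omega>)" by (rule emeasure_lebesgue_on_bounded(1)[OF \<Omega> C])
  show "h \<in> borel_measurable (lebesgue_on \<Omega>)" by (rule h(1))
  show "emeasure (lebesgue_on \<Omega>) (C \<inter> \<Omega>) < \<infinity>" by (rule emeasure_lebesgue_on_bounded(2)[OF \<Omega> C])
  show "AE x in lebesgue_on \<Omega>. x \<in> C \<inter> \<Omega> \<longrightarrow> norm (h x) \<le> B"
    using h(2) by eventually_elim simp
  show "AE x in lebesgue_on \<Omega>. x \<notin> C \<inter> \<Omega> \<longrightarrow> h x = 0"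
    using AE_space by eventually_elim (use z in auto)
qed

lemma cube_integral_bound:
  fixes x :: "real^'n::finite"
  assumes \<Omega>: "open \<Omega>" and e: "0 \<le> e" and C: "corner_cube x e \<subseteq> \<Omega>" and B: "0 \<le> B"
    and h: "AE y in lebesgue_on \<Omega>. y \<in> corner_cube x e \<longrightarrow> \<bar>h y\<bar> \<le> B"
    and z: "\<And>y. y \<notin> corner_cube x e \<Longrightarrow> h y = 0"
  shows "\<bar>LINT y|lebesgue_on \<Omega>. h y\<bar> \<le> B * e ^ CARD('n)"
proof -
  let ?C = "corner_cube x e"
  have b: "bounded ?C" "?C \<in> sets lebesgue" by (auto simp: corner_cube_def bounded_cbox)
  have Cm: "?C \<in> sets (lebesgue_on \<Omega>)" "emeasure (lebesgue_on \<Omega>) ?C < \<infinity>"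
    using emeasure_lebesgue_on_bounded[OF \<Omega> b] C by (simp_all add: Int_absorb2)
  have "\<bar>LINT y|lebesgue_on \<Omega>. h y\<bar> \<le> (LINT y|lebesgue_on \<Omega>. \<bar>h y\<bar>)" by (rule integral_abs_bound)
  also have "\<dots> \<le> (LINT y|lebesgue_on \<Omega>. B * indicator ?C y)"
  proof (rule integral_mono_AE')
    show "integrable (lebesgue_on \<Omega>) (\<lambda>y. B * indicator ?C y)"
      using Cm by (intro integrable_mult_right integrable_real_indicator) auto
    show "AE y in lebesgue_on \<Omega>. \<bar>h y\<bar> \<le> B * indicator ?C y"
      using h by eventually_elim (use z in \<open>auto simp: indicator_def\<close>)
  qed (use B in auto)
  also have "\<dots> = B * measure (lebesgue_on \<Omega>) ?C"
    using C by (simp add: Int_absorb2)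
  also have "measure (lebesgue_on \<Omega>) ?C = measure lebesgue ?C"
    using emeasure_lebesgue_on[OF \<Omega> C] by (simp add: measure_def)
  finally show ?thesis by (simp add: measure_corner_cube[OF e])
qed

text \<open>
  The derivative of \<open>x \<mapsto> \<integral> w(y) q((y - x) / e) dy\<close> falls on the kernel, so this mollification is as smooth as
  the kernel even if \<open>w\<close> is an indicator function.  The bound \<open>K\<close> is required only for the integral, not for
  the integrand: in the applications it comes from cancellation.
\<close>

lemma mollified_difference_bound:
  fixes x x' :: "real^'n::finite"
  assumes \<Omega>: "open \<Omega>" and q: "kernel q" and e: "0 < e"
    and w: "w \<in> borel_measurable (lebesgue_on \<Omega>)" "AE y in lebesgue_on \<Omega>. \<bar>w y\<bar> \<le> W"
    and K: "\<And>z. z \<in> closed_segment x x' \<Longrightarrow>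
      \<bar>LINT y|lebesgue_on \<Omega>. w y * (\<Sum>l\<in>UNIV. (x' - x) $ l * (1 / e * rescale (partial_deriv l q) e z y))\<bar> \<le> K"
  shows "\<bar>(LINT y|lebesgue_on \<Omega>. w y * rescale q e x' y) - (LINT y|lebesgue_on \<Omega>. w y * rescale q e x y)\<bar> \<le> K"
proof -
  let ?M = "lebesgue_on \<Omega>"
  define X where "X = (\<lambda>t::real. x + t *\<^sub>R (x' - x))"
  define v where "v = x' - x"
  define f where "f = (\<lambda>t y. w y * rescale q e (X t) y)"
  define Dq where "Dq = (\<lambda>z y. \<Sum>l\<in>UNIV. v $ l * (1 / e * rescale (partial_deriv l q) e z y))"
  define f' where "f' = (\<lambda>t y. w y * - Dq (X t) y)"
  define r where "r = 2 * norm v + e * real CARD('n)"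
  define C where "C = cball x r"
  have Cb: "bounded C" "C \<in> sets lebesgue" by (auto simp: C_def)
  have inC: "corner_cube (X t) e \<subseteq> C" if "t \<in> {-1<..<2}" for t
    unfolding C_def r_def
  proof (rule corner_cube_subset_cball[OF order_refl])
    have "\<bar>t\<bar> \<le> 2" using that by auto
    then have "norm (t *\<^sub>R v) \<le> 2 * norm v" by (simp add: mult_right_mono)
    then show "X t \<in> cball x (2 * norm v)" by (simp add: X_def v_def dist_norm)
  qed
  have q_sm: "smooth_fun q" using q by (simp add: kernel_def)
  obtain B where B: "0 \<le> B" "\<And>z. \<bar>q z\<bar> \<le> B" by (rule kernel_bounded[OF q]) blast
  have "\<exists>B. 0 \<le> B \<and> (\<forall>z. \<bar>partial_deriv l q z\<bar> \<le> B)" for l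
    by (rule kernel_bounded[OF kernel_partial[OF q, of l]]) blast
  then obtain L where L: "\<And>l. 0 \<le> L l" "\<And>l z. \<bar>partial_deriv l q z\<bar> \<le> L l" by metis
  define LL where "LL = (\<Sum>l\<in>UNIV. \<bar>v $ l\<bar> * (1 / e * L l))"
  have LL: "0 \<le> LL" unfolding LL_def using L e by (intro sum_nonneg) auto
  have Dq_b: "\<bar>Dq z y\<bar> \<le> LL" for z y
  proof -
    have "\<bar>Dq z y\<bar> \<le> (\<Sum>l\<in>UNIV. \<bar>v $ l * (1 / e * rescale (partial_deriv l q) e z y)\<bar>)"
      unfolding Dq_def by (rule sum_abs)
    also have "\<dots> \<le> LL" unfolding LL_def
      using e L(2) by (intro sum_mono) (auto simp: abs_mult rescale_def intro!: mult_left_mono divide_right_mono)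
    finally show ?thesis .
  qed
  have Dq0: "Dq z y = 0" if "y \<notin> corner_cube z e" for z y
    unfolding Dq_def using rescale_kernel_outside[OF kernel_partial[OF q] e that] by simp
  have fi: "integrable ?M (f t)" if t: "t \<in> {-1<..<2}" for t
  proof (rule bounded_support_integrable[OF \<Omega> Cb])
    show "f t \<in> borel_measurable ?M" unfolding f_def
      using w(1) rescale_kernel_measurable[OF q \<Omega>] by simp
    show "AE y in ?M. \<bar>f t y\<bar> \<le> W * B"
      using w(2) unfolding f_def abs_mult
      by eventually_elim (use B in \<open>auto simp: rescale_def intro!: mult_mono intro: order_trans[OF abs_ge_zero]\<close>)
    show "f t y = 0" if "y \<notin> C" for y
      using rescale_kernel_outside[OF q e, of y "X t"] inC[OF t] that by (auto simp: f_def)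
  qed
  have der: "((\<lambda>t. f t y) has_real_derivative f' t y) (at t)" for t y
  proof -
    let ?z = "(1 / e) *\<^sub>R (y - X t)"
    have 1: "((\<lambda>t. (1 / e) *\<^sub>R (y - X t)) has_derivative (\<lambda>h. (1 / e) *\<^sub>R (- (h *\<^sub>R v)))) (at t)"
      unfolding X_def v_def by (auto intro!: derivative_eq_intros)
    have d: "q differentiable (at ?z)" by (rule smooth_fun_differentiable[OF q_sm])
    have "((\<lambda>t. q ((1 / e) *\<^sub>R (y - X t))) has_derivative
        (\<lambda>h. frechet_derivative q (at ?z) ((1 / e) *\<^sub>R (- (h *\<^sub>R v))))) (at t)"
      by (rule has_derivative_compose[OF 1 has_derivative_frechet[OF d]])
    moreover have "(\<lambda>h. frechet_derivative q (at ?z) ((1 / e) *\<^sub>R (- (h *\<^sub>R v)))) = (*) (- Dq (X t) y)"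
      unfolding frechet_derivative_partials[OF d] Dq_def rescale_def
      by (rule ext) (simp add: sum_distrib_left sum_negf[symmetric] algebra_simps)
    ultimately have "((\<lambda>t. rescale q e (X t) y) has_real_derivative - Dq (X t) y) (at t)"
      by (simp only: has_field_derivative_def rescale_def)
    then show ?thesis unfolding f_def f'_def by (rule DERIV_cmult)
  qed
  have main: "((\<lambda>t. LINT y|?M. f t y) has_real_derivative (LINT y|?M. f' t y)) (at t)"
    if "t \<in> {-1<..<2}" for t
  proof (rule has_real_derivative_integral[where g = "\<lambda>y. \<bar>W\<bar> * LL * indicator C y", OF fi der _ _ that])
    show "AE y in ?M. \<forall>t\<in>{-1<..<2}. \<bar>f' t y\<bar> \<le> \<bar>W\<bar> * LL * indicator C y"
      using w(2)
    proof eventually_elim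
      case (elim y)
      show ?case
      proof
        fix t :: real assume t: "t \<in> {-1<..<2}"
        show "\<bar>f' t y\<bar> \<le> \<bar>W\<bar> * LL * indicator C y"
        proof (cases "y \<in> C")
          case True
          have "\<bar>w y\<bar> * \<bar>Dq (X t) y\<bar> \<le> \<bar>W\<bar> * LL"
            using elim Dq_b LL by (intro mult_mono) auto
          then show ?thesis using True by (simp add: f'_def abs_mult)
        next
          case False
          then show ?thesis using inC[OF t] Dq0[of y "X t"] by (auto simp: f'_def)
        qed
      qed
    qed
    have "(\<lambda>y. indicator C y :: real) \<in> borel_measurable ?M"
      using emeasure_lebesgue_on_bounded(1)[OF \<Omega> Cb] by (simp add: borel_measurable_indicator_iff)
    then show "integrable ?M (\<lambda>y. \<bar>W\<bar> * LL * indicator C y)"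
      by (intro bounded_support_integrable[OF \<Omega> Cb, where B = "\<bar>W\<bar> * LL"] borel_measurable_times)
        (use LL in \<open>auto simp: abs_mult indicator_def\<close>)
  qed auto
  obtain t where t: "0 < t" "t < 1" and mvt: "(LINT y|?M. f 1 y) - (LINT y|?M. f 0 y) = (1 - 0) * (LINT y|?M. f' t y)"
    using MVT2[of 0 1 "\<lambda>t. LINT y|?M. f t y" "\<lambda>t. LINT y|?M. f' t y"] main by auto
  have "X t \<in> closed_segment x x'"
    using t by (auto simp: X_def in_segment algebra_simps intro!: exI[of _ t])
  from K[OF this] have "\<bar>LINT y|?M. f' t y\<bar> \<le> K"
    by (simp add: f'_def Dq_def v_def)
  moreover have "f 1 = (\<lambda>y. w y * rescale q e x' y)" "f 0 = (\<lambda>y. w y * rescale q e x y)"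
    by (simp_all add: f_def X_def)
  ultimately show ?thesis using mvt by simp
qed

section \<open>The mollifier\<close>

definition mollifier_root :: "real^'n::finite \<Rightarrow> real" where
  "mollifier_root = bump ((1 / 2) *\<^sub>R One) (1 / 2)"

definition mollifier :: "real^'n::finite \<Rightarrow> real" where
  "mollifier z = mollifier_root z * mollifier_root z"

lemma kernel_mollifier_root: "kernel (mollifier_root :: real^'n::finite \<Rightarrow> real)"
  unfolding kernel_def
proof (intro conjI allI impI)
  show "smooth_fun (mollifier_root :: real^'n \<Rightarrow> real)"
    unfolding mollifier_root_def using bump_test[of "1/2" _ UNIV] by (intro test_functions_smooth) auto
  fix z :: "real^'n" assume z: "z \<notin> corner_cube 0 1"
  then obtain i where "\<not> (0 \<le> z $ i \<and> z $ i \<le> 1)" by (auto simp: mem_corner_cube)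
  then have "1 / 2 \<le> \<bar>(z - (1 / 2) *\<^sub>R One) $ i\<bar>" by (auto simp: One_component)
  then have "1 / 2 \<le> norm (z - (1 / 2) *\<^sub>R One)"
    using component_le_norm_cart[of "z - (1 / 2) *\<^sub>R One" i] by linarith
  then show "mollifier_root z = 0"
    unfolding mollifier_root_def
    using bump_pos_iff[of "1 / 2" "(1 / 2) *\<^sub>R One" z] bump_nonneg[of "(1 / 2) *\<^sub>R One" "1 / 2" z]
    by (simp add: dist_norm norm_minus_commute)
qed

lemma kernel_mollifier: "kernel mollifier"
  using kernel_mollifier_root unfolding kernel_def mollifier_def[abs_def]
  by (auto intro: smooth_fun_mult)

lemma mollifier_nonneg: "0 \<le> mollifier z"
  by (simp add: mollifier_def)

definition mollifier_mass :: "'n::finite itself \<Rightarrow> real" where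
  "mollifier_mass _ = (LINT z|lborel. mollifier (z :: real^'n))"

lemma borel_measurable_kernel: "kernel q \<Longrightarrow> q \<in> borel_measurable borel"
  by (intro borel_measurable_continuous_onI smooth_fun_continuous) (simp add: kernel_def)

lemma mollifier_mass_pos: "0 < mollifier_mass TYPE('n::finite)"
proof -
  let ?q = "mollifier :: real^'n \<Rightarrow> real"
  have int: "integrable lborel ?q"
  proof -
    have "?q \<in> test_functions UNIV" by (rule kernel_test[OF kernel_mollifier])
    from bounded_mult_test_integrable(1)[OF open_UNIV this, of "\<lambda>_. 1" 1]
    have "integrable (lebesgue_on UNIV) ?q" by simp
    moreover have "?q \<in> borel_measurable lborel"
      using borel_measurable_kernel[OF kernel_mollifier] by simp
    ultimately show ?thesis
      unfolding lebesgue_on_UNIV_eq by (simp only: integrable_completion)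
  qed
  have "mollifier_mass TYPE('n) \<noteq> 0"
  proof
    assume "mollifier_mass TYPE('n) = 0"
    then have AE0: "AE z in lborel. ?q z = 0"
      using integral_nonneg_eq_0_iff_AE[OF int] by (simp add: mollifier_mass_def mollifier_nonneg)
    have nz: "?q z \<noteq> 0" if "z \<in> ball ((1 / 2) *\<^sub>R One) (1 / 2)" for z
      using that bump_pos_iff[of "1 / 2" "(1 / 2) *\<^sub>R One" z] by (simp add: mollifier_def mollifier_root_def)
    have "AE z :: real^'n in lborel. z \<notin> ball ((1 / 2) *\<^sub>R One) (1 / 2)"
      using AE0 by eventually_elim (use nz in auto)
    then have "ball ((1 / 2) *\<^sub>R One) (1 / 2) \<in> null_sets (lborel :: (real^'n) measure)"
      by (subst AE_iff_null_sets) auto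
    then have "negligible (ball ((1 / 2) *\<^sub>R One) (1 / 2) :: (real^'n) set)"
      by (simp add: negligible_iff_null_sets null_sets_completionI)
    then show False by (simp add: open_not_negligible)
  qed
  moreover have "0 \<le> mollifier_mass TYPE('n)"
    unfolding mollifier_mass_def by (intro integral_nonneg_AE) (simp add: mollifier_nonneg)
  ultimately show ?thesis by simp
qed

text \<open>
  The mass of the rescaled kernel does not depend on the centre.  This is used when local averages at two
  points are compared.
\<close>

lemma integral_rescale_mollifier:
  fixes x :: "real^'n::finite"
  assumes \<Omega>: "open \<Omega>" and e: "0 < e" and C: "corner_cube x e \<subseteq> \<Omega>"
  shows "(LINT y|lebesgue_on \<Omega>. rescale mollifier e x y) = e ^ CARD('n) * mollifier_mass TYPE('n)"
proof -
  let ?f = "rescale mollifier e x"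
  have fm: "?f \<in> borel_measurable borel"
    using borel_measurable_continuous_onI[OF smooth_fun_continuous[OF smooth_fun_rescale]]
      kernel_mollifier by (auto simp: kernel_def)
  have "(LINT y|lebesgue_on \<Omega>. ?f y) = (LINT y|lebesgue. indicator \<Omega> y *\<^sub>R ?f y)"
    by (rule integral_restrict_space) (use \<Omega> in \<open>auto simp: borel_open\<close>)
  also have "\<dots> = (LINT y|lebesgue. ?f y)"
    using rescale_kernel_outside[OF kernel_mollifier e, of _ x] C
    by (intro Bochner_Integration.integral_cong) (auto simp: indicator_def)
  also have "\<dots> = (LINT y|lborel. ?f y)"
    using fm by (intro integral_completion) simp
  also have "\<dots> = (LINT y|density (distr lborel borel (\<lambda>z. x + e *\<^sub>R z)) (\<lambda>_. ennreal (\<bar>e\<bar> ^ DIM(real^'n))). ?f y)"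
    using e by (subst lborel_affine[of e x]) auto
  also have "\<dots> = (LINT z|lborel. e ^ CARD('n) * ?f (x + e *\<^sub>R z))"
    using e fm by (subst integral_density) (auto simp: integral_distr)
  also have "\<dots> = e ^ CARD('n) * mollifier_mass TYPE('n)"
    using e by (simp add: rescale_def mollifier_mass_def)
  finally show ?thesis .
qed

section \<open>Lipschitz continuity of the coefficients\<close>

lemma kernel_smooth: "kernel q \<Longrightarrow> smooth_fun q"
  by (simp add: kernel_def)

lemmas smooth_fun_mollifier = kernel_smooth[OF kernel_mollifier]

text \<open>
  The gradient of a mollification of \<open>c\<close> is the mollification of the weak gradient, hence bounded by
  \<open>G\<close> independently of the scale.  By continuity of \<open>c\<close> the mollifications converge at every point.
\<close>

lemma weak_partials_bounded_imp_lipschitz: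
  fixes c :: "real^'n::finite \<Rightarrow> real"
  assumes \<Omega>: "open \<Omega>" and r: "0 < r" "cball x0 (2 * r) \<subseteq> \<Omega>"
    and c: "continuous_on \<Omega> c" "c \<in> borel_measurable (lebesgue_on \<Omega>)"
      "AE x in lebesgue_on \<Omega>. \<bar>c x\<bar> \<le> B"
    and g: "\<And>l. has_weak_partial \<Omega> l c (g l)" "\<And>l. g l \<in> borel_measurable (lebesgue_on \<Omega>)"
      "\<And>l. AE x in lebesgue_on \<Omega>. \<bar>g l x\<bar> \<le> G"
    and x: "x \<in> cball x0 r" "x' \<in> cball x0 r" and G0: "0 \<le> G"
  shows "\<bar>c x' - c x\<bar> \<le> real CARD('n) * G * norm (x' - x)"
proof -
  let ?M = "lebesgue_on \<Omega>" and ?N = "real CARD('n)"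
  define J where "J = mollifier_mass TYPE('n)"
  have J: "0 < J" unfolding J_def by (rule mollifier_mass_pos)
  have N: "0 < ?N" by (simp only: of_nat_0_less_iff zero_less_card_finite)
  have cube: "corner_cube z e \<subseteq> \<Omega>" if "z \<in> cball x0 r" "e * ?N \<le> r" for z e
  proof (rule subset_trans[OF corner_cube_subset_cball[OF that(2,1)]])
    show "cball x0 (r + r) \<subseteq> \<Omega>" using r(2) by (simp only: mult_2)
  qed
  define W where "W = (\<lambda>e z. LINT y|?M. c y * rescale mollifier e z y)"
  have lip: "\<bar>W e x' - W e x\<bar> \<le> ?N * G * norm (x' - x) * (e ^ CARD('n) * J)"
    if e: "0 < e" "e * ?N \<le> r" for e
    unfolding W_def
  proof (rule mollified_difference_bound[OF \<Omega> kernel_mollifier e(1) c(2,3)])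
    fix z assume z: "z \<in> closed_segment x x'"
    have zr: "z \<in> cball x0 r"
      using z x closed_segment_subset[OF x convex_cball] by blast
    note ctest = rescale_kernel_test[OF kernel_mollifier e(1) cube[OF zr e(2)]]
    note ptest = rescale_kernel_test[OF kernel_partial[OF kernel_mollifier] e(1) cube[OF zr e(2)]]
    let ?q = "rescale mollifier e z"
    have weak: "(LINT y|?M. c y * (1 / e * rescale (partial_deriv l mollifier) e z y))
        = - (LINT y|?M. g l y * ?q y)" for l
    proof -
      have "(LINT y|?M. c y * partial_deriv l ?q y) = - (LINT y|?M. g l y * ?q y)"
        using g(1)[of l] ctest unfolding has_weak_partial_def by blast
      moreover have "smooth_fun (mollifier :: real^'n \<Rightarrow> real)"
        by (rule smooth_fun_mollifier)
      ultimately show ?thesis by (simp only: partial_deriv_rescale)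
    qed
    have gq: "\<bar>LINT y|?M. g l y * ?q y\<bar> \<le> G * (e ^ CARD('n) * J)" for l
    proof -
      have "\<bar>LINT y|?M. g l y * ?q y\<bar> \<le> (LINT y|?M. \<bar>g l y * ?q y\<bar>)" by (rule integral_abs_bound)
      also have "\<dots> \<le> (LINT y|?M. G * ?q y)"
      proof (rule integral_mono_AE)
        show "integrable ?M (\<lambda>y. \<bar>g l y * ?q y\<bar>)"
          by (intro integrable_abs bounded_mult_test_integrable(1)[OF \<Omega> ctest g(2,3)])
        show "integrable ?M (\<lambda>y. G * ?q y)"
          by (rule bounded_mult_test_integrable(1)[OF \<Omega> ctest, of "\<lambda>_. G" "\<bar>G\<bar>"]) auto
        show "AE y in ?M. \<bar>g l y * ?q y\<bar> \<le> G * ?q y"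
          using g(3)[of l]
          by eventually_elim (auto simp: abs_mult rescale_def mollifier_nonneg intro: mult_right_mono)
      qed
      also have "\<dots> = G * (e ^ CARD('n) * J)"
        using integral_rescale_mollifier[OF \<Omega> e(1) cube[OF zr e(2)]] by (simp add: J_def)
      finally show ?thesis .
    qed
    have "(LINT y|?M. c y * (\<Sum>l\<in>UNIV. (x' - x) $ l * (1 / e * rescale (partial_deriv l mollifier) e z y)))
      = (LINT y|?M. (\<Sum>l\<in>UNIV. (x' - x) $ l * (c y * (1 / e * rescale (partial_deriv l mollifier) e z y))))"
      by (simp add: sum_distrib_left mult_ac)
    also have "\<dots> = (\<Sum>l\<in>UNIV. (x' - x) $ l * (LINT y|?M. c y * (1 / e * rescale (partial_deriv l mollifier) e z y)))"
      by (subst Bochner_Integration.integral_sum[OF integrable_mult_right[OF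
            bounded_mult_test_integrable(1)[OF \<Omega> test_functions_scale[OF ptest] c(2,3)]]])
        (simp only: integral_mult_right_zero)
    also have "\<dots> = (\<Sum>l\<in>UNIV. (x' - x) $ l * - (LINT y|?M. g l y * ?q y))"
      by (simp only: weak)
    finally have "\<bar>LINT y|?M. c y * (\<Sum>l\<in>UNIV. (x' - x) $ l * (1 / e * rescale (partial_deriv l mollifier) e z y))\<bar>
        \<le> (\<Sum>l\<in>UNIV. \<bar>(x' - x) $ l * - (LINT y|?M. g l y * ?q y)\<bar>)"
      by (simp only: sum_abs)
    also have "\<dots> \<le> (\<Sum>l\<in>(UNIV::'n set). norm (x' - x) * (G * (e ^ CARD('n) * J)))"
      unfolding abs_mult abs_minus_cancel
      using component_le_norm_cart[of "x' - x"] gq by (intro sum_mono mult_mono) auto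
    also have "\<dots> = ?N * G * norm (x' - x) * (e ^ CARD('n) * J)" by simp
    finally show "\<bar>LINT y|?M. c y * (\<Sum>l\<in>UNIV. (x' - x) $ l * (1 / e * rescale (partial_deriv l mollifier) e z y))\<bar>
        \<le> ?N * G * norm (x' - x) * (e ^ CARD('n) * J)" .
  qed
  have close: "\<bar>W e z - c z * (e ^ CARD('n) * J)\<bar> \<le> h * (e ^ CARD('n) * J)"
    if e: "0 < e" "e * ?N \<le> r" and z: "z \<in> cball x0 r" and h: "0 \<le> h"
      and osc: "\<And>y. y \<in> corner_cube z e \<Longrightarrow> \<bar>c y - c z\<bar> \<le> h" for e z h
  proof -
    let ?q = "rescale mollifier e z"
    note ctest = rescale_kernel_test[OF kernel_mollifier e(1) cube[OF z e(2)]]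
    have mass: "(LINT y|?M. ?q y) = e ^ CARD('n) * J"
      unfolding J_def by (rule integral_rescale_mollifier[OF \<Omega> e(1) cube[OF z e(2)]])
    have i1: "integrable ?M (\<lambda>y. c y * ?q y)"
      by (rule bounded_mult_test_integrable(1)[OF \<Omega> ctest c(2,3)])
    have i2: "integrable ?M (\<lambda>y. k * ?q y)" for k
      by (rule bounded_mult_test_integrable(1)[OF \<Omega> ctest, of "\<lambda>_. k" "\<bar>k\<bar>"]) auto
    have "W e z - c z * (e ^ CARD('n) * J) = (LINT y|?M. c y * ?q y - c z * ?q y)"
      unfolding W_def mass[symmetric] using i1 i2[of "c z"] by simp
    also have "\<bar>\<dots>\<bar> \<le> (LINT y|?M. \<bar>c y * ?q y - c z * ?q y\<bar>)" by (rule integral_abs_bound)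
    also have "\<dots> \<le> (LINT y|?M. h * ?q y)"
    proof (rule integral_mono[OF _ i2])
      show "integrable ?M (\<lambda>y. \<bar>c y * ?q y - c z * ?q y\<bar>)"
        by (intro integrable_abs Bochner_Integration.integrable_diff i1 i2)
      fix y
      show "\<bar>c y * ?q y - c z * ?q y\<bar> \<le> h * ?q y"
      proof (cases "y \<in> corner_cube z e")
        case True
        have "\<bar>c y * ?q y - c z * ?q y\<bar> = \<bar>c y - c z\<bar> * ?q y"
          by (simp add: left_diff_distrib[symmetric] abs_mult rescale_def mollifier_nonneg)
        also have "\<dots> \<le> h * ?q y"
          using osc[OF True] by (intro mult_right_mono) (auto simp: rescale_def mollifier_nonneg)
        finally show ?thesis .
      next
        case False
        from rescale_kernel_outside[OF kernel_mollifier e(1) this] show ?thesis by simp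
      qed
    qed
    also have "\<dots> = h * (e ^ CARD('n) * J)" using mass by simp
    finally show ?thesis .
  qed
  show ?thesis
  proof (rule field_le_epsilon)
    fix h :: real assume h: "0 < h"
    have "\<exists>d>0. \<forall>y. norm (y - z) < d \<longrightarrow> \<bar>c y - c z\<bar> \<le> h / 2" if z: "z \<in> cball x0 r" for z
    proof -
      have zO: "z \<in> \<Omega>"
        using z subset_trans[OF subset_cball r(2), of r] r(1) by auto
      have "continuous (at z) c" using c(1) \<Omega> zO by (simp add: continuous_on_eq_continuous_at)
      then obtain d where "d > 0" "\<And>y. dist y z < d \<Longrightarrow> dist (c y) (c z) < h / 2"
        using h unfolding continuous_at_eps_delta by (metis half_gt_zero)
      then show ?thesis by (intro exI[of _ d]) (auto simp: dist_norm intro: less_imp_le)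
    qed
    then obtain d d' where d: "d > 0" "\<And>y. norm (y - x) < d \<Longrightarrow> \<bar>c y - c x\<bar> \<le> h / 2"
      and d': "d' > 0" "\<And>y. norm (y - x') < d' \<Longrightarrow> \<bar>c y - c x'\<bar> \<le> h / 2"
      using x by meson
    define e where "e = min r (min (d / 2) (d' / 2)) / ?N"
    have e: "0 < e" "e * ?N \<le> r" "e * ?N < d" "e * ?N < d'"
      using r d d' by (auto simp: e_def)
    define m where "m = e ^ CARD('n) * J"
    have m: "m > 0" using e J by (simp add: m_def)
    have "\<bar>W e x - c x * m\<bar> \<le> h / 2 * m"
      unfolding m_def
    proof (rule close[OF e(1,2) x(1)])
      fix y assume "y \<in> corner_cube x e"
      from le_less_trans[OF corner_cube_norm[OF this] e(3)] show "\<bar>c y - c x\<bar> \<le> h / 2" by (rule d(2))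
    qed (use h in simp)
    moreover have "\<bar>W e x' - c x' * m\<bar> \<le> h / 2 * m"
      unfolding m_def
    proof (rule close[OF e(1,2) x(2)])
      fix y assume "y \<in> corner_cube x' e"
      from le_less_trans[OF corner_cube_norm[OF this] e(4)] show "\<bar>c y - c x'\<bar> \<le> h / 2" by (rule d'(2))
    qed (use h in simp)
    moreover have "\<bar>W e x' - W e x\<bar> \<le> ?N * G * norm (x' - x) * m"
      unfolding m_def by (rule lip[OF e(1,2)])
    ultimately have "\<bar>c x' * m - c x * m\<bar> \<le> ?N * G * norm (x' - x) * m + h / 2 * m + h / 2 * m"
      by linarith
    moreover have "\<bar>c x' * m - c x * m\<bar> = \<bar>c x' - c x\<bar> * m"
      using m by (simp add: left_diff_distrib[symmetric] abs_mult)
    moreover have "?N * G * norm (x' - x) * m + h / 2 * m + h / 2 * m = (?N * G * norm (x' - x) + h) * m"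
      by (simp add: distrib_right)
    ultimately have "\<bar>c x' - c x\<bar> * m \<le> (?N * G * norm (x' - x) + h) * m"
      by (simp only:)
    then show "\<bar>c x' - c x\<bar> \<le> ?N * G * norm (x' - x) + h"
      using m by (rule mult_right_le_imp_le)
  qed
qed

section \<open>The elliptic operator\<close>

text \<open>
  Here \<open>g l i j\<close> is a version of the weak derivative \<open>\<partial>\<^sub>l c\<^sub>i\<^sub>j\<close>.
\<close>

locale elliptic_coefficients =
  fixes \<Omega> :: "(real^'n::finite) set" and c :: "real^'n \<Rightarrow> real^'n^'n"
    and g :: "'n \<Rightarrow> 'n \<Rightarrow> 'n \<Rightarrow> real^'n \<Rightarrow> real" and Cb Gb :: real
  assumes open_\<Omega>: "open \<Omega>"
    and c_cont: "continuous_on \<Omega> (\<lambda>x. c x $ i $ j)"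
    and c_meas: "(\<lambda>x. c x $ i $ j) \<in> borel_measurable (lebesgue_on \<Omega>)"
    and c_bound: "AE x in lebesgue_on \<Omega>. \<bar>c x $ i $ j\<bar> \<le> Cb"
    and c_sym: "x \<in> \<Omega> \<Longrightarrow> c x $ i $ j = c x $ j $ i"
    and c_pos: "x \<in> \<Omega> \<Longrightarrow> v \<noteq> 0 \<Longrightarrow> 0 < v \<bullet> (c x *v v)"
    and g_weak: "has_weak_partial \<Omega> l (\<lambda>x. c x $ i $ j) (g l i j)"
    and g_meas: "g l i j \<in> borel_measurable (lebesgue_on \<Omega>)"
    and g_bound: "AE x in lebesgue_on \<Omega>. \<bar>g l i j x\<bar> \<le> Gb"
    and Gb_nonneg: "0 \<le> Gb"

lemma admissible_coefficients_imp_elliptic: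
  assumes "open \<Omega>" "admissible_coefficients \<Omega> c"
  obtains g Cb Gb where "elliptic_coefficients \<Omega> c g Cb Gb"
proof -
  have W: "(\<lambda>x. c x $ i $ j) \<in> W1_infinity \<Omega>" for i j
    using assms(2) by (simp add: admissible_coefficients_def)
  have "\<exists>B. AE x in lebesgue_on \<Omega>. \<bar>c x $ i $ j\<bar> \<le> B" for i j
    using W[of i j] by (auto simp: W1_infinity_def L_infinity_def)
  then obtain B where B: "\<And>i j. AE x in lebesgue_on \<Omega>. \<bar>c x $ i $ j\<bar> \<le> B i j" by metis
  have "\<exists>h. h \<in> L_infinity (lebesgue_on \<Omega>) \<and> has_weak_partial \<Omega> l (\<lambda>x. c x $ i $ j) h" for l i j
    using W[of i j] by (auto simp: W1_infinity_def)
  then obtain g where g: "\<And>l i j. g l i j \<in> L_infinity (lebesgue_on \<Omega>)"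
    "\<And>l i j. has_weak_partial \<Omega> l (\<lambda>x. c x $ i $ j) (g l i j)" by metis
  have "\<exists>B. AE x in lebesgue_on \<Omega>. \<bar>g l i j x\<bar> \<le> B" for l i j
    using g(1)[of l i j] by (auto simp: L_infinity_def)
  then obtain D where D: "\<And>l i j. AE x in lebesgue_on \<Omega>. \<bar>g l i j x\<bar> \<le> D l i j" by metis
  define Cb where "Cb = (\<Sum>i\<in>UNIV. \<Sum>j\<in>UNIV. \<bar>B i j\<bar>)"
  define Gb where "Gb = (\<Sum>l\<in>UNIV. \<Sum>i\<in>UNIV. \<Sum>j\<in>UNIV. \<bar>D l i j\<bar>)"
  have CB: "B i j \<le> Cb" for i j
  proof -
    have "\<bar>B i j\<bar> \<le> (\<Sum>j\<in>UNIV. \<bar>B i j\<bar>)" by (rule member_le_sum) auto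
    also have "\<dots> \<le> Cb" unfolding Cb_def by (rule member_le_sum) (auto intro: sum_nonneg)
    finally show ?thesis by simp
  qed
  have GB: "D l i j \<le> Gb" for l i j
  proof -
    have "\<bar>D l i j\<bar> \<le> (\<Sum>j\<in>UNIV. \<bar>D l i j\<bar>)" by (rule member_le_sum) auto
    also have "\<dots> \<le> (\<Sum>i\<in>UNIV. \<Sum>j\<in>UNIV. \<bar>D l i j\<bar>)" by (rule member_le_sum) (auto intro: sum_nonneg)
    also have "\<dots> \<le> Gb" unfolding Gb_def by (rule member_le_sum) (auto intro: sum_nonneg)
    finally show ?thesis by simp
  qed
  have "elliptic_coefficients \<Omega> c g Cb Gb"
  proof
    show "AE x in lebesgue_on \<Omega>. \<bar>c x $ i $ j\<bar> \<le> Cb" for i j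
      using B[of i j] by eventually_elim (use CB[of i j] in linarith)
    show "AE x in lebesgue_on \<Omega>. \<bar>g l i j x\<bar> \<le> Gb" for l i j
      using D[of l i j] by eventually_elim (use GB[of l i j] in linarith)
    show "0 \<le> Gb" by (auto simp: Gb_def intro!: sum_nonneg)
    show "(\<lambda>x. c x $ i $ j) \<in> borel_measurable (lebesgue_on \<Omega>)" for i j
      using W[of i j] by (auto simp: W1_infinity_def L_infinity_def)
    show "g l i j \<in> borel_measurable (lebesgue_on \<Omega>)" for l i j
      using g(1)[of l i j] by (auto simp: L_infinity_def)
  qed (use assms g(2) in \<open>auto simp: admissible_coefficients_def\<close>)
  then show ?thesis by (rule that)
qed

context elliptic_coefficients
begin

abbreviation M where "M \<equiv> lebesgue_on \<Omega>"

definition ell :: "(real^'n \<Rightarrow> real) \<Rightarrow> real^'n \<Rightarrow> real" where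
  "ell \<phi> x = - (\<Sum>i\<in>UNIV. \<Sum>j\<in>UNIV.
      c x $ i $ j * partial_deriv i (partial_deriv j \<phi>) x + g i i j x * partial_deriv j \<phi> x)"

lemma c_mult_test:
  assumes "\<phi> \<in> test_functions \<Omega>"
  shows "integrable M (\<lambda>x. c x $ i $ j * \<phi> x)" "(\<lambda>x. c x $ i $ j * \<phi> x) \<in> L2 M"
  by (rule bounded_mult_test_integrable[OF open_\<Omega> assms c_meas c_bound])+

lemma g_mult_test:
  assumes "\<phi> \<in> test_functions \<Omega>"
  shows "integrable M (\<lambda>x. g l i j x * \<phi> x)" "(\<lambda>x. g l i j x * \<phi> x) \<in> L2 M"
  by (rule bounded_mult_test_integrable[OF open_\<Omega> assms g_meas g_bound])+

lemma ell_L2: "\<phi> \<in> test_functions \<Omega> \<Longrightarrow> ell \<phi> \<in> L2 M"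
  unfolding ell_def[abs_def]
  by (intro L2_uminus L2_sum L2_add c_mult_test g_mult_test test_functions_partial) auto

lemma coefficient_weak_partial:
  "\<eta> \<in> test_functions \<Omega> \<Longrightarrow>
    (LINT x|M. c x $ i $ j * partial_deriv l \<eta> x) = - (LINT x|M. g l i j x * \<eta> x)"
  using g_weak[of l i j] by (simp add: has_weak_partial_def)

text \<open>
  The definition of the weak derivative is tested with the product of \<open>u\<close> and \<open>v\<close>.
\<close>

lemma coefficient_integration_by_parts:
  assumes u: "u \<in> test_functions \<Omega>" and v: "v \<in> test_functions \<Omega>"
  shows "(LINT x|M. c x $ i $ j * v x * partial_deriv l u x)
    = - (LINT x|M. (c x $ i $ j * partial_deriv l v x + g l i j x * v x) * u x)"
proof -
  have uv: "(\<lambda>x. u x * v x) \<in> test_functions \<Omega>"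
    by (intro test_functions_mult u test_functions_smooth[OF v])
  have u'v: "(\<lambda>x. partial_deriv l u x * v x) \<in> test_functions \<Omega>"
    by (intro test_functions_mult test_functions_partial u test_functions_smooth[OF v])
  have uv': "(\<lambda>x. u x * partial_deriv l v x) \<in> test_functions \<Omega>"
    by (intro test_functions_mult u test_functions_smooth[OF test_functions_partial[OF v]])
  have "partial_deriv l (\<lambda>x. u x * v x) = (\<lambda>x. u x * partial_deriv l v x + partial_deriv l u x * v x)"
    by (intro ext partial_deriv_mult test_functions_differentiable[OF u] test_functions_differentiable[OF v])
  then have "(LINT x|M. c x $ i $ j * (u x * partial_deriv l v x + partial_deriv l u x * v x))
      = - (LINT x|M. g l i j x * (u x * v x))"
    using coefficient_weak_partial[OF uv, of i j l] by simp
  moreover have "(LINT x|M. c x $ i $ j * (u x * partial_deriv l v x + partial_deriv l u x * v x))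
     = (LINT x|M. c x $ i $ j * (u x * partial_deriv l v x))
      + (LINT x|M. c x $ i $ j * (partial_deriv l u x * v x))"
    using c_mult_test[OF uv'] c_mult_test[OF u'v] by (simp add: distrib_left)
  moreover have "(LINT x|M. (c x $ i $ j * partial_deriv l v x + g l i j x * v x) * u x)
    = (LINT x|M. c x $ i $ j * (u x * partial_deriv l v x)) + (LINT x|M. g l i j x * (u x * v x))"
    using c_mult_test[OF uv'] g_mult_test[OF uv]
    by (subst Bochner_Integration.integral_add[symmetric]) (auto simp: algebra_simps)
  moreover have "(LINT x|M. c x $ i $ j * v x * partial_deriv l u x)
     = (LINT x|M. c x $ i $ j * (partial_deriv l u x * v x))"
    by (simp add: mult_ac)
  ultimately show ?thesis by linarith
qed

lemma ellipticity_on_compact: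
  assumes "cball x0 R \<subseteq> \<Omega>" "0 \<le> R"
  obtains l where "0 < l" "\<And>x v. x \<in> cball x0 R \<Longrightarrow> l * (norm v)\<^sup>2 \<le> v \<bullet> (c x *v v)"
proof -
  let ?Q = "\<lambda>(x, v). \<Sum>i\<in>UNIV. v $ i * (\<Sum>j\<in>UNIV. c x $ i $ j * v $ j)"
  have Q: "v \<bullet> (c x *v v) = ?Q (x, v)" for x v
    by (simp add: inner_vec_def matrix_vector_mult_def)
  have comp: "compact (cball x0 R \<times> sphere (0::real^'n) 1)" by (intro compact_Times compact_cball compact_sphere)
  have ne: "cball x0 R \<times> sphere (0::real^'n) 1 \<noteq> {}"
  proof -
    have "norm (axis undefined 1 :: real^'n) = 1" by (simp add: norm_axis_1)
    then have "(x0, axis undefined 1) \<in> cball x0 R \<times> sphere (0::real^'n) 1" using assms by simp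
    then show ?thesis by blast
  qed
  have cont: "continuous_on (cball x0 R \<times> sphere (0::real^'n) 1) ?Q"
  proof -
    have cc: "continuous_on (cball x0 R \<times> sphere (0::real^'n) 1) (\<lambda>p. c (fst p) $ i $ j)" for i j
      by (rule continuous_on_compose2[OF c_cont[of i j] continuous_on_fst[OF continuous_on_id]])
        (use assms in auto)
    show ?thesis unfolding case_prod_beta
      by (intro continuous_intros cc)
  qed
  obtain p where p: "p \<in> cball x0 R \<times> sphere (0::real^'n) 1"
    "\<And>q. q \<in> cball x0 R \<times> sphere (0::real^'n) 1 \<Longrightarrow> ?Q p \<le> ?Q q"
    using continuous_attains_inf[OF comp ne cont] by blast
  define l where "l = ?Q p"
  have "snd p \<noteq> 0" using p(1) by auto
  moreover have "fst p \<in> \<Omega>" using p(1) assms by auto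
  ultimately have l: "0 < l" using c_pos[of "fst p" "snd p"] unfolding Q l_def by simp
  show ?thesis
  proof (rule that[OF l])
    fix x v assume x: "x \<in> cball x0 R"
    show "l * (norm v)\<^sup>2 \<le> v \<bullet> (c x *v v)"
    proof (cases "v = 0")
      case False
      let ?u = "(1 / norm v) *\<^sub>R v"
      have "l \<le> ?Q (x, ?u)" unfolding l_def using x False by (intro p(2)) auto
      also have "\<dots> = ?u \<bullet> (c x *v ?u)" by (simp only: Q)
      also have "\<dots> = (v \<bullet> (c x *v v)) / (norm v)\<^sup>2"
        by (simp only: scaleR_matrix_vector_assoc[symmetric] matrix_vector_mult_scaleR)
          (simp add: power2_eq_square)
      finally show ?thesis using False by (simp add: field_simps)
    qed simp
  qed
qed

end

context elliptic_coefficients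
begin

section \<open>Reducing sets are locally trivial\<close>

text \<open>
  What remains of the property that multiplication by the indicator of \<open>A\<close> commutes with a symmetric
  extension of \<open>ell\<close> when only test functions are considered.
\<close>

definition reducing_set :: "(real^'n) set \<Rightarrow> bool" where
  "reducing_set A \<longleftrightarrow> A \<in> sets M \<and> (\<forall>u\<in>test_functions \<Omega>. \<forall>v\<in>test_functions \<Omega>.
     (LINT x|M. indicator A x * (u x * ell v x - ell u x * v x)) = 0)"

text \<open>
  In divergence form \<open>u H v - v H u = - div (C (u \<nabla>v - v \<nabla>u))\<close>, and for \<open>u = \<theta>\<close>, \<open>v = \<theta> x\<^sub>k\<close> the vector in
  brackets is \<open>\<theta>\<^sup>2 e\<^sub>k\<close>.  Thus \<open>\<theta>\<close> itself localizes the coordinate function, and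
  its derivatives cancel.
\<close>

lemma ell_mult_coordinate:
  assumes \<theta>: "\<theta> \<in> test_functions \<Omega>" and x: "x \<in> \<Omega>"
  shows "\<theta> x * ell (\<lambda>x. \<theta> x * x $ k) x - ell \<theta> x * (\<theta> x * x $ k)
    = - (\<Sum>i\<in>UNIV. c x $ i $ k * partial_deriv i (\<lambda>x. \<theta> x * \<theta> x) x + g i i k x * (\<theta> x * \<theta> x))"
proof -
  have d: "\<theta> differentiable (at y)" "partial_deriv j \<theta> differentiable (at y)" for y j
    using test_functions_differentiable[OF \<theta>] test_functions_differentiable[OF test_functions_partial[OF \<theta>]]
    by auto
  have dk: "(\<lambda>x. x $ k) differentiable (at y)" for y :: "real^'n"
    by (rule smooth_fun_differentiable[OF smooth_fun_coordinate])
  have pk: "partial_deriv j (\<lambda>x. x $ k) y = of_bool (j = k)" for j and y :: "real^'n"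
    using partial_deriv_eqI[OF affine_coordinate_deriv[of 1 k 0 y], of j]
    by (simp add: axis_def)
  have 1: "partial_deriv j (\<lambda>x. \<theta> x * x $ k) = (\<lambda>y. \<theta> y * of_bool (j = k) + partial_deriv j \<theta> y * y $ k)" for j
    by (rule ext) (simp add: partial_deriv_mult d dk pk)
  have 2: "partial_deriv i (partial_deriv j (\<lambda>x. \<theta> x * x $ k)) x
    = partial_deriv i \<theta> x * of_bool (j = k) + partial_deriv j \<theta> x * of_bool (i = k)
      + partial_deriv i (partial_deriv j \<theta>) x * x $ k" for i j
  proof -
    have const: "partial_deriv i (\<lambda>y. of_bool (j = k)) x = 0"
      by (rule partial_deriv_eqI[OF has_derivative_const])
    show ?thesis unfolding 1
      by (subst partial_deriv_add)
        (auto simp: partial_deriv_mult d dk pk const intro!: derivative_intros d dk)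
  qed
  have 3: "partial_deriv i (\<lambda>x. \<theta> x * \<theta> x) x = 2 * \<theta> x * partial_deriv i \<theta> x" for i
    by (simp add: partial_deriv_mult d)
  have "ell (\<lambda>x. \<theta> x * x $ k) x = - (\<Sum>i\<in>UNIV. \<Sum>j\<in>UNIV.
      (c x $ i $ j * partial_deriv i \<theta> x + g i i j x * \<theta> x) * of_bool (j = k)
      + c x $ i $ j * partial_deriv j \<theta> x * of_bool (i = k)
      + (c x $ i $ j * partial_deriv i (partial_deriv j \<theta>) x + g i i j x * partial_deriv j \<theta> x) * x $ k)"
    unfolding ell_def 2 unfolding 1 by (simp add: algebra_simps)
  also have "\<dots> = - ((\<Sum>i\<in>UNIV. c x $ i $ k * partial_deriv i \<theta> x + g i i k x * \<theta> x)
      + (\<Sum>j\<in>UNIV. c x $ k $ j * partial_deriv j \<theta> x)) + ell \<theta> x * x $ k"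
  proof -
    have A: "(\<Sum>j\<in>UNIV. F j * of_bool (j = k)) = F k" for F :: "'n \<Rightarrow> real"
      by (simp add: sum.delta)
    have B: "(\<Sum>i\<in>UNIV. \<Sum>j\<in>UNIV. H i j * of_bool (i = k)) = (\<Sum>j\<in>UNIV. H k j)"
      for H :: "'n \<Rightarrow> 'n \<Rightarrow> real"
      unfolding sum_distrib_right[symmetric] by (rule A)
    have "(\<Sum>i\<in>UNIV. \<Sum>j\<in>UNIV. F i j * of_bool (j = k) + H i j * of_bool (i = k) + X i j * y)
        = (\<Sum>i\<in>UNIV. F i k) + (\<Sum>j\<in>UNIV. H k j) + (\<Sum>i\<in>UNIV. \<Sum>j\<in>UNIV. X i j) * y"
      for F H X :: "'n \<Rightarrow> 'n \<Rightarrow> real" and y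
      by (simp only: sum.distrib A B sum_distrib_right)
    then show ?thesis unfolding ell_def by (simp only:)
  qed
  also have "(\<Sum>j\<in>UNIV. c x $ k $ j * partial_deriv j \<theta> x) = (\<Sum>i\<in>UNIV. c x $ i $ k * partial_deriv i \<theta> x)"
    using c_sym[OF x] by simp
  finally have 4: "ell (\<lambda>x. \<theta> x * x $ k) x
      = - ((\<Sum>i\<in>UNIV. c x $ i $ k * partial_deriv i \<theta> x + g i i k x * \<theta> x)
        + (\<Sum>i\<in>UNIV. c x $ i $ k * partial_deriv i \<theta> x)) + ell \<theta> x * x $ k" .
  have 5: "(\<Sum>i\<in>UNIV. c x $ i $ k * (2 * \<theta> x * partial_deriv i \<theta> x) + g i i k x * (\<theta> x * \<theta> x))
      = \<theta> x * ((\<Sum>i\<in>UNIV. c x $ i $ k * partial_deriv i \<theta> x + g i i k x * \<theta> x)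
        + (\<Sum>i\<in>UNIV. c x $ i $ k * partial_deriv i \<theta> x))"
    unfolding sum.distrib[symmetric] sum_distrib_left by (rule sum.cong) (auto simp: algebra_simps)
  show ?thesis
    unfolding 3 4 5 by (simp add: algebra_simps)
qed

context
  fixes A :: "(real^'n) set"
  assumes A: "reducing_set A"
begin

lemma A_sets: "A \<in> sets M" "A \<in> sets lebesgue" "A \<subseteq> \<Omega>"
  using A sets_lebesgue_on[OF open_\<Omega>, of A] by (auto simp: reducing_set_def)

lemma indicator_A_measurable: "(\<lambda>y. indicator A y :: real) \<in> borel_measurable M"
  using A_sets(1) by simp

lemma indicator_A_mult_integrable:
  assumes "\<phi> \<in> test_functions \<Omega>"
  shows "integrable M (\<lambda>y. indicator A y * (c y $ i $ j * \<phi> y))"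
    "integrable M (\<lambda>y. indicator A y * (g l i j y * \<phi> y))"
    "integrable M (\<lambda>y. indicator A y * (k * \<phi> y))"
proof -
  have *: "integrable M (\<lambda>y. indicator A y * (b y * \<phi> y))"
    if "b \<in> borel_measurable M" "AE y in M. \<bar>b y\<bar> \<le> B" for b B
  proof -
    have "integrable M (\<lambda>y. (indicator A y * b y) * \<phi> y)"
      by (rule bounded_mult_test_integrable(1)[OF open_\<Omega> assms, where B = "\<bar>B\<bar>"])
        (use that indicator_A_measurable in \<open>auto elim!: eventually_mono simp: indicator_def\<close>)
    then show ?thesis by (simp add: mult.assoc)
  qed
  show "integrable M (\<lambda>y. indicator A y * (c y $ i $ j * \<phi> y))" by (rule *[OF c_meas c_bound])
  show "integrable M (\<lambda>y. indicator A y * (g l i j y * \<phi> y))" by (rule *[OF g_meas g_bound])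
  show "integrable M (\<lambda>y. indicator A y * (k * \<phi> y))" by (rule *[of "\<lambda>_. k" "\<bar>k\<bar>"]) auto
qed

text \<open>
  Read with \<open>\<theta>\<^sup>2\<close> as a test function, this is the distributional equation \<open>\<Sum>\<^sub>i c\<^sub>i\<^sub>k \<partial>\<^sub>i 1\<^sub>A = 0\<close>.
\<close>

lemma weak_gradient_zero:
  assumes \<theta>: "\<theta> \<in> test_functions \<Omega>"
  shows "(LINT y|M. indicator A y * (\<Sum>i\<in>UNIV. c y $ i $ k * partial_deriv i (\<lambda>x. \<theta> x * \<theta> x) y
      + g i i k y * (\<theta> y * \<theta> y))) = 0"
proof -
  have \<theta>k: "(\<lambda>x. \<theta> x * x $ k) \<in> test_functions \<Omega>"
    by (intro test_functions_mult \<theta> smooth_fun_coordinate)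
  have "(LINT y|M. indicator A y * (\<theta> y * ell (\<lambda>x. \<theta> x * x $ k) y - ell \<theta> y * (\<theta> y * y $ k))) = 0"
    using A \<theta> \<theta>k unfolding reducing_set_def by blast
  also have "(LINT y|M. indicator A y * (\<theta> y * ell (\<lambda>x. \<theta> x * x $ k) y - ell \<theta> y * (\<theta> y * y $ k)))
    = (LINT y|M. - (indicator A y * (\<Sum>i\<in>UNIV. c y $ i $ k * partial_deriv i (\<lambda>x. \<theta> x * \<theta> x) y
      + g i i k y * (\<theta> y * \<theta> y))))"
    by (rule Bochner_Integration.integral_cong) (auto simp: ell_mult_coordinate[OF \<theta>])
  finally show ?thesis by simp
qed

text \<open>
  A commutator estimate.  Let \<open>D\<close> be, up to sign, the gradient of the mollified indicator at \<open>z\<close>.  Freezing the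
  coefficients at \<open>z\<close>, the equation for \<open>1\<^sub>A\<close> gives
  \<open>(C(z) D)\<^sub>k = \<integral>\<^sub>A \<Sum>\<^sub>i ((c\<^sub>i\<^sub>k(z) - c\<^sub>i\<^sub>k(y)) \<partial>\<^sub>i \<rho> - \<partial>\<^sub>i c\<^sub>i\<^sub>k(y) \<rho>) dy\<close>.
  On the cube of side \<open>e\<close> the oscillation of the coefficients is of order \<open>e\<close>, which compensates the factor
  \<open>1 / e\<close> of the differentiated kernel.  Ellipticity at \<open>z\<close> turns the bound for \<open>C(z) D\<close> into one for \<open>D\<close>.
\<close>

lemma mollified_indicator_lipschitz:
  assumes R: "0 < R" "cball x0 (4 * R) \<subseteq> \<Omega>"
  obtains K where "0 \<le> K" "\<And>x x' e. x \<in> cball x0 R \<Longrightarrow> x' \<in> cball x0 R \<Longrightarrow> 0 < e \<Longrightarrow> e * real CARD('n) \<le> R \<Longrightarrow>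
    \<bar>(LINT y|M. indicator A y * rescale mollifier e x' y) - (LINT y|M. indicator A y * rescale mollifier e x y)\<bar>
      \<le> K * norm (x' - x) * e ^ CARD('n)"
proof -
  let ?N = "real CARD('n)"
  obtain l where l: "0 < l" "\<And>x v. x \<in> cball x0 R \<Longrightarrow> l * (norm v)\<^sup>2 \<le> v \<bullet> (c x *v v)"
  proof (rule ellipticity_on_compact)
    show "cball x0 R \<subseteq> \<Omega>" by (rule subset_trans[OF subset_cball R(2)]) (use R in simp)
  qed (use R in auto)
  obtain C0 where C0: "0 \<le> C0" "\<And>z. \<bar>mollifier (z :: real^'n)\<bar> \<le> C0"
    by (rule kernel_bounded[OF kernel_mollifier]) blast
  have "\<exists>B. 0 \<le> B \<and> (\<forall>z. \<bar>partial_deriv i (mollifier :: real^'n \<Rightarrow> real) z\<bar> \<le> B)" for i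
    by (rule kernel_bounded[OF kernel_partial[OF kernel_mollifier, of i]]) blast
  then obtain B where B: "\<And>i. 0 \<le> B i" "\<And>i z. \<bar>partial_deriv i (mollifier :: real^'n \<Rightarrow> real) z\<bar> \<le> B i" by metis
  define L where "L = ?N * Gb"
  define K1 where "K1 = (\<Sum>i\<in>UNIV. L * ?N * B i + Gb * C0)"
  have L0: "0 \<le> L" using Gb_nonneg by (simp add: L_def)
  have K1: "0 \<le> K1" unfolding K1_def using L0 Gb_nonneg C0 B by (intro sum_nonneg add_nonneg_nonneg mult_nonneg_nonneg) auto
  have cL: "\<bar>c x $ i $ k - c y $ i $ k\<bar> \<le> L * norm (x - y)"
    if "x \<in> cball x0 (2 * R)" "y \<in> cball x0 (2 * R)" for x y i k
    unfolding L_def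
    by (rule weak_partials_bounded_imp_lipschitz[OF open_\<Omega> _ _ c_cont c_meas c_bound g_weak g_meas g_bound that(2,1)
      Gb_nonneg]) (use R in auto)
  define K where "K = ?N * (?N * K1 / l)"
  have K: "0 \<le> K" unfolding K_def using K1 l by simp
  show ?thesis
  proof (rule that[OF K])
    fix x x' e assume x: "x \<in> cball x0 R" "x' \<in> cball x0 R" and e: "0 < e" "e * ?N \<le> R"
    show "\<bar>(LINT y|M. indicator A y * rescale mollifier e x' y) - (LINT y|M. indicator A y * rescale mollifier e x y)\<bar>
      \<le> K * norm (x' - x) * e ^ CARD('n)"
    proof (rule mollified_difference_bound[OF open_\<Omega> kernel_mollifier e(1) indicator_A_measurable, where W = 1])
      fix z assume "z \<in> closed_segment x x'"
      then have z: "z \<in> cball x0 R" using x closed_segment_subset[OF x convex_cball] by blast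
      have z2: "z \<in> cball x0 (2 * R)"
        by (rule subsetD[OF subset_cball z]) (use R in simp)
      have cube2: "corner_cube z e \<subseteq> cball x0 (2 * R)"
        using corner_cube_subset_cball[OF e(2) z] by (simp only: mult_2)
      have c2\<Omega>: "cball x0 (2 * R) \<subseteq> \<Omega>" by (rule subset_trans[OF subset_cball R(2)]) (use R in simp)
      have cube: "corner_cube z e \<subseteq> \<Omega>" by (rule subset_trans[OF cube2 c2\<Omega>])
      have z\<Omega>: "z \<in> \<Omega>" using z2 c2\<Omega> by (rule subsetD[rotated])
      let ?q = "rescale mollifier e z"
      let ?dq = "\<lambda>i y. 1 / e * rescale (partial_deriv i mollifier) e z y"
      have qt: "?q \<in> test_functions \<Omega>" by (rule rescale_kernel_test[OF kernel_mollifier e(1) cube])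
      have dqt: "?dq i \<in> test_functions \<Omega>" for i
        by (intro test_functions_scale rescale_kernel_test[OF kernel_partial[OF kernel_mollifier] e(1) cube])
      define D where "D = (\<chi> i. LINT y|M. indicator A y * ?dq i y)"
      have iD: "integrable M (\<lambda>y. indicator A y * ?dq i y)" for i
        using indicator_A_mult_integrable(3)[OF dqt[of i], of 1] by (simp only: mult_1)
      have cD: "\<bar>\<Sum>i\<in>UNIV. c z $ i $ k * D $ i\<bar> \<le> K1 * e ^ CARD('n)" for k
      proof -
        let ?\<theta> = "rescale mollifier_root e z"
        have \<theta>: "?\<theta> \<in> test_functions \<Omega>" by (rule rescale_kernel_test[OF kernel_mollifier_root e(1) cube])
        have \<theta>\<theta>: "(\<lambda>y. ?\<theta> y * ?\<theta> y) = ?q" by (simp add: rescale_def[abs_def] mollifier_def)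
        have sm: "smooth_fun (mollifier :: real^'n \<Rightarrow> real)" by (rule smooth_fun_mollifier)
        have zero: "(LINT y|M. indicator A y * (\<Sum>i\<in>UNIV. c y $ i $ k * ?dq i y + g i i k y * ?q y)) = 0"
          using weak_gradient_zero[OF \<theta>, of k] unfolding \<theta>\<theta> partial_deriv_rescale[OF sm]
            fun_cong[OF \<theta>\<theta>] .
        let ?h = "\<lambda>y. indicator A y * (\<Sum>i\<in>UNIV. (c z $ i $ k - c y $ i $ k) * ?dq i y - g i i k y * ?q y)"
        have "(\<Sum>i\<in>UNIV. c z $ i $ k * D $ i) = (LINT y|M. (\<Sum>i\<in>UNIV. indicator A y * (c z $ i $ k * ?dq i y)))"
          by (subst Bochner_Integration.integral_sum[OF indicator_A_mult_integrable(3)[OF dqt]])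
            (simp add: D_def mult.left_commute[of "indicator A _"])
        also have "\<dots> = (LINT y|M. (\<Sum>i\<in>UNIV. indicator A y * (c z $ i $ k * ?dq i y)))
            - (LINT y|M. (\<Sum>i\<in>UNIV. indicator A y * (c y $ i $ k * ?dq i y) + indicator A y * (g i i k y * ?q y)))"
          using zero by (simp add: sum_distrib_left distrib_left)
        also have "\<dots> = (LINT y|M. (\<Sum>i\<in>UNIV. indicator A y * (c z $ i $ k * ?dq i y))
            - (\<Sum>i\<in>UNIV. indicator A y * (c y $ i $ k * ?dq i y) + indicator A y * (g i i k y * ?q y)))"
          by (rule Bochner_Integration.integral_diff[symmetric])
            (intro Bochner_Integration.integrable_sum Bochner_Integration.integrable_add
              indicator_A_mult_integrable dqt qt)+
        also have "\<dots> = (LINT y|M. ?h y)"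
          by (simp only: sum_subtractf[symmetric]) (simp add: sum_distrib_left algebra_simps)
        finally have eq: "(\<Sum>i\<in>UNIV. c z $ i $ k * D $ i) = (LINT y|M. ?h y)" .
        show ?thesis unfolding eq
        proof (rule cube_integral_bound[OF open_\<Omega> _ cube K1])
          have "AE y in M. \<forall>i. \<bar>g i i k y\<bar> \<le> Gb"
            by (intro eventually_all_finite g_bound)
          then show "AE y in M. y \<in> corner_cube z e \<longrightarrow> \<bar>?h y\<bar> \<le> K1"
          proof eventually_elim
            case (elim y)
            show ?case
            proof
              assume y: "y \<in> corner_cube z e"
              have yz: "norm (z - y) \<le> e * ?N" using corner_cube_norm[OF y] by (simp add: norm_minus_commute)
              have "\<bar>?h y\<bar> \<le> \<bar>\<Sum>i\<in>UNIV. (c z $ i $ k - c y $ i $ k) * ?dq i y - g i i k y * ?q y\<bar>"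
                by (simp add: abs_mult indicator_def)
              also have "\<dots> \<le> (\<Sum>i\<in>UNIV. \<bar>(c z $ i $ k - c y $ i $ k) * ?dq i y - g i i k y * ?q y\<bar>)"
                by (rule sum_abs)
              also have "\<dots> \<le> K1"
                unfolding K1_def
              proof (rule sum_mono)
                fix i
                have "\<bar>(c z $ i $ k - c y $ i $ k) * ?dq i y\<bar> \<le> L * ?N * B i"
                proof -
                  have "\<bar>c z $ i $ k - c y $ i $ k\<bar> \<le> L * (e * ?N)"
                    using cL[OF z2, of y i k] cube2 y mult_left_mono[OF yz L0] by force
                  moreover have "\<bar>?dq i y\<bar> \<le> 1 / e * B i"
                    using B(2)[of i "(1 / e) *\<^sub>R (y - z)"] e
                    by (simp add: rescale_def abs_mult divide_right_mono)
                  ultimately have "\<bar>c z $ i $ k - c y $ i $ k\<bar> * \<bar>?dq i y\<bar> \<le> L * (e * ?N) * (1 / e * B i)"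
                    using L0 e by (intro mult_mono) auto
                  also have "\<dots> = L * ?N * B i" using e by simp
                  finally show ?thesis by (simp only: abs_mult)
                qed
                moreover have "\<bar>g i i k y * ?q y\<bar> \<le> Gb * C0"
                  unfolding abs_mult using elim C0 Gb_nonneg
                  by (intro mult_mono) (auto simp: rescale_def)
                ultimately show "\<bar>(c z $ i $ k - c y $ i $ k) * ?dq i y - g i i k y * ?q y\<bar>
                    \<le> L * ?N * B i + Gb * C0" by linarith
              qed
              finally show "\<bar>?h y\<bar> \<le> K1" .
            qed
          qed
          show "?h y = 0" if "y \<notin> corner_cube z e" for y
            using rescale_kernel_outside[OF kernel_mollifier e(1) that]
              rescale_kernel_outside[OF kernel_partial[OF kernel_mollifier] e(1) that] by simp
        qed (use e in simp)
      qed
      have Dn: "norm D \<le> ?N * K1 * e ^ CARD('n) / l"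
      proof -
        have "l * (norm D)\<^sup>2 \<le> D \<bullet> (c z *v D)" by (rule l(2)[OF z])
        also have "\<dots> = (\<Sum>k\<in>UNIV. D $ k * (\<Sum>i\<in>UNIV. c z $ i $ k * D $ i))"
          unfolding inner_vec_def matrix_vector_mult_def
          using c_sym[OF z\<Omega>] by (auto intro!: sum.cong)
        also have "\<dots> \<le> (\<Sum>k\<in>(UNIV::'n set). norm D * (K1 * e ^ CARD('n)))"
        proof (rule sum_mono)
          fix k
          have "D $ k * (\<Sum>i\<in>UNIV. c z $ i $ k * D $ i) \<le> \<bar>D $ k\<bar> * \<bar>\<Sum>i\<in>UNIV. c z $ i $ k * D $ i\<bar>"
            unfolding abs_mult[symmetric] by (rule abs_ge_self)
          also have "\<dots> \<le> norm D * (K1 * e ^ CARD('n))"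
            by (intro mult_mono cD component_le_norm_cart) auto
          finally show "D $ k * (\<Sum>i\<in>UNIV. c z $ i $ k * D $ i) \<le> norm D * (K1 * e ^ CARD('n))" .
        qed
        also have "\<dots> = norm D * (?N * K1 * e ^ CARD('n))" by simp
        finally have *: "norm D * (l * norm D) \<le> norm D * (?N * K1 * e ^ CARD('n))"
          by (simp only: power2_eq_square mult.left_commute[of l])
        show ?thesis
        proof (cases "norm D = 0")
          case True
          have "0 \<le> ?N * K1 * e ^ CARD('n) / l" using K1 l(1) e(1) by simp
          then show ?thesis unfolding True .
        next
          case False
          then have "0 < norm D" by simp
          with * have "l * norm D \<le> ?N * K1 * e ^ CARD('n)" by (rule mult_left_le_imp_le)
          then show ?thesis using l(1) by (simp only: pos_le_divide_eq mult.commute[of l])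
        qed
      qed
      have "(LINT y|M. indicator A y * (\<Sum>i\<in>UNIV. (x' - x) $ i * ?dq i y))
        = (LINT y|M. (\<Sum>i\<in>UNIV. (x' - x) $ i * (indicator A y * ?dq i y)))"
        by (simp only: sum_distrib_left mult.left_commute[of "indicator A _"])
      also have "\<dots> = (\<Sum>i\<in>UNIV. (x' - x) $ i * D $ i)"
        by (subst Bochner_Integration.integral_sum[OF integrable_mult_right[OF iD]]) (simp add: D_def)
      finally have "\<bar>LINT y|M. indicator A y * (\<Sum>i\<in>UNIV. (x' - x) $ i * ?dq i y)\<bar>
          \<le> (\<Sum>i\<in>UNIV. \<bar>(x' - x) $ i * D $ i\<bar>)" by (simp only: sum_abs)
      also have "\<dots> \<le> (\<Sum>i\<in>(UNIV::'n set). norm (x' - x) * (?N * K1 * e ^ CARD('n) / l))"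
        unfolding abs_mult
        by (intro sum_mono mult_mono component_le_norm_cart order_trans[OF component_le_norm_cart Dn]) auto
      also have "\<dots> = K * norm (x' - x) * e ^ CARD('n)" by (simp add: K_def)
      finally show "\<bar>LINT y|M. indicator A y * (\<Sum>i\<in>UNIV. (x' - x) $ i * ?dq i y)\<bar>
          \<le> K * norm (x' - x) * e ^ CARD('n)" .
    qed (auto simp: indicator_def)
  qed
qed

text \<open>
  If \<open>A\<close> has small density in the cube, the mollified indicator is small; if it has density close to 1,
  it is close to the mass of the kernel.
\<close>

lemma mollified_indicator_mass:
  assumes e: "0 < e" and cube: "corner_cube x e \<subseteq> \<Omega>" and C0: "\<And>z. \<bar>mollifier (z :: real^'n)\<bar> \<le> C0"
  defines "m \<equiv> LINT y|M. indicator A y * rescale mollifier e x y"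
    and "a \<equiv> measure lebesgue (A \<inter> corner_cube x e)"
  shows "m \<le> C0 * a" "e ^ CARD('n) * mollifier_mass TYPE('n) - m \<le> C0 * (e ^ CARD('n) - a)"
proof -
  let ?q = "rescale mollifier e x" and ?C = "corner_cube x e"
  have qt: "?q \<in> test_functions \<Omega>" by (rule rescale_kernel_test[OF kernel_mollifier e cube])
  have q0: "?q y = 0" if "y \<notin> ?C" for y by (rule rescale_kernel_outside[OF kernel_mollifier e that])
  have qb: "0 \<le> ?q y" "?q y \<le> C0" for y
    using C0[of "(1 / e) *\<^sub>R (y - x)"] by (auto simp: rescale_def mollifier_nonneg)
  have bC: "bounded ?C" "?C \<in> sets lebesgue" "?C \<in> lmeasurable"
    by (auto simp: corner_cube_def bounded_cbox)
  have meas: "integrable M (indicator E :: _ \<Rightarrow> real)" "(LINT y|M. indicator E y) = measure lebesgue E"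
    if "E \<subseteq> ?C" "E \<in> sets lebesgue" for E
  proof -
    have EO: "E \<subseteq> \<Omega>" using that cube by auto
    have "E \<in> lmeasurable" using that bC by (meson bounded_set_imp_lmeasurable bounded_subset)
    then have "emeasure M E < \<infinity>"
      unfolding emeasure_lebesgue_on[OF open_\<Omega> EO] infinity_ennreal_def less_top[symmetric]
      by (rule fmeasurableD2)
    moreover have "E \<in> sets M" using that EO by (simp add: sets_lebesgue_on[OF open_\<Omega>])
    ultimately show "integrable M (indicator E :: _ \<Rightarrow> real)" by (intro integrable_real_indicator)
    show "(LINT y|M. indicator E y) = measure lebesgue E"
      using EO emeasure_lebesgue_on[OF open_\<Omega> EO] by (simp add: Int_absorb2 measure_def)
  qed
  have AC: "A \<inter> ?C \<in> sets lebesgue" "?C - A \<in> sets lebesgue" using A_sets bC by auto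
  have iA: "integrable M (\<lambda>y. indicator A y * ?q y)"
    using indicator_A_mult_integrable(3)[OF qt, of 1] by simp
  have iq: "integrable M ?q"
    using bounded_mult_test_integrable(1)[OF open_\<Omega> qt, of "\<lambda>_. 1" 1] by simp
  have "m \<le> (LINT y|M. C0 * indicator (A \<inter> ?C) y)"
    unfolding m_def
  proof (rule integral_mono[OF iA integrable_mult_right[OF meas(1)]])
    show "indicator A y * ?q y \<le> C0 * indicator (A \<inter> ?C) y" for y
      using qb[of y] q0[of y] by (cases "y \<in> ?C") (auto simp: indicator_def)
  qed (use AC in auto)
  also have "\<dots> = C0 * a" using meas(2)[of "A \<inter> ?C"] AC by (simp add: a_def)
  finally show "m \<le> C0 * a" .
  have "e ^ CARD('n) * mollifier_mass TYPE('n) - m = (LINT y|M. ?q y - indicator A y * ?q y)"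
    unfolding m_def integral_rescale_mollifier[OF open_\<Omega> e cube, symmetric]
    by (rule Bochner_Integration.integral_diff[OF iq iA, symmetric])
  also have "\<dots> \<le> (LINT y|M. C0 * indicator (?C - A) y)"
  proof (rule integral_mono[OF Bochner_Integration.integrable_diff[OF iq iA] integrable_mult_right[OF meas(1)]])
    show "?q y - indicator A y * ?q y \<le> C0 * indicator (?C - A) y" for y
      using qb[of y] q0[of y] by (cases "y \<in> ?C") (auto simp: indicator_def)
  qed (use AC in auto)
  also have "\<dots> = C0 * measure lebesgue (?C - A)" using meas(2)[of "?C - A"] AC by simp
  also have "measure lebesgue (?C - A) = e ^ CARD('n) - a"
  proof -
    have "measure lebesgue (?C - A \<inter> ?C) = measure lebesgue ?C - measure lebesgue (A \<inter> ?C)"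
      using bC AC fmeasurableD2[OF bC(3)] unfolding infinity_ennreal_def[symmetric]
      by (intro measure_Diff) blast+
    moreover have "?C - A \<inter> ?C = ?C - A" by auto
    ultimately show ?thesis using e by (simp add: a_def measure_corner_cube)
  qed
  finally show "e ^ CARD('n) * mollifier_mass TYPE('n) - m \<le> C0 * (e ^ CARD('n) - a)" .
qed

text \<open>
  By the differentiation theorem almost every point of a small ball is a point of density of \<open>A\<close> or of its
  complement.  The mollified indicator would differ by nearly the whole mass of the kernel between points of the
  two kinds, and on a small ball this is more than its Lipschitz constant allows.  So only one kind occurs.
\<close>

lemma reducing_set_locally_trivial:
  assumes x0: "x0 \<in> \<Omega>"
  shows "\<exists>r>0. ball x0 r \<subseteq> \<Omega> \<and> (negligible (A \<inter> ball x0 r) \<or> negligible (ball x0 r - A))"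
proof -
  let ?N = "real CARD('n)"
  obtain R0 where "R0 > 0" "cball x0 R0 \<subseteq> \<Omega>" using open_\<Omega> x0 open_contains_cball by blast
  then obtain R where R: "0 < R" "cball x0 (4 * R) \<subseteq> \<Omega>" using that[of "R0 / 4"] by auto
  obtain K where K: "0 \<le> K" "\<And>x x' e. x \<in> cball x0 R \<Longrightarrow> x' \<in> cball x0 R \<Longrightarrow> 0 < e \<Longrightarrow> e * ?N \<le> R \<Longrightarrow>
    \<bar>(LINT y|M. indicator A y * rescale mollifier e x' y) - (LINT y|M. indicator A y * rescale mollifier e x y)\<bar>
      \<le> K * norm (x' - x) * e ^ CARD('n)"
    by (rule mollified_indicator_lipschitz[OF R]) blast
  obtain C0 where C0: "0 \<le> C0" "\<And>z. \<bar>mollifier (z :: real^'n)\<bar> \<le> C0"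
    by (rule kernel_bounded[OF kernel_mollifier]) blast
  define J where "J = mollifier_mass TYPE('n)"
  have J: "0 < J" unfolding J_def by (rule mollifier_mass_pos)
  have "A \<inter> cbox a b \<in> lmeasurable" for a b
    using A_sets by (intro bounded_set_imp_lmeasurable) (auto intro: bounded_subset)
  then obtain N where N: "negligible N" "\<And>x h. x \<notin> N \<Longrightarrow> 0 < h \<Longrightarrow>
      \<exists>d>0. \<forall>e. 0 < e \<and> e < d \<longrightarrow>
        norm (integral (cbox x (x + e *\<^sub>R One)) (indicat_real A) /\<^sub>R e ^ DIM(real^'n) - indicat_real A x) < h"
    using integrable_ccontinuous_explicit[of "indicat_real A"] by (metis integrable_on_indicator)
  have dens: "\<exists>d>0. \<forall>e. 0 < e \<and> e < d \<longrightarrow>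
      \<bar>measure lebesgue (A \<inter> corner_cube x e) - indicator A x * e ^ CARD('n)\<bar> \<le> h * e ^ CARD('n)"
    if x: "x \<notin> N" and h: "0 < h" for x h
  proof -
    obtain d where d: "d > 0" "\<And>e. 0 < e \<Longrightarrow> e < d \<Longrightarrow>
        norm (integral (cbox x (x + e *\<^sub>R One)) (indicat_real A) /\<^sub>R e ^ DIM(real^'n) - indicat_real A x) < h"
      using N(2)[OF x h] by blast
    show ?thesis
    proof (intro exI[of _ d] conjI allI impI d(1))
      fix e assume "0 < e \<and> e < d"
      then have e: "0 < e" "e < d" by auto
      define P where "P = e ^ CARD('n)"
      have P: "0 < P" using e by (simp add: P_def)
      have "integral (cbox x (x + e *\<^sub>R One)) (indicat_real A) = measure lebesgue (A \<inter> corner_cube x e)"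
        unfolding corner_cube_def by (rule Equivalence_Lebesgue_Henstock_Integration.integral_indicator) fact
      then have "\<bar>measure lebesgue (A \<inter> corner_cube x e) / P - indicator A x\<bar> < h"
        using d(2)[OF e] by (simp add: P_def divide_inverse mult.commute)
      then have "\<bar>measure lebesgue (A \<inter> corner_cube x e) / P - indicator A x\<bar> * P \<le> h * P"
        using P by (intro mult_right_mono) auto
      moreover have "\<bar>measure lebesgue (A \<inter> corner_cube x e) / P - indicator A x\<bar> * P
          = \<bar>(measure lebesgue (A \<inter> corner_cube x e) / P - indicator A x) * P\<bar>"
        using P by (simp add: abs_mult)
      moreover have "(measure lebesgue (A \<inter> corner_cube x e) / P - indicator A x) * P
          = measure lebesgue (A \<inter> corner_cube x e) - indicator A x * P"
        using P by (simp add: left_diff_distrib)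
      ultimately show "\<bar>measure lebesgue (A \<inter> corner_cube x e) - indicator A x * e ^ CARD('n)\<bar> \<le> h * e ^ CARD('n)"
        unfolding P_def[symmetric] by (simp only:)
    qed
  qed
  \<comment> \<open>Two points of the ball of radius \<open>r\<close> have distance at most \<open>2 r\<close>, so that the mollified indicator
    varies by at most half of the mass \<open>J\<close>.\<close>
  define r where "r = min R (J / (4 * (K + 1)))"
  have r: "0 < r" "r \<le> R" "4 * K * r \<le> J"
  proof -
    show "0 < r" "r \<le> R" using R J K by (auto simp: r_def)
    have "4 * K * r \<le> 4 * K * (J / (4 * (K + 1)))" using K by (intro mult_left_mono) (auto simp: r_def)
    also have "\<dots> \<le> J" using K J by (simp add: field_simps)
    finally show "4 * K * r \<le> J" .
  qed
  have no: False if x: "x \<in> ball x0 r" "x \<in> A" "x \<notin> N" and x': "x' \<in> ball x0 r" "x' \<notin> A" "x' \<notin> N" for x x'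
  proof -
    \<comment> \<open>The two density errors use up at most a quarter of the mass.\<close>
    define h where "h = J / (8 * (C0 + 1))"
    have h: "0 < h" using J C0 by (simp add: h_def)
    have hC: "8 * (C0 * h) \<le> J" unfolding h_def using J C0 by (simp add: field_simps)
    obtain d where d: "d > 0" "\<And>e. 0 < e \<Longrightarrow> e < d \<Longrightarrow>
        \<bar>measure lebesgue (A \<inter> corner_cube x e) - e ^ CARD('n)\<bar> \<le> h * e ^ CARD('n)"
      using dens[OF x(3) h] x(2) by auto
    obtain d' where d': "d' > 0" "\<And>e. 0 < e \<Longrightarrow> e < d' \<Longrightarrow>
        \<bar>measure lebesgue (A \<inter> corner_cube x' e)\<bar> \<le> h * e ^ CARD('n)"
      using dens[OF x'(3) h] x'(2) by auto
    define e where "e = min (R / ?N) (min (d / 2) (d' / 2))"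
    have e: "0 < e" "e < d" "e < d'" using R d d' by (auto simp: e_def)
    have eR: "e * ?N \<le> R"
    proof -
      have "e * ?N \<le> R / ?N * ?N" by (intro mult_right_mono) (auto simp: e_def)
      then show ?thesis by simp
    qed
    define P where "P = e ^ CARD('n)"
    have P: "0 < P" using e by (simp add: P_def)
    have xR: "x \<in> cball x0 R" "x' \<in> cball x0 R" using x x' r by auto
    have cubes: "corner_cube z e \<subseteq> \<Omega>" if "z \<in> cball x0 R" for z
      by (rule subset_trans[OF corner_cube_subset_cball[OF eR that] subset_trans[OF subset_cball R(2)]])
        (use R in simp)
    let ?m = "\<lambda>z. LINT y|M. indicator A y * rescale mollifier e z y"
    have "P * J - ?m x \<le> C0 * (P - measure lebesgue (A \<inter> corner_cube x e))"
      using mollified_indicator_mass(2)[OF e(1) cubes[OF xR(1)] C0(2)] by (simp add: P_def J_def)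
    also have "\<dots> \<le> C0 * (h * P)" using d(2)[OF e(1,2)] C0 by (intro mult_left_mono) (auto simp: P_def)
    finally have 1: "P * J - ?m x \<le> C0 * (h * P)" .
    have "?m x' \<le> C0 * measure lebesgue (A \<inter> corner_cube x' e)"
      by (rule mollified_indicator_mass(1)[OF e(1) cubes[OF xR(2)] C0(2)])
    also have "\<dots> \<le> C0 * (h * P)" using d'(2)[OF e(1,3)] C0 by (intro mult_left_mono) (auto simp: P_def)
    finally have 2: "?m x' \<le> C0 * (h * P)" .
    have "norm (x' - x) \<le> 2 * r"
      using x(1) x'(1) dist_triangle2[of x' x x0] by (simp add: dist_norm dist_commute) (simp add: norm_minus_commute)
    then have "K * norm (x' - x) * P \<le> K * (2 * r) * P" using K(1) P r(1) by (intro mult_mono) auto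
    then have 3: "\<bar>?m x' - ?m x\<bar> \<le> K * (2 * r) * P" using K(2)[OF xR e(1) eR] by (simp add: P_def)
    have "4 * K * r * P \<le> J * P" "8 * (C0 * h) * P \<le> J * P"
      using r(3) hC P by (intro mult_right_mono; simp)+
    then have "K * (2 * r) * P \<le> J * P / 2" "C0 * (h * P) \<le> J * P / 8" by (simp_all add: mult_ac)
    with 1 2 3 have "P * J \<le> J * P / 8 + J * P / 8 + J * P / 2" by linarith
    then show False using P J by (simp add: mult.commute)
  qed
  have "A \<inter> ball x0 r \<subseteq> N \<or> ball x0 r - A \<subseteq> N" using no by blast
  then have "negligible (A \<inter> ball x0 r) \<or> negligible (ball x0 r - A)"
    using N(1) negligible_subset by blast
  moreover have "ball x0 r \<subseteq> \<Omega>"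
    by (rule subset_trans[OF ball_subset_cball subset_trans[OF subset_cball R(2)]]) (use r R in simp)
  ultimately show ?thesis using r(1) by blast
qed

end

text \<open>
  The points near which \<open>A\<close> is null and those near which its complement is null form two disjoint open sets
  that cover the domain.  Being null is a local property.
\<close>

lemma connected_imp_reducing_set_trivial:
  assumes conn: "connected \<Omega>" and A: "reducing_set A"
  shows "negligible A \<or> negligible (\<Omega> - A)"
proof -
  define U where "U = {x \<in> \<Omega>. \<exists>r>0. ball x r \<subseteq> \<Omega> \<and> negligible (A \<inter> ball x r)}"
  define V where "V = {x \<in> \<Omega>. \<exists>r>0. ball x r \<subseteq> \<Omega> \<and> negligible (ball x r - A)}"
  have op: "open {x \<in> \<Omega>. \<exists>r>0. ball x r \<subseteq> \<Omega> \<and> negligible (E (ball x r))}"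
    if mono: "\<And>B B' :: (real^'n) set. B \<subseteq> B' \<Longrightarrow> E B \<subseteq> E B'" for E
    unfolding open_contains_ball
  proof (intro ballI)
    fix x assume "x \<in> {x \<in> \<Omega>. \<exists>r>0. ball x r \<subseteq> \<Omega> \<and> negligible (E (ball x r))}"
    then obtain r where x: "x \<in> \<Omega>" "0 < r" "ball x r \<subseteq> \<Omega>" "negligible (E (ball x r))" by blast
    show "\<exists>e>0. ball x e \<subseteq> {x \<in> \<Omega>. \<exists>r>0. ball x r \<subseteq> \<Omega> \<and> negligible (E (ball x r))}"
    proof (intro exI[of _ "r / 2"] conjI)
      have "y \<in> \<Omega> \<and> (\<exists>r>0. ball y r \<subseteq> \<Omega> \<and> negligible (E (ball y r)))" if y: "y \<in> ball x (r / 2)" for y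
      proof
      have sub: "ball y (r / 2) \<subseteq> ball x r"
      proof
        fix z assume "z \<in> ball y (r / 2)"
        then show "z \<in> ball x r" using y dist_triangle[of x z y] by simp
      qed
      show "y \<in> \<Omega>" using y x by auto
      show "\<exists>r>0. ball y r \<subseteq> \<Omega> \<and> negligible (E (ball y r))"
        using sub x mono[OF sub] negligible_subset by (intro exI[of _ "r / 2"]) auto
      qed
      then show "ball x (r / 2) \<subseteq> {x \<in> \<Omega>. \<exists>r>0. ball x r \<subseteq> \<Omega> \<and> negligible (E (ball x r))}" by blast
    qed (use x in simp)
  qed
  have U: "open U" unfolding U_def by (rule op) auto
  have V: "open V" unfolding V_def by (rule op) auto
  have cover: "\<Omega> \<subseteq> U \<union> V"
  proof
    fix x assume x: "x \<in> \<Omega>"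
    then obtain r where "r > 0" "ball x r \<subseteq> \<Omega>" "negligible (A \<inter> ball x r) \<or> negligible (ball x r - A)"
      using reducing_set_locally_trivial[OF A] by blast
    then show "x \<in> U \<union> V" using x unfolding U_def V_def by blast
  qed
  have disj: "U \<inter> V = {}"
  proof (rule ccontr)
    assume "U \<inter> V \<noteq> {}"
    then obtain x r s where *: "0 < r" "negligible (A \<inter> ball x r)" "0 < s" "negligible (ball x s - A)"
      by (auto simp: U_def V_def)
    have "ball x (min r s) \<subseteq> (A \<inter> ball x r) \<union> (ball x s - A)" by auto
    then have "negligible (ball x (min r s))" using * negligible_Un negligible_subset by metis
    then show False using * open_not_negligible[of "ball x (min r s)"] by auto
  qed
  have "U \<inter> \<Omega> = {} \<or> V \<inter> \<Omega> = {}"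
  proof (rule connectedD[OF conn U V])
    show "U \<inter> V \<inter> \<Omega> = {}" using disj by simp
  qed (rule cover)
  then have VU: "V = {} \<or> U = {}" by (auto simp: U_def V_def)
  have "negligible E" if small: "\<And>x. x \<in> E \<Longrightarrow> \<exists>r>0. negligible (E \<inter> ball x r)" for E :: "(real^'n) set"
    unfolding locally_negligible_alt[of E]
  proof
    fix x assume x: "x \<in> E"
    then obtain r where r: "r > 0" "negligible (E \<inter> ball x r)" using small[OF x] by blast
    show "\<exists>U. openin (top_of_set E) U \<and> x \<in> U \<and> negligible U"
    proof (intro exI conjI)
      show "openin (top_of_set E) (E \<inter> ball x r)" by (rule openin_open_Int[OF open_ball])
      show "x \<in> E \<inter> ball x r" using x r(1) by simp
    qed (rule r(2))
  qed note loc = this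
  from VU show ?thesis
  proof
    assume "V = {}"
    then have "\<Omega> \<subseteq> U" using cover by auto
    have "negligible A"
    proof (rule loc)
      fix x assume "x \<in> A"
      then have "x \<in> U" using A_sets(3)[OF A] \<open>\<Omega> \<subseteq> U\<close> by auto
      then show "\<exists>r>0. negligible (A \<inter> ball x r)" by (auto simp: U_def)
    qed
    then show ?thesis ..
  next
    assume "U = {}"
    then have "\<Omega> \<subseteq> V" using cover by auto
    have "negligible (\<Omega> - A)"
    proof (rule loc)
      fix x assume "x \<in> \<Omega> - A"
      then have "x \<in> V" using \<open>\<Omega> \<subseteq> V\<close> by auto
      then obtain r where r: "r > 0" "negligible (ball x r - A)" by (auto simp: V_def)
      moreover have "(\<Omega> - A) \<inter> ball x r \<subseteq> ball x r - A" by auto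
      ultimately show "\<exists>r>0. negligible ((\<Omega> - A) \<inter> ball x r)" using negligible_subset by blast
    qed
    then show ?thesis ..
  qed
qed

end

section \<open>The operator of a closable form\<close>

text \<open>
  A positive form given by a symmetric operator \<open>H\<close>.  The representation \<open>a u v = (u, H v)\<close> makes the form
  closable and bilinear.
\<close>

locale operator_form =
  fixes M :: "'a measure" and D :: "('a \<Rightarrow> real) set"
    and a :: "('a \<Rightarrow> real) \<Rightarrow> ('a \<Rightarrow> real) \<Rightarrow> real" and H :: "('a \<Rightarrow> real) \<Rightarrow> 'a \<Rightarrow> real"
  assumes D_L2: "u \<in> D \<Longrightarrow> u \<in> L2 M" and H_L2: "u \<in> D \<Longrightarrow> H u \<in> L2 M"
    and D_add: "u \<in> D \<Longrightarrow> v \<in> D \<Longrightarrow> (\<lambda>x. u x + v x) \<in> D"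
    and D_scale: "u \<in> D \<Longrightarrow> (\<lambda>x. k * u x) \<in> D"
    and a_H: "u \<in> D \<Longrightarrow> v \<in> D \<Longrightarrow> a u v = l2_inner M u (H v)"
    and a_sym: "u \<in> D \<Longrightarrow> v \<in> D \<Longrightarrow> a u v = a v u"
    and a_nonneg: "u \<in> D \<Longrightarrow> 0 \<le> a u u"
begin

lemma D_diff: "u \<in> D \<Longrightarrow> v \<in> D \<Longrightarrow> (\<lambda>x. u x - v x) \<in> D"
  using D_add[OF _ D_scale, of u v "-1"] by simp

lemma a_add_left: "u \<in> D \<Longrightarrow> v \<in> D \<Longrightarrow> w \<in> D \<Longrightarrow> a (\<lambda>x. u x + v x) w = a u w + a v w"
  by (simp add: a_H D_add l2_inner_add_left D_L2 H_L2)

lemma a_diff_left: "u \<in> D \<Longrightarrow> v \<in> D \<Longrightarrow> w \<in> D \<Longrightarrow> a (\<lambda>x. u x - v x) w = a u w - a v w"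
  by (simp add: a_H D_diff l2_inner_diff_left D_L2 H_L2)

lemma a_scale_left: "u \<in> D \<Longrightarrow> w \<in> D \<Longrightarrow> a (\<lambda>x. k * u x) w = k * a u w"
  by (simp add: a_H D_scale l2_inner_scale_left)

lemma a_add_right: "u \<in> D \<Longrightarrow> v \<in> D \<Longrightarrow> w \<in> D \<Longrightarrow> a w (\<lambda>x. u x + v x) = a w u + a w v"
  using a_add_left[of u v w] a_sym[of w "\<lambda>x. u x + v x"] a_sym[of w u] a_sym[of w v] by (simp add: D_add)

lemma a_diff_right: "u \<in> D \<Longrightarrow> v \<in> D \<Longrightarrow> w \<in> D \<Longrightarrow> a w (\<lambda>x. u x - v x) = a w u - a w v"
  using a_diff_left[of u v w] a_sym[of w "\<lambda>x. u x - v x"] a_sym[of w u] a_sym[of w v] by (simp add: D_diff)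

lemma a_scale_right: "u \<in> D \<Longrightarrow> w \<in> D \<Longrightarrow> a w (\<lambda>x. k * u x) = k * a w u"
  using a_scale_left[of u w k] a_sym[of w "\<lambda>x. k * u x"] a_sym[of w u] by (simp add: D_scale)

definition energy :: "('a \<Rightarrow> real) \<Rightarrow> real" where "energy u = sqrt (a u u)"

lemma energy_nonneg: "u \<in> D \<Longrightarrow> 0 \<le> energy u"
  by (simp add: energy_def a_nonneg)

lemma energy_square: "u \<in> D \<Longrightarrow> (energy u)\<^sup>2 = a u u"
  by (simp add: energy_def a_nonneg)

lemma a_Cauchy_Schwarz:
  assumes "u \<in> D" "v \<in> D" shows "\<bar>a u v\<bar> \<le> energy u * energy v"
proof -
  have "0 \<le> a u u + 2 * t * a u v + t\<^sup>2 * a v v" for t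
  proof -
    have tv: "(\<lambda>x. t * v x) \<in> D" by (intro D_scale assms)
    have "0 \<le> a (\<lambda>x. u x + t * v x) (\<lambda>x. u x + t * v x)" by (intro a_nonneg D_add tv assms)
    also have "\<dots> = a u u + t * a u v + (t * a v u + t * (t * a v v))"
      by (simp only: a_add_left[OF assms(1) tv D_add[OF assms(1) tv]] a_add_right[OF assms(1) tv assms(1)]
          a_add_right[OF assms(1) tv tv] a_scale_left[OF assms(2,1)] a_scale_left[OF assms(2) tv]
          a_scale_right[OF assms(2,1)] a_scale_right[OF assms(2,2)])
    also have "\<dots> = a u u + 2 * t * a u v + t\<^sup>2 * a v v"
      using a_sym[OF assms] by (simp add: power2_eq_square)
    finally show ?thesis .
  qed
  then have "(a u v)\<^sup>2 \<le> a u u * a v v" by (rule quadratic_nonneg_imp_discriminant)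
  also have "\<dots> = (energy u * energy v)\<^sup>2" by (simp add: power_mult_distrib energy_square assms)
  finally have "\<bar>a u v\<bar> \<le> \<bar>energy u * energy v\<bar>" by (simp only: abs_le_square_iff)
  then show ?thesis by (simp add: energy_nonneg assms)
qed

lemma energy_add:
  assumes "u \<in> D" "v \<in> D" shows "energy (\<lambda>x. u x + v x) \<le> energy u + energy v"
proof (rule power2_le_imp_le)
  have uv: "(\<lambda>x. u x + v x) \<in> D" by (intro D_add assms)
  have "(energy (\<lambda>x. u x + v x))\<^sup>2 = a u u + a u v + (a v u + a v v)"
    by (simp only: energy_square[OF uv] a_add_left[OF assms uv] a_add_right[OF assms assms(1)]
        a_add_right[OF assms assms(2)])
  also have "\<dots> \<le> (energy u)\<^sup>2 + 2 * (energy u * energy v) + (energy v)\<^sup>2"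
    using a_Cauchy_Schwarz[OF assms] a_sym[OF assms] by (simp add: energy_square assms)
  also have "\<dots> = (energy u + energy v)\<^sup>2" by (simp add: power2_sum)
  finally show "(energy (\<lambda>x. u x + v x))\<^sup>2 \<le> (energy u + energy v)\<^sup>2" .
qed (simp add: energy_nonneg assms)

lemma energy_uminus: "u \<in> D \<Longrightarrow> energy (\<lambda>x. - u x) = energy u"
  using a_scale_left[of u "\<lambda>x. - 1 * u x" "-1"] a_scale_right[of u u "-1"] D_scale[of u "-1"]
  by (simp add: energy_def)

lemma energy_diff:
  assumes "u \<in> D" "v \<in> D" shows "energy (\<lambda>x. u x - v x) \<le> energy u + energy v"
proof -
  have "(\<lambda>x. - v x) \<in> D" using D_scale[OF assms(2), of "-1"] by simp
  from energy_add[OF assms(1) this] show ?thesis by (simp add: energy_uminus[OF assms(2)])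
qed

lemma form_approx_D: "form_approx M D a u f \<Longrightarrow> u n \<in> D"
  by (simp add: form_approx_def)

lemma form_approx_tendsto: "form_approx M D a u f \<Longrightarrow> l2_tendsto M u f sequentially"
  by (simp add: form_approx_def)

lemma form_approx_Cauchy:
  assumes "form_approx M D a u f" "0 < e"
  obtains N where "\<And>m n. N \<le> m \<Longrightarrow> N \<le> n \<Longrightarrow> energy (\<lambda>x. u m x - u n x) < e"
proof -
  have "0 < e\<^sup>2" using assms(2) by simp
  then obtain N where N: "\<And>m n. N \<le> m \<Longrightarrow> N \<le> n \<Longrightarrow> a (\<lambda>x. u m x - u n x) (\<lambda>x. u m x - u n x) < e\<^sup>2"
    using assms(1) unfolding form_approx_def by meson
  show ?thesis
  proof (rule that)
    fix m n assume "N \<le> m" "N \<le> n"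
    from real_sqrt_less_mono[OF N[OF this]] show "energy (\<lambda>x. u m x - u n x) < e"
      using assms(2) by (simp add: energy_def)
  qed
qed

lemma form_approx_bounded:
  assumes "form_approx M D a u f"
  obtains B N where "0 \<le> B" "\<And>n. N \<le> n \<Longrightarrow> energy (u n) \<le> B"
proof -
  obtain N where N: "\<And>m n. N \<le> m \<Longrightarrow> N \<le> n \<Longrightarrow> energy (\<lambda>x. u m x - u n x) < 1"
    by (rule form_approx_Cauchy[OF assms zero_less_one]) blast
  note D = form_approx_D[OF assms]
  show ?thesis
  proof (rule that)
    show "0 \<le> energy (u N) + 1" using energy_nonneg[OF D] by (simp add: add_nonneg_nonneg)
    fix n assume "N \<le> n"
    have "energy (\<lambda>x. (u n x - u N x) + u N x) \<le> energy (\<lambda>x. u n x - u N x) + energy (u N)"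
      by (intro energy_add D_diff D)
    then show "energy (u n) \<le> energy (u N) + 1" using N[OF \<open>N \<le> n\<close> order_refl] by simp
  qed
qed

lemma form_approx_diff:
  assumes u: "form_approx M D a u f" and v: "form_approx M D a v f" and f: "f \<in> L2 M"
  shows "form_approx M D a (\<lambda>n x. u n x - v n x) (\<lambda>x. 0)"
proof -
  note uD = form_approx_D[OF u] and vD = form_approx_D[OF v]
  have "l2_tendsto M (\<lambda>n x. u n x - v n x) (\<lambda>x. 0) sequentially"
    unfolding l2_tendsto_def
  proof (rule tendsto_sandwich[of "\<lambda>_. 0"])
    show "(\<lambda>n. l2_norm M (\<lambda>x. u n x - f x) + l2_norm M (\<lambda>x. v n x - f x)) \<longlonglongrightarrow> 0"
      using tendsto_add[OF form_approx_tendsto[OF u, unfolded l2_tendsto_def]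
          form_approx_tendsto[OF v, unfolded l2_tendsto_def]] by simp
    show "\<forall>\<^sub>F n in sequentially. l2_norm M (\<lambda>x. u n x - v n x - 0)
        \<le> l2_norm M (\<lambda>x. u n x - f x) + l2_norm M (\<lambda>x. v n x - f x)"
    proof (intro always_eventually allI)
      fix n
      show "l2_norm M (\<lambda>x. u n x - v n x - 0) \<le> l2_norm M (\<lambda>x. u n x - f x) + l2_norm M (\<lambda>x. v n x - f x)"
        using l2_norm_triangle[OF D_L2[OF uD[of n]] f D_L2[OF vD[of n]]]
          l2_norm_minus_commute[of M f "v n"] by simp
    qed
  qed auto
  moreover have "\<exists>N. \<forall>m\<ge>N. \<forall>n\<ge>N. a (\<lambda>x. (u m x - v m x) - (u n x - v n x))
      (\<lambda>x. (u m x - v m x) - (u n x - v n x)) < e" if e: "0 < e" for e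
  proof -
    have s: "0 < sqrt e / 2" using e by simp
    obtain N1 where N1: "\<And>m n. N1 \<le> m \<Longrightarrow> N1 \<le> n \<Longrightarrow> energy (\<lambda>x. u m x - u n x) < sqrt e / 2"
      by (rule form_approx_Cauchy[OF u s]) blast
    obtain N2 where N2: "\<And>m n. N2 \<le> m \<Longrightarrow> N2 \<le> n \<Longrightarrow> energy (\<lambda>x. v m x - v n x) < sqrt e / 2"
      by (rule form_approx_Cauchy[OF v s]) blast
    show ?thesis
    proof (intro exI[of _ "max N1 N2"] allI impI)
      fix m n assume mn: "max N1 N2 \<le> m" "max N1 N2 \<le> n"
      have "energy (\<lambda>x. (u m x - v m x) - (u n x - v n x))
          = energy (\<lambda>x. (u m x - u n x) - (v m x - v n x))" by (simp add: algebra_simps)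
      also have "\<dots> \<le> energy (\<lambda>x. u m x - u n x) + energy (\<lambda>x. v m x - v n x)"
        by (intro energy_diff D_diff uD vD)
      also have "\<dots> < sqrt e" using N1[of m n] N2[of m n] mn by simp
      finally show "a (\<lambda>x. (u m x - v m x) - (u n x - v n x)) (\<lambda>x. (u m x - v m x) - (u n x - v n x)) < e"
        unfolding energy_def by (simp only: real_sqrt_less_iff)
    qed
  qed
  ultimately show ?thesis using uD vD unfolding form_approx_def by (auto intro: D_diff)
qed

text \<open>
  Closability: \<open>a(w\<^sub>n, w\<^sub>n) = a(w\<^sub>n, w\<^sub>n - w\<^sub>m) + (w\<^sub>n, H w\<^sub>m)\<close>, where the first term is small for large \<open>m\<close> and \<open>n\<close>, and the
  second one tends to 0 for fixed \<open>m\<close>.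
\<close>

lemma form_approx_zero_energy:
  assumes w: "form_approx M D a w (\<lambda>x. 0)"
  shows "(\<lambda>n. energy (w n)) \<longlonglongrightarrow> 0"
proof -
  note wD = form_approx_D[OF w]
  obtain B N0 where B: "0 \<le> B" "\<And>n. N0 \<le> n \<Longrightarrow> energy (w n) \<le> B"
    by (rule form_approx_bounded[OF w]) blast
  have "(\<lambda>n. (energy (w n))\<^sup>2) \<longlonglongrightarrow> 0"
    unfolding LIMSEQ_iff
  proof (intro allI impI)
    fix r :: real assume r: "0 < r"
    define e where "e = r / (2 * (B + 1))"
    have e0: "0 < e" using r B(1) by (simp add: e_def)
    have "(B + 1) * e = r / 2" using B(1) by (simp add: e_def field_simps)
    then have "B * e = r / 2 - e" by (simp add: algebra_simps)
    with e0 have e: "0 < e" "B * e \<le> r / 2" by auto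
    obtain N1 where N1: "\<And>m n. N1 \<le> m \<Longrightarrow> N1 \<le> n \<Longrightarrow> energy (\<lambda>x. w m x - w n x) < e"
      by (rule form_approx_Cauchy[OF w e(1)]) blast
    define m where "m = max N0 N1"
    have "(\<lambda>n. l2_inner M (w n) (H (w m))) \<longlonglongrightarrow> l2_inner M (\<lambda>x. 0) (H (w m))"
      by (intro l2_tendsto_inner form_approx_tendsto[OF w] always_eventually allI D_L2 wD L2_zero H_L2)
    then have "\<forall>\<^sub>F n in sequentially. l2_inner M (w n) (H (w m)) < r / 2"
      using r by (intro order_tendstoD(2)) auto
    then obtain N2 where N2: "\<And>n. N2 \<le> n \<Longrightarrow> l2_inner M (w n) (H (w m)) < r / 2"
      by (auto simp: eventually_sequentially)
    show "\<exists>no. \<forall>n\<ge>no. norm ((energy (w n))\<^sup>2 - 0) < r"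
    proof (intro exI[of _ "max m N2"] allI impI)
      fix n assume n: "max m N2 \<le> n"
      have "a (w n) (w n) = a (w n) (\<lambda>x. w n x - w m x) + a (w n) (w m)"
        by (simp add: a_diff_right wD)
      moreover have "a (w n) (\<lambda>x. w n x - w m x) \<le> B * e"
      proof -
        have "a (w n) (\<lambda>x. w n x - w m x) \<le> energy (w n) * energy (\<lambda>x. w n x - w m x)"
          using a_Cauchy_Schwarz[OF wD D_diff[OF wD wD], of n n m] by linarith
        also have "\<dots> \<le> B * e"
          using n N1[of n m] by (intro mult_mono B) (auto simp: m_def less_imp_le energy_nonneg D_diff wD B(1))
        finally show ?thesis .
      qed
      moreover have "a (w n) (w m) < r / 2" using N2[of n] n by (simp add: a_H wD)
      ultimately have "a (w n) (w n) < r" using e(2) by linarith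
      then show "norm ((energy (w n))\<^sup>2 - 0) < r" by (simp add: energy_square wD a_nonneg)
    qed
  qed
  from tendsto_real_sqrt[OF this] show ?thesis by (simp add: energy_nonneg wD)
qed

lemma closure_form_limit:
  assumes u: "form_approx M D a u f" and v: "form_approx M D a v g"
    and f: "f \<in> L2 M" and g: "g \<in> L2 M"
  shows "(\<lambda>n. a (u n) (v n)) \<longlonglongrightarrow> closure_form M D a f g"
proof -
  note uD = form_approx_D[OF u] and vD = form_approx_D[OF v]
  obtain B Nu where B: "0 \<le> B" "\<And>n. Nu \<le> n \<Longrightarrow> energy (u n) \<le> B"
    by (rule form_approx_bounded[OF u]) blast
  obtain C Nv where C: "0 \<le> C" "\<And>n. Nv \<le> n \<Longrightarrow> energy (v n) \<le> C"
    by (rule form_approx_bounded[OF v]) blast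
  have "Cauchy (\<lambda>n. a (u n) (v n))"
    unfolding Cauchy_iff
  proof (intro allI impI)
    fix r :: real assume r: "0 < r"
    define e where "e = r / (B + C + 1)"
    have e0: "0 < e" using r B(1) C(1) by (simp add: e_def)
    have "(B + C + 1) * e = r" using B(1) C(1) by (simp add: e_def)
    then have "e * C + B * e = r - e" by (simp add: algebra_simps)
    with e0 have e: "0 < e" "e * C + B * e < r" by auto
    obtain N1 where N1: "\<And>m n. N1 \<le> m \<Longrightarrow> N1 \<le> n \<Longrightarrow> energy (\<lambda>x. u m x - u n x) < e"
      by (rule form_approx_Cauchy[OF u e(1)]) blast
    obtain N2 where N2: "\<And>m n. N2 \<le> m \<Longrightarrow> N2 \<le> n \<Longrightarrow> energy (\<lambda>x. v m x - v n x) < e"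
      by (rule form_approx_Cauchy[OF v e(1)]) blast
    show "\<exists>N. \<forall>m\<ge>N. \<forall>n\<ge>N. norm (a (u m) (v m) - a (u n) (v n)) < r"
    proof (intro exI[of _ "max (max N1 N2) (max Nu Nv)"] allI impI)
      fix m n assume "max (max N1 N2) (max Nu Nv) \<le> m" "max (max N1 N2) (max Nu Nv) \<le> n"
      then have mn: "N1 \<le> m" "N1 \<le> n" "N2 \<le> m" "N2 \<le> n" "Nu \<le> n" "Nv \<le> m" by auto
      have "a (u m) (v m) - a (u n) (v n)
          = a (\<lambda>x. u m x - u n x) (v m) + a (u n) (\<lambda>x. v m x - v n x)"
        by (simp add: a_diff_left a_diff_right uD vD)
      moreover have "\<bar>a (\<lambda>x. u m x - u n x) (v m)\<bar> \<le> e * C"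
      proof (rule order_trans[OF a_Cauchy_Schwarz[OF D_diff[OF uD uD] vD]])
        show "energy (\<lambda>x. u m x - u n x) * energy (v m) \<le> e * C"
          using N1[OF mn(1,2)] C(2)[OF mn(6)] e(1) by (intro mult_mono) (auto simp: energy_nonneg vD)
      qed
      moreover have "\<bar>a (u n) (\<lambda>x. v m x - v n x)\<bar> \<le> B * e"
      proof (rule order_trans[OF a_Cauchy_Schwarz[OF uD D_diff[OF vD vD]]])
        show "energy (u n) * energy (\<lambda>x. v m x - v n x) \<le> B * e"
          using N2[OF mn(3,4)] B(2)[OF mn(5)] B(1) by (intro mult_mono) (auto simp: energy_nonneg vD D_diff)
      qed
      ultimately show "norm (a (u m) (v m) - a (u n) (v n)) < r" using e(2) by simp
    qed
  qed
  then obtain l where l: "(\<lambda>n. a (u n) (v n)) \<longlonglongrightarrow> l" by (auto simp: Cauchy_convergent_iff convergent_def)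
  have all: "(\<lambda>n. a (u' n) (v' n)) \<longlonglongrightarrow> l"
    if u': "form_approx M D a u' f" and v': "form_approx M D a v' g" for u' v'
  proof -
    note u'D = form_approx_D[OF u'] and v'D = form_approx_D[OF v']
    obtain B' Nu' where B': "0 \<le> B'" "\<And>n. Nu' \<le> n \<Longrightarrow> energy (u' n) \<le> B'"
      by (rule form_approx_bounded[OF u']) blast
    have E1: "(\<lambda>n. energy (\<lambda>x. u' n x - u n x)) \<longlonglongrightarrow> 0"
      by (rule form_approx_zero_energy[OF form_approx_diff[OF u' u f]])
    have E2: "(\<lambda>n. energy (\<lambda>x. v' n x - v n x)) \<longlonglongrightarrow> 0"
      by (rule form_approx_zero_energy[OF form_approx_diff[OF v' v g]])
    have "(\<lambda>n. a (u' n) (v' n) - a (u n) (v n)) \<longlonglongrightarrow> 0"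
    proof (rule Lim_null_comparison)
      show "(\<lambda>n. energy (\<lambda>x. u' n x - u n x) * C + B' * energy (\<lambda>x. v' n x - v n x)) \<longlonglongrightarrow> 0"
        using tendsto_add[OF tendsto_mult_right[OF E1, of C] tendsto_mult_left[OF E2, of B']] by simp
      show "\<forall>\<^sub>F n in sequentially. norm (a (u' n) (v' n) - a (u n) (v n))
          \<le> energy (\<lambda>x. u' n x - u n x) * C + B' * energy (\<lambda>x. v' n x - v n x)"
        using eventually_ge_at_top[of "max Nv Nu'"]
      proof eventually_elim
        case (elim n)
        have "a (u' n) (v' n) - a (u n) (v n)
            = a (\<lambda>x. u' n x - u n x) (v n) + a (u' n) (\<lambda>x. v' n x - v n x)"
          by (simp add: a_diff_left a_diff_right uD vD u'D v'D)
        moreover have "\<bar>a (\<lambda>x. u' n x - u n x) (v n)\<bar> \<le> energy (\<lambda>x. u' n x - u n x) * C"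
          by (rule order_trans[OF a_Cauchy_Schwarz[OF D_diff[OF u'D uD] vD]])
            (use elim in \<open>intro mult_left_mono C(2) energy_nonneg D_diff u'D uD; simp\<close>)
        moreover have "\<bar>a (u' n) (\<lambda>x. v' n x - v n x)\<bar> \<le> B' * energy (\<lambda>x. v' n x - v n x)"
          by (rule order_trans[OF a_Cauchy_Schwarz[OF u'D D_diff[OF v'D vD]]])
            (use elim in \<open>intro mult_right_mono B'(2) energy_nonneg D_diff v'D vD; simp\<close>)
        ultimately show ?case by simp
      qed
    qed
    from tendsto_add[OF this l] show ?thesis by simp
  qed
  have "closure_form M D a f g = l"
    unfolding closure_form_def
  proof (rule the_equality)
    show "\<forall>u v. form_approx M D a u f \<and> form_approx M D a v g \<longrightarrow> (\<lambda>n. a (u n) (v n)) \<longlonglongrightarrow> l"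
      using all by blast
    fix r assume "\<forall>u v. form_approx M D a u f \<and> form_approx M D a v g \<longrightarrow> (\<lambda>n. a (u n) (v n)) \<longlonglongrightarrow> r"
    then have "(\<lambda>n. a (u n) (v n)) \<longlonglongrightarrow> r" using u v by blast
    then show "r = l" using l LIMSEQ_unique by blast
  qed
  then show ?thesis using l by simp
qed

lemma form_approx_const: "v \<in> D \<Longrightarrow> form_approx M D a (\<lambda>n. v) v"
  using a_scale_left[of v "\<lambda>x. 0 * v x" 0] D_scale[of v 0]
  by (simp add: form_approx_def l2_tendsto_def)

definition form_op :: "(('a \<Rightarrow> real) \<times> ('a \<Rightarrow> real)) set" where
  "form_op = form_operator M (closure_form_domain M D a) (closure_form M D a)"

lemma form_op_L2: "(f, k) \<in> form_op \<Longrightarrow> f \<in> L2 M" "(f, k) \<in> form_op \<Longrightarrow> k \<in> L2 M"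
  by (auto simp: form_op_def form_operator_def closure_form_domain_def)

lemma D_in_domain: "v \<in> D \<Longrightarrow> v \<in> closure_form_domain M D a"
  using form_approx_const D_L2 by (auto simp: closure_form_domain_def)

lemma form_op_approx:
  assumes "(f, k) \<in> form_op" "form_approx M D a u f" "v \<in> D"
  shows "(\<lambda>n. a (u n) v) \<longlonglongrightarrow> l2_inner M k v"
proof -
  have "closure_form M D a f v = l2_inner M k v"
    using assms(1) D_in_domain[OF assms(3)] by (auto simp: form_op_def form_operator_def)
  then show ?thesis
    using closure_form_limit[OF assms(2) form_approx_const[OF assms(3)] form_op_L2(1)[OF assms(1)] D_L2[OF assms(3)]]
    by simp
qed

lemma D_H_in_form_op:
  assumes "v \<in> D" shows "(v, H v) \<in> form_op"
  unfolding form_op_def form_operator_def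
proof (intro CollectI case_prodI conjI ballI)
  show "v \<in> closure_form_domain M D a" by (rule D_in_domain[OF assms])
  show "H v \<in> L2 M" by (rule H_L2[OF assms])
  fix w assume "w \<in> closure_form_domain M D a"
  then obtain u where w: "w \<in> L2 M" and u: "form_approx M D a u w" by (auto simp: closure_form_domain_def)
  have "(\<lambda>n. a v (u n)) \<longlonglongrightarrow> closure_form M D a v w"
    by (rule closure_form_limit[OF form_approx_const[OF assms] u D_L2[OF assms] w])
  moreover have "(\<lambda>n. l2_inner M (u n) (H v)) \<longlonglongrightarrow> l2_inner M w (H v)"
    by (intro l2_tendsto_inner form_approx_tendsto[OF u] always_eventually allI D_L2 form_approx_D[OF u] w H_L2 assms)
  moreover have "a v (u n) = l2_inner M (u n) (H v)" for n
    using a_sym[OF assms form_approx_D[OF u]] a_H[OF form_approx_D[OF u] assms] by simp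
  ultimately have "closure_form M D a v w = l2_inner M w (H v)" using LIMSEQ_unique by simp
  then show "closure_form M D a v w = l2_inner M (H v) w" by (simp only: l2_inner_commute[of M w "H v"])
qed

lemma form_op_symmetric:
  assumes "(f, f') \<in> form_op" "(g, g') \<in> form_op"
  shows "l2_inner M f' g = l2_inner M f g'"
proof -
  have fd: "f \<in> closure_form_domain M D a" "g \<in> closure_form_domain M D a"
    using assms by (auto simp: form_op_def form_operator_def)
  then obtain u v where u: "form_approx M D a u f" and v: "form_approx M D a v g"
    by (auto simp: closure_form_domain_def)
  note L = form_op_L2(1)[OF assms(1)] form_op_L2(1)[OF assms(2)]
  have "(\<lambda>n. a (u n) (v n)) \<longlonglongrightarrow> closure_form M D a f g" by (rule closure_form_limit[OF u v L])
  moreover have "(\<lambda>n. a (u n) (v n)) \<longlonglongrightarrow> closure_form M D a g f"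
    using closure_form_limit[OF v u L(2,1)] a_sym[OF form_approx_D[OF u] form_approx_D[OF v]] by simp
  ultimately have "closure_form M D a f g = closure_form M D a g f" using LIMSEQ_unique by blast
  moreover have "closure_form M D a f g = l2_inner M f' g" "closure_form M D a g f = l2_inner M g' f"
    using assms fd by (auto simp: form_op_def form_operator_def)
  ultimately show ?thesis by (metis l2_inner_commute)
qed

text \<open>
  Transfers a monotonicity property of the form to its operator.  The pairing with \<open>Q f\<close> is
  read off from an approximating sequence: \<open>(k, Q (u n))\<close> is the limit of \<open>a (u m) (Q (u n))\<close> as \<open>m\<close> tends to infinity, and it differs
  little from \<open>a (u n) (Q (u n)) \<ge> 0\<close> because \<open>Q\<close> is bounded in energy along the sequence.
\<close>

lemma form_op_accretive:
  assumes fk: "(f, k) \<in> form_op"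
    and Q: "\<And>u. u \<in> D \<Longrightarrow> Q u \<in> D" and QL: "Q f \<in> L2 M"
    and pos: "\<And>u. u \<in> D \<Longrightarrow> 0 \<le> a u (Q u)"
    and contr: "\<And>u. u \<in> D \<Longrightarrow> energy (Q u) \<le> C * energy u" and C: "0 \<le> C"
    and lip: "\<And>u. u \<in> D \<Longrightarrow> l2_norm M (\<lambda>x. Q u x - Q f x) \<le> L * l2_norm M (\<lambda>x. u x - f x)"
  shows "0 \<le> l2_inner M k (Q f)"
proof -
  note fL = form_op_L2[OF fk]
  obtain u where u: "form_approx M D a u f"
    using fk by (auto simp: form_op_def form_operator_def closure_form_domain_def)
  note uD = form_approx_D[OF u]
  obtain B N0 where B: "0 \<le> B" "\<And>n. N0 \<le> n \<Longrightarrow> energy (u n) \<le> B"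
    by (rule form_approx_bounded[OF u]) blast
  have "l2_tendsto M (\<lambda>n. Q (u n)) (Q f) sequentially"
    by (rule l2_tendsto_squeeze[OF form_approx_tendsto[OF u] always_eventually]) (use lip uD in blast)
  then have lim: "(\<lambda>n. l2_inner M (Q (u n)) k) \<longlonglongrightarrow> l2_inner M (Q f) k"
    by (intro l2_tendsto_inner always_eventually allI D_L2 Q uD QL fL)
  have low: "- (e * (C * B)) \<le> l2_inner M (Q f) k" if e: "0 < e" for e
  proof -
    obtain N1 where N1: "\<And>m n. N1 \<le> m \<Longrightarrow> N1 \<le> n \<Longrightarrow> energy (\<lambda>x. u m x - u n x) < e"
      by (rule form_approx_Cauchy[OF u e]) blast
    have "- (e * (C * B)) \<le> l2_inner M (Q (u n)) k" if n: "max N0 N1 \<le> n" for n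
    proof -
      have Qn: "Q (u n) \<in> D" by (rule Q[OF uD])
      have "energy (Q (u n)) \<le> C * energy (u n)" by (rule contr[OF uD])
      also have "\<dots> \<le> C * B" using B(2)[of n] n C by (intro mult_left_mono) auto
      finally have En: "energy (Q (u n)) \<le> C * B" .
      have "- (e * (C * B)) \<le> a (u m) (Q (u n))" if m: "N1 \<le> m" for m
      proof -
        have "a (u m) (Q (u n)) = a (u n) (Q (u n)) + a (\<lambda>x. u m x - u n x) (Q (u n))"
          by (simp add: a_diff_left uD Qn)
        moreover have "\<bar>a (\<lambda>x. u m x - u n x) (Q (u n))\<bar> \<le> e * (C * B)"
        proof (rule order_trans[OF a_Cauchy_Schwarz[OF D_diff[OF uD uD] Qn]])
          show "energy (\<lambda>x. u m x - u n x) * energy (Q (u n)) \<le> e * (C * B)"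
            using N1[OF m, of n] n En e by (intro mult_mono) (auto simp: energy_nonneg Qn)
        qed
        ultimately show ?thesis using pos[OF uD, of n] by linarith
      qed
      then have "- (e * (C * B)) \<le> l2_inner M k (Q (u n))"
        by (intro LIMSEQ_le_const[OF form_op_approx[OF fk u Qn]]) blast
      then show ?thesis by (simp only: l2_inner_commute[of M k])
    qed
    then show ?thesis by (intro LIMSEQ_le_const[OF lim]) blast
  qed
  have "0 \<le> l2_inner M (Q f) k"
  proof (rule field_le_epsilon)
    fix d :: real assume d: "0 < d"
    define t where "t = d / (C * B + 1)"
    have CB: "0 < C * B + 1" using C B(1) by (simp add: add_nonneg_pos)
    have t: "0 < t" using d CB by (simp add: t_def)
    have "t * (C * B + 1) = d" using CB by (simp add: t_def)
    then have "t * (C * B) = d - t" by (simp add: distrib_left)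
    then show "0 \<le> l2_inner M (Q f) k + d" using low[OF t] t by linarith
  qed
  then show ?thesis by (simp only: l2_inner_commute[of M k])
qed

end

context elliptic_coefficients
begin

section \<open>The elliptic form and the Friedrichs extension\<close>

definition gradient_form :: "(real^'n \<Rightarrow> real) \<Rightarrow> (real^'n \<Rightarrow> real) \<Rightarrow> real^'n \<Rightarrow> real" where
  "gradient_form u v x = (\<Sum>i\<in>UNIV. \<Sum>j\<in>UNIV. c x $ i $ j * partial_deriv i u x * partial_deriv j v x)"

lemma gradient_term_integrable:
  assumes "u \<in> test_functions \<Omega>" "v \<in> test_functions \<Omega>"
  shows "integrable M (\<lambda>x. c x $ i $ j * partial_deriv i u x * partial_deriv j v x)"
  using c_mult_test(1)[OF test_functions_mult[OF test_functions_partial[OF assms(1)]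
      test_functions_smooth[OF test_functions_partial[OF assms(2)]]]]
  by (simp add: mult.assoc)

lemma gradient_form_integrable:
  "u \<in> test_functions \<Omega> \<Longrightarrow> v \<in> test_functions \<Omega> \<Longrightarrow> integrable M (gradient_form u v)"
  unfolding gradient_form_def[abs_def]
  by (intro Bochner_Integration.integrable_sum gradient_term_integrable)

lemma elliptic_form_eq:
  assumes "u \<in> test_functions \<Omega>" "v \<in> test_functions \<Omega>"
  shows "elliptic_form \<Omega> c u v = (LINT x|M. gradient_form u v x)"
  unfolding elliptic_form_def gradient_form_def
  by (simp add: Bochner_Integration.integral_sum Bochner_Integration.integrable_sum
      gradient_term_integrable[OF assms])

lemma gradient_form_nonneg:
  assumes "x \<in> \<Omega>" shows "0 \<le> gradient_form u u x"
proof -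
  let ?v = "\<chi> i. partial_deriv i u x"
  have "gradient_form u u x = ?v \<bullet> (c x *v ?v)"
    by (simp add: gradient_form_def inner_vec_def matrix_vector_mult_def sum_distrib_left mult_ac)
  also have "\<dots> \<ge> 0" using c_pos[OF assms, of ?v] by (cases "?v = 0") auto
  finally show ?thesis .
qed

lemma elliptic_form_ell:
  assumes u: "u \<in> test_functions \<Omega>" and v: "v \<in> test_functions \<Omega>"
  shows "elliptic_form \<Omega> c u v = l2_inner M u (ell v)"
proof -
  let ?t = "\<lambda>i j x. c x $ i $ j * partial_deriv i (partial_deriv j v) x + g i i j x * partial_deriv j v x"
  have tL: "?t i j \<in> L2 M" for i j
    by (intro L2_add c_mult_test g_mult_test test_functions_partial v)
  have "elliptic_form \<Omega> c u v = (\<Sum>i\<in>UNIV. \<Sum>j\<in>UNIV. - (LINT x|M. ?t i j x * u x))"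
    unfolding elliptic_form_def
  proof (intro sum.cong refl)
    fix i j
    have "(LINT x|M. c x $ i $ j * partial_deriv i u x * partial_deriv j v x)
        = (LINT x|M. c x $ i $ j * partial_deriv j v x * partial_deriv i u x)" by (simp add: mult_ac)
    also have "\<dots> = - (LINT x|M. ?t i j x * u x)"
      by (rule coefficient_integration_by_parts[OF u test_functions_partial[OF v]])
    finally show "(LINT x|M. c x $ i $ j * partial_deriv i u x * partial_deriv j v x) = - (LINT x|M. ?t i j x * u x)" .
  qed
  also have "\<dots> = - (LINT x|M. (\<Sum>i\<in>UNIV. \<Sum>j\<in>UNIV. ?t i j x * u x))"
    using L2_integrable_mult[OF tL test_functions_L2[OF u open_\<Omega>]]
    by (simp only: Bochner_Integration.integral_sum Bochner_Integration.integrable_sum sum_negf)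
  also have "\<dots> = l2_inner M u (ell v)"
    by (simp add: l2_inner_def ell_def sum_distrib_left sum_distrib_right mult.commute)
  finally show ?thesis .
qed

lemma elliptic_form_sym:
  assumes u: "u \<in> test_functions \<Omega>" and v: "v \<in> test_functions \<Omega>"
  shows "elliptic_form \<Omega> c u v = elliptic_form \<Omega> c v u"
  unfolding elliptic_form_eq[OF u v] elliptic_form_eq[OF v u]
proof (rule Bochner_Integration.integral_cong[OF refl])
  fix x assume "x \<in> space M"
  then have x: "x \<in> \<Omega>" by simp
  show "gradient_form u v x = gradient_form v u x"
    unfolding gradient_form_def
    by (subst sum.swap) (intro sum.cong refl, simp add: c_sym[OF x] mult_ac)
qed

sublocale form: operator_form M "test_functions \<Omega>" "elliptic_form \<Omega> c" ell
proof
  show "0 \<le> elliptic_form \<Omega> c u u" if "u \<in> test_functions \<Omega>" for u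
    unfolding elliptic_form_eq[OF that that]
    by (intro integral_nonneg_AE) (use AE_space in eventually_elim, simp add: gradient_form_nonneg)
qed (auto intro: test_functions_L2[OF _ open_\<Omega>] ell_L2 test_functions_add test_functions_scale
      elliptic_form_ell elliptic_form_sym)

lemma friedrichs_eq: "friedrichs_extension \<Omega> c = form.form_op"
  by (simp add: friedrichs_extension_def form.form_op_def)

lemma friedrichs_densely_defined: "densely_defined M (friedrichs_extension \<Omega> c)"
  unfolding densely_defined_def friedrichs_eq
proof
  fix f assume "f \<in> L2 M"
  from test_functions_dense[OF open_\<Omega> this]
  obtain u where u: "\<And>n. u n \<in> test_functions \<Omega>" "l2_tendsto M u f sequentially" by blast
  then show "\<exists>u. (\<forall>n. u n \<in> Domain form.form_op \<inter> L2 M) \<and> l2_tendsto M u f sequentially"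
    using form.D_H_in_form_op form.D_L2 by (intro exI[of _ u]) blast
qed

section \<open>Positivity\<close>

text \<open>
  An increasing smooth function with root at 0 and bounded slope.  Its rescalings \<open>root_shift (n s) / n\<close> tend to
  \<open>s - \<bar>s\<bar>\<close>, minus twice the negative part.
\<close>

definition root_shift :: "real \<Rightarrow> real" where
  "root_shift s = s - (s\<^sup>2 + 1) powr (1 / 2) + 1"

lemma root_shift_deriv:
  obtains P' where "\<And>s. (root_shift has_real_derivative P' s) (at s)" "\<And>s. 0 \<le> P' s" "\<And>s. P' s \<le> 2"
proof (rule that[of "\<lambda>s. 1 - s * (s\<^sup>2 + 1) powr (- 1 / 2)"])
  fix s :: real
  have p: "0 < s\<^sup>2 + 1" using zero_le_power2[of s] by linarith
  show "(root_shift has_real_derivative (1 - s * (s\<^sup>2 + 1) powr (- 1 / 2))) (at s)"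
    unfolding root_shift_def[abs_def] using p
    by (auto intro!: derivative_eq_intros simp: powr_diff powr_minus_divide powr_half_sqrt field_simps)
  have "s * (s\<^sup>2 + 1) powr (- 1 / 2) = s / sqrt (s\<^sup>2 + 1)"
    using p by (simp add: powr_minus_divide powr_half_sqrt)
  moreover have "\<bar>s\<bar> \<le> sqrt (s\<^sup>2 + 1)" by (rule real_le_rsqrt) simp
  ultimately have "\<bar>s * (s\<^sup>2 + 1) powr (- 1 / 2)\<bar> \<le> 1" using p by (simp add: abs_divide)
  then show "0 \<le> 1 - s * (s\<^sup>2 + 1) powr (- 1 / 2)" "1 - s * (s\<^sup>2 + 1) powr (- 1 / 2) \<le> 2" by linarith+
qed

lemma root_shift_lipschitz: "\<bar>root_shift s - root_shift t\<bar> \<le> 2 * \<bar>s - t\<bar>"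
proof -
  obtain P' where P': "\<And>s. (root_shift has_real_derivative P' s) (at s)" "\<And>s. 0 \<le> P' s" "\<And>s. P' s \<le> 2"
    by (rule root_shift_deriv) blast
  have "norm (root_shift s - root_shift t) \<le> 2 * norm (s - t)"
    by (rule field_differentiable_bound[of UNIV root_shift P'])
      (use P' in \<open>auto simp: abs_le_iff intro: order_trans[of _ 0]\<close>)
  then show ?thesis by simp
qed

lemma root_shift_0: "root_shift 0 = 0" by (simp add: root_shift_def)

lemma smooth1_root_shift: "smooth1 root_shift"
proof -
  have "smooth1 (\<lambda>s. (s + (- 1) * (s\<^sup>2 + 1) powr (1 / 2)) + 1)" by (intro smooth1.intros)
  then show ?thesis by (simp add: root_shift_def[abs_def])
qed

lemma root_shift_scaled_limit: "(\<lambda>n. root_shift (real (Suc n) * s) / real (Suc n)) \<longlonglongrightarrow> s - \<bar>s\<bar>"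
proof -
  have eq: "root_shift (real (Suc n) * s) / real (Suc n) = s - sqrt (s\<^sup>2 + (1 / real (Suc n))\<^sup>2) + 1 / real (Suc n)" for n
  proof -
    let ?N = "real (Suc n)"
    have N: "?N > 0" by simp
    have p: "0 < (?N * s)\<^sup>2 + 1" using zero_le_power2[of "?N * s"] by linarith
    have "sqrt ((?N * s)\<^sup>2 + 1) / ?N = sqrt (((?N * s)\<^sup>2 + 1) / ?N\<^sup>2)"
      using N by (simp add: real_sqrt_divide)
    also have "((?N * s)\<^sup>2 + 1) / ?N\<^sup>2 = s\<^sup>2 + (1 / ?N)\<^sup>2"
      using N by (simp add: add_divide_distrib power_mult_distrib power_divide)
    finally have "sqrt ((?N * s)\<^sup>2 + 1) / ?N = sqrt (s\<^sup>2 + (1 / ?N)\<^sup>2)" .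
    moreover have "root_shift (?N * s) / ?N = s - sqrt ((?N * s)\<^sup>2 + 1) / ?N + 1 / ?N"
      unfolding root_shift_def using p N
      by (simp add: powr_half_sqrt add_divide_distrib diff_divide_distrib del: of_nat_Suc)
    ultimately show ?thesis by simp
  qed
  have z: "(\<lambda>n. 1 / real (Suc n)) \<longlonglongrightarrow> 0"
    using LIMSEQ_inverse_real_of_nat by (simp add: inverse_eq_divide)
  have "(\<lambda>n. s - sqrt (s\<^sup>2 + (1 / real (Suc n))\<^sup>2) + 1 / real (Suc n)) \<longlonglongrightarrow> s - sqrt (s\<^sup>2 + 0\<^sup>2) + 0"
    by (intro tendsto_intros z)
  then show ?thesis unfolding eq by simp
qed

text \<open>
  In the form, \<open>(u, p(u))\<close> equals the integral of \<open>p'(u) \<Sum> c\<^sub>i\<^sub>j \<partial>\<^sub>i u \<partial>\<^sub>j u \<ge> 0\<close> for smooth increasing \<open>p\<close> and test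
  functions \<open>u\<close>; approximate \<open>s - \<bar>s\<bar>\<close> by such \<open>p\<close>.
\<close>

lemma friedrichs_negative_part:
  assumes fk: "(f, k) \<in> friedrichs_extension \<Omega> c"
  shows "0 \<le> l2_inner M (\<lambda>x. f x - \<bar>f x\<bar>) k"
proof -
  have fk': "(f, k) \<in> form.form_op" using fk by (simp add: friedrichs_eq)
  note fL = form.form_op_L2[OF fk']
  obtain P' where P': "\<And>s. (root_shift has_real_derivative P' s) (at s)" "\<And>s. 0 \<le> P' s" "\<And>s. P' s \<le> 2"
    by (rule root_shift_deriv) blast
  define Q where "Q = (\<lambda>n (u :: real^'n \<Rightarrow> real) x. root_shift (real (Suc n) * u x) / real (Suc n))"
  have Qlip: "\<bar>Q n u x - Q n v x\<bar> \<le> 2 * \<bar>u x - v x\<bar>" for n u v x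
  proof -
    have "\<bar>root_shift (real (Suc n) * u x) - root_shift (real (Suc n) * v x)\<bar>
        \<le> 2 * \<bar>real (Suc n) * u x - real (Suc n) * v x\<bar>" by (rule root_shift_lipschitz)
    also have "\<dots> = real (Suc n) * (2 * \<bar>u x - v x\<bar>)"
      by (simp add: right_diff_distrib[symmetric] abs_mult del: of_nat_Suc)
    finally show ?thesis
      by (simp add: Q_def diff_divide_distrib[symmetric] abs_divide pos_divide_le_eq mult.commute del: of_nat_Suc)
  qed
  have Q0: "\<bar>Q n u x\<bar> \<le> 2 * \<bar>u x\<bar>" for n u x
    using Qlip[of n u x "\<lambda>_. 0"] by (simp add: Q_def root_shift_0)
  have rm: "root_shift \<in> borel_measurable borel"
    using P'(1) by (intro borel_measurable_continuous_onI continuous_at_imp_continuous_on)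
      (auto intro: DERIV_isCont)
  have Qm: "Q n u \<in> borel_measurable M" if "u \<in> borel_measurable M" for n u
    unfolding Q_def using that rm by (intro borel_measurable_divide measurable_compose[OF _ rm]) auto
  have QL: "Q n u \<in> L2 M" if "u \<in> L2 M" for n u
    by (rule L2_dominated[OF L2_scale[OF that, of 2] Qm[OF L2_measurable[OF that]]]) (use Q0 in \<open>auto simp: abs_mult\<close>)
  have Qt: "Q n u \<in> test_functions \<Omega>" if "u \<in> test_functions \<Omega>" for n u
    using test_functions_scale[OF test_functions_comp[OF test_functions_scale[OF that, of "real (Suc n)"]
        smooth1_root_shift root_shift_0], of "1 / real (Suc n)"]
    by (simp add: Q_def)
  have Qd: "partial_deriv i (Q n u) x = P' (real (Suc n) * u x) * partial_deriv i u x"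
    if "u \<in> test_functions \<Omega>" for i n u x
  proof -
    have "((\<lambda>s. root_shift (real (Suc n) * s) / real (Suc n)) has_real_derivative P' (real (Suc n) * u x)) (at (u x))"
      by (rule DERIV_cong[OF DERIV_cdivide[OF DERIV_chain2[OF P'(1) DERIV_cmult_Id]]]) simp
    from partial_deriv_comp(2)[OF test_functions_differentiable[OF that] this]
    show ?thesis by (simp add: Q_def)
  qed
  have "0 \<le> l2_inner M k (Q n f)" for n
  proof (rule form.form_op_accretive[OF fk', where C = 2 and L = 2])
    fix u assume u: "u \<in> test_functions \<Omega>"
    show "Q n u \<in> test_functions \<Omega>" by (rule Qt[OF u])
    have "gradient_form u (Q n u) x = P' (real (Suc n) * u x) * gradient_form u u x" for x
      unfolding gradient_form_def Qd[OF u] sum_distrib_left by (simp only: mult_ac)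
    then show "0 \<le> elliptic_form \<Omega> c u (Q n u)"
      unfolding elliptic_form_eq[OF u Qt[OF u]]
      by (intro integral_nonneg_AE)
        (use AE_space in eventually_elim, simp add: gradient_form_nonneg P'(2))
    have g2: "gradient_form (Q n u) (Q n u) x = (P' (real (Suc n) * u x))\<^sup>2 * gradient_form u u x" for x
      unfolding gradient_form_def Qd[OF u] sum_distrib_left by (simp only: mult_ac power2_eq_square)
    have "elliptic_form \<Omega> c (Q n u) (Q n u) \<le> (LINT x|M. 2\<^sup>2 * gradient_form u u x)"
      unfolding elliptic_form_eq[OF Qt[OF u] Qt[OF u]]
    proof (rule integral_mono[OF gradient_form_integrable[OF Qt[OF u] Qt[OF u]]
          integrable_mult_right[OF gradient_form_integrable[OF u u]]])
      fix x assume "x \<in> space M"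
      then show "gradient_form (Q n u) (Q n u) x \<le> 2\<^sup>2 * gradient_form u u x"
        unfolding g2 by (intro mult_right_mono power_mono P' gradient_form_nonneg) auto
    qed
    also have "\<dots> = 2\<^sup>2 * elliptic_form \<Omega> c u u" by (simp add: elliptic_form_eq[OF u u])
    finally have "sqrt (elliptic_form \<Omega> c (Q n u) (Q n u)) \<le> sqrt (2\<^sup>2 * elliptic_form \<Omega> c u u)"
      by (rule real_sqrt_le_mono)
    then show "form.energy (Q n u) \<le> 2 * form.energy u"
      unfolding form.energy_def real_sqrt_mult real_sqrt_abs by simp
    have uL: "u \<in> L2 M" by (rule form.D_L2[OF u])
    have "\<bar>Q n u x - Q n f x\<bar> \<le> \<bar>2 * (u x - f x)\<bar>" for x
      unfolding abs_mult abs_numeral by (rule Qlip)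
    then have "l2_norm M (\<lambda>x. Q n u x - Q n f x) \<le> l2_norm M (\<lambda>x. 2 * (u x - f x))"
      by (intro l2_norm_mono_AE L2_scale L2_diff uL fL borel_measurable_diff Qm L2_measurable
          always_eventually allI)
    then show "l2_norm M (\<lambda>x. Q n u x - Q n f x) \<le> 2 * l2_norm M (\<lambda>x. u x - f x)"
      by (simp only: l2_norm_scale abs_numeral)
  qed (use QL fL in auto)
  then have nn: "0 \<le> l2_inner M (Q n f) k" for n by (simp only: l2_inner_commute[of M "Q n f"])
  have f2: "(\<lambda>x. 2 * f x) \<in> L2 M" by (rule L2_scale[OF fL(1)])
  have mm: "(\<lambda>x. f x - \<bar>f x\<bar>) \<in> borel_measurable M" using fL(1) by (auto simp: L2_def)
  note lim = l2_tendsto_dominated[of "\<lambda>n. Q n f" M "\<lambda>x. f x - \<bar>f x\<bar>" "\<lambda>x. 2 * f x",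
      OF Qm[OF L2_measurable[OF fL(1)]] mm f2]
  have "(\<lambda>n. l2_inner M (Q n f) k) \<longlonglongrightarrow> l2_inner M (\<lambda>x. f x - \<bar>f x\<bar>) k"
  proof (intro l2_tendsto_inner lim always_eventually allI QL fL)
    show "(\<lambda>n. Q n f x) \<longlonglongrightarrow> f x - \<bar>f x\<bar>" for x
      unfolding Q_def by (rule root_shift_scaled_limit)
    then show "(\<lambda>n. Q n f x) \<longlonglongrightarrow> f x - \<bar>f x\<bar>" for x .
  qed (use Q0 in \<open>auto simp: abs_mult\<close>)
  then show ?thesis by (rule LIMSEQ_le_const) (use nn in blast)
qed

text \<open>
  The norm of the negative part decreases along orbits that start at a test function.  By density it does so along all
  orbits, since the negative part is a contraction in \<open>L\<^sub>2\<close>.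
\<close>

lemma friedrichs_semigroup_positive:
  assumes G: "generates M (friedrichs_extension \<Omega> c) S"
  shows "positive_semigroup M S"
  unfolding positive_semigroup_def
proof (intro allI impI ballI)
  interpret G: l2_generator M "friedrichs_extension \<Omega> c" S by unfold_locales (rule G)
  fix t :: real and f assume "0 < t" and f: "f \<in> L2 M" and f0: "AE x in M. 0 \<le> f x"
  then have t: "0 \<le> t" by simp
  define N where "N = (\<lambda>(u :: real^'n \<Rightarrow> real) x. min (u x) 0)"
  have NL: "N u \<in> L2 M" if "u \<in> L2 M" for u
    by (rule L2_dominated[OF that]) (use that in \<open>auto simp: N_def L2_def\<close>)
  have Nle: "l2_norm M (N (S t u)) \<le> l2_norm M (N u)" if u: "u \<in> test_functions \<Omega>" for u
  proof -
    have uL: "u \<in> L2 M" by (rule form.D_L2[OF u])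
    have "(LINT x|M. (min (S t u x) 0)\<^sup>2) \<le> (LINT x|M. (min (u x) 0)\<^sup>2)"
    proof (rule G.energy_decreasing[where P = "\<lambda>x s. (min s 0)\<^sup>2" and p = "\<lambda>x s. s - \<bar>s\<bar>", OF _ _ _ _ _ _ t])
      show "(u, ell u) \<in> friedrichs_extension \<Omega> c" unfolding friedrichs_eq by (rule form.D_H_in_form_op[OF u])
      show "integrable M (\<lambda>x. (min (h x) 0)\<^sup>2)" if "h \<in> L2 M" for h
        using L2_integrable_square[OF NL[OF that]] by (simp add: N_def)
      show "(\<lambda>x. h x - \<bar>h x\<bar>) \<in> L2 M" if "h \<in> L2 M" for h by (intro L2_intros that)
      show "\<bar>a - \<bar>a\<bar>\<bar> \<le> 2 * \<bar>a\<bar>" for a :: real by linarith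
      show "(min (a + b) 0)\<^sup>2 \<le> (min a 0)\<^sup>2 + (a - \<bar>a\<bar>) * b + b\<^sup>2" for a b :: real
      proof (cases "a \<le> 0")
        case True
        then have "(min a 0)\<^sup>2 + (a - \<bar>a\<bar>) * b + b\<^sup>2 = (a + b)\<^sup>2"
          by (simp add: power2_eq_square algebra_simps)
        moreover have "(min (a + b) 0)\<^sup>2 \<le> (a + b)\<^sup>2" by (auto simp: min_def)
        ultimately show ?thesis by simp
      next
        case False
        then have "(min (a + b) 0)\<^sup>2 \<le> b\<^sup>2"
          by (intro power2_mono) (auto simp: min_def)
        then show ?thesis using False by simp
      qed
      show "0 \<le> l2_inner M (\<lambda>x. h x - \<bar>h x\<bar>) h'" if "(h, h') \<in> friedrichs_extension \<Omega> c" for h h'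
        by (rule friedrichs_negative_part[OF that])
    qed
    then have "(l2_norm M (N (S t u)))\<^sup>2 \<le> (l2_norm M (N u))\<^sup>2"
      unfolding l2_norm_square l2_inner_def N_def by (simp add: power2_eq_square)
    then show ?thesis by (rule power2_le_imp_le) simp
  qed
  have Nlip: "l2_norm M (N u) \<le> l2_norm M (N v) + l2_norm M (\<lambda>x. u x - v x)"
    if "u \<in> L2 M" "v \<in> L2 M" for u v
  proof -
    have "l2_norm M (N u) \<le> l2_norm M (N v) + l2_norm M (\<lambda>x. N u x - N v x)"
      by (rule l2_norm_le_add_diff[OF NL[OF that(1)] NL[OF that(2)]])
    also have "l2_norm M (\<lambda>x. N u x - N v x) \<le> l2_norm M (\<lambda>x. u x - v x)"
      by (intro l2_norm_mono_AE L2_measurable L2_diff NL that) (auto simp: N_def min_def)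
    finally show ?thesis by simp
  qed
  obtain u where u: "\<And>n. u n \<in> test_functions \<Omega>" "l2_tendsto M u f sequentially"
    using test_functions_dense[OF open_\<Omega> f] by blast
  have uL: "u n \<in> L2 M" for n by (rule form.D_L2[OF u(1)])
  have Nf: "l2_norm M (N f) = 0"
    using f0 by (subst l2_norm_eq_0_iff[OF NL[OF f]]) (auto elim!: eventually_mono simp: N_def)
  have "l2_norm M (N (S t f)) \<le> 0"
  proof (rule LIMSEQ_le_const)
    have "l2_tendsto M (\<lambda>n. S t (u n)) (S t f) sequentially"
      by (intro G.S_l2_tendsto t u f always_eventually allI uL)
    from tendsto_add[OF u(2)[unfolded l2_tendsto_def] this[unfolded l2_tendsto_def]]
    show "(\<lambda>n. l2_norm M (\<lambda>x. u n x - f x) + l2_norm M (\<lambda>x. S t (u n) x - S t f x)) \<longlonglongrightarrow> 0" by simp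
    have "l2_norm M (N (S t f)) \<le> l2_norm M (\<lambda>x. u n x - f x) + l2_norm M (\<lambda>x. S t (u n) x - S t f x)" for n
      using Nlip[OF G.S_L2[OF t f] G.S_L2[OF t uL[of n]]] Nle[OF u(1)[of n]] Nlip[OF uL[of n] f] Nf
        l2_norm_minus_commute[of M "S t f" "S t (u n)"] by linarith
    then show "\<exists>N'. \<forall>n\<ge>N'. l2_norm M (N (S t f))
        \<le> l2_norm M (\<lambda>x. u n x - f x) + l2_norm M (\<lambda>x. S t (u n) x - S t f x)" by blast
  qed
  then have "l2_norm M (N (S t f)) = 0" using l2_norm_nonneg[of M "N (S t f)"] by (rule antisym)
  then have "AE x in M. N (S t f) x = 0" using l2_norm_eq_0_iff[OF NL[OF G.S_L2[OF t f]]] by simp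
  then show "AE x in M. 0 \<le> S t f x" by eventually_elim (auto simp: N_def min_def split: if_splits)
qed

section \<open>Connected domains\<close>

lemma AE_lebesgue_on_negligible:
  assumes "negligible N" shows "AE x in M. x \<notin> N"
proof -
  have "AE x in lebesgue. x \<notin> N" using assms by (simp add: AE_not_in negligible_iff_null_sets)
  then show ?thesis
    by (subst AE_restrict_space_iff) (use open_\<Omega> in \<open>auto simp: borel_open\<close>)
qed

lemma symmetric_positive_irreducible:
  assumes conn: "connected \<Omega>" and S: "symmetric_positive_generator M K S"
    and ext: "\<And>u. u \<in> test_functions \<Omega> \<Longrightarrow> (u, ell u) \<in> K"
  shows "irreducible_semigroup M S"
proof (rule ccontr)
  interpret S: symmetric_positive_generator M K S by (rule S)
  assume "\<not> irreducible_semigroup M S"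
  then obtain P where P: "P \<in> sets M" "\<not> (AE x in M. x \<in> P)" "\<not> (AE x in M. x \<notin> P)"
    "\<And>u u' v v'. (u, u') \<in> K \<Longrightarrow> (v, v') \<in> K \<Longrightarrow>
      (LINT x|M. indicator P x * (u x * v' x - u' x * v x)) = 0"
    by (rule S.not_irreducible_imp_reducing_set) blast
  have "reducing_set P" unfolding reducing_set_def using P(1) P(4)[OF ext ext] by blast
  from connected_imp_reducing_set_trivial[OF conn this] show False
  proof
    assume "negligible P"
    from AE_lebesgue_on_negligible[OF this] show False using P(3) by simp
  next
    assume "negligible (\<Omega> - P)"
    from AE_lebesgue_on_negligible[OF this] have "AE x in M. x \<in> P"
      using AE_space by eventually_elim auto
    then show False using P(2) by simp
  qed
qed

lemma symmetric_positive_generatorI: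
  assumes G: "generates M K S"
    and sym: "\<And>f f' g g'. (f, f') \<in> K \<Longrightarrow> (g, g') \<in> K \<Longrightarrow> l2_inner M f' g = l2_inner M f g'"
    and dense: "densely_defined M K" and pos: "positive_semigroup M S"
  shows "symmetric_positive_generator M K S"
proof -
  interpret G: l2_generator M K S by unfold_locales (rule G)
  show ?thesis
  proof
    show "positive_semigroup M S" by (rule pos)
    show "l2_inner M (S t f) g = l2_inner M f (S t g)" if "0 \<le> t" "f \<in> L2 M" "g \<in> L2 M" for t f g
      by (rule generators_dual[OF G G sym dense dense that(2,3,1)])
  qed
qed

lemma friedrichs_irreducible:
  assumes conn: "connected \<Omega>" and G: "generates M (friedrichs_extension \<Omega> c) S"
  shows "irreducible_semigroup M S"
proof (rule symmetric_positive_irreducible[OF conn symmetric_positive_generatorI[OF G]])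
  show "l2_inner M f' g = l2_inner M f g'"
    if "(f, f') \<in> friedrichs_extension \<Omega> c" "(g, g') \<in> friedrichs_extension \<Omega> c" for f f' g g'
    using that unfolding friedrichs_eq by (rule form.form_op_symmetric)
  show "(u, ell u) \<in> friedrichs_extension \<Omega> c" if "u \<in> test_functions \<Omega>" for u
    unfolding friedrichs_eq by (rule form.D_H_in_form_op[OF that])
qed (intro friedrichs_densely_defined friedrichs_semigroup_positive[OF G])+

lemma locally_integrable_onI:
  assumes "integrable M h" shows "locally_integrable_on h \<Omega>"
  unfolding locally_integrable_on_def
proof (intro allI impI)
  fix C assume C: "compact C \<and> C \<subseteq> \<Omega>"
  have "set_integrable lebesgue \<Omega> h"
    using assms open_\<Omega> unfolding set_integrable_def
    by (subst (asm) integrable_restrict_space) (auto simp: borel_open)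
  then show "h absolutely_integrable_on C"
    by (rule set_integrable_subset) (use C in \<open>auto simp: borel_closed compact_imp_closed\<close>)
qed

lemma ell_in_elliptic_op:
  assumes u: "u \<in> test_functions \<Omega>" shows "(u, ell u) \<in> elliptic_op \<Omega> c"
proof -
  let ?G = "\<lambda>i j x. c x $ i $ j * partial_deriv i (partial_deriv j u) x + g i i j x * partial_deriv j u x"
  note u1 = test_functions_partial[OF u] and u2 = test_functions_partial[OF test_functions_partial[OF u]]
  have "has_weak_partial \<Omega> i (\<lambda>x. c x $ i $ j * partial_deriv j u x) (?G i j)" for i j
    unfolding has_weak_partial_def
  proof (intro conjI ballI)
    show "locally_integrable_on (\<lambda>x. c x $ i $ j * partial_deriv j u x) \<Omega>"
      by (intro locally_integrable_onI c_mult_test u1)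
    show "locally_integrable_on (?G i j) \<Omega>"
      by (intro locally_integrable_onI Bochner_Integration.integrable_add c_mult_test g_mult_test u1 u2)
    fix \<eta> assume "\<eta> \<in> test_functions \<Omega>"
    from coefficient_integration_by_parts[OF this u1]
    show "(LINT x|M. c x $ i $ j * partial_deriv j u x * partial_deriv i \<eta> x) = - (LINT x|M. ?G i j x * \<eta> x)" .
  qed
  then show ?thesis
    unfolding elliptic_op_def using u ell_L2[OF u]
    by (intro CollectI case_prodI conjI exI[of _ ?G] allI) (simp_all add: ell_def)
qed

text \<open>
  A nonnegative function is the limit of its truncations, which are multiples of functions with values in \<open>[0, 1]\<close>.
\<close>

lemma submarkovian_imp_positive:
  assumes C0: "C0_semigroup M' S" and sub: "submarkovian_semigroup M' S"
  shows "positive_semigroup M' S"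
  unfolding positive_semigroup_def
proof (intro allI impI ballI)
  interpret l2_semigroup M' S by unfold_locales (rule C0)
  fix t :: real and f assume t: "0 < t" and f: "f \<in> L2 M'" "AE x in M'. 0 \<le> f x"
  then have t0: "0 \<le> t" by simp
  define u where "u = (\<lambda>n x. min (f x) (real (Suc n)))"
  have um: "u n \<in> borel_measurable M'" for n using f(1) by (auto simp: u_def L2_def)
  have ub: "AE x in M'. \<bar>u n x\<bar> \<le> \<bar>f x\<bar>" for n
    using f(2) by eventually_elim (auto simp: u_def min_def)
  have uL: "u n \<in> L2 M'" for n by (rule L2_dominated[OF f(1) um ub])
  have "l2_tendsto M' u f sequentially"
  proof (rule l2_tendsto_dominated(2)[OF um L2_measurable[OF f(1)] f(1) _ ub])
    show "AE x in M'. (\<lambda>n. u n x) \<longlonglongrightarrow> f x"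
    proof (intro always_eventually allI)
      fix x
      obtain n0 where "f x < real n0" using reals_Archimedean2 by blast
      then have "\<forall>\<^sub>F n in sequentially. u n x = f x"
        by (intro eventually_sequentiallyI[of n0]) (simp add: u_def)
      then show "(\<lambda>n. u n x) \<longlonglongrightarrow> f x" by (rule tendsto_eventually)
    qed
  qed
  then have "l2_tendsto M' (\<lambda>n. S t (u n)) (S t f) sequentially"
    by (intro S_l2_tendsto t0 always_eventually allI uL f)
  then show "AE x in M'. 0 \<le> S t f x"
  proof (rule l2_nonneg_limit)
    show "\<forall>\<^sub>F n in sequentially. S t (u n) \<in> L2 M' \<and> (AE x in M'. 0 \<le> S t (u n) x)"
    proof (rule always_eventually, intro allI conjI S_L2 t0 uL)
      fix n
      let ?N = "real (Suc n)"
      have "AE x in M'. 0 \<le> u n x / ?N \<and> u n x / ?N \<le> 1"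
        using f(2) by eventually_elim (simp add: u_def divide_le_eq_1 del: of_nat_Suc)
      then have "AE x in M'. 0 \<le> S t (\<lambda>x. u n x / ?N) x \<and> S t (\<lambda>x. u n x / ?N) x \<le> 1"
        using sub[unfolded submarkovian_semigroup_def, rule_format, OF t L2_divide[OF uL]] by blast
      with S_divide[OF t0 uL[of n], of ?N] show "AE x in M'. 0 \<le> S t (u n) x"
        by eventually_elim (auto simp: zero_le_divide_iff)
    qed
    show "S t f \<in> L2 M'" by (rule S_L2[OF t0 f(1)])
  qed simp
qed

lemma submarkovian_extension_irreducible:
  assumes conn: "connected \<Omega>" and K: "submarkovian_extension \<Omega> c K" and G: "generates M K S"
  shows "irreducible_semigroup M S"
proof -
  obtain S' where S': "generates M K S'" "submarkovian_semigroup M S'"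
    and sa: "selfadjoint_op M K" and ext: "elliptic_op \<Omega> c \<subseteq> K"
    using K by (auto simp: submarkovian_extension_def)
  have dense: "densely_defined M K" using sa by (simp add: selfadjoint_op_def)
  have sym: "l2_inner M f' h = l2_inner M f h'" if "(f, f') \<in> K" "(h, h') \<in> K" for f f' h h'
  proof -
    have "(f, f') \<in> adjoint_op M K" using sa that by (simp add: selfadjoint_op_def)
    then show ?thesis using that(2) by (auto simp: adjoint_op_def)
  qed
  have pos: "positive_semigroup M S'"
    using S' by (intro submarkovian_imp_positive) (auto simp: generates_def)
  have "positive_semigroup M S"
    unfolding positive_semigroup_def
  proof (intro allI impI ballI)
    fix t :: real and f assume t: "0 < t" and f: "f \<in> L2 M" "AE x in M. 0 \<le> f x"
    with pos have "AE x in M. 0 \<le> S' t f x" by (simp add: positive_semigroup_def)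
    moreover have "AE x in M. S t f x = S' t f x"
      using t by (intro symmetric_generator_semigroup_unique[OF G S'(1) sym dense f(1)]) auto
    ultimately show "AE x in M. 0 \<le> S t f x" by eventually_elim simp
  qed
  from symmetric_positive_irreducible[OF conn symmetric_positive_generatorI[OF G sym dense this]]
  show ?thesis using ell_in_elliptic_op ext by blast
qed

section \<open>Disconnected domains\<close>

text \<open>
  The indicator of a component is locally constant on the domain, and outside of the domain the test function
  vanishes locally.
\<close>

lemma test_functions_restrict_component:
  assumes V: "open U" "open V" "\<Omega> = U \<union> V" "U \<inter> V = {}" and u: "u \<in> test_functions \<Omega>"
  shows "(\<lambda>x. indicator V x * u x) \<in> test_functions \<Omega>"
    "partial_deriv i (\<lambda>x. indicator V x * u x) = (\<lambda>x. indicator V x * partial_deriv i u x)"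
proof -
  have der: "((\<lambda>x. indicator V x * u x) has_derivative (\<lambda>v. indicator V x * frechet_derivative u (at x) v)) (at x)"
    if u: "u \<in> test_functions \<Omega>" for u x
  proof -
    obtain C where C: "compact C" "C \<subseteq> \<Omega>" "\<And>x. x \<notin> C \<Longrightarrow> u x = 0" by (rule test_functionsE[OF u]) blast
    have du: "(u has_derivative frechet_derivative u (at x)) (at x)"
      by (rule has_derivative_frechet[OF test_functions_differentiable[OF u]])
    show ?thesis
    proof (cases "x \<in> V")
      case True
      have "((\<lambda>x. indicator V x * u x) has_derivative frechet_derivative u (at x)) (at x)"
        by (rule has_derivative_transform_within_open[OF du V(2) True]) simp
      then show ?thesis using True by simp
    next
      case False
      have z: "((\<lambda>_. 0) has_derivative (\<lambda>_. 0)) (at x)" by simp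
      have "open (U \<union> - C)" using V(1) C(1) by (intro open_Un open_Compl compact_imp_closed)
      moreover have "x \<in> U \<union> - C" using False C(2) V(3) by auto
      ultimately have "((\<lambda>x. indicator V x * u x) has_derivative (\<lambda>_. 0)) (at x)"
        by (rule has_derivative_transform_within_open[OF z])
          (use V(4) C(3) in \<open>auto simp: indicator_def\<close>)
      then show ?thesis using False by simp
    qed
  qed
  have pd: "partial_deriv i (\<lambda>x. indicator V x * u x) = (\<lambda>x. indicator V x * partial_deriv i u x)"
    if "u \<in> test_functions \<Omega>" for i u
    by (rule ext) (simp add: partial_deriv_eqI[OF der[OF that]] partial_deriv_def)
  show "partial_deriv i (\<lambda>x. indicator V x * u x) = (\<lambda>x. indicator V x * partial_deriv i u x)"
    by (rule pd[OF u])
  have sm: "smooth_fun (\<lambda>x. indicator V x * u x)"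
  proof (rule smooth_fun_coinduct[where F = "(\<lambda>u x. indicator V x * u x) ` test_functions \<Omega>"])
    show "(\<lambda>x. indicator V x * u x) \<in> (\<lambda>u x. indicator V x * u x) ` test_functions \<Omega>" using u by (rule imageI)
    fix h assume "h \<in> (\<lambda>u x. indicator V x * u x) ` test_functions \<Omega>"
    then obtain w where w: "w \<in> test_functions \<Omega>" "h = (\<lambda>x. indicator V x * w x)" by blast
    show "h differentiable (at x)" for x unfolding w(2) by (rule differentiableI[OF der[OF w(1)]])
    show "partial_deriv i h \<in> (\<lambda>u x. indicator V x * u x) ` test_functions \<Omega>" for i
      unfolding w(2) pd[OF w(1)] by (rule imageI[OF test_functions_partial[OF w(1)]])
  qed
  obtain C where C: "compact C" "C \<subseteq> \<Omega>" "\<And>x. x \<notin> C \<Longrightarrow> u x = 0" by (rule test_functionsE[OF u]) blast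
  show "(\<lambda>x. indicator V x * u x) \<in> test_functions \<Omega>"
    by (rule test_functionsI[OF sm C(1,2)]) (simp add: C(3))
qed

lemma friedrichs_component_accretive:
  assumes V: "open U" "open V" "\<Omega> = U \<union> V" "U \<inter> V = {}" and fk: "(f, k) \<in> friedrichs_extension \<Omega> c"
  shows "0 \<le> l2_inner M (\<lambda>x. indicator V x * f x) k"
proof -
  have fk': "(f, k) \<in> form.form_op" using fk by (simp add: friedrichs_eq)
  note fL = form.form_op_L2[OF fk'] and r = test_functions_restrict_component[OF V]
  have Vs: "V \<in> sets M"
    by (subst sets_lebesgue_on[OF open_\<Omega>]) (use V(2,3) in \<open>auto simp: borel_open\<close>)
  have "0 \<le> l2_inner M k (\<lambda>x. indicator V x * f x)"
  proof (rule form.form_op_accretive[OF fk', where Q = "\<lambda>u x. indicator V x * u x" and C = 1 and L = 1])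
    fix u assume u: "u \<in> test_functions \<Omega>"
    let ?w = "\<lambda>x. indicator V x * u x"
    show w: "?w \<in> test_functions \<Omega>" by (rule r(1)[OF u])
    have g1: "gradient_form u ?w x = indicator V x * gradient_form u u x" for x
      unfolding gradient_form_def r(2)[OF u] sum_distrib_left by (simp only: mult_ac)
    have g2: "gradient_form ?w ?w x = indicator V x * gradient_form u u x" for x
      unfolding gradient_form_def r(2)[OF u] sum_distrib_left by (intro sum.cong) (auto simp: indicator_def)
    show "0 \<le> elliptic_form \<Omega> c u ?w"
      unfolding elliptic_form_eq[OF u w] g1
      by (intro integral_nonneg_AE) (use AE_space in eventually_elim, simp add: gradient_form_nonneg)
    have "elliptic_form \<Omega> c ?w ?w \<le> elliptic_form \<Omega> c u u"
      unfolding elliptic_form_eq[OF w w] elliptic_form_eq[OF u u]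
    proof (rule integral_mono[OF gradient_form_integrable[OF w w] gradient_form_integrable[OF u u]])
      fix x assume "x \<in> space M"
      then show "gradient_form ?w ?w x \<le> gradient_form u u x"
        unfolding g2 using gradient_form_nonneg[of x u] by (simp add: indicator_def)
    qed
    then show "form.energy ?w \<le> 1 * form.energy u"
      unfolding form.energy_def by simp
    have "l2_norm M (\<lambda>x. ?w x - indicator V x * f x) \<le> l2_norm M (\<lambda>x. u x - f x)"
      by (intro l2_norm_mono_AE L2_measurable L2_diff L2_indicator_mult Vs form.D_L2[OF u] fL)
        (auto simp: indicator_def)
    then show "l2_norm M (\<lambda>x. ?w x - indicator V x * f x) \<le> 1 * l2_norm M (\<lambda>x. u x - f x)" by simp
  qed (use L2_indicator_mult[OF fL(1) Vs] in auto)
  then show ?thesis by (simp only: l2_inner_commute[of M "\<lambda>x. indicator V x * f x"])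
qed

text \<open>
  By the energy argument, the norm of \<open>1\<^sub>V S\<^sub>t u\<close> does not increase, and it is 0 initially.
\<close>

lemma friedrichs_preserves_component:
  assumes G: "generates M (friedrichs_extension \<Omega> c) S"
    and V: "open U" "open V" "\<Omega> = U \<union> V" "U \<inter> V = {}"
    and u: "u \<in> test_functions \<Omega>" "\<And>x. x \<in> V \<Longrightarrow> u x = 0" and t: "0 \<le> t"
  shows "AE x in M. x \<in> V \<longrightarrow> S t u x = 0"
proof -
  interpret G: l2_generator M "friedrichs_extension \<Omega> c" S by unfold_locales (rule G)
  have Vs: "V \<in> sets M"
    by (subst sets_lebesgue_on[OF open_\<Omega>]) (use V(2,3) in \<open>auto simp: borel_open\<close>)
  have uL: "u \<in> L2 M" by (rule form.D_L2[OF u(1)])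
  have sq: "integrable M (\<lambda>x. indicator V x * (h x)\<^sup>2)" if "h \<in> L2 M" for h
  proof -
    have "(\<lambda>x. (indicator V x * h x)\<^sup>2) = (\<lambda>x. indicator V x * (h x)\<^sup>2)"
      by (auto simp: indicator_def fun_eq_iff)
    then show ?thesis using L2_integrable_square[OF L2_indicator_mult[OF that Vs]] by simp
  qed
  have "(LINT x|M. indicator V x * (S t u x)\<^sup>2) \<le> (LINT x|M. indicator V x * (u x)\<^sup>2)"
  proof (rule G.energy_decreasing[where P = "\<lambda>x s. indicator V x * s\<^sup>2" and p = "\<lambda>x s. 2 * (indicator V x * s)",
        OF sq _ _ _ _ _ t])
    show "(u, ell u) \<in> friedrichs_extension \<Omega> c" unfolding friedrichs_eq by (rule form.D_H_in_form_op[OF u(1)])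
    show "(\<lambda>x. 2 * (indicator V x * h x)) \<in> L2 M" if "h \<in> L2 M" for h
      by (intro L2_scale L2_indicator_mult that Vs)
    show "\<bar>2 * (indicator V x * a)\<bar> \<le> 2 * \<bar>a\<bar>" for x and a :: real
      by (simp add: indicator_def abs_mult)
    show "indicator V x * (a + b)\<^sup>2 \<le> indicator V x * a\<^sup>2 + 2 * (indicator V x * a) * b + b\<^sup>2" for x and a b :: real
      by (simp add: indicator_def power2_sum)
    show "0 \<le> l2_inner M (\<lambda>x. 2 * (indicator V x * h x)) h'" if "(h, h') \<in> friedrichs_extension \<Omega> c" for h h'
      using friedrichs_component_accretive[OF V that] by (simp add: l2_inner_scale_left)
  qed
  also have "(LINT x|M. indicator V x * (u x)\<^sup>2) = 0"
    by (intro integral_eq_zero_AE always_eventually allI) (use u(2) in \<open>auto simp: indicator_def\<close>)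
  finally have "(LINT x|M. indicator V x * (S t u x)\<^sup>2) \<le> 0" .
  moreover have "0 \<le> (LINT x|M. indicator V x * (S t u x)\<^sup>2)" by (intro integral_nonneg_AE) simp
  ultimately have "(LINT x|M. indicator V x * (S t u x)\<^sup>2) = 0" by (rule antisym)
  then have "AE x in M. indicator V x * (S t u x)\<^sup>2 = 0"
    by (subst (asm) integral_nonneg_eq_0_iff_AE[OF sq[OF G.S_L2[OF t uL]]]) auto
  then show ?thesis by eventually_elim (simp add: indicator_def)
qed

lemma friedrichs_irreducible_imp_connected:
  assumes G: "generates M (friedrichs_extension \<Omega> c) S" and irr: "irreducible_semigroup M S"
  shows "connected \<Omega>"
proof (rule ccontr)
  assume "\<not> connected \<Omega>"
  then obtain A B where AB: "open A" "open B" "\<Omega> \<subseteq> A \<union> B" "A \<inter> B \<inter> \<Omega> = {}" "A \<inter> \<Omega> \<noteq> {}" "B \<inter> \<Omega> \<noteq> {}"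
    unfolding connected_def by blast
  define U V where "U = A \<inter> \<Omega>" and "V = B \<inter> \<Omega>"
  have V: "open U" "open V" "\<Omega> = U \<union> V" "U \<inter> V = {}" using AB open_\<Omega> by (auto simp: U_def V_def)
  have "U \<noteq> {}" "V \<noteq> {}" using AB by (auto simp: U_def V_def)
  have neg: "\<not> negligible W" if "W = U \<or> W = V" for W
    using that V(1,2) \<open>U \<noteq> {}\<close> \<open>V \<noteq> {}\<close> open_not_negligible by blast
  have nz: "\<not> (AE x in M. x \<notin> W)" if W: "open W" "W \<noteq> {}" "W \<subseteq> \<Omega>" for W
  proof
    assume "AE x in M. x \<notin> W"
    then have "AE x in lebesgue. x \<in> \<Omega> \<longrightarrow> x \<notin> W"
      by (subst (asm) AE_restrict_space_iff) (use open_\<Omega> in \<open>auto simp: borel_open\<close>)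
    then have "AE x in lebesgue. x \<notin> W" by eventually_elim (use W(3) in auto)
    then have "W \<in> null_sets lebesgue" using W(1) by (subst AE_iff_null_sets) (auto simp: borel_open)
    then show False using open_not_negligible[OF W(1,2)] by (simp add: negligible_iff_null_sets)
  qed
  obtain x0 where "x0 \<in> U" using \<open>U \<noteq> {}\<close> by blast
  then obtain r where r: "0 < r" "cball x0 r \<subseteq> U" using V(1) open_contains_cball by blast
  have rO: "cball x0 r \<subseteq> \<Omega>" using r(2) V(3) by blast
  have u: "bump x0 r \<in> test_functions \<Omega>" by (rule bump_test[OF r(1) rO])
  have uV: "bump x0 r x = 0" if "x \<in> V" for x
  proof -
    have "x \<notin> ball x0 r" using that r(2) V(4) ball_subset_cball by blast
    then show ?thesis using bump_pos_iff[OF r(1), of x0 x] bump_nonneg[of x0 r x] by linarith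
  qed
  have "\<not> (AE x in M. bump x0 r x = 0)"
  proof
    assume "AE x in M. bump x0 r x = 0"
    then have "AE x in M. x \<notin> ball x0 r"
      by eventually_elim (use bump_pos_iff[OF r(1), of x0] in force)
    moreover have "ball x0 r \<subseteq> \<Omega>" using rO ball_subset_cball by blast
    ultimately show False using nz[of "ball x0 r"] r(1) by auto
  qed
  moreover have "\<forall>t>0. \<forall>f\<in>L2 M. (AE x in M. 0 \<le> f x) \<and> \<not> (AE x in M. f x = 0) \<longrightarrow> (AE x in M. 0 < S t f x)"
    using irr by (simp add: irreducible_semigroup_def)
  ultimately have "AE x in M. 0 < S 1 (bump x0 r) x"
    using form.D_L2[OF u] by (simp add: bump_nonneg)
  moreover have "AE x in M. x \<in> V \<longrightarrow> S 1 (bump x0 r) x = 0"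
    by (rule friedrichs_preserves_component[OF G V u uV]) auto
  ultimately have "AE x in M. x \<notin> V" by eventually_elim auto
  then show False using nz[OF V(2) \<open>V \<noteq> {}\<close>] V(3) by auto
qed

end

theorem proposition6p10:
  fixes \<Omega> :: "(real^'n) set" and c :: "real^'n \<Rightarrow> real^'n^'n"
  assumes "open \<Omega>"
    and "admissible_coefficients \<Omega> c"
  shows "(\<forall>SF. generates (lebesgue_on \<Omega>) (friedrichs_extension \<Omega> c) SF \<longrightarrow>
            (irreducible_semigroup (lebesgue_on \<Omega>) SF \<longleftrightarrow> connected \<Omega>)) \<and>
         (connected \<Omega> \<longrightarrow>
            (\<forall>K S. submarkovian_extension \<Omega> c K \<and> generates (lebesgue_on \<Omega>) K S \<longrightarrow>
               irreducible_semigroup (lebesgue_on \<Omega>) S))"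
proof -
  obtain g Cb Gb where "elliptic_coefficients \<Omega> c g Cb Gb"
    by (rule admissible_coefficients_imp_elliptic[OF assms])
  then interpret elliptic_coefficients \<Omega> c g Cb Gb .
  show ?thesis
    using friedrichs_irreducible friedrichs_irreducible_imp_connected submarkovian_extension_irreducible
    by blast
qed

end
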